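(* Let $V$ be a smooth vector field on $S^3$ (parts (1), (2)), or a smooth compactly supported vector field on $H^3$ (part (3)), and let $H(V)=\int BS(V)(y)\cdot V(y)\,dy$ be its helicity, where $BS$ is the Biot-Savart operator. Then: (1) On $S^3$, with left translation: $$H(V)=\int_{S^3\times S^3}\big(L_{yx^{-1}}V(x)\times V(y)\big)\cdot\nabla_y\varphi_0(x,y)\,dx\,dy-\frac1{4\pi^2}\int_{S^3\times S^3}L_{yx^{-1}}V(x)\cdot V(y)\,dx\,dy+2\int_{S^3\times S^3}\nabla_y\big(L_{yx^{-1}}V(x)\cdot\nabla_y\varphi_1(x,y)\big)\cdot V(y)\,dx\,dy,$$ where $\varphi_0(\alpha)=\frac1{4\pi^2}(\pi-\alpha)\cot\alpha$ and $\varphi_1(\alpha)=-\frac1{16\pi^2}\alpha(2\pi-\alpha)$. (2) On $S^3$, with parallel transport: $$H(V)=\int_{S^3\times S^3}\big(P_{yx}V(x)\times V(y)\big)\cdot\nabla_y\varphi(x,y)\,dx\,dy,$$ where $\varphi(\alpha)=\frac1{4\pi^2}(\pi-\alpha)\csc\alpha$. (3) On $H^3$, with parallel transport: $$H(V)=\int_{H^3\times H^3}\big(P_{yx}V(x)\times V(y)\big)\cdot\nabla_y\varphi(x,y)\,dx\,dy,$$ where $\varphi(\alpha)=\frac1{4\pi}\operatorname{csch}\alpha$.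
   Context: $S^3$ is regarded as the group of unit quaternions in $\mathbb R^4$, with its round metric, oriented so that $(i,j,k)$ is a positively oriented basis of the tangent space at $1$ (so left-invariant fields $V$ satisfy $\nabla\times V=-2V$). $H^3$ is simply connected hyperbolic space of curvature $-1$ with a fixed orientation. $\alpha=\alpha(x,y)$ is the distance from $x$ to $y$, and $\varphi(x,y)$ means $\varphi(\alpha(x,y))$. $dx,dy$ denote volume elements. $L_{yx^{-1}}:T_xS^3\to T_yS^3$ is the differential of left translation by $yx^{-1}$; $P_{yx}$ is parallel transport from $x$ to $y$ along the minimizing geodesic segment (on $S^3$ ambiguous only when $y=-x$, where $\nabla_y\varphi=0$). $\nabla_y$ is the gradient in $y$. Biot-Savart operator: on $S^3$, $BS$ is the unique linear operator on smooth vector fields such that $BS(V)$ has finite energy, $\nabla\cdot BS(V)=0$, $BS(V)=0$ when $V$ is a gradient field, and $\nabla\times BS(V)=V$ when $V$ is divergence-free. On $H^3$, for smooth compactly supported $V$, it is given by $BS(V)(y)=\int_{H^3}P_{yx}V(x)\times\nabla_y\psi(x,y)\,dx$ with $\psi(\alpha)=-\frac1{4\pi}\operatorname{csch}\alpha$. *)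

theory Defs
  imports "HOL-Analysis.Analysis"
begin

(* Both spaces are quadrics in real^4: the unit sphere for the Euclidean inner product and the
   upper sheet of the hyperboloid for the Lorentz form.  The geometry is therefore developed once,
   for a submanifold M that is (a component of) a level set x \<mapsto> g x x = const \<noteq> 0 of a
   nondegenerate symmetric bilinear form g that is positive definite on the tangent spaces of M.
   Functions and vector fields on M are functions on real^4 of which only the values on M matter. *)

lemma vector_4 [simp]:
  fixes w x y z :: "'a::zero"
  shows "(vector [w, x, y, z] :: 'a^4) $ 1 = w"
    and "(vector [w, x, y, z] :: 'a^4) $ 2 = x"
    and "(vector [w, x, y, z] :: 'a^4) $ 3 = y"
    and "(vector [w, x, y, z] :: 'a^4) $ 4 = z"
  unfolding vector_def by simp_all

subsection \<open>Smooth functions and vector fields\<close>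

primrec Ck_on :: "nat \<Rightarrow> 'a::real_normed_vector set \<Rightarrow> ('a \<Rightarrow> 'b::real_normed_vector) \<Rightarrow> bool" where
  "Ck_on 0 U f \<longleftrightarrow> continuous_on U f"
| "Ck_on (Suc k) U f \<longleftrightarrow>
     (\<forall>x\<in>U. f differentiable (at x)) \<and> (\<forall>v. Ck_on k U (\<lambda>x. frechet_derivative f (at x) v))"

definition smooth_on_mfd :: "'a::real_normed_vector set \<Rightarrow> ('a \<Rightarrow> 'b::real_normed_vector) \<Rightarrow> bool" where
  "smooth_on_mfd M f \<longleftrightarrow>
     (\<forall>p\<in>M. \<exists>U F. open U \<and> p \<in> U \<and> (\<forall>k. Ck_on k U F) \<and> (\<forall>x\<in>U \<inter> M. F x = f x))"

type_synonym form = "real^4 \<Rightarrow> real^4 \<Rightarrow> real"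

definition tangent :: "form \<Rightarrow> real^4 \<Rightarrow> (real^4) set" where
  "tangent g x = {v. g x v = 0}"

definition smooth_vector_field :: "form \<Rightarrow> (real^4) set \<Rightarrow> (real^4 \<Rightarrow> real^4) \<Rightarrow> bool" where
  "smooth_vector_field g M V \<longleftrightarrow> smooth_on_mfd M V \<and> (\<forall>x\<in>M. V x \<in> tangent g x)"

subsection \<open>Vector calculus on M\<close>

(* The derivative of f within M is determined only on tangent vectors, and frechet_derivative picks
   one of the candidates.  All definitions below apply it to tangent vectors only. *)

(* By convention 0 where f is not differentiable, e.g. at the singularity of a kernel. *)
definition grad :: "form \<Rightarrow> (real^4) set \<Rightarrow> (real^4 \<Rightarrow> real) \<Rightarrow> real^4 \<Rightarrow> real^4" where
  "grad g M f x =
     (if f differentiable (at x within M)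
      then (THE w. w \<in> tangent g x \<and>
                   (\<forall>v\<in>tangent g x. g w v = frechet_derivative f (at x within M) v))
      else 0)"

definition tangent_proj :: "form \<Rightarrow> real^4 \<Rightarrow> real^4 \<Rightarrow> real^4" where
  "tangent_proj g x w = w - (g x w / g x x) *\<^sub>R x"

(* Levi-Civita connection of the metric induced by g: \<nabla>_v V at x. *)
definition cov_deriv :: "form \<Rightarrow> (real^4) set \<Rightarrow> (real^4 \<Rightarrow> real^4) \<Rightarrow> real^4 \<Rightarrow> real^4 \<Rightarrow> real^4" where
  "cov_deriv g M V x v = tangent_proj g x (frechet_derivative V (at x within M) v)"

(* The oriented volume form of the tangent space at x is s * det (x, -, -, -); the sign s = 1 or
   s = -1 selects the orientation. *)
definition cross :: "form \<Rightarrow> real \<Rightarrow> real^4 \<Rightarrow> real^4 \<Rightarrow> real^4 \<Rightarrow> real^4" where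
  "cross g s x a b =
     (THE c. c \<in> tangent g x \<and>
             (\<forall>d\<in>tangent g x. g c d = s * det (vector [x, a, b, d] :: real^4^4)))"

definition divergence :: "form \<Rightarrow> (real^4) set \<Rightarrow> (real^4 \<Rightarrow> real^4) \<Rightarrow> real^4 \<Rightarrow> real" where
  "divergence g M V x =
     (THE d. \<forall>e :: 3 \<Rightarrow> real^4.
        (\<forall>i. e i \<in> tangent g x) \<and> (\<forall>i j. g (e i) (e j) = (if i = j then 1 else 0)) \<longrightarrow>
        d = (\<Sum>i\<in>UNIV. g (cov_deriv g M V x (e i)) (e i)))"

definition curl :: "form \<Rightarrow> real \<Rightarrow> (real^4) set \<Rightarrow> (real^4 \<Rightarrow> real^4) \<Rightarrow> real^4 \<Rightarrow> real^4" where
  "curl g s M V x =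
     (THE c. c \<in> tangent g x \<and>
        (\<forall>a\<in>tangent g x. \<forall>b\<in>tangent g x.
           g c (cross g s x a b) = g (cov_deriv g M V x a) b - g (cov_deriv g M V x b) a))"

subsection \<open>Geodesics and parallel transport\<close>

(* Unit speed geodesic of length l from x to y, with velocity \<gamma>'. *)
definition geodesic_segment ::
  "form \<Rightarrow> (real^4) set \<Rightarrow> real \<Rightarrow> (real \<Rightarrow> real^4) \<Rightarrow> (real \<Rightarrow> real^4) \<Rightarrow> real^4 \<Rightarrow> real^4 \<Rightarrow> bool" where
  "geodesic_segment g M l \<gamma> \<gamma>' x y \<longleftrightarrow>
     \<gamma> 0 = x \<and> \<gamma> l = y \<and>
     (\<forall>t\<in>{0..l}. \<gamma> t \<in> M \<and> (\<gamma> has_vector_derivative \<gamma>' t) (at t within {0..l}) \<and>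
        g (\<gamma>' t) (\<gamma>' t) = 1 \<and>
        (\<exists>a. (\<gamma>' has_vector_derivative a) (at t within {0..l}) \<and> tangent_proj g (\<gamma> t) a = 0))"

definition parallel_along ::
  "form \<Rightarrow> real \<Rightarrow> (real \<Rightarrow> real^4) \<Rightarrow> (real \<Rightarrow> real^4) \<Rightarrow> bool" where
  "parallel_along g l \<gamma> W \<longleftrightarrow>
     (\<forall>t\<in>{0..l}. W t \<in> tangent g (\<gamma> t) \<and>
        (\<exists>a. (W has_vector_derivative a) (at t within {0..l}) \<and> tangent_proj g (\<gamma> t) a = 0))"

(* Taken with l the distance from x to y, so that the geodesic is minimizing. *)
definition transport ::
  "form \<Rightarrow> (real^4) set \<Rightarrow> real \<Rightarrow> real^4 \<Rightarrow> real^4 \<Rightarrow> real^4 \<Rightarrow> real^4" where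
  "transport g M l x y v =
     (THE w. \<exists>\<gamma> \<gamma>' W. geodesic_segment g M l \<gamma> \<gamma>' x y \<and> parallel_along g l \<gamma> W \<and>
                     W 0 = v \<and> W l = w)"

subsection \<open>Riemannian volume and helicity\<close>

(* Volume element sqrt (det (g (\<partial>_i \<Phi>) (\<partial>_j \<Phi>))) du in a parametrization \<Phi> of M by all of real^3.
   The underlying measurable space is M with its Borel sets. *)
definition riemannian_volume ::
  "form \<Rightarrow> (real^4) set \<Rightarrow> (real^3 \<Rightarrow> real^4) \<Rightarrow> (real^4) measure" where
  "riemannian_volume g M \<Phi> =
     distr
       (density lborel (\<lambda>u. ennreal (sqrt (det ((\<chi> i j.
          g (frechet_derivative \<Phi> (at u) (axis i 1)) (frechet_derivative \<Phi> (at u) (axis j 1)))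
          :: real^3^3)))))
       (restrict_space borel M) \<Phi>"

definition helicity ::
  "form \<Rightarrow> (real^4) measure \<Rightarrow> ((real^4 \<Rightarrow> real^4) \<Rightarrow> real^4 \<Rightarrow> real^4) \<Rightarrow> (real^4 \<Rightarrow> real^4) \<Rightarrow> real" where
  "helicity g \<mu> BS V = (LINT y|\<mu>. g (BS V y) (V y))"

subsection \<open>The 3-sphere\<close>

(* The quaternion a + b i + c j + d k is vector [a, b, c, d]. *)
definition qmul :: "real^4 \<Rightarrow> real^4 \<Rightarrow> real^4" where
  "qmul p q = vector
     [p$1 * q$1 - p$2 * q$2 - p$3 * q$3 - p$4 * q$4,
      p$1 * q$2 + p$2 * q$1 + p$3 * q$4 - p$4 * q$3,
      p$1 * q$3 - p$2 * q$4 + p$3 * q$1 + p$4 * q$2,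
      p$1 * q$4 + p$2 * q$3 - p$3 * q$2 + p$4 * q$1]"

definition qinv :: "real^4 \<Rightarrow> real^4" where
  "qinv p = (1 / (p \<bullet> p)) *\<^sub>R vector [p$1, - p$2, - p$3, - p$4]"

definition S3 :: "(real^4) set" where
  "S3 = sphere 0 1"

definition S3_dist :: "real^4 \<Rightarrow> real^4 \<Rightarrow> real" where
  "S3_dist x y = arccos (x \<bullet> y)"

(* At x = 1 the volume form det (1, -, -, -) is positive on (i, j, k), and left translations by unit
   quaternions preserve the determinant, so the orientation sign of S3 is 1. *)
abbreviation S3_cross :: "real^4 \<Rightarrow> real^4 \<Rightarrow> real^4 \<Rightarrow> real^4" where
  "S3_cross \<equiv> cross (\<bullet>) 1"

abbreviation S3_curl :: "(real^4 \<Rightarrow> real^4) \<Rightarrow> real^4 \<Rightarrow> real^4" where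
  "S3_curl \<equiv> curl (\<bullet>) 1 S3"

abbreviation S3_div :: "(real^4 \<Rightarrow> real^4) \<Rightarrow> real^4 \<Rightarrow> real" where
  "S3_div \<equiv> divergence (\<bullet>) S3"

abbreviation S3_grad :: "(real^4 \<Rightarrow> real) \<Rightarrow> real^4 \<Rightarrow> real^4" where
  "S3_grad \<equiv> grad (\<bullet>) S3"

abbreviation S3_field :: "(real^4 \<Rightarrow> real^4) \<Rightarrow> bool" where
  "S3_field \<equiv> smooth_vector_field (\<bullet>) S3"

(* Left translation by y x^{-1} is linear on the quaternions, hence equal to its differential. *)
definition S3_left :: "real^4 \<Rightarrow> real^4 \<Rightarrow> real^4 \<Rightarrow> real^4" where
  "S3_left x y v = qmul (qmul y (qinv x)) v"

definition S3_transport :: "real^4 \<Rightarrow> real^4 \<Rightarrow> real^4 \<Rightarrow> real^4" where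
  "S3_transport x y v = transport (\<bullet>) S3 (S3_dist x y) x y v"

(* Inverse stereographic projection; it misses only the point -1. *)
definition S3_chart :: "real^3 \<Rightarrow> real^4" where
  "S3_chart u = (1 / (1 + u \<bullet> u)) *\<^sub>R vector [1 - u \<bullet> u, 2 * u$1, 2 * u$2, 2 * u$3]"

definition S3_vol :: "(real^4) measure" where
  "S3_vol = riemannian_volume (\<bullet>) S3 S3_chart"

definition S3_biot_savart :: "((real^4 \<Rightarrow> real^4) \<Rightarrow> real^4 \<Rightarrow> real^4) \<Rightarrow> bool" where
  "S3_biot_savart BS \<longleftrightarrow>
     (\<forall>V. S3_field V \<longrightarrow> S3_field (BS V)) \<and>
     (\<forall>V W a b. S3_field V \<longrightarrow> S3_field W \<longrightarrow>
        (\<forall>x\<in>S3. BS (\<lambda>z. a *\<^sub>R V z + b *\<^sub>R W z) x = a *\<^sub>R BS V x + b *\<^sub>R BS W x)) \<and>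
     (\<forall>V. S3_field V \<longrightarrow> integrable S3_vol (\<lambda>x. BS V x \<bullet> BS V x)) \<and>
     (\<forall>V. S3_field V \<longrightarrow> (\<forall>x\<in>S3. S3_div (BS V) x = 0)) \<and>
     (\<forall>V f. S3_field V \<longrightarrow> smooth_on_mfd S3 f \<longrightarrow> (\<forall>x\<in>S3. V x = S3_grad f x) \<longrightarrow>
        (\<forall>x\<in>S3. BS V x = 0)) \<and>
     (\<forall>V. S3_field V \<longrightarrow> (\<forall>x\<in>S3. S3_div V x = 0) \<longrightarrow> (\<forall>x\<in>S3. S3_curl (BS V) x = V x))"

(* At \<alpha> = pi the kernels \<phi>0 and \<phi> are extended by their limits; this makes them smooth functions
   of y near -x, with vanishing gradient at -x. *)
definition S3_phi0 :: "real \<Rightarrow> real" where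
  "S3_phi0 \<alpha> = (if \<alpha> = pi then - 1 / (4 * pi\<^sup>2) else 1 / (4 * pi\<^sup>2) * (pi - \<alpha>) * cot \<alpha>)"

definition S3_phi1 :: "real \<Rightarrow> real" where
  "S3_phi1 \<alpha> = - 1 / (16 * pi\<^sup>2) * \<alpha> * (2 * pi - \<alpha>)"

definition S3_phi :: "real \<Rightarrow> real" where
  "S3_phi \<alpha> = (if \<alpha> = pi then 1 / (4 * pi\<^sup>2) else 1 / (4 * pi\<^sup>2) * (pi - \<alpha>) * (1 / sin \<alpha>))"

subsection \<open>Hyperbolic 3-space\<close>

definition lorentz :: form where
  "lorentz x y = x$2 * y$2 + x$3 * y$3 + x$4 * y$4 - x$1 * y$1"

definition H3 :: "(real^4) set" where
  "H3 = {x. lorentz x x = - 1 \<and> x$1 > 0}"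

definition H3_dist :: "real^4 \<Rightarrow> real^4 \<Rightarrow> real" where
  "H3_dist x y = arcosh (- lorentz x y)"

abbreviation H3_cross :: "real \<Rightarrow> real^4 \<Rightarrow> real^4 \<Rightarrow> real^4 \<Rightarrow> real^4" where
  "H3_cross \<equiv> cross lorentz"

abbreviation H3_grad :: "(real^4 \<Rightarrow> real) \<Rightarrow> real^4 \<Rightarrow> real^4" where
  "H3_grad \<equiv> grad lorentz H3"

abbreviation H3_field :: "(real^4 \<Rightarrow> real^4) \<Rightarrow> bool" where
  "H3_field \<equiv> smooth_vector_field lorentz H3"

definition H3_transport :: "real^4 \<Rightarrow> real^4 \<Rightarrow> real^4 \<Rightarrow> real^4" where
  "H3_transport x y v = transport lorentz H3 (H3_dist x y) x y v"

definition H3_chart :: "real^3 \<Rightarrow> real^4" where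
  "H3_chart u = vector [sqrt (1 + u \<bullet> u), u$1, u$2, u$3]"

definition H3_vol :: "(real^4) measure" where
  "H3_vol = riemannian_volume lorentz H3 H3_chart"

definition H3_psi :: "real \<Rightarrow> real" where
  "H3_psi \<alpha> = - 1 / (4 * pi) * (1 / sinh \<alpha>)"

definition H3_phi :: "real \<Rightarrow> real" where
  "H3_phi \<alpha> = 1 / (4 * pi) * (1 / sinh \<alpha>)"

definition H3_biot_savart :: "real \<Rightarrow> (real^4 \<Rightarrow> real^4) \<Rightarrow> real^4 \<Rightarrow> real^4" where
  "H3_biot_savart s V y =
     (LINT x|H3_vol. H3_cross s y (H3_transport x y (V x)) (H3_grad (\<lambda>z. H3_psi (H3_dist x z)) y))"

end

theory Submission
  imports Defs "HOL-Real_Asymp.Real_Asymp"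
begin

text \<open>
  On the sphere both formulas follow from one explicit formula for the Biot-Savart operator in the
  frame of the left-invariant fields \<open>x i\<close>, \<open>x j\<close>, \<open>x k\<close>. A vector field \<open>V\<close> is replaced by its three
  coefficients \<open>V\<^sub>a = V \<bullet> x a\<close> (\<open>coef\<close>) and derivatives are taken along the frame (\<open>Lie\<close>). Then
  \<open>div V = L_i V_i + L_j V_j + L_k V_k\<close>, and \<open>(curl V)_a = L_b V_c - L_c V_b - 2 V_a\<close> for the cyclic
  permutations \<open>(a, b, c)\<close> of \<open>(i, j, k)\<close>, where the last term comes from the rotation of the frame
  (\<open>S3_div_eq\<close>, \<open>S3_curl_eq\<close>). The commutation rules \<open>[L_a, L_b] = 2 L_c\<close> turn this into the identity
  \<open>(curl + 2) curl B = - \<Delta> B\<close> for divergence-free \<open>B\<close>, in which the Laplacian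
  \<open>\<Delta> = L_i\<^sup>2 + L_j\<^sup>2 + L_k\<^sup>2\<close> acts on each coefficient separately (\<open>Lap_of_curl\<close>). So only scalar
  potential theory is needed.

  The Green's function of \<open>\<Delta>\<close> is \<open>\<phi>\<^sub>0\<close>: as a function of \<open>t = x \<bullet> y\<close> it satisfies
  \<open>\<Delta> \<phi>\<^sub>0 = 1 / (2 \<pi>\<^sup>2) - \<delta>\<close>, where \<open>2 \<pi>\<^sup>2\<close> is the volume of the sphere (\<open>Green_formula\<close>). Integrations
  by parts against a singular kernel \<open>k t\<close> are done for the smooth kernels \<open>k (r t)\<close> with \<open>r < 1\<close>, and
  \<open>r\<close> tends to 1 under the integrable bound \<open>1 / (1 - t\<^sup>2)\<close>. They need that the integral of a
  derivative \<open>L_a F\<close> vanishes, which is the invariance of the volume under right translations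
  (\<open>S3_vol_right_invariant\<close>).

  For a general field \<open>V\<close> the convolution \<open>f\<close> of \<open>- \<phi>\<^sub>0\<close> with \<open>div V\<close> is smooth and solves
  \<open>\<Delta> f = div V\<close>, so \<open>V - grad f\<close> is divergence-free, \<open>B = BS(V) = BS(V - grad f)\<close>, and
  \<open>curl B = V - grad f\<close>. Inserting \<open>B\<close> into Green's formula expresses \<open>B\<close> by \<open>V\<close>, \<open>\<phi>\<^sub>0\<close> and \<open>L_a f\<close>;
  the last is removed by \<open>\<phi>\<^sub>1\<close>, which satisfies \<open>\<Delta> \<phi>\<^sub>1 = 1 / (8 \<pi>\<^sup>2) - \<phi>\<^sub>0\<close> (\<open>hk_Laplacian\<close>,
  \<open>biot_savart_coef\<close>). Moving the derivatives from \<open>V\<close> to the kernels gives the helicity as a sum of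
  three double integrals (\<open>helicity_frame_kernel\<close>), and off the antipodal pairs their integrands
  are those of the left-translation formula. For parallel transport, \<open>P\<^sub>y\<^sub>x v = v - (v \<bullet> y) / (1 + x \<bullet> y) (x + y)\<close>,
  and the correction is killed by the determinant \<open>det (y, P\<^sub>y\<^sub>x V(x), V(y), x)\<close> that is the triple
  product. The resulting integrand equals the combination of the other three at every pair of points that are
  neither equal nor antipodal (\<open>transport_term\<close>): this is an algebraic identity that uses only the
  first-order equation \<open>(1 - t\<^sup>2) p' = 1 + t p\<close> of \<open>p = 4 \<pi>\<^sup>2 \<phi>\<close>.

  On hyperbolic space the operator is given as an integral, and the same formula for \<open>P\<^sub>y\<^sub>x\<close>, in
  Lorentz signature, makes both sides integrals of the same determinant. What remains is Fubini's
  theorem, whose hypothesis holds because the integrand vanishes off a compact set and the determinant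
  cancels one order of the singularity: it grows at most like \<open>1 / \<bar>u - w\<bar>\<^sup>2\<close>, with \<open>u\<close> and \<open>w\<close> the
  spatial parts of \<open>x\<close> and \<open>y\<close> (\<open>helicity_hyperbolic\<close>).
\<close>

section \<open>Calculus of k times continuously differentiable functions\<close>

lemma Ck_on_imp_continuous_on: "Ck_on k U f \<Longrightarrow> continuous_on U f"
  by (cases k) (auto simp: differentiable_imp_continuous_on differentiable_at_imp_differentiable_on)

lemma Ck_on_lower: "Ck_on (Suc k) U f \<Longrightarrow> Ck_on k U f"
proof (induction k arbitrary: f)
  case 0
  then show ?case using Ck_on_imp_continuous_on by (metis Ck_on.simps(1))
next
  case (Suc k)
  then show ?case by (metis Ck_on.simps(2))
qed

lemma Ck_on_subset: "Ck_on k U f \<Longrightarrow> W \<subseteq> U \<Longrightarrow> Ck_on k W f"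
proof (induction k arbitrary: f)
  case 0
  then show ?case using continuous_on_subset by auto
next
  case (Suc k)
  then show ?case by (simp add: subset_iff)
qed

lemma Ck_on_cong:
  assumes "open U" "\<And>x. x \<in> U \<Longrightarrow> f x = g x" "Ck_on k U f"
  shows "Ck_on k U g"
  using assms(2,3)
proof (induction k arbitrary: f g)
  case 0
  then show ?case using continuous_on_cong by (metis Ck_on.simps(1))
next
  case (Suc k)
  have d: "(g has_derivative frechet_derivative f (at x)) (at x)" if "x \<in> U" for x
    using Suc.prems that assms(1)
    by (metis Ck_on.simps(2) frechet_derivative_works has_derivative_transform_within_open)
  then have e: "frechet_derivative g (at x) = frechet_derivative f (at x)" if "x \<in> U" for x
    using frechet_derivative_at that by metis
  show ?case
    unfolding Ck_on.simps
  proof safe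
    fix x assume "x \<in> U" then show "g differentiable at x" using d differentiableI by blast
  next
    fix v
    have "Ck_on k U (\<lambda>x. frechet_derivative f (at x) v)" using Suc.prems by simp
    then show "Ck_on k U (\<lambda>x. frechet_derivative g (at x) v)"
      by (rule Suc.IH[rotated]) (simp add: e)
  qed
qed

text \<open>
  Introduction rule that never mentions \<open>frechet_derivative\<close>: it suffices to exhibit some derivative
  whose directional values are smooth.\<close>

lemma Ck_on_SucI:
  assumes "open U" "\<And>x. x \<in> U \<Longrightarrow> (f has_derivative f' x) (at x)"
    and "\<And>v. Ck_on k U (\<lambda>x. f' x v)"
  shows "Ck_on (Suc k) U f"
  unfolding Ck_on.simps
proof safe
  fix x assume "x \<in> U" then show "f differentiable at x" using assms(2) differentiableI by blast
next
  fix v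
  show "Ck_on k U (\<lambda>x. frechet_derivative f (at x) v)"
  proof (rule Ck_on_cong[OF assms(1) _ assms(3)[of v]])
    fix x assume "x \<in> U"
    show "f' x v = frechet_derivative f (at x) v"
      using frechet_derivative_at[OF assms(2)[OF \<open>x \<in> U\<close>]] by simp
  qed
qed

lemma Ck_on_SucD:
  assumes "Ck_on (Suc k) U f" "x \<in> U"
  shows "(f has_derivative frechet_derivative f (at x)) (at x)"
  using assms frechet_derivative_works by auto

lemma Ck_on_local:
  assumes "\<And>x. x \<in> U \<Longrightarrow> \<exists>W. open W \<and> x \<in> W \<and> Ck_on k W f"
  shows "Ck_on k U f"
  using assms
proof (induction k arbitrary: f)
  case 0
  then have "\<exists>W. open W \<and> x \<in> W \<and> continuous_on W f" if "x \<in> U" for x using that by simp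
  then have "isCont f x" if "x \<in> U" for x using that continuous_on_eq_continuous_at by blast
  then show ?case by (simp add: continuous_at_imp_continuous_on)
next
  case (Suc k)
  show ?case
    unfolding Ck_on.simps
  proof safe
    fix x assume "x \<in> U" then show "f differentiable at x" using Suc.prems by fastforce
  next
    fix v
    show "Ck_on k U (\<lambda>x. frechet_derivative f (at x) v)"
      using Suc.prems by (intro Suc.IH) fastforce
  qed
qed

lemma Ck_on_const: "open U \<Longrightarrow> Ck_on k U (\<lambda>x. c)"
proof (induction k arbitrary: c)
  case (Suc k)
  then show ?case by (intro Ck_on_SucI[where f'="\<lambda>x v. 0"]) auto
qed simp

lemma Ck_on_bounded_linear: "open U \<Longrightarrow> bounded_linear L \<Longrightarrow> Ck_on k U L"
proof (cases k)
  case (Suc n)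
  assume "open U" "bounded_linear L"
  then show ?thesis unfolding Suc
    by (intro Ck_on_SucI[where f'="\<lambda>x. L"]) (auto intro: Ck_on_const bounded_linear_imp_has_derivative)
qed (auto simp: linear_continuous_on)

lemma Ck_on_linear_compose:
  assumes "open U" "bounded_linear L"
  shows "Ck_on k U f \<Longrightarrow> Ck_on k U (\<lambda>x. L (f x))"
proof (induction k arbitrary: f)
  case 0
  then show ?case using assms(2) by (simp add: bounded_linear.continuous_on)
next
  case (Suc k)
  show ?case
    by (rule Ck_on_SucI[OF assms(1), where f'="\<lambda>x v. L (frechet_derivative f (at x) v)"])
      (use Suc assms in \<open>auto intro!: bounded_linear.has_derivative[OF assms(2)] simp: frechet_derivative_works[symmetric]\<close>)
qed

lemma Ck_on_add:
  assumes "open U"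
  shows "Ck_on k U f \<Longrightarrow> Ck_on k U g \<Longrightarrow> Ck_on k U (\<lambda>x. f x + g x)"
proof (induction k arbitrary: f g)
  case 0
  then show ?case by (simp add: continuous_on_add)
next
  case (Suc k)
  show ?case
    by (rule Ck_on_SucI[OF assms(1), where f'="\<lambda>x v. frechet_derivative f (at x) v + frechet_derivative g (at x) v"])
      (use Suc assms in \<open>auto intro!: has_derivative_add simp: frechet_derivative_works[symmetric]\<close>)
qed

lemma Ck_on_sum:
  assumes "open U" "\<And>i. i \<in> I \<Longrightarrow> Ck_on k U (f i)"
  shows "Ck_on k U (\<lambda>x. \<Sum>i\<in>I. f i x)"
  using assms(2)
  by (induction I rule: infinite_finite_induct) (auto intro!: Ck_on_const Ck_on_add assms(1))

text \<open>
  All products below (of scalars, of a scalar and a vector, inner products) are instances, so the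
  Leibniz rule is proved once.\<close>

lemma Ck_on_bilinear:
  assumes "open U" "bounded_bilinear B"
  shows "Ck_on k U f \<Longrightarrow> Ck_on k U g \<Longrightarrow> Ck_on k U (\<lambda>x. B (f x) (g x))"
proof (induction k arbitrary: f g)
  case 0
  then show ?case using assms(2) by (simp add: bounded_bilinear.continuous_on)
next
  case (Suc k)
  show ?case
  proof (rule Ck_on_SucI[OF assms(1)])
    fix x assume "x \<in> U"
    then show "((\<lambda>x. B (f x) (g x)) has_derivative
       (\<lambda>v. B (f x) (frechet_derivative g (at x) v) + B (frechet_derivative f (at x) v) (g x))) (at x)"
      using Suc.prems by (intro bounded_bilinear.FDERIV[OF assms(2)]) (auto simp: frechet_derivative_works[symmetric])
  next
    fix v
    show "Ck_on k U (\<lambda>x. B (f x) (frechet_derivative g (at x) v) + B (frechet_derivative f (at x) v) (g x))"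
      using Suc.prems Ck_on_lower[OF Suc.prems(1)] Ck_on_lower[OF Suc.prems(2)]
      by (intro Ck_on_add assms Suc.IH) auto
  qed
qed

lemmas Ck_on_mult = Ck_on_bilinear[OF _ bounded_bilinear_mult]
lemmas Ck_on_scaleR = Ck_on_bilinear[OF _ bounded_bilinear_scaleR]
lemmas Ck_on_inner = Ck_on_bilinear[OF _ bounded_bilinear_inner]

lemma linear_sum_Basis:
  fixes L :: "'a::euclidean_space \<Rightarrow> 'b::real_vector"
  assumes "linear L"
  shows "L v = (\<Sum>b\<in>Basis. (v \<bullet> b) *\<^sub>R L b)"
proof -
  have "L v = L (\<Sum>b\<in>Basis. (v \<bullet> b) *\<^sub>R b)" by (simp add: euclidean_representation)
  also have "\<dots> = (\<Sum>b\<in>Basis. (v \<bullet> b) *\<^sub>R L b)"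
    using assms by (simp add: linear_sum linear_cmul)
  finally show ?thesis .
qed

lemma frechet_derivative_sum_Basis:
  fixes f :: "'a::euclidean_space \<Rightarrow> 'b::real_normed_vector"
  assumes "f differentiable (at x)"
  shows "frechet_derivative f (at x) v = (\<Sum>b\<in>Basis. (v \<bullet> b) *\<^sub>R frechet_derivative f (at x) b)"
  by (rule linear_sum_Basis) (rule linear_frechet_derivative[OF assms])

lemma Ck_on_compose:
  fixes g :: "'a::real_normed_vector \<Rightarrow> 'b::euclidean_space" and f :: "'b \<Rightarrow> 'c::real_normed_vector"
  assumes "open U" "open W" "g ` U \<subseteq> W"
  shows "Ck_on k W f \<Longrightarrow> Ck_on k U g \<Longrightarrow> Ck_on k U (\<lambda>x. f (g x))"
proof (induction k arbitrary: f)
  case 0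
  then show ?case using assms by (auto intro: continuous_on_compose2)
next
  case (Suc k)
  have gU: "g x \<in> W" if "x \<in> U" for x using that assms by auto
  show ?case
  proof (rule Ck_on_SucI[OF assms(1)])
    fix x assume x: "x \<in> U"
    have "((\<lambda>x. f (g x)) has_derivative (\<lambda>v. frechet_derivative f (at (g x)) (frechet_derivative g (at x) v))) (at x)"
      using Ck_on_SucD[OF Suc.prems(1) gU[OF x]] Ck_on_SucD[OF Suc.prems(2) x]
      by (rule has_derivative_compose[rotated])
    moreover have "f differentiable (at (g x))" using Suc.prems(1) gU[OF x] by simp
    ultimately show "((\<lambda>x. f (g x)) has_derivative
       (\<lambda>v. \<Sum>b\<in>Basis. (frechet_derivative g (at x) v \<bullet> b) *\<^sub>R frechet_derivative f (at (g x)) b)) (at x)"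
      by (subst (asm) frechet_derivative_sum_Basis) auto
  next
    fix v
    have 1: "Ck_on k U (\<lambda>x. frechet_derivative f (at (g x)) b)" for b
      using Suc.prems Ck_on_lower[OF Suc.prems(2)] by (intro Suc.IH) auto
    have 2: "Ck_on k U (\<lambda>x. frechet_derivative g (at x) v \<bullet> b)" for b
      using Suc.prems by (intro Ck_on_inner Ck_on_const assms) auto
    show "Ck_on k U (\<lambda>x. \<Sum>b\<in>Basis. (frechet_derivative g (at x) v \<bullet> b) *\<^sub>R frechet_derivative f (at (g x)) b)"
      by (intro Ck_on_sum Ck_on_scaleR 1 2 assms)
  qed
qed

lemma Ck_on_powr: "Ck_on k {0<..} (\<lambda>s::real. s powr a)"
proof (induction k arbitrary: a)
  case 0
  show ?case by (auto intro!: continuous_intros)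
next
  case (Suc k)
  show ?case
  proof (rule Ck_on_SucI)
    fix x :: real assume "x \<in> {0<..}"
    then have "((\<lambda>s. s powr a) has_derivative (*) (a * x powr (a - 1))) (at x)"
      using has_real_derivative_powr[of x a] by (simp add: has_field_derivative_def)
    then show "((\<lambda>s. s powr a) has_derivative (\<lambda>v. v * (a * x powr (a - 1)))) (at x)"
      by (rule has_derivative_eq_rhs) (auto simp: mult.commute)
  qed (auto intro!: Ck_on_mult Ck_on_const Suc)
qed

text \<open>
  Two applications of the mean value theorem. The left-hand side is symmetric in \<open>u\<close> and \<open>v\<close>, the
  right-hand side is a mixed second derivative in a fixed order; comparing the two orders shows that
  second derivatives commute.\<close>

lemma second_difference_mean_value:
  fixes F :: "'a::real_normed_vector \<Rightarrow> real"
  assumes C: "Ck_on 2 U F" and "h > 0"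
    and U: "\<And>s t. 0 \<le> s \<Longrightarrow> s \<le> h \<Longrightarrow> 0 \<le> t \<Longrightarrow> t \<le> h \<Longrightarrow> x + s *\<^sub>R u + t *\<^sub>R v \<in> U"
  shows "\<exists>s t. 0 < s \<and> s < h \<and> 0 < t \<and> t < h \<and>
     F (x + h *\<^sub>R u + h *\<^sub>R v) - F (x + h *\<^sub>R u) - F (x + h *\<^sub>R v) + F x
      = h * (h * frechet_derivative (\<lambda>y. frechet_derivative F (at y) u) (at (x + s *\<^sub>R u + t *\<^sub>R v)) v)"
proof -
  let ?A = "\<lambda>y. frechet_derivative F (at y) u"
  have C2: "Ck_on (Suc (Suc 0)) U F" using C by (simp add: numeral_2_eq_2)
  have dF: "(F has_derivative frechet_derivative F (at y)) (at y)" if "y \<in> U" for y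
    using Ck_on_SucD[OF C2 that] .
  have dA: "(?A has_derivative frechet_derivative ?A (at y)) (at y)" if "y \<in> U" for y
  proof -
    have "Ck_on (Suc 0) U ?A" using C2[unfolded Ck_on.simps(2)[of "Suc 0"]] by blast
    then show ?thesis using that by (rule Ck_on_SucD)
  qed
  have line: "((\<lambda>s. G (z + s *\<^sub>R w)) has_real_derivative frechet_derivative G (at (z + s *\<^sub>R w)) w) (at s)"
    if "(G has_derivative frechet_derivative G (at (z + s *\<^sub>R w))) (at (z + s *\<^sub>R w))"
    for G :: "'a \<Rightarrow> real" and z w s
  proof -
    have "((\<lambda>s. G (z + s *\<^sub>R w)) has_derivative (\<lambda>r. frechet_derivative G (at (z + s *\<^sub>R w)) (r *\<^sub>R w))) (at s)"
      by (rule has_derivative_compose[where f="\<lambda>s. z + s *\<^sub>R w" and g=G, OF _ that])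
        (auto intro!: derivative_eq_intros)
    moreover have "linear (frechet_derivative G (at (z + s *\<^sub>R w)))"
      using that has_derivative_linear by blast
    ultimately show ?thesis
      by (simp add: has_field_derivative_def linear_cmul mult_commute_abs)
  qed
  define \<phi> where "\<phi> s = F (x + h *\<^sub>R v + s *\<^sub>R u) - F (x + s *\<^sub>R u)" for s
  have "\<exists>z>0. z < h \<and> \<phi> h - \<phi> 0 = (h - 0) * (?A (x + h *\<^sub>R v + z *\<^sub>R u) - ?A (x + z *\<^sub>R u))"
  proof (rule MVT2[OF \<open>h > 0\<close>])
    fix s assume s: "0 \<le> s" "s \<le> h"
    have "x + h *\<^sub>R v + s *\<^sub>R u \<in> U" "x + s *\<^sub>R u \<in> U"
      using U[of s h] U[of s 0] s \<open>h > 0\<close> by (auto simp: algebra_simps)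
    then show "(\<phi> has_real_derivative ?A (x + h *\<^sub>R v + s *\<^sub>R u) - ?A (x + s *\<^sub>R u)) (at s)"
      unfolding \<phi>_def by (intro DERIV_diff line dF)
  qed
  then obtain s where s: "s > 0" "s < h"
    and e1: "\<phi> h - \<phi> 0 = h * (?A (x + h *\<^sub>R v + s *\<^sub>R u) - ?A (x + s *\<^sub>R u))" by auto
  have "\<exists>z>0. z < h \<and> ?A (x + s *\<^sub>R u + h *\<^sub>R v) - ?A (x + s *\<^sub>R u + 0 *\<^sub>R v)
       = (h - 0) * frechet_derivative ?A (at (x + s *\<^sub>R u + z *\<^sub>R v)) v"
    by (rule MVT2[OF \<open>h > 0\<close>]) (use U s in \<open>auto intro!: line dA\<close>)
  then obtain t where "t > 0" "t < h" "?A (x + s *\<^sub>R u + h *\<^sub>R v) - ?A (x + s *\<^sub>R u)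
       = h * frechet_derivative ?A (at (x + s *\<^sub>R u + t *\<^sub>R v)) v" by auto
  then show ?thesis using s e1 unfolding \<phi>_def
    by (intro exI[of _ s] exI[of _ t]) (simp add: algebra_simps)
qed

lemma symmetric_second_derivative:
  fixes F :: "'a::real_normed_vector \<Rightarrow> real"
  assumes C: "Ck_on 2 U F" and "open U" "x \<in> U"
  shows "frechet_derivative (\<lambda>y. frechet_derivative F (at y) u) (at x) v
       = frechet_derivative (\<lambda>y. frechet_derivative F (at y) v) (at x) u"
proof -
  define P where "P y = frechet_derivative (\<lambda>y. frechet_derivative F (at y) u) (at y) v" for y
  define Q where "Q y = frechet_derivative (\<lambda>y. frechet_derivative F (at y) v) (at y) u" for y
  have "continuous_on U P" "continuous_on U Q"
    using C unfolding P_def Q_def by (simp_all add: numeral_2_eq_2)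
  then have cP: "isCont P x" and cQ: "isCont Q x"
    using assms(2,3) continuous_on_eq_continuous_at by blast+
  have "\<bar>P x - Q x\<bar> \<le> 2 * e" if "e > 0" for e
  proof -
    obtain d1 where d1: "d1 > 0" "\<And>y. dist y x < d1 \<Longrightarrow> \<bar>P y - P x\<bar> < e"
      using cP \<open>e > 0\<close> unfolding continuous_at_eps_delta dist_real_def by blast
    obtain d2 where d2: "d2 > 0" "\<And>y. dist y x < d2 \<Longrightarrow> \<bar>Q y - Q x\<bar> < e"
      using cQ \<open>e > 0\<close> unfolding continuous_at_eps_delta dist_real_def by blast
    obtain d3 where d3: "d3 > 0" "\<And>y. dist y x < d3 \<Longrightarrow> y \<in> U"
      using assms(2,3) unfolding open_dist by blast
    define d where "d = min d1 (min d2 d3)"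
    define h where "h = d / (2 * (norm u + norm v + 1))"
    have "d > 0" "h > 0" using d1 d2 d3 by (auto simp: d_def h_def intro!: divide_pos_pos add_nonneg_pos)
    have near: "dist (x + s *\<^sub>R u + t *\<^sub>R v) x < d"
      if "0 \<le> s" "s \<le> h" "0 \<le> t" "t \<le> h" for s t
    proof -
      have "dist (x + s *\<^sub>R u + t *\<^sub>R v) x \<le> s * norm u + t * norm v"
        using that norm_triangle_ineq[of "s *\<^sub>R u" "t *\<^sub>R v"] by (simp add: dist_norm)
      also have "\<dots> \<le> h * norm u + h * norm v" using that by (intro add_mono mult_right_mono) auto
      also have "\<dots> < h * (2 * (norm u + norm v + 1))" using \<open>h > 0\<close> 
        by (simp add: algebra_simps) (smt (verit) mult_nonneg_nonneg norm_ge_zero)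
      also have "\<dots> = d" by (simp add: h_def) (smt (verit) norm_ge_zero)
      finally show ?thesis .
    qed
    obtain s t where 1: "0 < s" "s < h" "0 < t" "t < h"
      "F (x + h *\<^sub>R u + h *\<^sub>R v) - F (x + h *\<^sub>R u) - F (x + h *\<^sub>R v) + F x = h * (h * P (x + s *\<^sub>R u + t *\<^sub>R v))"
      using second_difference_mean_value[OF C \<open>h > 0\<close>, of x u v] near d3 unfolding P_def d_def by force
    have near': "x + s *\<^sub>R v + t *\<^sub>R u \<in> U" if "0 \<le> s" "s \<le> h" "0 \<le> t" "t \<le> h" for s t
      using near[of t s] d3 that unfolding d_def by (simp add: algebra_simps)
    obtain s' t' where 2: "0 < s'" "s' < h" "0 < t'" "t' < h"
      "F (x + h *\<^sub>R v + h *\<^sub>R u) - F (x + h *\<^sub>R v) - F (x + h *\<^sub>R u) + F x = h * (h * Q (x + s' *\<^sub>R v + t' *\<^sub>R u))"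
      using second_difference_mean_value[OF C \<open>h > 0\<close>, of x v u] near' unfolding Q_def by force
    have "h * (h * P (x + s *\<^sub>R u + t *\<^sub>R v)) = h * (h * Q (x + s' *\<^sub>R v + t' *\<^sub>R u))"
      using 1(5) 2(5) by (simp add: algebra_simps)
    then have "P (x + s *\<^sub>R u + t *\<^sub>R v) = Q (x + s' *\<^sub>R v + t' *\<^sub>R u)" using \<open>h > 0\<close> by simp
    moreover have "\<bar>P (x + s *\<^sub>R u + t *\<^sub>R v) - P x\<bar> < e"
      using near[of s t] 1 d1 unfolding d_def by auto
    moreover have "\<bar>Q (x + s' *\<^sub>R v + t' *\<^sub>R u) - Q x\<bar> < e"
      using near[of t' s'] 2 d2 unfolding d_def by (auto simp: algebra_simps)
    ultimately show ?thesis by linarith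
  qed
  then have "\<bar>P x - Q x\<bar> \<le> e" if "e > 0" for e using that by (metis field_sum_of_halves half_gt_zero mult_2)
  then show ?thesis unfolding P_def Q_def by (metis dense_ge abs_le_zero_iff eq_iff_diff_eq_0)
qed

section \<open>Quaternions and left-invariant derivatives\<close>

lemma det_4:
  "det (A::'a::comm_ring_1^4^4) =
    A$1$1 * (A$2$2 * A$3$3 * A$4$4 + A$2$3 * A$3$4 * A$4$2 + A$2$4 * A$3$2 * A$4$3
      - A$2$2 * A$3$4 * A$4$3 - A$2$3 * A$3$2 * A$4$4 - A$2$4 * A$3$3 * A$4$2)
  - A$1$2 * (A$2$1 * A$3$3 * A$4$4 + A$2$3 * A$3$4 * A$4$1 + A$2$4 * A$3$1 * A$4$3
      - A$2$1 * A$3$4 * A$4$3 - A$2$3 * A$3$1 * A$4$4 - A$2$4 * A$3$3 * A$4$1)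
  + A$1$3 * (A$2$1 * A$3$2 * A$4$4 + A$2$2 * A$3$4 * A$4$1 + A$2$4 * A$3$1 * A$4$2
      - A$2$1 * A$3$4 * A$4$2 - A$2$2 * A$3$1 * A$4$4 - A$2$4 * A$3$2 * A$4$1)
  - A$1$4 * (A$2$1 * A$3$2 * A$4$3 + A$2$2 * A$3$3 * A$4$1 + A$2$3 * A$3$1 * A$4$2
      - A$2$1 * A$3$3 * A$4$2 - A$2$2 * A$3$1 * A$4$3 - A$2$3 * A$3$2 * A$4$1)"
proof -
  have f1: "finite {2::4, 3, 4}" "1 \<notin> {2::4, 3, 4}" by auto
  have f2: "finite {3::4, 4}" "2 \<notin> {3::4, 4}" by auto
  have f3: "finite {4::4}" "3 \<notin> {4::4}" by auto
  show ?thesis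
    unfolding det_def UNIV_4
    unfolding sum_over_permutations_insert[OF f1]
    unfolding sum_over_permutations_insert[OF f2]
    unfolding sum_over_permutations_insert[OF f3]
    unfolding permutes_sing
    by (simp add: sign_swap_id permutation_swap_id permutation_compose sign_compose sign_id swap_id_eq algebra_simps)
qed

lemmas quat_simps = qmul_def vec_eq_iff forall_4 inner_vec_def sum_4

definition qone :: "real^4" where "qone = vector [1, 0, 0, 0]"
definition qcnj :: "real^4 \<Rightarrow> real^4" where "qcnj p = vector [p$1, - p$2, - p$3, - p$4]"

lemma qmul_assoc: "qmul (qmul p q) r = qmul p (qmul q r)"
  by (simp add: quat_simps algebra_simps)

lemma qmul_one [simp]: "qmul qone p = p" "qmul p qone = p"
  by (simp_all add: quat_simps qone_def)

lemma qmul_linear_simps: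
  "qmul (p + q) r = qmul p r + qmul q r" "qmul r (p + q) = qmul r p + qmul r q"
  "qmul (p - q) r = qmul p r - qmul q r" "qmul r (p - q) = qmul r p - qmul r q"
  "qmul (c *\<^sub>R p) r = c *\<^sub>R qmul p r" "qmul r (c *\<^sub>R p) = c *\<^sub>R qmul r p"
  by (simp_all add: quat_simps algebra_simps)

lemma inner_qmul_same: "qmul p q \<bullet> qmul p q = (p \<bullet> p) * (q \<bullet> q)"
  by (simp add: quat_simps algebra_simps)

lemma norm_qmul: "norm (qmul p q) = norm p * norm q"
  by (simp add: norm_eq_sqrt_inner inner_qmul_same real_sqrt_mult)

lemma bounded_bilinear_qmul: "bounded_bilinear qmul"
  by (rule bounded_bilinear.intro)
    (auto simp: qmul_linear_simps norm_qmul intro!: exI[of _ 1])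

lemmas continuous_on_qmul [continuous_intros] = bounded_bilinear.continuous_on[OF bounded_bilinear_qmul]
lemmas bounded_linear_qmul_left = bounded_bilinear.bounded_linear_left[OF bounded_bilinear_qmul]
lemmas bounded_linear_qmul_right = bounded_bilinear.bounded_linear_right[OF bounded_bilinear_qmul]

lemma qmul_qcnj_left: "qmul (qcnj p) p = (p \<bullet> p) *\<^sub>R qone"
  by (simp add: quat_simps qcnj_def qone_def algebra_simps)

lemma qmul_qcnj_right: "qmul p (qcnj p) = (p \<bullet> p) *\<^sub>R qone"
  by (simp add: quat_simps qcnj_def qone_def algebra_simps)

lemma inner_qmul_right: "qmul p q \<bullet> r = p \<bullet> qmul r (qcnj q)"
  by (simp add: quat_simps qcnj_def algebra_simps)

lemma norm_qcnj [simp]: "norm (qcnj p) = norm p"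
  by (simp add: norm_eq_sqrt_inner inner_vec_def sum_4 qcnj_def)

lemma norm_qone [simp]: "norm qone = 1"
  by (simp add: norm_eq_sqrt_inner inner_vec_def sum_4 qone_def)

lemma S3_iff: "x \<in> S3 \<longleftrightarrow> x \<bullet> x = 1" "x \<in> S3 \<longleftrightarrow> norm x = 1"
  by (simp_all add: S3_def norm_eq_sqrt_inner)

lemma qinv_S3: "x \<in> S3 \<Longrightarrow> qinv x = qcnj x"
  by (simp add: qinv_def qcnj_def S3_iff)

lemma qmul_S3: "x \<in> S3 \<Longrightarrow> y \<in> S3 \<Longrightarrow> qmul x y \<in> S3"
  by (simp add: S3_iff(2) norm_qmul)

lemma qcnj_S3: "x \<in> S3 \<Longrightarrow> qcnj x \<in> S3"
  by (simp add: S3_iff(2))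

lemma qone_S3 [simp]: "qone \<in> S3"
  by (simp add: S3_iff(2))

lemma compact_S3: "compact S3" by (simp add: S3_def)

lemma S3_nonzero: "x \<in> S3 \<Longrightarrow> x \<noteq> 0" by (auto simp: S3_def)

subsection \<open>Global smooth extensions\<close>

text \<open>
  The sphere is a retract of the punctured space, so a smooth function on it has one global smooth
  extension, constant along rays. Left-invariant derivatives can then be iterated as ordinary
  derivatives in \<open>real^4\<close>, with no change of extension in between.\<close>

definition smooth_away_0 :: "(real^4 \<Rightarrow> 'b::real_normed_vector) \<Rightarrow> bool" where
  "smooth_away_0 F \<longleftrightarrow> (\<forall>k. Ck_on k (- {0}) F)"

text \<open>
  The factor \<open>1 / norm x\<close> is written as a power of \<open>x \<bullet> x\<close> because smoothness of all orders then
  follows by composing a polynomial with \<open>powr\<close>.\<close>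

definition radial_ext :: "(real^4 \<Rightarrow> 'b) \<Rightarrow> real^4 \<Rightarrow> 'b" where
  "radial_ext f x = f ((x \<bullet> x) powr (- 1 / 2) *\<^sub>R x)"

lemma open_punctured [simp]: "open (- {0 :: real^4})" by (simp add: open_Compl)

lemma radial_S3:
  fixes x :: "real^4"
  assumes "x \<noteq> 0"
  shows "(x \<bullet> x) powr (- 1 / 2) *\<^sub>R x \<in> S3"
proof -
  have "x \<bullet> x > 0" using assms by simp
  then have "(x \<bullet> x) powr (- 1 / 2) * (x \<bullet> x) powr (- 1 / 2) = 1 / (x \<bullet> x)"
    by (simp add: powr_add[symmetric] powr_minus_divide)
  then show ?thesis using \<open>x \<bullet> x > 0\<close> by (simp add: S3_iff(1) mult.assoc[symmetric])
qed

lemma Ck_on_radial: "Ck_on k (- {0}) (\<lambda>x::real^4. (x \<bullet> x) powr (- 1 / 2) *\<^sub>R x)"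
proof (intro Ck_on_scaleR)
  have "Ck_on k (- {0}) (\<lambda>x::real^4. x \<bullet> x)"
    by (intro Ck_on_inner Ck_on_bounded_linear) auto
  then show "Ck_on k (- {0}) (\<lambda>x::real^4. (x \<bullet> x) powr (- 1 / 2))"
    by (intro Ck_on_compose[OF _ _ _ Ck_on_powr]) auto
qed (auto intro!: Ck_on_bounded_linear)

lemma radial_ext_S3: "x \<in> S3 \<Longrightarrow> radial_ext f x = f x"
  by (simp add: radial_ext_def S3_iff)

lemma smooth_away_0_radial_ext:
  assumes "smooth_on_mfd S3 f"
  shows "smooth_away_0 (radial_ext f)"
  unfolding smooth_away_0_def
proof
  fix k
  show "Ck_on k (- {0}) (radial_ext f)"
  proof (rule Ck_on_local)
    fix x :: "real^4" assume "x \<in> - {0}"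
    define N where "N = (\<lambda>x::real^4. (x \<bullet> x) powr (- 1 / 2) *\<^sub>R x)"
    have "N x \<in> S3" using radial_S3 \<open>x \<in> - {0}\<close> by (auto simp: N_def)
    then obtain U F where U: "open U" "N x \<in> U" "\<And>k. Ck_on k U F" "\<And>y. y \<in> U \<inter> S3 \<Longrightarrow> F y = f y"
      using assms unfolding smooth_on_mfd_def by metis
    define W where "W = (- {0}) \<inter> N -` U"
    have "continuous_on (- {0}) N"
      unfolding N_def by (rule Ck_on_imp_continuous_on[OF Ck_on_radial])
    then have W: "open W" unfolding W_def by (rule continuous_open_preimage) (auto simp: U)
    moreover have "x \<in> W" using \<open>x \<in> - {0}\<close> U by (auto simp: W_def)
    moreover have "Ck_on k W (radial_ext f)"
    proof (rule Ck_on_cong[OF W])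
      show "Ck_on k W (\<lambda>y. F (N y))"
      proof (rule Ck_on_compose[OF W U(1) _ U(3)])
        show "Ck_on k W N"
          using Ck_on_subset[OF Ck_on_radial[folded N_def]] by (simp add: W_def)
      qed (auto simp: W_def)
      show "F (N y) = radial_ext f y" if "y \<in> W" for y
        using that U(4)[of "N y"] radial_S3[of y] by (auto simp: W_def radial_ext_def N_def)
    qed
    ultimately show "\<exists>W. open W \<and> x \<in> W \<and> Ck_on k W (radial_ext f)" by blast
  qed
qed

lemma smooth_on_S3I:
  assumes "smooth_away_0 F" "\<And>x. x \<in> S3 \<Longrightarrow> f x = F x"
  shows "smooth_on_mfd S3 f"
  unfolding smooth_on_mfd_def
  by (intro ballI exI[of _ "- {0}"] exI[of _ F])
    (use assms in \<open>auto simp: smooth_away_0_def S3_nonzero\<close>)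

lemma smooth_const: "smooth_away_0 (\<lambda>x. c)"
  by (auto simp: smooth_away_0_def intro!: Ck_on_const)
lemma smooth_linear: "bounded_linear L \<Longrightarrow> smooth_away_0 L"
  by (auto simp: smooth_away_0_def intro!: Ck_on_bounded_linear)
lemma smooth_add: "smooth_away_0 f \<Longrightarrow> smooth_away_0 g \<Longrightarrow> smooth_away_0 (\<lambda>x. f x + g x)"
  by (auto simp: smooth_away_0_def intro!: Ck_on_add)
lemma smooth_mult: 
  fixes f :: "_ \<Rightarrow> real"
  shows "smooth_away_0 f \<Longrightarrow> smooth_away_0 g \<Longrightarrow> smooth_away_0 (\<lambda>x. f x * g x)"
  by (auto simp: smooth_away_0_def intro!: Ck_on_mult)
lemma smooth_scaleR: "smooth_away_0 f \<Longrightarrow> smooth_away_0 g \<Longrightarrow> smooth_away_0 (\<lambda>x. f x *\<^sub>R g x)"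
  by (auto simp: smooth_away_0_def intro!: Ck_on_scaleR)
lemma smooth_inner: "smooth_away_0 f \<Longrightarrow> smooth_away_0 g \<Longrightarrow> smooth_away_0 (\<lambda>x. f x \<bullet> g x)"
  by (auto simp: smooth_away_0_def intro!: Ck_on_inner)
lemma smooth_minus: "smooth_away_0 f \<Longrightarrow> smooth_away_0 (\<lambda>x. - f x)"
  by (auto simp: smooth_away_0_def intro!: Ck_on_linear_compose[OF _ bounded_linear_minus[OF bounded_linear_ident]])
lemma smooth_diff: "smooth_away_0 f \<Longrightarrow> smooth_away_0 g \<Longrightarrow> smooth_away_0 (\<lambda>x. f x - g x)"
  using smooth_add[OF _ smooth_minus, of f g] by simp
lemma smooth_sum: "(\<And>i. i \<in> I \<Longrightarrow> smooth_away_0 (f i)) \<Longrightarrow> smooth_away_0 (\<lambda>x. \<Sum>i\<in>I. f i x)"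
  by (auto simp: smooth_away_0_def intro!: Ck_on_sum)
lemma smooth_cmult: 
  fixes f :: "_ \<Rightarrow> real"
  shows "smooth_away_0 f \<Longrightarrow> smooth_away_0 (\<lambda>x. c * f x)"
  by (intro smooth_mult smooth_const)
lemma smooth_partial: "smooth_away_0 f \<Longrightarrow> smooth_away_0 (\<lambda>x. frechet_derivative f (at x) v)"
  by (metis Ck_on.simps(2) smooth_away_0_def)
lemma smooth_frame: "smooth_away_0 (\<lambda>x. qmul x a)"
  by (rule smooth_linear[OF bounded_linear_qmul_left])

lemma smooth_has_derivative:
  "smooth_away_0 f \<Longrightarrow> x \<noteq> 0 \<Longrightarrow> (f has_derivative frechet_derivative f (at x)) (at x)"
  by (metis Ck_on_SucD smooth_away_0_def ComplI singletonD)
lemma smooth_differentiable: "smooth_away_0 f \<Longrightarrow> x \<noteq> 0 \<Longrightarrow> f differentiable (at x)"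
  using smooth_has_derivative differentiableI by blast
lemma smooth_continuous_on: "smooth_away_0 f \<Longrightarrow> continuous_on (- {0}) f"
  by (metis Ck_on.simps(1) smooth_away_0_def)
lemma smooth_continuous_on_S3: "smooth_away_0 f \<Longrightarrow> continuous_on S3 f"
  using continuous_on_subset[OF smooth_continuous_on] S3_nonzero by blast

subsection \<open>Left-invariant derivatives\<close>

text \<open>
  The fields \<open>x a\<close> are the left-invariant ones: they commute with left translations and generate the
  right translations. The definition makes sense for every quaternion \<open>a\<close>; for \<open>a = 1\<close> it is the
  radial derivative.\<close>

definition Lie :: "real^4 \<Rightarrow> (real^4 \<Rightarrow> real) \<Rightarrow> real^4 \<Rightarrow> real" where
  "Lie a F x = frechet_derivative F (at x) (qmul x a)"

lemma Lie_sum_Basis: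
  "smooth_away_0 F \<Longrightarrow> x \<noteq> 0 \<Longrightarrow> Lie a F x = (\<Sum>b\<in>Basis. (qmul x a \<bullet> b) * frechet_derivative F (at x) b)"
  unfolding Lie_def using frechet_derivative_sum_Basis[OF smooth_differentiable] by (metis (no_types, lifting) real_scaleR_def sum.cong)

lemma smooth_Lie:
  assumes "smooth_away_0 F" shows "smooth_away_0 (Lie a F)"
  unfolding smooth_away_0_def
proof
  fix k
  have "smooth_away_0 (\<lambda>x. \<Sum>b\<in>Basis. (qmul x a \<bullet> b) * frechet_derivative F (at x) b)"
    by (intro smooth_sum smooth_mult smooth_inner smooth_frame smooth_const smooth_partial assms)
  then show "Ck_on k (- {0}) (Lie a F)"
    unfolding smooth_away_0_def
    by (intro Ck_on_cong[OF open_punctured, where g="Lie a F"]) (auto simp: Lie_sum_Basis[OF assms])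
qed

lemma Lie_eqI: "(F has_derivative F') (at x) \<Longrightarrow> Lie a F x = F' (qmul x a)"
  unfolding Lie_def using frechet_derivative_at by metis

lemma Lie_const [simp]: "Lie a (\<lambda>x. c) x = 0"
  by (simp add: Lie_def)

lemma Lie_add: "smooth_away_0 f \<Longrightarrow> smooth_away_0 g \<Longrightarrow> x \<noteq> 0 \<Longrightarrow> Lie a (\<lambda>x. f x + g x) x = Lie a f x + Lie a g x"
  by (subst Lie_eqI[OF has_derivative_add[OF smooth_has_derivative smooth_has_derivative]]) (auto simp: Lie_def)

lemma Lie_diff: "smooth_away_0 f \<Longrightarrow> smooth_away_0 g \<Longrightarrow> x \<noteq> 0 \<Longrightarrow> Lie a (\<lambda>x. f x - g x) x = Lie a f x - Lie a g x"
  by (subst Lie_eqI[OF has_derivative_diff[OF smooth_has_derivative smooth_has_derivative]]) (auto simp: Lie_def)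

lemma Lie_mult: "smooth_away_0 f \<Longrightarrow> smooth_away_0 g \<Longrightarrow> x \<noteq> 0 \<Longrightarrow>
   Lie a (\<lambda>x. f x * g x) x = f x * Lie a g x + Lie a f x * g x"
  by (subst Lie_eqI[OF has_derivative_mult[OF smooth_has_derivative smooth_has_derivative]]) (auto simp: Lie_def)

lemma Lie_cmult: "smooth_away_0 f \<Longrightarrow> x \<noteq> 0 \<Longrightarrow> Lie a (\<lambda>x. c * f x) x = c * Lie a f x"
  by (subst Lie_mult) (auto intro: smooth_const)

lemma Lie_direction: "smooth_away_0 f \<Longrightarrow> x \<noteq> 0 \<Longrightarrow> Lie (c *\<^sub>R a) f x = c * Lie a f x"
  using linear_frechet_derivative[OF smooth_differentiable, of f x]
  by (simp add: Lie_def qmul_linear_simps linear_cmul)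

text \<open>
  The first-order term comes from differentiating the linear field \<open>x b\<close>; it is the only part that is
  not symmetric in \<open>a\<close> and \<open>b\<close>.\<close>

lemma Lie_Lie:
  assumes F: "smooth_away_0 F" and x: "x \<noteq> 0"
  shows "Lie a (Lie b F) x = Lie (qmul a b) F x +
    (\<Sum>c\<in>Basis. \<Sum>d\<in>Basis. (qmul x b \<bullet> c) * (qmul x a \<bullet> d) *
        frechet_derivative (\<lambda>y. frechet_derivative F (at y) c) (at x) d)"
proof -
  let ?D = "\<lambda>c x. frechet_derivative F (at x) c"
  have D: "(?D c has_derivative frechet_derivative (?D c) (at x)) (at x)" for c
    by (rule smooth_has_derivative[OF smooth_partial[OF F] x])
  have DD: "frechet_derivative (?D c) (at x) (qmul x a) = (\<Sum>d\<in>Basis. (qmul x a \<bullet> d) * frechet_derivative (?D c) (at x) d)" for c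
    using frechet_derivative_sum_Basis[where f="?D c" and v="qmul x a", OF smooth_differentiable[OF smooth_partial[OF F] x]]
    by (simp only: real_scaleR_def)
  have "((\<lambda>x. \<Sum>c\<in>Basis. (qmul x b \<bullet> c) * ?D c x) has_derivative
     (\<lambda>v. \<Sum>c\<in>Basis. (qmul x b \<bullet> c) * frechet_derivative (?D c) (at x) v + (qmul v b \<bullet> c) * ?D c x)) (at x)"
    by (intro has_derivative_sum has_derivative_mult D has_derivative_inner_left
        bounded_linear_imp_has_derivative bounded_linear_qmul_left)
  then have "(Lie b F has_derivative
     (\<lambda>v. \<Sum>c\<in>Basis. (qmul x b \<bullet> c) * frechet_derivative (?D c) (at x) v + (qmul v b \<bullet> c) * ?D c x)) (at x)"
    by (rule has_derivative_transform_within_open[OF _ open_punctured]) (use x Lie_sum_Basis[OF F] in auto)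
  from Lie_eqI[OF this, of a] have
    "Lie a (Lie b F) x = (\<Sum>c\<in>Basis. (qmul x b \<bullet> c) * frechet_derivative (?D c) (at x) (qmul x a))
       + (\<Sum>c\<in>Basis. (qmul (qmul x a) b \<bullet> c) * ?D c x)"
    by (simp add: sum.distrib)
  also have "(\<Sum>c\<in>Basis. (qmul (qmul x a) b \<bullet> c) * ?D c x) = Lie (qmul a b) F x"
    by (simp add: Lie_sum_Basis[OF F x] qmul_assoc)
  finally show ?thesis by (simp add: DD sum_distrib_left mult.assoc)
qed

lemma Lie_commutator:
  assumes F: "smooth_away_0 F" and x: "x \<noteq> 0"
  shows "Lie a (Lie b F) x - Lie b (Lie a F) x = Lie (qmul a b - qmul b a) F x"
proof -
  let ?H = "\<lambda>c d. frechet_derivative (\<lambda>y. frechet_derivative F (at y) c) (at x) d"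
  have sym: "?H c d = ?H d c" for c d
    using symmetric_second_derivative[of "- {0}" F x c d] F x by (auto simp: smooth_away_0_def)
  have "(\<Sum>c\<in>Basis. \<Sum>d\<in>Basis. (qmul x b \<bullet> c) * (qmul x a \<bullet> d) * ?H c d)
      = (\<Sum>d\<in>Basis. \<Sum>c\<in>Basis. (qmul x b \<bullet> c) * (qmul x a \<bullet> d) * ?H c d)"
    by (rule sum.swap)
  also have "\<dots> = (\<Sum>c\<in>Basis. \<Sum>d\<in>Basis. (qmul x a \<bullet> c) * (qmul x b \<bullet> d) * ?H c d)"
  proof (intro sum.cong refl)
    fix c d :: "real^4"
    show "(qmul x b \<bullet> d) * (qmul x a \<bullet> c) * ?H d c = (qmul x a \<bullet> c) * (qmul x b \<bullet> d) * ?H c d"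
      using sym[of d c] by simp
  qed
  finally have "Lie a (Lie b F) x - Lie b (Lie a F) x = Lie (qmul a b) F x - Lie (qmul b a) F x"
    by (simp add: Lie_Lie[OF F x])
  also have "\<dots> = Lie (qmul a b - qmul b a) F x"
    using linear_frechet_derivative[OF smooth_differentiable[OF F x]]
    by (simp add: Lie_def qmul_linear_simps linear_diff)
  finally show ?thesis .
qed

definition imaginary_unit :: "real^4 \<Rightarrow> bool" where
  "imaginary_unit a \<longleftrightarrow> a$1 = 0 \<and> a \<bullet> a = 1"

text \<open>
  The one-parameter group of an imaginary unit \<open>a\<close>, so that right multiplication by it is the flow of
  the left-invariant field \<open>x a\<close>.\<close>

definition qexp :: "real^4 \<Rightarrow> real \<Rightarrow> real^4" where
  "qexp a t = cos t *\<^sub>R qone + sin t *\<^sub>R a"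

lemma imaginary_unit_square: "imaginary_unit a \<Longrightarrow> qmul a a = - qone"
  by (auto simp: imaginary_unit_def quat_simps qone_def algebra_simps)

lemma qexp_add: "imaginary_unit a \<Longrightarrow> qexp a (s + t) = qmul (qexp a s) (qexp a t)"
  by (simp add: qexp_def qmul_linear_simps imaginary_unit_square cos_add sin_add algebra_simps)

lemma qexp_0 [simp]: "qexp a 0 = qone" by (simp add: qexp_def)

lemma qexp_S3:
  assumes "imaginary_unit a"
  shows "qexp a t \<in> S3"
proof -
  have "qone \<bullet> a = 0" "a \<bullet> qone = 0" "a \<bullet> a = 1" "qone \<bullet> qone = 1"
    using assms by (auto simp: imaginary_unit_def inner_vec_def sum_4 qone_def)
  then have "qexp a t \<bullet> qexp a t = (cos t)\<^sup>2 + (sin t)\<^sup>2"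
    by (simp add: qexp_def inner_add_left inner_add_right power2_eq_square)
  then show ?thesis by (simp add: S3_iff(1))
qed

lemma qexp_has_vector_derivative: "(qexp a has_vector_derivative (- sin t) *\<^sub>R qone + cos t *\<^sub>R a) (at t)"
  unfolding qexp_def
  by (rule has_vector_derivative_eq_rhs, rule has_vector_derivative_add;
      (rule has_vector_derivative_scaleR has_vector_derivative_const)?)
    (auto intro!: derivative_eq_intros)

text \<open>
  A kernel \<open>k (r * (x \<bullet> y))\<close> with \<open>k\<close> smooth on the open interval (-1, 1) is smooth near the sphere
  but not on the punctured space. For such functions the left-invariant derivative is taken along the
  orbits of its flow, which stay on the sphere.\<close>

definition has_Lie :: "real^4 \<Rightarrow> (real^4 \<Rightarrow> real) \<Rightarrow> (real^4 \<Rightarrow> real) \<Rightarrow> bool" where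
  "has_Lie a F G \<longleftrightarrow> continuous_on S3 G \<and>
     (\<forall>x\<in>S3. ((\<lambda>t. F (qmul x (qexp a t))) has_real_derivative G x) (at 0))"

lemma curve_has_real_derivative:
  assumes "(F has_derivative F') (at (qmul x (qexp a 0)))"
  shows "((\<lambda>t. F (qmul x (qexp a t))) has_real_derivative F' (qmul x a)) (at 0)"
proof -
  have "((\<lambda>t. qmul x (qexp a t)) has_derivative (\<lambda>r. r *\<^sub>R qmul x a)) (at 0)"
    using bounded_linear.has_derivative[OF bounded_linear_qmul_right
      qexp_has_vector_derivative[of a 0, unfolded has_vector_derivative_def]]
    by (simp add: qmul_linear_simps)
  from has_derivative_compose[where f="\<lambda>t. qmul x (qexp a t)" and g=F, OF this assms] have
    "((\<lambda>t. F (qmul x (qexp a t))) has_derivative (\<lambda>r. F' (r *\<^sub>R qmul x a))) (at 0)" .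
  moreover have "linear F'" using assms has_derivative_linear by blast
  ultimately show ?thesis
    by (simp add: has_field_derivative_def linear_cmul mult_commute_abs)
qed

lemma has_Lie_Lie: "smooth_away_0 F \<Longrightarrow> has_Lie a F (Lie a F)"
  unfolding has_Lie_def
proof safe
  assume F: "smooth_away_0 F"
  then show "continuous_on S3 (Lie a F)" by (intro smooth_continuous_on_S3 smooth_Lie)
  fix x assume "x \<in> S3"
  then show "((\<lambda>t. F (qmul x (qexp a t))) has_real_derivative Lie a F x) (at 0)"
    unfolding Lie_def by (intro curve_has_real_derivative) (auto intro!: smooth_has_derivative F dest: S3_nonzero)
qed

lemma Lie_cong_S3:
  assumes "smooth_away_0 F" "smooth_away_0 G" "\<And>x. x \<in> S3 \<Longrightarrow> F x = G x" "imaginary_unit a" "x \<in> S3"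
  shows "Lie a F x = Lie a G x"
proof -
  have "((\<lambda>t. F (qmul x (qexp a t))) has_real_derivative Lie a F x) (at 0)"
    "((\<lambda>t. G (qmul x (qexp a t))) has_real_derivative Lie a G x) (at 0)"
    using has_Lie_Lie assms(1,2,5) unfolding has_Lie_def by auto
  moreover have "F (qmul x (qexp a t)) = G (qmul x (qexp a t))" for t
    using assms(3-5) qmul_S3 qexp_S3 by blast
  ultimately show ?thesis using DERIV_unique by auto
qed

lemma has_Lie_mult:
  assumes "has_Lie a F F'" "has_Lie a G G'" "continuous_on S3 F" "continuous_on S3 G"
  shows "has_Lie a (\<lambda>x. F x * G x) (\<lambda>x. F' x * G x + F x * G' x)"
  unfolding has_Lie_def
proof safe
  show "continuous_on S3 (\<lambda>x. F' x * G x + F x * G' x)"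
    using assms by (auto simp: has_Lie_def intro!: continuous_intros)
  fix x assume "x \<in> S3"
  then show "((\<lambda>t. F (qmul x (qexp a t)) * G (qmul x (qexp a t))) has_real_derivative F' x * G x + F x * G' x) (at 0)"
    using assms by (auto simp: has_Lie_def intro!: derivative_eq_intros)
qed

section \<open>Gradients, cross products and parallel transport on quadrics\<close>

definition det4 :: "real^4 \<Rightarrow> real^4 \<Rightarrow> real^4 \<Rightarrow> real^4 \<Rightarrow> real" where
  "det4 x a b d = det (vector [x, a, b, d] :: real^4^4)"

lemma det4_expand: "det4 x a b d =
    x$1 * (a$2 * b$3 * d$4 + a$3 * b$4 * d$2 + a$4 * b$2 * d$3 - a$2 * b$4 * d$3 - a$3 * b$2 * d$4 - a$4 * b$3 * d$2)
  - x$2 * (a$1 * b$3 * d$4 + a$3 * b$4 * d$1 + a$4 * b$1 * d$3 - a$1 * b$4 * d$3 - a$3 * b$1 * d$4 - a$4 * b$3 * d$1)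
  + x$3 * (a$1 * b$2 * d$4 + a$2 * b$4 * d$1 + a$4 * b$1 * d$2 - a$1 * b$4 * d$2 - a$2 * b$1 * d$4 - a$4 * b$2 * d$1)
  - x$4 * (a$1 * b$2 * d$3 + a$2 * b$3 * d$1 + a$3 * b$1 * d$2 - a$1 * b$3 * d$2 - a$2 * b$1 * d$3 - a$3 * b$2 * d$1)"
  unfolding det4_def det_4 by simp

lemma det4_linear:
  "det4 x (a + a') b d = det4 x a b d + det4 x a' b d" "det4 x (r *\<^sub>R a) b d = r * det4 x a b d"
  "det4 x a (b + b') d = det4 x a b d + det4 x a b' d" "det4 x a (r *\<^sub>R b) d = r * det4 x a b d"
  "det4 x a b (d + d') = det4 x a b d + det4 x a b d'" "det4 x a b (r *\<^sub>R d) = r * det4 x a b d"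
  "det4 x (a - a') b d = det4 x a b d - det4 x a' b d" "det4 x a b (d - d') = det4 x a b d - det4 x a b d'"
  by (simp_all add: det4_expand algebra_simps)

text \<open>
  The cancellations behind all formulas for parallel transport: a multiple of \<open>x\<close> or \<open>y\<close> in one
  argument does not contribute when the same vector stands in another.\<close>

lemma det4_alternating:
  "det4 x a b x = 0" "det4 x x b d = 0" "det4 x a x d = 0" "det4 x a a d = 0" "det4 x a b a = 0" "det4 x a b b = 0"
  by (simp_all add: det4_expand algebra_simps)

lemma has_vector_derivative_zero_constant_interval:
  fixes f :: "real \<Rightarrow> 'a::real_normed_vector"
  assumes "\<And>t. t \<in> {0..l} \<Longrightarrow> (f has_vector_derivative 0) (at t within {0..l})" "t \<in> {0..l}"
  shows "f t = f 0"
  by (rule has_derivative_zero_unique[where s="{0..l}"])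
    (use assms in \<open>auto simp: has_vector_derivative_def\<close>)

text \<open>
  The unit sphere (\<open>\<sigma> = 1\<close>, \<open>c = cos\<close>, \<open>s = sin\<close>) and the hyperboloid (\<open>\<sigma> = - 1\<close>, \<open>c = cosh\<close>,
  \<open>s = sinh\<close>) are treated together. The curves \<open>c t *\<^sub>R x + s t *\<^sub>R v\<close> are the unit speed geodesics,
  and \<open>cofactor\<close> is the vector that represents the linear form \<open>det (x, a, b, -)\<close> with respect to \<open>g\<close>,
  that is, the cross product.\<close>

locale quadric =
  fixes g :: form and M :: "(real^4) set" and \<sigma> :: real and c s :: "real \<Rightarrow> real"
    and cofactor :: "real^4 \<Rightarrow> real^4 \<Rightarrow> real^4 \<Rightarrow> real^4"
  assumes bilinear_g: "bounded_bilinear g"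
    and sym: "g x y = g y x"
    and sigma: "\<sigma> * \<sigma> = 1"
    and M_level: "x \<in> M \<Longrightarrow> g x x = \<sigma>"
    and pos: "x \<in> M \<Longrightarrow> g x v = 0 \<Longrightarrow> v \<noteq> 0 \<Longrightarrow> g v v > 0"
    and geodesic_M: "x \<in> M \<Longrightarrow> g x v = 0 \<Longrightarrow> g v v = 1 \<Longrightarrow> c t *\<^sub>R x + s t *\<^sub>R v \<in> M"
    and deriv_c: "(c has_real_derivative - \<sigma> * s t) (at t)"
    and deriv_s: "(s has_real_derivative c t) (at t)"
    and cs_0: "c 0 = 1" "s 0 = 0"
    and cs_square: "c t * c t + \<sigma> * (s t * s t) = 1"
    and cofactor: "g (cofactor x a b) d = det4 x a b d"
begin

sublocale g: bounded_bilinear g by (rule bilinear_g)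

lemmas g_simps = g.add_left g.add_right g.diff_left g.diff_right g.scaleR_left g.scaleR_right
  g.minus_left g.minus_right g.zero_left g.zero_right

lemma tangentD: "v \<in> tangent g x \<Longrightarrow> g x v = 0" by (simp add: tangent_def)

lemma tangent_proj_eq: "x \<in> M \<Longrightarrow> tangent_proj g x w = w - (\<sigma> * g x w) *\<^sub>R x"
  using sigma by (simp add: tangent_proj_def M_level)
    (metis divide_inverse inverse_unique mult.commute)

lemma tangent_eqI:
  assumes "x \<in> M" "v \<in> tangent g x" "w \<in> tangent g x" "\<And>d. d \<in> tangent g x \<Longrightarrow> g v d = g w d"
  shows "v = w"
proof (rule ccontr)
  assume "v \<noteq> w"
  have "v - w \<in> tangent g x" using assms by (simp add: tangent_def g_simps)
  then have "g (v - w) (v - w) = 0" using assms(4)[of "v - w"] by (simp add: g_simps)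
  moreover have "g (v - w) (v - w) > 0"
    using pos[OF assms(1), of "v - w"] \<open>v - w \<in> _\<close> \<open>v \<noteq> w\<close> by (simp add: tangent_def)
  ultimately show False by simp
qed

lemma geodesic_derivative:
  assumes "x \<in> M" "g x u = 0" "g u u = 1" "(f has_derivative f') (at x within M)"
  shows "((\<lambda>t. f (c t *\<^sub>R x + s t *\<^sub>R u)) has_vector_derivative f' u) (at 0)"
proof -
  let ?\<gamma> = "\<lambda>t. c t *\<^sub>R x + s t *\<^sub>R u"
  have "(?\<gamma> has_vector_derivative ((- \<sigma> * s 0) *\<^sub>R x + c 0 *\<^sub>R u)) (at 0)"
    by (auto intro!: derivative_eq_intros has_vector_derivative_scaleR
        has_real_derivative_iff_has_vector_derivative[THEN iffD1] deriv_c[THEN DERIV_subset] deriv_s simp: deriv_c deriv_s)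
  then have d: "(?\<gamma> has_derivative (\<lambda>r. r *\<^sub>R u)) (at 0)" by (simp add: cs_0 has_vector_derivative_def)
  have "(f has_derivative f') (at (?\<gamma> 0) within range ?\<gamma>)"
    using assms geodesic_M by (auto simp: cs_0 intro!: has_derivative_subset[OF assms(4)])
  from has_derivative_in_compose[OF d this] show ?thesis
    using assms(4) has_derivative_linear[OF assms(4)] by (simp add: has_vector_derivative_def linear_cmul)
qed

text \<open>
  Each tangent direction is realised by a geodesic in \<open>M\<close>, along which the derivative is an ordinary
  one. Hence a derivative within \<open>M\<close> is determined on tangent vectors.\<close>

lemma derivative_within_unique:
  assumes "x \<in> M" "(f has_derivative f') (at x within M)" "(f has_derivative f'') (at x within M)"
    and "v \<in> tangent g x"
  shows "f' v = f'' v"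
proof (cases "v = 0")
  case True
  then show ?thesis using assms has_derivative_linear linear_0 by metis
next
  case False
  define r where "r = sqrt (g v v)"
  have "g v v > 0" using pos assms False by (auto simp: tangent_def)
  then have r: "r > 0" "r * r = g v v" by (simp_all add: r_def)
  define u where "u = (1 / r) *\<^sub>R v"
  have u: "g x u = 0" "g u u = 1" "v = r *\<^sub>R u"
    using assms(4) r \<open>g v v > 0\<close> by (simp_all add: u_def tangent_def g_simps)
  have "f' u = f'' u"
    using geodesic_derivative[OF assms(1) u(1,2)] assms(2,3) vector_derivative_unique_at by blast
  then show ?thesis
    using has_derivative_linear[OF assms(2)] has_derivative_linear[OF assms(3)] by (simp add: u(3) linear_cmul)
qed

lemma frechet_derivative_within:
  assumes "x \<in> M" "(f has_derivative f') (at x within M)" "v \<in> tangent g x"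
  shows "frechet_derivative f (at x within M) v = f' v"
  using derivative_within_unique[OF assms(1) _ assms(2,3)] assms(2) frechet_derivative_works differentiableI
  by blast

lemma grad_eqI:
  assumes "x \<in> M" "(f has_derivative f') (at x within M)" "w \<in> tangent g x"
    "\<And>v. v \<in> tangent g x \<Longrightarrow> g w v = f' v"
  shows "grad g M f x = w"
proof -
  have "f differentiable (at x within M)" using assms(2) differentiableI by blast
  moreover have "(THE w. w \<in> tangent g x \<and>
     (\<forall>v\<in>tangent g x. g w v = frechet_derivative f (at x within M) v)) = w"
    using assms frechet_derivative_within[OF assms(1,2)] tangent_eqI[OF assms(1)]
    by (intro the_equality) auto
  ultimately show ?thesis by (simp add: grad_def)
qed

text \<open>
  The derivatives in the directions \<open>u\<close> and \<open>- u\<close> agree, so they vanish. This gives the gradients of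
  the singular kernels at \<open>y = x\<close> and \<open>y = - x\<close>; where the kernel is not differentiable the gradient
  is 0 by convention.\<close>

lemma grad_even:
  assumes "x \<in> M"
    and even: "\<And>u t. g x u = 0 \<Longrightarrow> g u u = 1 \<Longrightarrow> f (c t *\<^sub>R x + s t *\<^sub>R u) = f (c t *\<^sub>R x - s t *\<^sub>R u)"
  shows "grad g M f x = 0"
proof (cases "f differentiable (at x within M)")
  case True
  then obtain f' where f': "(f has_derivative f') (at x within M)" by (auto simp: differentiable_def)
  have 0: "f' v = 0" if "v \<in> tangent g x" for v
  proof (cases "v = 0")
    case True
    then show ?thesis using f' has_derivative_linear linear_0 by metis
  next
    case False
    define r where "r = sqrt (g v v)"
    have "g v v > 0" using pos assms False that by (auto simp: tangent_def)
    then have r: "r > 0" "r * r = g v v" by (simp_all add: r_def)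
    define u where "u = (1 / r) *\<^sub>R v"
    have u: "g x u = 0" "g u u = 1" "v = r *\<^sub>R u"
      using that r \<open>g v v > 0\<close> by (simp_all add: u_def tangent_def g_simps)
    have "((\<lambda>t. f (c t *\<^sub>R x + s t *\<^sub>R u)) has_vector_derivative f' u) (at 0)"
      using geodesic_derivative[OF assms(1) u(1,2) f'] .
    moreover have "((\<lambda>t. f (c t *\<^sub>R x + s t *\<^sub>R (- u))) has_vector_derivative f' (- u)) (at 0)"
      using u by (intro geodesic_derivative[OF assms(1) _ _ f']) (auto simp: g_simps)
    ultimately have "f' u = f' (- u)"
      using even[OF u(1,2)] by (simp add: vector_derivative_unique_at)
    then have "f' u = 0" using has_derivative_linear[OF f'] by (simp add: linear_neg)
    then show ?thesis using has_derivative_linear[OF f'] by (simp add: u(3) linear_cmul)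
  qed
  show ?thesis
    by (rule grad_eqI[OF assms(1) f']) (auto simp: tangent_def g_simps 0)
qed (simp add: grad_def)

lemma tangential_part:
  assumes "y \<in> M"
  shows "x - (\<sigma> * g x y) *\<^sub>R y \<in> tangent g y"
  using assms sigma by (simp add: tangent_def g_simps M_level sym[of y x] mult.assoc[symmetric] mult.commute)

text \<open>
  For a function of \<open>g x z\<close>, where \<open>x\<close> is fixed, the gradient points along the projection of \<open>x\<close> to
  the tangent space at \<open>y\<close>.\<close>

lemma grad_zonal:
  assumes y: "y \<in> M" and f: "\<And>z. z \<in> M \<Longrightarrow> g x z \<in> I \<Longrightarrow> f z = k (g x z)"
    and "open I" "g x y \<in> I" and k: "(k has_real_derivative k') (at (g x y))"
  shows "grad g M f y = k' *\<^sub>R (x - (\<sigma> * g x y) *\<^sub>R y)"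
proof -
  have "((\<lambda>z. k (g x z)) has_derivative (\<lambda>v. k' * g x v)) (at y)"
    using has_derivative_compose[OF g.bounded_linear_right[THEN bounded_linear_imp_has_derivative] k[unfolded has_field_derivative_def]] .
  then have d: "((\<lambda>z. k (g x z)) has_derivative (\<lambda>v. k' * g x v)) (at y within M)"
    by (rule has_derivative_at_withinI)
  have "open (g x -` I)"
    using \<open>open I\<close> by (rule open_vimage) (rule linear_continuous_on[OF g.bounded_linear_right])
  then obtain e where e: "e > 0" "\<And>z. dist z y < e \<Longrightarrow> g x z \<in> I"
    using \<open>g x y \<in> I\<close> unfolding open_dist by auto
  have "(f has_derivative (\<lambda>v. k' * g x v)) (at y within M)"
    by (rule has_derivative_transform_within[OF d e(1) y]) (use e(2) f in auto)
  then show ?thesis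
  proof (rule grad_eqI[OF y])
    show "k' *\<^sub>R (x - (\<sigma> * g x y) *\<^sub>R y) \<in> tangent g y"
      using tangential_part[OF y, of x] by (simp add: tangent_def g_simps)
    show "g (k' *\<^sub>R (x - (\<sigma> * g x y) *\<^sub>R y)) v = k' * g x v" if "v \<in> tangent g y" for v
      using tangentD[OF that] by (simp add: g_simps)
  qed
qed

lemma cross_eq:
  assumes "x \<in> M"
  shows "cross g r x a b = r *\<^sub>R cofactor x a b"
  unfolding cross_def det4_def[symmetric]
proof (rule the_equality)
  show 1: "r *\<^sub>R cofactor x a b \<in> tangent g x \<and> (\<forall>d\<in>tangent g x. g (r *\<^sub>R cofactor x a b) d = r * det4 x a b d)"
    by (simp add: tangent_def g_simps cofactor sym[of x] det4_alternating)
  show "w = r *\<^sub>R cofactor x a b" if "w \<in> tangent g x \<and> (\<forall>d\<in>tangent g x. g w d = r * det4 x a b d)" for w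
    using tangent_eqI[OF assms] that 1 by auto
qed

text \<open>
  The defining equations say that the tangential parts of \<open>\<gamma>''\<close> and \<open>W'\<close> vanish; differentiating
  \<open>g(\<gamma>, \<gamma>') = 0\<close> and \<open>g(\<gamma>, W) = 0\<close> gives the normal parts, so \<open>\<gamma>'' = - \<sigma> \<gamma>\<close> and \<open>W' = - \<sigma> g(\<gamma>', W) \<gamma>\<close>.
  Every solution is then known from constants of motion, without a uniqueness theorem for differential
  equations.\<close>

lemma parallel_transport_along_geodesic:
  assumes "l > 0" and \<gamma>: "geodesic_segment g M l \<gamma> \<gamma>' x y" and W: "parallel_along g l \<gamma> W"
  shows "W l = W 0 + g (\<gamma>' 0) (W 0) *\<^sub>R (\<gamma>' l - \<gamma>' 0)"
    and "s l *\<^sub>R \<gamma>' l = c l *\<^sub>R y - x" "s l *\<^sub>R \<gamma>' 0 = y - c l *\<^sub>R x"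
proof -
  let ?I = "{0..l}"
  have M: "\<gamma> t \<in> M" and d\<gamma>: "(\<gamma> has_vector_derivative \<gamma>' t) (at t within ?I)" and unit: "g (\<gamma>' t) (\<gamma>' t) = 1"
    and ex: "\<exists>a. (\<gamma>' has_vector_derivative a) (at t within ?I) \<and> tangent_proj g (\<gamma> t) a = 0"
    if "t \<in> ?I" for t using \<gamma> that by (auto simp: geodesic_segment_def)
  have ends: "\<gamma> 0 = x" "\<gamma> l = y" using \<gamma> by (auto simp: geodesic_segment_def)
  have const: "D = 0" if "t \<in> ?I" "(f has_vector_derivative D) (at t within ?I)" "\<And>r. r \<in> ?I \<Longrightarrow> f r = k"
    for f :: "real \<Rightarrow> real" and D k t
  proof -
    have "(f has_vector_derivative 0) (at t within ?I)"
      by (rule has_vector_derivative_transform[OF that(1) _ has_vector_derivative_const[of k]]) (use that in auto)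
    then show ?thesis
      using vector_derivative_unique_within_closed_interval[of 0 l t f D 0] \<open>l > 0\<close> that by auto
  qed
  have orth: "g (\<gamma> t) (\<gamma>' t) = 0" if t: "t \<in> ?I" for t
  proof -
    have "((\<lambda>r. g (\<gamma> r) (\<gamma> r)) has_vector_derivative g (\<gamma> t) (\<gamma>' t) + g (\<gamma>' t) (\<gamma> t)) (at t within ?I)"
      by (intro g.has_vector_derivative d\<gamma> t)
    from const[OF t this, of \<sigma>] show ?thesis using M M_level by (simp add: sym[of "\<gamma>' t"])
  qed
  have d\<gamma>': "(\<gamma>' has_vector_derivative (- \<sigma>) *\<^sub>R \<gamma> t) (at t within ?I)" if t: "t \<in> ?I" for t
  proof -
    obtain a where a: "(\<gamma>' has_vector_derivative a) (at t within ?I)" "tangent_proj g (\<gamma> t) a = 0"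
      using ex[OF t] by blast
    have "((\<lambda>r. g (\<gamma> r) (\<gamma>' r)) has_vector_derivative g (\<gamma> t) a + g (\<gamma>' t) (\<gamma>' t)) (at t within ?I)"
      by (intro g.has_vector_derivative d\<gamma> a t)
    from const[OF t this, of 0] have ga: "g (\<gamma> t) a = - 1" using orth unit[OF t] by simp
    have "a = (\<sigma> * g (\<gamma> t) a) *\<^sub>R \<gamma> t" using a(2) tangent_proj_eq[OF M[OF t]] by simp
    then have "a = (- \<sigma>) *\<^sub>R \<gamma> t" unfolding ga by simp
    then show ?thesis using a by simp
  qed
  have dc: "(c has_vector_derivative - \<sigma> * s t) (at t within ?I)" and ds: "(s has_vector_derivative c t) (at t within ?I)" for t
    using deriv_c[of t] deriv_s[of t] has_real_derivative_iff_has_vector_derivative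
      has_vector_derivative_at_within by blast+
  \<comment> \<open>For an explicit geodesic this expression is the initial point, the one below the initial
    velocity.\<close>
  have "c t *\<^sub>R \<gamma> t - s t *\<^sub>R \<gamma>' t = c 0 *\<^sub>R \<gamma> 0 - s 0 *\<^sub>R \<gamma>' 0" if "t \<in> ?I" for t
  proof (rule has_vector_derivative_zero_constant_interval[OF _ that])
    fix t assume t: "t \<in> ?I"
    have "((\<lambda>t. c t *\<^sub>R \<gamma> t - s t *\<^sub>R \<gamma>' t) has_vector_derivative
      (c t *\<^sub>R \<gamma>' t + (- \<sigma> * s t) *\<^sub>R \<gamma> t) - (s t *\<^sub>R ((- \<sigma>) *\<^sub>R \<gamma> t) + c t *\<^sub>R \<gamma>' t)) (at t within ?I)"
      by (intro has_vector_derivative_diff has_vector_derivative_scaleR d\<gamma> d\<gamma>' t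
          dc[folded has_real_derivative_iff_has_vector_derivative] ds[folded has_real_derivative_iff_has_vector_derivative])
    then show "((\<lambda>t. c t *\<^sub>R \<gamma> t - s t *\<^sub>R \<gamma>' t) has_vector_derivative 0) (at t within ?I)"
      by (simp add: algebra_simps)
  qed
  from this[of l] \<open>l > 0\<close> show 1: "s l *\<^sub>R \<gamma>' l = c l *\<^sub>R y - x" by (simp add: ends cs_0 algebra_simps)
  have "(\<sigma> * s t) *\<^sub>R \<gamma> t + c t *\<^sub>R \<gamma>' t = (\<sigma> * s 0) *\<^sub>R \<gamma> 0 + c 0 *\<^sub>R \<gamma>' 0" if "t \<in> ?I" for t
  proof (rule has_vector_derivative_zero_constant_interval[OF _ that])
    fix t assume t: "t \<in> ?I"
    have ds': "((\<lambda>t. \<sigma> * s t) has_real_derivative \<sigma> * c t) (at t within ?I)"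
      by (intro DERIV_cmult ds[folded has_real_derivative_iff_has_vector_derivative])
    have "((\<lambda>t. (\<sigma> * s t) *\<^sub>R \<gamma> t + c t *\<^sub>R \<gamma>' t) has_vector_derivative
      ((\<sigma> * s t) *\<^sub>R \<gamma>' t + (\<sigma> * c t) *\<^sub>R \<gamma> t) + (c t *\<^sub>R ((- \<sigma>) *\<^sub>R \<gamma> t) + (- \<sigma> * s t) *\<^sub>R \<gamma>' t)) (at t within ?I)"
      by (intro has_vector_derivative_add has_vector_derivative_scaleR d\<gamma> d\<gamma>' t ds'
          dc[folded has_real_derivative_iff_has_vector_derivative])
    then show "((\<lambda>t. (\<sigma> * s t) *\<^sub>R \<gamma> t + c t *\<^sub>R \<gamma>' t) has_vector_derivative 0) (at t within ?I)"
      by (simp add: algebra_simps)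
  qed
  from this[of l] \<open>l > 0\<close> have 2: "\<gamma>' 0 = (\<sigma> * s l) *\<^sub>R y + c l *\<^sub>R \<gamma>' l" by (simp add: ends cs_0)
  have "s l *\<^sub>R \<gamma>' 0 = (\<sigma> * (s l * s l)) *\<^sub>R y + c l *\<^sub>R (s l *\<^sub>R \<gamma>' l)"
    by (simp add: 2 scaleR_add_right mult_ac)
  also have "\<dots> = (c l * c l + \<sigma> * (s l * s l)) *\<^sub>R y - c l *\<^sub>R x"
    by (simp add: 1 algebra_simps)
  finally show "s l *\<^sub>R \<gamma>' 0 = y - c l *\<^sub>R x" by (simp add: cs_square)
  have Wt: "g (\<gamma> t) (W t) = 0" and exW: "\<exists>a. (W has_vector_derivative a) (at t within ?I) \<and> tangent_proj g (\<gamma> t) a = 0"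
    if "t \<in> ?I" for t using W that by (auto simp: parallel_along_def tangent_def)
  have dW: "(W has_vector_derivative (- \<sigma> * g (\<gamma>' t) (W t)) *\<^sub>R \<gamma> t) (at t within ?I)" if t: "t \<in> ?I" for t
  proof -
    obtain a where a: "(W has_vector_derivative a) (at t within ?I)" "tangent_proj g (\<gamma> t) a = 0"
      using exW[OF t] by blast
    have "((\<lambda>r. g (\<gamma> r) (W r)) has_vector_derivative g (\<gamma> t) a + g (\<gamma>' t) (W t)) (at t within ?I)"
      by (intro g.has_vector_derivative d\<gamma> a t)
    from const[OF t this, of 0] have ga: "g (\<gamma> t) a = - g (\<gamma>' t) (W t)" using Wt by simp
    have "a = (\<sigma> * g (\<gamma> t) a) *\<^sub>R \<gamma> t" using a(2) tangent_proj_eq[OF M[OF t]] by simp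
    then have "a = (- \<sigma> * g (\<gamma>' t) (W t)) *\<^sub>R \<gamma> t" unfolding ga by simp
    then show ?thesis using a by simp
  qed
  have K: "g (\<gamma>' t) (W t) = g (\<gamma>' 0) (W 0)" if "t \<in> ?I" for t
  proof (rule has_vector_derivative_zero_constant_interval[OF _ that])
    fix t assume t: "t \<in> ?I"
    have "((\<lambda>t. g (\<gamma>' t) (W t)) has_vector_derivative
       g (\<gamma>' t) ((- \<sigma> * g (\<gamma>' t) (W t)) *\<^sub>R \<gamma> t) + g ((- \<sigma>) *\<^sub>R \<gamma> t) (W t)) (at t within ?I)"
      by (intro g.has_vector_derivative d\<gamma>' dW t)
    then show "((\<lambda>t. g (\<gamma>' t) (W t)) has_vector_derivative 0) (at t within ?I)"
      using orth[OF t] Wt[OF t] by (simp add: g_simps sym[of "\<gamma>' t" "\<gamma> t"])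
  qed
  \<comment> \<open>The inner product of \<open>W\<close> and the velocity is constant, and \<open>W'\<close> is that multiple of \<open>\<gamma>''\<close>.\<close>
  let ?k = "g (\<gamma>' 0) (W 0)"
  have "W t - ?k *\<^sub>R \<gamma>' t = W 0 - ?k *\<^sub>R \<gamma>' 0" if "t \<in> ?I" for t
  proof (rule has_vector_derivative_zero_constant_interval[OF _ that])
    fix t assume t: "t \<in> ?I"
    have "((\<lambda>t. W t - ?k *\<^sub>R \<gamma>' t) has_vector_derivative
       (- \<sigma> * g (\<gamma>' t) (W t)) *\<^sub>R \<gamma> t - ?k *\<^sub>R ((- \<sigma>) *\<^sub>R \<gamma> t)) (at t within ?I)"
      by (intro has_vector_derivative_diff dW t bounded_linear.has_vector_derivative[OF bounded_linear_scaleR_right] d\<gamma>')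
    then show "((\<lambda>t. W t - ?k *\<^sub>R \<gamma>' t) has_vector_derivative 0) (at t within ?I)"
      by (simp add: K[OF t] mult.commute)
  qed
  from this[of l] \<open>l > 0\<close> show "W l = W 0 + ?k *\<^sub>R (\<gamma>' l - \<gamma>' 0)"
    by (simp add: algebra_simps)
qed

text \<open>
  The previous lemma shows that the transported vector is unique and gives its value; the explicit
  geodesic and the explicit parallel field show that one exists, so the description in the definition
  of \<open>transport\<close> applies.\<close>

lemma transport_eq:
  assumes x: "x \<in> M" and y: "y \<in> M" and v: "v \<in> tangent g x" and l: "l > 0" "s l \<noteq> 0" "g x y = \<sigma> * c l"
  shows "transport g M l x y v = v - (g v y / (\<sigma> + g x y)) *\<^sub>R (x + y)"
proof -
  have sig: "\<sigma> * (\<sigma> * r) = r" for r using sigma by (simp add: mult.assoc[symmetric])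
  have csl: "(1 - c l) * (1 + c l) = \<sigma> * (s l * s l)"
    using cs_square[of l] by (simp add: algebra_simps)
  have "\<sigma> \<noteq> 0" using sigma by auto
  with csl have c1: "1 + c l \<noteq> 0" "1 - c l \<noteq> 0" using l(2) by auto
  have uniq: "W l = v - (g v y / (\<sigma> + g x y)) *\<^sub>R (x + y)"
    if \<gamma>: "geodesic_segment g M l \<gamma> \<gamma>' x y" and W: "parallel_along g l \<gamma> W" and "W 0 = v" for \<gamma> \<gamma>' W
  proof -
    note R = parallel_transport_along_geodesic[OF l(1) \<gamma> W]
    have a: "\<gamma>' l = (1 / s l) *\<^sub>R (c l *\<^sub>R y - x)" "\<gamma>' 0 = (1 / s l) *\<^sub>R (y - c l *\<^sub>R x)"
      using l(2) R(2,3) by (simp_all flip: R(2,3))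
    have "g (\<gamma>' 0) v = g v y / s l"
      using v by (simp add: a g_simps tangent_def sym[of y v])
    moreover have "\<gamma>' l - \<gamma>' 0 = (- (1 - c l) / s l) *\<^sub>R (x + y)"
      unfolding a by (simp add: algebra_simps add_divide_distrib diff_divide_distrib)
    ultimately have "W l = v + (g v y / s l * (- (1 - c l) / s l)) *\<^sub>R (x + y)"
      using R(1) \<open>W 0 = v\<close> by simp
    also have "g v y / s l * (- (1 - c l) / s l) = - (g v y / (\<sigma> + g x y))"
    proof -
      have ss: "s l * s l = \<sigma> * ((1 - c l) * (1 + c l))"
        using sig[of "s l * s l"] by (simp add: csl)
      have "g v y / s l * (- (1 - c l) / s l) = - ((1 - c l) * g v y / (s l * s l))"
        by (simp add: algebra_simps diff_divide_distrib)
      also have "s l * s l = (1 - c l) * (\<sigma> * (1 + c l))" by (simp only: ss mult_ac)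
      also have "(1 - c l) * g v y / ((1 - c l) * (\<sigma> * (1 + c l))) = g v y / (\<sigma> * (1 + c l))"
        by (rule mult_divide_mult_cancel_left[OF c1(2)])
      finally show ?thesis by (simp add: l(3) algebra_simps)
    qed
    finally show ?thesis by simp
  qed
  \<comment> \<open>The initial velocity of the geodesic from \<open>x\<close> to \<open>y\<close>.\<close>
  define \<xi> where "\<xi> = (1 / s l) *\<^sub>R (y - c l *\<^sub>R x)"
  define \<gamma> where "\<gamma> t = c t *\<^sub>R x + s t *\<^sub>R \<xi>" for t
  define \<gamma>' where "\<gamma>' t = (- \<sigma> * s t) *\<^sub>R x + c t *\<^sub>R \<xi>" for t
  define k where "k = \<sigma> * g v \<xi>"
  \<comment> \<open>Integrates \<open>W' = - k \<gamma>\<close>.\<close>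
  define W where "W t = v - k *\<^sub>R (s t *\<^sub>R x + (\<sigma> * (1 - c t)) *\<^sub>R \<xi>)" for t
  have x\<xi>: "g x \<xi> = 0" "g \<xi> x = 0" using l(3) by (simp_all add: \<xi>_def g_simps M_level[OF x] sym[of y x])
  have "g \<xi> \<xi> = (\<sigma> * (1 - c l * c l)) / (s l * s l)"
  proof -
    have "g (y - c l *\<^sub>R x) (y - c l *\<^sub>R x) = \<sigma> * (1 - c l * c l)"
      using l(3) by (simp add: g_simps M_level x y sym[of y x] algebra_simps)
    then show ?thesis by (simp add: \<xi>_def g.scaleR_left g.scaleR_right)
  qed
  also have "1 - c l * c l = \<sigma> * (s l * s l)" using cs_square[of l] by simp
  finally have \<xi>\<xi>: "g \<xi> \<xi> = 1" using l(2) sig by simp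
  have dc: "(c has_real_derivative - \<sigma> * s t) (at t within A)" and ds: "(s has_real_derivative c t) (at t within A)" for t A
    using deriv_c deriv_s by (blast intro: DERIV_subset)+
  have \<gamma>M: "\<gamma> t \<in> M" for t unfolding \<gamma>_def by (rule geodesic_M[OF x x\<xi>(1) \<xi>\<xi>])
  have proj: "tangent_proj g (\<gamma> t) (r *\<^sub>R \<gamma> t) = 0" for r t
    using \<gamma>M[of t] sig by (simp add: tangent_proj_eq g_simps M_level mult.left_commute mult.commute)
  have seg: "geodesic_segment g M l \<gamma> \<gamma>' x y"
    unfolding geodesic_segment_def
  proof (intro conjI ballI)
    show "\<gamma> 0 = x" by (simp add: \<gamma>_def cs_0)
    show "\<gamma> l = y" using l(2) by (simp add: \<gamma>_def \<xi>_def)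
    fix t assume "t \<in> {0..l}"
    show "\<gamma> t \<in> M" by (rule \<gamma>M)
    show "(\<gamma> has_vector_derivative \<gamma>' t) (at t within {0..l})"
      unfolding \<gamma>_def \<gamma>'_def
      by (rule has_vector_derivative_eq_rhs, rule has_vector_derivative_add;
        (rule has_vector_derivative_scaleR, rule dc ds, rule has_vector_derivative_const)?) simp
    show "g (\<gamma>' t) (\<gamma>' t) = 1"
      using cs_square[of t] by (simp add: \<gamma>'_def g_simps x\<xi> \<xi>\<xi> M_level[OF x] sig algebra_simps)
    have "(\<gamma>' has_vector_derivative (- \<sigma>) *\<^sub>R \<gamma> t) (at t within {0..l})"
      unfolding \<gamma>_def \<gamma>'_def
      by (rule has_vector_derivative_eq_rhs, rule has_vector_derivative_add;
        (rule has_vector_derivative_scaleR, (rule DERIV_cmult[OF ds] dc), rule has_vector_derivative_const)?)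
       (simp add: algebra_simps)
    then show "\<exists>a. (\<gamma>' has_vector_derivative a) (at t within {0..l}) \<and> tangent_proj g (\<gamma> t) a = 0"
      using proj by blast
  qed
  have par: "parallel_along g l \<gamma> W"
    unfolding parallel_along_def
  proof (intro conjI ballI)
    fix t assume "t \<in> {0..l}"
    have "g (\<gamma> t) (W t) = s t * g v \<xi> - k * (\<sigma> * s t)"
      using v by (simp add: \<gamma>_def W_def g_simps x\<xi> \<xi>\<xi> M_level[OF x] tangent_def sym[of \<xi> v] algebra_simps)
    then show "W t \<in> tangent g (\<gamma> t)"
      using sig[of "s t * g v \<xi>"] by (simp add: tangent_def k_def algebra_simps)
    have "((\<lambda>t. \<sigma> * (1 - c t)) has_real_derivative \<sigma> * (0 - - \<sigma> * s t)) (at t within {0..l})"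
      by (intro DERIV_cmult DERIV_diff DERIV_const dc)
    then have d1: "((\<lambda>t. \<sigma> * (1 - c t)) has_real_derivative s t) (at t within {0..l})"
      using sig by simp
    have "((\<lambda>t. s t *\<^sub>R x + (\<sigma> * (1 - c t)) *\<^sub>R \<xi>) has_vector_derivative \<gamma> t) (at t within {0..l})"
      unfolding \<gamma>_def
      by (rule has_vector_derivative_eq_rhs, rule has_vector_derivative_add;
        (rule has_vector_derivative_scaleR, (rule ds d1), rule has_vector_derivative_const)?) simp
    from has_vector_derivative_diff[OF has_vector_derivative_const[of v] bounded_linear.has_vector_derivative[OF bounded_linear_scaleR_right[of k] this]]
    have "(W has_vector_derivative (- k) *\<^sub>R \<gamma> t) (at t within {0..l})"
      unfolding W_def by simp
    then show "\<exists>a. (W has_vector_derivative a) (at t within {0..l}) \<and> tangent_proj g (\<gamma> t) a = 0"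
      using proj by blast
  qed
  have W0: "W 0 = v" by (simp add: W_def cs_0)
  show ?thesis
    unfolding transport_def
  proof (rule the_equality)
    show "\<exists>\<gamma> \<gamma>' W'. geodesic_segment g M l \<gamma> \<gamma>' x y \<and> parallel_along g l \<gamma> W' \<and> W' 0 = v \<and>
       W' l = v - (g v y / (\<sigma> + g x y)) *\<^sub>R (x + y)"
      using seg par W0 uniq[OF seg par W0] by blast
  qed (use uniq in blast)
qed

end

section \<open>The sphere and hyperbolic space as quadrics\<close>

definition S3_cofactor :: "real^4 \<Rightarrow> real^4 \<Rightarrow> real^4 \<Rightarrow> real^4" where
  "S3_cofactor x a b = vector [det4 x a b (axis 1 1), det4 x a b (axis 2 1), det4 x a b (axis 3 1), det4 x a b (axis 4 1)]"

definition H3_cofactor :: "real^4 \<Rightarrow> real^4 \<Rightarrow> real^4 \<Rightarrow> real^4" where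
  "H3_cofactor x a b = vector [- det4 x a b (axis 1 1), det4 x a b (axis 2 1), det4 x a b (axis 3 1), det4 x a b (axis 4 1)]"

lemma S3_cofactor: "S3_cofactor x a b \<bullet> d = det4 x a b d"
  by (simp add: S3_cofactor_def det4_expand inner_vec_def sum_4 axis_def algebra_simps)

lemma H3_cofactor: "lorentz (H3_cofactor x a b) d = det4 x a b d"
  by (simp add: H3_cofactor_def lorentz_def det4_expand inner_vec_def sum_4 axis_def algebra_simps)

lemma bounded_bilinear_lorentz: "bounded_bilinear lorentz"
proof -
  define J :: "real^4 \<Rightarrow> real^4" where "J x = vector [- (x$1), x$2, x$3, x$4]" for x
  have "linear J" by (rule linearI) (simp_all add: J_def vec_eq_iff forall_4)
  then have "bounded_linear J" by (rule linear_conv_bounded_linear[THEN iffD1])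
  from bounded_bilinear.comp1[OF bounded_bilinear_inner this]
  have "bounded_bilinear (\<lambda>x y. J x \<bullet> y)" .
  moreover have "(\<lambda>x y. J x \<bullet> y) = lorentz"
    by (simp add: fun_eq_iff J_def lorentz_def inner_vec_def sum_4)
  ultimately show ?thesis by simp
qed

interpretation lor: bounded_bilinear lorentz by (rule bounded_bilinear_lorentz)

lemma lorentz_sym: "lorentz x y = lorentz y x" by (simp add: lorentz_def mult.commute)

text \<open>
  A vector that is Lorentz orthogonal to a point of the hyperboloid is spacelike: the Cauchy-Schwarz
  inequality for the spatial parts bounds its time component. Hence the form is positive definite on
  tangent spaces, and geodesics stay on the upper sheet.\<close>

lemma lorentz_orthogonal_bound:
  assumes "x \<in> H3" "lorentz x v = 0"
  shows "(v$1)\<^sup>2 \<le> ((x$1)\<^sup>2 - 1) * lorentz v v"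
    and "(v$2)\<^sup>2 + (v$3)\<^sup>2 + (v$4)\<^sup>2 \<le> (x$1)\<^sup>2 * lorentz v v"
proof -
  have x: "(x$1)\<^sup>2 = 1 + ((x$2)\<^sup>2 + (x$3)\<^sup>2 + (x$4)\<^sup>2)"
    using assms by (simp add: H3_def lorentz_def power2_eq_square)
  have v: "x$1 * v$1 = x$2 * v$2 + x$3 * v$3 + x$4 * v$4"
    using assms by (simp add: lorentz_def)
  let ?X = "(x$2)\<^sup>2 + (x$3)\<^sup>2 + (x$4)\<^sup>2" and ?V = "(v$2)\<^sup>2 + (v$3)\<^sup>2 + (v$4)\<^sup>2"
  have "(x$2 * v$2 + x$3 * v$3 + x$4 * v$4)\<^sup>2 \<le> ?X * ?V"
  proof -
    have "?X * ?V - (x$2 * v$2 + x$3 * v$3 + x$4 * v$4)\<^sup>2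
      = (x$2 * v$3 - x$3 * v$2)\<^sup>2 + (x$2 * v$4 - x$4 * v$2)\<^sup>2 + (x$3 * v$4 - x$4 * v$3)\<^sup>2"
      by (simp add: power2_eq_square algebra_simps)
    moreover have "\<dots> \<ge> 0" by (intro add_nonneg_nonneg zero_le_power2)
    ultimately show ?thesis by linarith
  qed
  then have cs: "(x$1)\<^sup>2 * (v$1)\<^sup>2 \<le> ?X * ?V"
    by (simp add: v[symmetric] power_mult_distrib)
  have l: "lorentz v v = ?V - (v$1)\<^sup>2" by (simp add: lorentz_def power2_eq_square)
  show "(v$1)\<^sup>2 \<le> ((x$1)\<^sup>2 - 1) * lorentz v v"
    using cs unfolding l x by (simp add: algebra_simps)
  show "?V \<le> (x$1)\<^sup>2 * lorentz v v"
    using cs unfolding l x by (simp add: algebra_simps)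
qed

lemma H3_geodesic:
  assumes "x \<in> H3" "lorentz x v = 0" "lorentz v v = 1"
  shows "cosh t *\<^sub>R x + sinh t *\<^sub>R v \<in> H3"
proof -
  have x: "lorentz x x = - 1" "x$1 > 0" using assms by (auto simp: H3_def)
  have "lorentz (cosh t *\<^sub>R x + sinh t *\<^sub>R v) (cosh t *\<^sub>R x + sinh t *\<^sub>R v)
     = (cosh t)\<^sup>2 * lorentz x x + 2 * cosh t * sinh t * lorentz x v + (sinh t)\<^sup>2 * lorentz v v"
    by (simp add: lor.add_left lor.add_right lor.scaleR_left lor.scaleR_right lorentz_sym[of v x] power2_eq_square algebra_simps)
  also have "\<dots> = - 1" by (simp add: x(1) assms(2,3) cosh_square_eq)
  finally have 1: "lorentz (cosh t *\<^sub>R x + sinh t *\<^sub>R v) (cosh t *\<^sub>R x + sinh t *\<^sub>R v) = - 1" .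
  have "(v$1)\<^sup>2 \<le> (x$1)\<^sup>2 - 1"
    using lorentz_orthogonal_bound(1)[OF assms(1,2)] assms(3) by simp
  then have "(v$1)\<^sup>2 < (x$1)\<^sup>2" by simp
  then have "\<bar>v$1\<bar> < x$1" using x(2) power2_less_imp_less[of "\<bar>v$1\<bar>" "x$1"] by auto
  moreover have "(sinh t)\<^sup>2 < (cosh t)\<^sup>2" using cosh_square_eq[of t] by simp
  then have "\<bar>sinh t\<bar> < cosh t" using cosh_real_pos[of t] power2_less_imp_less[of "\<bar>sinh t\<bar>" "cosh t"] by auto
  ultimately have "\<bar>sinh t\<bar> * \<bar>v$1\<bar> < cosh t * x$1"
    by (intro mult_strict_mono') auto
  then have "\<bar>sinh t * v$1\<bar> < cosh t * x$1" by (simp only: abs_mult)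
  then have "cosh t * x$1 + sinh t * v$1 > 0" by linarith
  then show ?thesis using 1 by (simp add: H3_def)
qed

lemma quadric_S3: "quadric (\<bullet>) S3 1 cos sin S3_cofactor"
proof (rule quadric.intro)
  show "bounded_bilinear ((\<bullet>) :: real^4 \<Rightarrow> _)" by (rule bounded_bilinear_inner)
  fix x v :: "real^4" and t
  assume x: "x \<in> S3"
  show "x \<bullet> x = 1" using x by (simp add: S3_iff)
  assume "x \<bullet> v = 0"
  show "v \<noteq> 0 \<Longrightarrow> v \<bullet> v > 0" by simp
  assume "v \<bullet> v = 1"
  then have "(cos t *\<^sub>R x + sin t *\<^sub>R v) \<bullet> (cos t *\<^sub>R x + sin t *\<^sub>R v) = (cos t)\<^sup>2 + (sin t)\<^sup>2"
    using \<open>x \<bullet> x = 1\<close> \<open>x \<bullet> v = 0\<close> by (simp add: inner_add_left inner_add_right inner_commute[of v x] power2_eq_square)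
  then show "cos t *\<^sub>R x + sin t *\<^sub>R v \<in> S3" by (simp add: S3_iff(1))
next
  fix t :: real
  show "cos t * cos t + 1 * (sin t * sin t) = 1" using sin_cos_squared_add2[of t] by (simp add: power2_eq_square)
  show "x \<bullet> y = y \<bullet> x" for x y :: "real^4" by (rule inner_commute)
  show "(cos has_real_derivative - 1 * sin t) (at t)" using DERIV_cos[of t] by simp
qed (simp_all add: S3_cofactor)

interpretation S3: quadric "(\<bullet>)" S3 1 cos sin S3_cofactor by (rule quadric_S3)

lemma quadric_H3: "quadric lorentz H3 (- 1) cosh sinh H3_cofactor"
proof (rule quadric.intro)
  show "bounded_bilinear lorentz" by (rule bounded_bilinear_lorentz)
  fix x v :: "real^4" and t
  assume x: "x \<in> H3"
  show "lorentz x x = - 1" using x by (simp add: H3_def)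
  assume v: "lorentz x v = 0"
  show "lorentz v v > 0" if "v \<noteq> 0"
  proof -
    have "(v$2)\<^sup>2 + (v$3)\<^sup>2 + (v$4)\<^sup>2 > 0"
    proof (rule ccontr)
      assume "\<not> ?thesis"
      then have "(v$2)\<^sup>2 + (v$3)\<^sup>2 + (v$4)\<^sup>2 \<le> 0" by simp
      then have z: "v$2 = 0" "v$3 = 0" "v$4 = 0"
        by (smt (verit) zero_le_power2 power_eq_0_iff pos2)+
      then have "v$1 = 0" using v x by (simp add: lorentz_def H3_def)
      with z \<open>v \<noteq> 0\<close> show False by (simp add: vec_eq_iff forall_4)
    qed
    then have "(x$1)\<^sup>2 * lorentz v v > 0" using lorentz_orthogonal_bound(2)[OF x v] by linarith
    then show ?thesis using zero_less_mult_pos[of "(x$1)\<^sup>2" "lorentz v v"] x by (simp add: H3_def)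
  qed
  assume "lorentz v v = 1"
  then show "cosh t *\<^sub>R x + sinh t *\<^sub>R v \<in> H3" by (rule H3_geodesic[OF x v])
next
  fix t :: real
  show "cosh t * cosh t + - 1 * (sinh t * sinh t) = 1" using cosh_square_eq[of t] by (simp add: power2_eq_square)
  show "lorentz x y = lorentz y x" for x y by (simp add: lorentz_def mult.commute)
  show "(cosh has_real_derivative - (- 1) * sinh t) (at t)" "(sinh has_real_derivative cosh t) (at t)"
    by (auto intro!: derivative_eq_intros)
qed (simp_all add: H3_cofactor)

interpretation H3: quadric lorentz H3 "- 1" cosh sinh H3_cofactor by (rule quadric_H3)

subsection \<open>Divergence and curl in the left-invariant frame\<close>

definition qi :: "real^4" where "qi = vector [0, 1, 0, 0]"
definition qj :: "real^4" where "qj = vector [0, 0, 1, 0]"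
definition qk :: "real^4" where "qk = vector [0, 0, 0, 1]"

lemma imaginary_units [simp]: "imaginary_unit qi" "imaginary_unit qj" "imaginary_unit qk"
  by (simp_all add: imaginary_unit_def inner_vec_def sum_4 qi_def qj_def qk_def)

lemma quaternion_products:
  "qmul qi qi = - qone" "qmul qj qj = - qone" "qmul qk qk = - qone"
  "qmul qi qj = qk" "qmul qj qk = qi" "qmul qk qi = qj"
  "qmul qj qi = - qk" "qmul qk qj = - qi" "qmul qi qk = - qj"
  by (simp_all add: quat_simps qone_def qi_def qj_def qk_def)

lemma frame_orthonormal:
  "qmul x a \<bullet> qmul x b = (x \<bullet> x) * (a \<bullet> b)"
  by (simp add: quat_simps algebra_simps)

lemma inner_units [simp]:
  "qi \<bullet> qi = 1" "qj \<bullet> qj = 1" "qk \<bullet> qk = 1" "qi \<bullet> qj = 0" "qi \<bullet> qk = 0" "qj \<bullet> qi = 0"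
  "qj \<bullet> qk = 0" "qk \<bullet> qi = 0" "qk \<bullet> qj = 0" "qone \<bullet> qi = 0" "qone \<bullet> qj = 0" "qone \<bullet> qk = 0" "qone \<bullet> qone = 1"
  by (simp_all add: inner_vec_def sum_4 qone_def qi_def qj_def qk_def)

lemma frame_expansion:
  "(x \<bullet> x) *\<^sub>R v = (v \<bullet> x) *\<^sub>R x + (v \<bullet> qmul x qi) *\<^sub>R qmul x qi + (v \<bullet> qmul x qj) *\<^sub>R qmul x qj
     + (v \<bullet> qmul x qk) *\<^sub>R qmul x qk"
  by (simp add: quat_simps qi_def qj_def qk_def algebra_simps)

lemma tangent_frame_expansion:
  "x \<in> S3 \<Longrightarrow> v \<in> tangent (\<bullet>) x \<Longrightarrow>
    v = (v \<bullet> qmul x qi) *\<^sub>R qmul x qi + (v \<bullet> qmul x qj) *\<^sub>R qmul x qj + (v \<bullet> qmul x qk) *\<^sub>R qmul x qk"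
  using frame_expansion[of x v] by (simp add: S3_iff tangent_def inner_commute[of v x])

lemma frame_tangent: "a$1 = 0 \<Longrightarrow> x \<bullet> qmul x a = 0"
  by (simp add: quat_simps algebra_simps)

lemma frame_tangent_units [simp]:
  "x \<bullet> qmul x qi = 0" "x \<bullet> qmul x qj = 0" "x \<bullet> qmul x qk = 0"
  "qmul x qi \<in> tangent (\<bullet>) x" "qmul x qj \<in> tangent (\<bullet>) x" "qmul x qk \<in> tangent (\<bullet>) x"
  by (auto simp: tangent_def intro!: frame_tangent) (simp_all add: qi_def qj_def qk_def)

lemma cofactor_frame:
  "S3_cofactor x (qmul x qi) (qmul x qj) = (x \<bullet> x) *\<^sub>R qmul x qk"
  "S3_cofactor x (qmul x qj) (qmul x qk) = (x \<bullet> x) *\<^sub>R qmul x qi"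
  "S3_cofactor x (qmul x qk) (qmul x qi) = (x \<bullet> x) *\<^sub>R qmul x qj"
  by (simp_all add: S3_cofactor_def det4_expand axis_def quat_simps qi_def qj_def qk_def algebra_simps)

definition coef :: "(real^4 \<Rightarrow> real^4) \<Rightarrow> real^4 \<Rightarrow> real^4 \<Rightarrow> real" where
  "coef V a x = radial_ext V x \<bullet> qmul x a"

lemma smooth_coef: "S3_field V \<Longrightarrow> smooth_away_0 (coef V a)"
  unfolding coef_def smooth_vector_field_def
  by (intro smooth_inner smooth_frame smooth_away_0_radial_ext) auto

lemma coef_S3: "x \<in> S3 \<Longrightarrow> coef V a x = V x \<bullet> qmul x a"
  by (simp add: coef_def radial_ext_S3)

lemma field_tangent: "S3_field V \<Longrightarrow> x \<in> S3 \<Longrightarrow> V x \<in> tangent (\<bullet>) x"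
  by (simp add: smooth_vector_field_def)

lemma field_expansion:
  "S3_field V \<Longrightarrow> x \<in> S3 \<Longrightarrow>
   V x = coef V qi x *\<^sub>R qmul x qi + coef V qj x *\<^sub>R qmul x qj + coef V qk x *\<^sub>R qmul x qk"
  using tangent_frame_expansion[OF _ field_tangent] by (simp add: coef_S3)

text \<open>
  The tangential projection does not change inner products with tangent vectors, so the covariant
  derivative may be computed with the ordinary derivative of the extension.\<close>

lemma cov_deriv_frame:
  assumes V: "S3_field V" and x: "x \<in> S3" and a: "a$1 = 0" and w: "w \<in> tangent (\<bullet>) x"
  shows "cov_deriv (\<bullet>) S3 V x (qmul x a) \<bullet> w = frechet_derivative (radial_ext V) (at x) (qmul x a) \<bullet> w"
proof -
  have sm: "smooth_away_0 (radial_ext V)"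
    using V by (auto simp: smooth_vector_field_def intro: smooth_away_0_radial_ext)
  have "(radial_ext V has_derivative frechet_derivative (radial_ext V) (at x)) (at x within S3)"
    by (rule has_derivative_at_withinI[OF smooth_has_derivative[OF sm S3_nonzero[OF x]]])
  then have "(V has_derivative frechet_derivative (radial_ext V) (at x)) (at x within S3)"
    by (rule has_derivative_transform[OF x, rotated]) (simp add: radial_ext_S3)
  from S3.frechet_derivative_within[OF x this] have
    "frechet_derivative V (at x within S3) (qmul x a) = frechet_derivative (radial_ext V) (at x) (qmul x a)"
    using a by (simp add: tangent_def frame_tangent)
  then show ?thesis
    using w by (simp add: cov_deriv_def tangent_proj_def inner_diff_left tangent_def)
qed

text \<open>
  The second term comes from differentiating the frame field \<open>x b\<close>. For \<open>a = b\<close> it is \<open>- V x \<bullet> x = 0\<close>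
  and drops out of the divergence; for \<open>a\<close> and \<open>b\<close> distinct it is antisymmetric and yields the term
  \<open>- 2 V\<close> of the curl.\<close>

lemma Lie_coef:
  assumes V: "S3_field V" and x: "x \<in> S3"
  shows "Lie a (coef V b) x = frechet_derivative (radial_ext V) (at x) (qmul x a) \<bullet> qmul x b
    + V x \<bullet> qmul x (qmul a b)"
proof -
  have sm: "smooth_away_0 (radial_ext V)"
    using V by (auto simp: smooth_vector_field_def intro: smooth_away_0_radial_ext)
  have "((\<lambda>x. radial_ext V x \<bullet> qmul x b) has_derivative
     (\<lambda>v. radial_ext V x \<bullet> qmul v b + frechet_derivative (radial_ext V) (at x) v \<bullet> qmul x b)) (at x)"
    by (intro has_derivative_inner smooth_has_derivative sm bounded_linear_imp_has_derivative bounded_linear_qmul_left)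
      (use x in \<open>auto dest: S3_nonzero\<close>)
  from Lie_eqI[OF this[folded coef_def], of a] show ?thesis
    using x by (simp add: qmul_assoc radial_ext_S3)
qed

lemma units_real_part [simp]: "qi$1 = 0" "qj$1 = 0" "qk$1 = 0"
  by (simp_all add: qi_def qj_def qk_def)

lemma cov_deriv_linear:
  assumes V: "S3_field V" and x: "x \<in> S3"
  shows "linear (\<lambda>a. frechet_derivative (radial_ext V) (at x) a)"
  by (intro linear_frechet_derivative smooth_differentiable smooth_away_0_radial_ext)
    (use V x in \<open>auto simp: smooth_vector_field_def dest: S3_nonzero\<close>)

definition frame3 :: "real^4 \<Rightarrow> 3 \<Rightarrow> real^4" where
  "frame3 x j = qmul x (if j = 1 then qi else if j = 2 then qj else qk)"

lemma frame3_simps [simp]: "frame3 x 1 = qmul x qi" "frame3 x 2 = qmul x qj" "frame3 x 3 = qmul x qk"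
  by (simp_all add: frame3_def)

lemma cov_deriv_tangent_inner:
  assumes V: "S3_field V" and x: "x \<in> S3" and v: "v \<in> tangent (\<bullet>) x" and w: "w \<in> tangent (\<bullet>) x"
  shows "cov_deriv (\<bullet>) S3 V x v \<bullet> w = frechet_derivative (radial_ext V) (at x) v \<bullet> w"
proof -
  have "v = qmul x (qmul (qcnj x) v)"
    using x by (simp add: qmul_assoc[symmetric] qmul_qcnj_right S3_iff qmul_linear_simps)
  moreover have "(qmul (qcnj x) v)$1 = 0"
    using v by (simp add: tangent_def quat_simps qcnj_def)
  ultimately show ?thesis using cov_deriv_frame[OF V x _ w] by metis
qed

text \<open>
  The trace of the covariant derivative is the same in all orthonormal bases of the tangent space, so
  it may be computed in the left-invariant frame.\<close>

lemma S3_div_eq: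
  assumes V: "S3_field V" and x: "x \<in> S3"
  shows "S3_div V x = Lie qi (coef V qi) x + Lie qj (coef V qj) x + Lie qk (coef V qk) x"
proof -
  let ?D = "frechet_derivative (radial_ext V) (at x)"
  have lin: "linear ?D" by (rule cov_deriv_linear[OF V x])
  have fr: "frame3 x j \<in> tangent (\<bullet>) x" for j by (cases j rule: exhaust_3[THEN disjE]) (auto simp: frame3_def)
  have on: "frame3 x i \<bullet> frame3 x j = (if i = j then 1 else 0)" for i j
    using exhaust_3[of i] exhaust_3[of j] x by (auto simp: frame_orthonormal S3_iff(1))
  have trace: "(\<Sum>i\<in>UNIV. cov_deriv (\<bullet>) S3 V x (e i) \<bullet> e i) = (\<Sum>j\<in>UNIV. ?D (frame3 x j) \<bullet> frame3 x j)"
    if e: "\<And>i. e i \<in> tangent (\<bullet>) x" and eo: "\<And>i j. e i \<bullet> e j = (if i = j then 1 else 0)"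
    for e :: "3 \<Rightarrow> real^4"
  proof -
    define Q :: "real^3^3" where "Q = (\<chi> i j. e i \<bullet> frame3 x j)"
    have ex: "e i = (\<Sum>j\<in>UNIV. Q$i$j *\<^sub>R frame3 x j)" for i
      using tangent_frame_expansion[OF x e[of i]] by (simp add: sum_3 Q_def)
    have "(Q ** transpose Q)$i$j = (mat 1 :: real^3^3)$i$j" for i j
    proof -
      have "(if i = j then 1 else 0) = (\<Sum>k\<in>UNIV. Q$i$k *\<^sub>R frame3 x k) \<bullet> e j"
        using eo[of i j] ex[of i] by simp
      also have "\<dots> = (\<Sum>k\<in>UNIV. Q$i$k * Q$j$k)"
        by (simp add: inner_sum_left inner_sum_right Q_def inner_commute)
      finally show ?thesis by (simp add: matrix_matrix_mult_def transpose_def mat_def)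
    qed
    then have "Q ** transpose Q = mat 1" by (simp add: vec_eq_iff)
    then have "transpose Q ** Q = mat 1" using matrix_left_right_inverse by blast
    then have QQ: "(\<Sum>i\<in>UNIV. Q$i$j * Q$i$k) = (if j = k then 1 else 0)" for j k
      by (simp add: vec_eq_iff matrix_matrix_mult_def transpose_def mat_def)
    have "cov_deriv (\<bullet>) S3 V x (e i) \<bullet> e i = (\<Sum>j\<in>UNIV. \<Sum>k\<in>UNIV. (Q$i$j * Q$i$k) * (?D (frame3 x j) \<bullet> frame3 x k))" for i
    proof -
      have "cov_deriv (\<bullet>) S3 V x (e i) \<bullet> e i = ?D (e i) \<bullet> e i"
        by (rule cov_deriv_tangent_inner[OF V x e e])
      also have "\<dots> = ?D (\<Sum>j\<in>UNIV. Q$i$j *\<^sub>R frame3 x j) \<bullet> (\<Sum>k\<in>UNIV. Q$i$k *\<^sub>R frame3 x k)"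
        by (simp only: ex[symmetric])
      also have "\<dots> = (\<Sum>j\<in>UNIV. \<Sum>k\<in>UNIV. (Q$i$j * Q$i$k) * (?D (frame3 x j) \<bullet> frame3 x k))"
        using lin by (simp add: sum_3 linear_add linear_cmul inner_add_left inner_add_right algebra_simps)
      finally show ?thesis .
    qed
    then have "(\<Sum>i\<in>UNIV. cov_deriv (\<bullet>) S3 V x (e i) \<bullet> e i)
      = (\<Sum>i\<in>UNIV. \<Sum>j\<in>UNIV. \<Sum>k\<in>UNIV. (Q$i$j * Q$i$k) * (?D (frame3 x j) \<bullet> frame3 x k))" by simp
    also have "\<dots> = (\<Sum>j\<in>UNIV. \<Sum>k\<in>UNIV. (\<Sum>i\<in>UNIV. Q$i$j * Q$i$k) * (?D (frame3 x j) \<bullet> frame3 x k))"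
      by (simp add: sum_3 algebra_simps)
    also have "\<dots> = (\<Sum>j\<in>UNIV. ?D (frame3 x j) \<bullet> frame3 x j)"
      by (simp add: QQ sum_3)
    finally show ?thesis .
  qed
  have "S3_div V x = (\<Sum>j\<in>UNIV. ?D (frame3 x j) \<bullet> frame3 x j)"
    unfolding divergence_def
  proof (rule the_equality)
    show "\<forall>e::3 \<Rightarrow> real^4. (\<forall>i. e i \<in> tangent (\<bullet>) x) \<and> (\<forall>i j. e i \<bullet> e j = (if i = j then 1 else 0)) \<longrightarrow>
        (\<Sum>j\<in>UNIV. ?D (frame3 x j) \<bullet> frame3 x j) = (\<Sum>i\<in>UNIV. cov_deriv (\<bullet>) S3 V x (e i) \<bullet> e i)"
      using trace by auto
    fix d assume d: "\<forall>e::3 \<Rightarrow> real^4. (\<forall>i. e i \<in> tangent (\<bullet>) x) \<and> (\<forall>i j. e i \<bullet> e j = (if i = j then 1 else 0)) \<longrightarrow>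
        d = (\<Sum>i\<in>UNIV. cov_deriv (\<bullet>) S3 V x (e i) \<bullet> e i)"
    then have "d = (\<Sum>i\<in>UNIV. cov_deriv (\<bullet>) S3 V x (frame3 x i) \<bullet> frame3 x i)"
      using fr on by blast
    then show "d = (\<Sum>j\<in>UNIV. ?D (frame3 x j) \<bullet> frame3 x j)" using trace fr on by simp
  qed
  also have "\<dots> = Lie qi (coef V qi) x + Lie qj (coef V qj) x + Lie qk (coef V qk) x"
    using field_tangent[OF V x]
    by (simp add: sum_3 Lie_coef[OF V x] quaternion_products tangent_def inner_commute[of "V x" x]
        bounded_bilinear.minus_right[OF bounded_bilinear_qmul])
  finally show ?thesis .
qed

lemma S3_curl_eq:
  assumes V: "S3_field V" and x: "x \<in> S3"
  shows "S3_curl V x \<bullet> qmul x qi = Lie qj (coef V qk) x - Lie qk (coef V qj) x - 2 * coef V qi x"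
    and "S3_curl V x \<bullet> qmul x qj = Lie qk (coef V qi) x - Lie qi (coef V qk) x - 2 * coef V qj x"
    and "S3_curl V x \<bullet> qmul x qk = Lie qi (coef V qj) x - Lie qj (coef V qi) x - 2 * coef V qk x"
proof -
  let ?D = "frechet_derivative (radial_ext V) (at x)"
  let ?A = "\<lambda>a b. ?D a \<bullet> b - ?D b \<bullet> a"
  have lin: "linear ?D" by (rule cov_deriv_linear[OF V x])
  let ?i = "qmul x qi" and ?j = "qmul x qj" and ?k = "qmul x qk"
  have xx: "x \<bullet> x = 1" using x by (simp add: S3_iff)
  define c where "c = ?A ?j ?k *\<^sub>R ?i + ?A ?k ?i *\<^sub>R ?j + ?A ?i ?j *\<^sub>R ?k"
  have ct: "c \<in> tangent (\<bullet>) x"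
    by (simp add: c_def tangent_def inner_add_right)
  have ci: "c \<bullet> ?i = ?A ?j ?k" "c \<bullet> ?j = ?A ?k ?i" "c \<bullet> ?k = ?A ?i ?j"
    by (simp_all add: c_def inner_add_left frame_orthonormal xx)
  have cr: "S3_cross x a b = S3_cofactor x a b" for a b
    using S3.cross_eq[OF x, of 1] by simp
  have spec: "c \<bullet> S3_cross x a b = cov_deriv (\<bullet>) S3 V x a \<bullet> b - cov_deriv (\<bullet>) S3 V x b \<bullet> a"
    if a: "a \<in> tangent (\<bullet>) x" and b: "b \<in> tangent (\<bullet>) x" for a b
  proof -
    obtain a1 a2 a3 where ae: "a = a1 *\<^sub>R ?i + a2 *\<^sub>R ?j + a3 *\<^sub>R ?k" using tangent_frame_expansion[OF x a] by blast
    obtain b1 b2 b3 where be: "b = b1 *\<^sub>R ?i + b2 *\<^sub>R ?j + b3 *\<^sub>R ?k" using tangent_frame_expansion[OF x b] by blast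
    have d: "det4 x ?i ?j c = c \<bullet> ?k" "det4 x ?j ?k c = c \<bullet> ?i" "det4 x ?k ?i c = c \<bullet> ?j"
      "det4 x ?j ?i c = - (c \<bullet> ?k)" "det4 x ?k ?j c = - (c \<bullet> ?i)" "det4 x ?i ?k c = - (c \<bullet> ?j)"
    proof -
      show 1: "det4 x ?i ?j c = c \<bullet> ?k" "det4 x ?j ?k c = c \<bullet> ?i" "det4 x ?k ?i c = c \<bullet> ?j"
        unfolding S3_cofactor[symmetric] cofactor_frame by (simp_all add: xx inner_commute)
      have sw: "det4 x a b d = - det4 x b a d" for a b d by (simp add: det4_expand algebra_simps)
      show "det4 x ?j ?i c = - (c \<bullet> ?k)" "det4 x ?k ?j c = - (c \<bullet> ?i)" "det4 x ?i ?k c = - (c \<bullet> ?j)"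
        using 1 sw[of ?j ?i c] sw[of ?k ?j c] sw[of ?i ?k c] by simp_all
    qed
    have "c \<bullet> S3_cross x a b = det4 x a b c"
      by (simp add: cr inner_commute[of c] S3_cofactor)
    also have "\<dots> = (a2 * b3 - a3 * b2) * (c \<bullet> ?i) + (a3 * b1 - a1 * b3) * (c \<bullet> ?j) + (a1 * b2 - a2 * b1) * (c \<bullet> ?k)"
      unfolding ae be by (simp add: det4_linear det4_alternating d algebra_simps)
    also have "\<dots> = ?A a b"
      unfolding ci unfolding ae be using lin
      by (simp add: linear_add linear_cmul inner_add_left inner_add_right algebra_simps)
    also have "\<dots> = cov_deriv (\<bullet>) S3 V x a \<bullet> b - cov_deriv (\<bullet>) S3 V x b \<bullet> a"
      by (simp add: cov_deriv_tangent_inner[OF V x] a b)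
    finally show ?thesis .
  qed
  have "S3_curl V x = c"
    unfolding curl_def
  proof (rule the_equality)
    show "c \<in> tangent (\<bullet>) x \<and> (\<forall>a\<in>tangent (\<bullet>) x. \<forall>b\<in>tangent (\<bullet>) x.
       c \<bullet> S3_cross x a b = cov_deriv (\<bullet>) S3 V x a \<bullet> b - cov_deriv (\<bullet>) S3 V x b \<bullet> a)"
      using ct spec by blast
    fix c' assume c': "c' \<in> tangent (\<bullet>) x \<and> (\<forall>a\<in>tangent (\<bullet>) x. \<forall>b\<in>tangent (\<bullet>) x.
       c' \<bullet> S3_cross x a b = cov_deriv (\<bullet>) S3 V x a \<bullet> b - cov_deriv (\<bullet>) S3 V x b \<bullet> a)"
    then have "c' \<bullet> S3_cross x a b = c \<bullet> S3_cross x a b" if "a \<in> tangent (\<bullet>) x" "b \<in> tangent (\<bullet>) x" for a b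
      using spec that by simp
    from this[of ?i ?j] this[of ?j ?k] this[of ?k ?i]
    have "c' \<bullet> ?k = c \<bullet> ?k" "c' \<bullet> ?i = c \<bullet> ?i" "c' \<bullet> ?j = c \<bullet> ?j"
      by (simp_all add: cr cofactor_frame xx)
    then show "c' = c" using tangent_frame_expansion[OF x] c' ct by metis
  qed
  then show "S3_curl V x \<bullet> ?i = Lie qj (coef V qk) x - Lie qk (coef V qj) x - 2 * coef V qi x"
    "S3_curl V x \<bullet> ?j = Lie qk (coef V qi) x - Lie qi (coef V qk) x - 2 * coef V qj x"
    "S3_curl V x \<bullet> ?k = Lie qi (coef V qj) x - Lie qj (coef V qi) x - 2 * coef V qk x"
    by (simp_all add: ci Lie_coef[OF V x] quaternion_products coef_S3 x
        bounded_bilinear.minus_right[OF bounded_bilinear_qmul])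
qed

definition frame_grad :: "(real^4 \<Rightarrow> real) \<Rightarrow> real^4 \<Rightarrow> real^4" where
  "frame_grad f x = Lie qi f x *\<^sub>R qmul x qi + Lie qj f x *\<^sub>R qmul x qj + Lie qk f x *\<^sub>R qmul x qk"

lemma S3_grad_eq:
  assumes f: "smooth_away_0 f" and x: "x \<in> S3"
  shows "S3_grad f x = frame_grad f x"
proof (rule S3.grad_eqI[OF x])
  have x0: "x \<noteq> 0" using x S3_nonzero by blast
  show "(f has_derivative frechet_derivative f (at x)) (at x within S3)"
    by (rule has_derivative_at_withinI[OF smooth_has_derivative[OF f x0]])
  show "frame_grad f x \<in> tangent (\<bullet>) x" by (simp add: frame_grad_def tangent_def inner_add_right)
  fix v assume v: "v \<in> tangent (\<bullet>) x"
  have "frechet_derivative f (at x) v = frechet_derivative f (at x)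
     ((v \<bullet> qmul x qi) *\<^sub>R qmul x qi + (v \<bullet> qmul x qj) *\<^sub>R qmul x qj + (v \<bullet> qmul x qk) *\<^sub>R qmul x qk)"
    using tangent_frame_expansion[OF x v] by simp
  then show "frame_grad f x \<bullet> v = frechet_derivative f (at x) v"
    using linear_frechet_derivative[OF smooth_differentiable[OF f x0]]
    by (simp add: frame_grad_def Lie_def linear_add linear_cmul inner_add_left inner_commute[of v] mult.commute)
qed

lemma S3_field_frame_grad:
  assumes f: "smooth_away_0 f"
  shows "smooth_away_0 (frame_grad f)" "S3_field (frame_grad f)"
proof -
  show 1: "smooth_away_0 (frame_grad f)"
    unfolding frame_grad_def by (intro smooth_add smooth_scaleR smooth_Lie f smooth_frame)
  then show "S3_field (frame_grad f)"
    using smooth_on_S3I[OF 1] by (simp add: smooth_vector_field_def frame_grad_def tangent_def inner_add_right)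
qed

section \<open>The volume of the sphere\<close>

definition emb :: "real^3 \<Rightarrow> real^4" where "emb u = vector [0, u$1, u$2, u$3]"
definition spatial :: "real^4 \<Rightarrow> real^3" where "spatial x = vector [x$2, x$3, x$4]"

lemma linear_emb: "linear emb" and linear_spatial: "linear spatial"
  by (auto intro!: linearI simp: emb_def spatial_def vec_eq_iff forall_4 forall_3)

lemmas bounded_linear_emb = linear_emb[THEN linear_conv_bounded_linear[THEN iffD1]]
lemmas bounded_linear_spatial = linear_spatial[THEN linear_conv_bounded_linear[THEN iffD1]]

lemma emb_inner [simp]: "emb u \<bullet> emb v = u \<bullet> v" "emb u \<bullet> qone = 0" "qone \<bullet> emb u = 0"
  by (simp_all add: emb_def qone_def inner_vec_def sum_3 sum_4)

lemma spatial_emb [simp]: "spatial (emb u) = u" "spatial qone = 0" "emb u $ 1 = 0" "qone $ 1 = 1"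
  by (simp_all add: spatial_def emb_def qone_def vec_eq_iff forall_3)

lemma qone_spatial: "x = x$1 *\<^sub>R qone + emb (spatial x)"
  by (simp add: spatial_def emb_def qone_def vec_eq_iff forall_4)

lemma one_plus_inner_pos: "1 + (u::'a::real_inner) \<bullet> u > 0"
  using inner_ge_zero[of u] by linarith

lemma S3_chart_emb: "S3_chart u = (2 / (1 + u \<bullet> u)) *\<^sub>R (qone + emb u) - qone"
  using one_plus_inner_pos[of u]
  by (simp add: S3_chart_def vec_eq_iff forall_4 qone_def emb_def divide_simps)

lemma S3_chart_re: "S3_chart u $ 1 = (1 - u \<bullet> u) / (1 + u \<bullet> u)"
  by (simp add: S3_chart_def)

lemma S3_chart_S3: "S3_chart u \<in> S3"
proof -
  have p: "1 + u \<bullet> u > 0" by (rule one_plus_inner_pos)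
  let ?c = "2 / (1 + u \<bullet> u)"
  have "(c *\<^sub>R (qone + emb u) - qone) \<bullet> (c *\<^sub>R (qone + emb u) - qone) = c\<^sup>2 * (1 + u \<bullet> u) - 2 * c + 1" for c
    by (simp add: inner_add_left inner_add_right inner_diff_left inner_diff_right power2_eq_square algebra_simps)
  then have inner: "S3_chart u \<bullet> S3_chart u = ?c\<^sup>2 * (1 + u \<bullet> u) - 2 * ?c + 1"
    by (simp only: S3_chart_emb)
  have "c\<^sup>2 * N - 2 * c + 1 = 1" if "N \<noteq> 0" "c = 2 / N" for c N :: real
    using that by (simp add: power2_eq_square)
  from this[of "1 + u \<bullet> u" ?c] p have "?c\<^sup>2 * (1 + u \<bullet> u) - 2 * ?c + 1 = 1" by simp
  then show ?thesis using inner by (simp add: S3_iff(1))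
qed

lemma S3_chart_derivative:
  "(S3_chart has_derivative (\<lambda>h. (- 4 * (u \<bullet> h) / (1 + u \<bullet> u)\<^sup>2) *\<^sub>R (qone + emb u) + (2 / (1 + u \<bullet> u)) *\<^sub>R emb h)) (at u)"
proof -
  have p: "1 + u \<bullet> u \<noteq> 0" using one_plus_inner_pos[of u] by linarith
  have "((\<lambda>u. 2 / (1 + u \<bullet> u)) has_derivative (\<lambda>h. - 4 * (u \<bullet> h) / (1 + u \<bullet> u)\<^sup>2)) (at u)"
    using p by (auto intro!: derivative_eq_intros simp: inner_commute power2_eq_square fun_eq_iff divide_simps)
  moreover have "((\<lambda>u. qone + emb u) has_derivative emb) (at u)"
    using has_derivative_add[OF has_derivative_const bounded_linear_imp_has_derivative[OF bounded_linear_emb]] by simp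
  ultimately have "((\<lambda>u. (2 / (1 + u \<bullet> u)) *\<^sub>R (qone + emb u) - qone) has_derivative
     (\<lambda>h. ((2 / (1 + u \<bullet> u)) *\<^sub>R emb h + (- 4 * (u \<bullet> h) / (1 + u \<bullet> u)\<^sup>2) *\<^sub>R (qone + emb u)) - 0)) (at u)"
    by (intro has_derivative_diff has_derivative_scaleR has_derivative_const)
  then show ?thesis unfolding S3_chart_emb by (simp add: add.commute)
qed

text \<open>
  Stereographic projection is conformal; the cube of its factor is the density of the volume.\<close>

lemma S3_chart_conformal:
  "frechet_derivative S3_chart (at u) h \<bullet> frechet_derivative S3_chart (at u) k = (2 / (1 + u \<bullet> u))\<^sup>2 * (h \<bullet> k)"
proof -
  define N where "N = 1 + u \<bullet> u"
  have N: "N \<noteq> 0" using one_plus_inner_pos[of u] by (simp add: N_def)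
  have e: "frechet_derivative S3_chart (at u) = (\<lambda>h. (- 4 * (u \<bullet> h) / N\<^sup>2) *\<^sub>R (qone + emb u) + (2 / N) *\<^sub>R emb h)"
    using frechet_derivative_at[OF S3_chart_derivative] by (simp add: N_def)
  have "frechet_derivative S3_chart (at u) h \<bullet> frechet_derivative S3_chart (at u) k
    = (- 4 * (u \<bullet> h) / N\<^sup>2) * (- 4 * (u \<bullet> k) / N\<^sup>2) * N + (- 4 * (u \<bullet> h) / N\<^sup>2) * (2 / N) * (u \<bullet> k)
      + (2 / N) * (- 4 * (u \<bullet> k) / N\<^sup>2) * (u \<bullet> h) + (2 / N) * (2 / N) * (h \<bullet> k)"
  proof -
    have "(a *\<^sub>R (qone + emb u) + r *\<^sub>R emb h) \<bullet> (b *\<^sub>R (qone + emb u) + r *\<^sub>R emb k)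
      = a * b * N + a * r * (u \<bullet> k) + r * b * (u \<bullet> h) + r * r * (h \<bullet> k)" for a b r
      by (simp add: inner_add_left inner_add_right inner_commute[of h u] N_def algebra_simps)
    then show ?thesis unfolding e by blast
  qed
  also have "\<dots> = (2 / N)\<^sup>2 * (h \<bullet> k)"
    using N by (simp add: power2_eq_square field_simps)
  finally show ?thesis by (simp add: N_def)
qed

definition S3_density :: "real^3 \<Rightarrow> real" where "S3_density u = 8 / (1 + u \<bullet> u) ^ 3"

lemma S3_density_pos: "S3_density u > 0"
  using one_plus_inner_pos[of u] by (simp add: S3_density_def)

lemma S3_density_measurable [measurable]: "S3_density \<in> borel_measurable borel"
  unfolding S3_density_def by measurable

lemma S3_vol_eq:
  "S3_vol = distr (density lborel (\<lambda>u. ennreal (S3_density u))) (restrict_space borel S3) S3_chart"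
proof -
  have "sqrt (det ((\<chi> i j. frechet_derivative S3_chart (at u) (axis i 1) \<bullet> frechet_derivative S3_chart (at u) (axis j 1)) :: real^3^3))
    = S3_density u" for u
  proof -
    have p: "1 + u \<bullet> u > 0" by (rule one_plus_inner_pos)
    have "det ((\<chi> i j. frechet_derivative S3_chart (at u) (axis i 1) \<bullet> frechet_derivative S3_chart (at u) (axis j 1)) :: real^3^3)
       = ((2 / (1 + u \<bullet> u))\<^sup>2) ^ 3"
      by (simp add: S3_chart_conformal inner_axis_axis det_3 power3_eq_cube)
    also have "\<dots> = (S3_density u)\<^sup>2"
      by (simp add: S3_density_def power2_eq_square power3_eq_cube field_simps)
    finally show ?thesis using S3_density_pos[of u] by simp
  qed
  then show ?thesis by (simp add: S3_vol_def riemannian_volume_def)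
qed

lemma sets_S3_vol [simp, measurable_cong]: "sets S3_vol = sets (restrict_space borel S3)"
  by (simp add: S3_vol_eq)

lemma space_S3_vol [simp]: "space S3_vol = S3"
  by (simp add: S3_vol_eq space_restrict_space)

lemma continuous_S3_chart: "continuous_on UNIV S3_chart"
  by (intro continuous_at_imp_continuous_on ballI has_derivative_continuous[OF S3_chart_derivative])

lemma S3_chart_measurable [measurable]: "S3_chart \<in> borel \<rightarrow>\<^sub>M restrict_space borel S3"
  by (rule measurable_restrict_space2)
    (auto intro: borel_measurable_continuous_onI continuous_S3_chart S3_chart_S3)

lemma nn_integral_S3_vol:
  assumes "f \<in> borel_measurable (restrict_space borel S3)"
  shows "(\<integral>\<^sup>+x. f x \<partial>S3_vol) = (\<integral>\<^sup>+u. ennreal (S3_density u) * f (S3_chart u) \<partial>lborel)"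
proof -
  have [measurable]: "f \<in> borel_measurable (restrict_space borel S3)" by fact
  show ?thesis
    unfolding S3_vol_eq by (subst nn_integral_distr) (auto simp: nn_integral_density)
qed

lemma continuous_on_measurable_S3:
  "continuous_on S3 f \<Longrightarrow> f \<in> borel_measurable (restrict_space borel S3)"
  by (rule borel_measurable_continuous_on_restrict)

subsection \<open>Integration of radial functions by layers\<close>

text \<open>
  A radial function is an integral over \<open>s\<close> of indicators of balls of radius \<open>s\<close>. Exchanging the
  integrals replaces the ball by its volume, which avoids polar coordinates.\<close>

lemma nn_integral_layers:
  fixes f :: "real \<Rightarrow> ennreal"
  assumes [measurable]: "f \<in> borel_measurable borel"
  shows "(\<integral>\<^sup>+(u::real^3). (\<integral>\<^sup>+s. f s * indicator {norm u ..} s \<partial>lborel) \<partial>lborel)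
     = (\<integral>\<^sup>+s. f s * ennreal (4 / 3 * pi * s ^ 3) * indicator {0..} s \<partial>lborel)"
proof -
  have ind: "indicator {norm u ..} s = (indicator {z. norm (fst z) \<le> snd z} (u, s) :: ennreal)" for u :: "real^3" and s
    by (simp add: indicator_def)
  have [measurable]: "{z :: (real^3) \<times> real. norm (fst z) \<le> snd z} \<in> sets borel"
    by (intro borel_closed closed_Collect_le continuous_intros)
  have m: "(\<lambda>(u::real^3, s). f s * indicator {norm u ..} s) \<in> borel_measurable (lborel \<Otimes>\<^sub>M lborel)"
    unfolding ind case_prod_beta prod.collapse by (simp add: borel_prod measurable_lborel1)
  have "(\<integral>\<^sup>+(u::real^3). (\<integral>\<^sup>+s. f s * indicator {norm u ..} s \<partial>lborel) \<partial>lborel)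
     = (\<integral>\<^sup>+s. (\<integral>\<^sup>+(u::real^3). f s * indicator {norm u ..} s \<partial>lborel) \<partial>lborel)"
    using lborel_pair.Fubini'[OF m] by simp
  also have "\<dots> = (\<integral>\<^sup>+s. f s * ennreal (4 / 3 * pi * s ^ 3) * indicator {0..} s \<partial>lborel)"
  proof (rule nn_integral_cong)
    fix s :: real
    have "(\<integral>\<^sup>+(u::real^3). f s * indicator {norm u ..} s \<partial>lborel)
       = (\<integral>\<^sup>+(u::real^3). f s * indicator (cball 0 s) u \<partial>lborel)"
      by (intro nn_integral_cong) (auto simp: indicator_def)
    also have "\<dots> = f s * emeasure lborel (cball (0::real^3) s)"
      by (subst nn_integral_cmult) (auto intro!: borel_measurable_indicator borel_closed)
    also have "\<dots> = f s * ennreal (4 / 3 * pi * s ^ 3) * indicator {0..} s"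
    proof (cases "s \<ge> 0")
      case True
      then show ?thesis by (simp add: emeasure_cball unit_ball_vol_3)
    qed simp
    finally show "(\<integral>\<^sup>+(u::real^3). f s * indicator {norm u ..} s \<partial>lborel)
       = f s * ennreal (4 / 3 * pi * s ^ 3) * indicator {0..} s" .
  qed
  finally show ?thesis .
qed

lemma one_plus_square_pos: "1 + (s::real)\<^sup>2 > 0" by (smt (verit) zero_le_power2)

lemma emeasure_S3: "emeasure S3_vol S3 = ennreal (2 * pi\<^sup>2)"
proof -
  \<comment> \<open>Minus the derivative of \<open>8 / (1 + s\<^sup>2) ^ 3\<close>, the density as a function of the radius.\<close>
  let ?f = "\<lambda>s::real. 48 * s / (1 + s\<^sup>2) ^ 4"
  have layer: "ennreal (S3_density u) = (\<integral>\<^sup>+s. ennreal (?f s) * indicator {norm u ..} s \<partial>lborel)" for u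
  proof -
    have "(\<integral>\<^sup>+s. ennreal (?f s) * indicator {norm u ..} s \<partial>lborel) = ennreal (0 - - 8 / (1 + (norm u)\<^sup>2) ^ 3)"
    proof (rule nn_integral_FTC_atLeast)
      fix s :: real assume "norm u \<le> s"
      then have s: "0 \<le> s" by (meson norm_ge_zero order_trans)
      show "0 \<le> ?f s" using s by simp
      have p: "1 + s\<^sup>2 \<noteq> 0" using one_plus_square_pos[of s] by simp
      have "((\<lambda>s. - 8 / (1 + s\<^sup>2) ^ 3) has_real_derivative
         (- (- 8 * (3 * (1 + s\<^sup>2)\<^sup>2 * (2 * s)))) / ((1 + s\<^sup>2) ^ 3 * (1 + s\<^sup>2) ^ 3)) (at s)"
        using p by (auto intro!: derivative_eq_intros simp: power2_eq_square)
      moreover have "(- (- 8 * (3 * (1 + s\<^sup>2)\<^sup>2 * (2 * s)))) / ((1 + s\<^sup>2) ^ 3 * (1 + s\<^sup>2) ^ 3) = ?f s"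
        using p by (simp add: divide_simps)
      ultimately show "((\<lambda>s. - 8 / (1 + s\<^sup>2) ^ 3) has_real_derivative ?f s) (at s)" by simp
    next
      show "((\<lambda>s::real. - 8 / (1 + s\<^sup>2) ^ 3) \<longlongrightarrow> 0) at_top" by real_asymp
    qed measurable
    then show ?thesis by (simp add: S3_density_def power2_norm_eq_inner)
  qed
  \<comment> \<open>An antiderivative of \<open>64 * pi * s ^ 4 / (1 + s\<^sup>2) ^ 4\<close>.\<close>
  let ?G = "\<lambda>s::real. 64 * pi * (arctan s / 16 + (3 * s ^ 5 - 8 * s ^ 3 - 3 * s) / (48 * (1 + s\<^sup>2) ^ 3))"
  have "emeasure S3_vol S3 = (\<integral>\<^sup>+x. 1 \<partial>S3_vol)"
    by (simp flip: space_S3_vol)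
  also have "\<dots> = (\<integral>\<^sup>+(u::real^3). (\<integral>\<^sup>+s. ennreal (?f s) * indicator {norm u ..} s \<partial>lborel) \<partial>lborel)"
    by (subst nn_integral_S3_vol) (simp_all add: layer)
  also have "\<dots> = (\<integral>\<^sup>+s. ennreal (?f s) * ennreal (4 / 3 * pi * s ^ 3) * indicator {0..} s \<partial>lborel)"
    by (rule nn_integral_layers) measurable
  also have "\<dots> = (\<integral>\<^sup>+s. ennreal (64 * pi * (s ^ 4 / (1 + s\<^sup>2) ^ 4)) * indicator {0..} s \<partial>lborel)"
    by (intro nn_integral_cong)
      (auto simp: ennreal_mult'[symmetric] indicator_def power_numeral_reduce intro!: arg_cong[where f=ennreal])
  also have "\<dots> = ennreal (64 * pi * (pi / 2 / 16) - ?G 0)"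
  proof (rule nn_integral_FTC_atLeast)
    fix s :: real assume "0 \<le> s"
    show "0 \<le> 64 * pi * (s ^ 4 / (1 + s\<^sup>2) ^ 4)" by simp
    have p: "1 + s\<^sup>2 \<noteq> 0" using one_plus_square_pos[of s] by simp
    have "((\<lambda>s. arctan s / 16 + (3 * s ^ 5 - 8 * s ^ 3 - 3 * s) / (48 * (1 + s\<^sup>2) ^ 3)) has_real_derivative
       (inverse (1 + s\<^sup>2) / 16 + ((15 * s ^ 4 - 24 * s\<^sup>2 - 3) * (48 * (1 + s\<^sup>2) ^ 3)
          - (3 * s ^ 5 - 8 * s ^ 3 - 3 * s) * (48 * (3 * (1 + s\<^sup>2)\<^sup>2 * (2 * s))))
         / ((48 * (1 + s\<^sup>2) ^ 3) * (48 * (1 + s\<^sup>2) ^ 3)))) (at s)"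
      using p by (auto intro!: derivative_eq_intros simp: power2_eq_square)
    moreover have "inverse (1 + s\<^sup>2) / 16 + ((15 * s ^ 4 - 24 * s\<^sup>2 - 3) * (48 * (1 + s\<^sup>2) ^ 3)
          - (3 * s ^ 5 - 8 * s ^ 3 - 3 * s) * (48 * (3 * (1 + s\<^sup>2)\<^sup>2 * (2 * s))))
         / ((48 * (1 + s\<^sup>2) ^ 3) * (48 * (1 + s\<^sup>2) ^ 3)) = s ^ 4 / (1 + s\<^sup>2) ^ 4"
    proof -
      define q where "q = 1 + s\<^sup>2"
      have q: "q \<noteq> 0" "s\<^sup>2 = q - 1" using p by (simp_all add: q_def)
      have e: "s ^ 4 = (q - 1)\<^sup>2" "s ^ 5 * s = (q - 1) ^ 3" "s ^ 3 * s = (q - 1)\<^sup>2" "s * s = q - 1"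
        unfolding q(2)[symmetric] by (simp_all add: eval_nat_numeral)
      have "(3 * s ^ 5 - 8 * s ^ 3 - 3 * s) * (48 * (3 * q\<^sup>2 * (2 * s)))
         = 288 * q\<^sup>2 * (3 * (s ^ 5 * s) - 8 * (s ^ 3 * s) - 3 * (s * s))" by (simp add: algebra_simps)
      then have n: "(3 * s ^ 5 - 8 * s ^ 3 - 3 * s) * (48 * (3 * q\<^sup>2 * (2 * s)))
         = 288 * q\<^sup>2 * (3 * (q - 1) ^ 3 - 8 * (q - 1)\<^sup>2 - 3 * (q - 1))" unfolding e .
      show ?thesis
        unfolding q_def[symmetric] n unfolding e(1) q(2) using q(1)
        by (simp add: divide_simps) (simp add: eval_nat_numeral algebra_simps)
    qed
    ultimately show "(?G has_real_derivative 64 * pi * (s ^ 4 / (1 + s\<^sup>2) ^ 4)) (at s)"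
      by (intro DERIV_cmult) simp
  next
    have "((\<lambda>s::real. (3 * s ^ 5 - 8 * s ^ 3 - 3 * s) / (48 * (1 + s\<^sup>2) ^ 3)) \<longlongrightarrow> 0) at_top" by real_asymp
    then have "(?G \<longlongrightarrow> 64 * pi * (pi / 2 / 16 + 0)) at_top"
      by (intro tendsto_intros tendsto_arctan_at_top) auto
    then show "(?G \<longlongrightarrow> 64 * pi * (pi / 2 / 16)) at_top" by simp
  qed measurable
  finally show ?thesis by (simp add: power2_eq_square)
qed

interpretation S3v: finite_measure S3_vol
  by (rule finite_measureI) (simp add: emeasure_S3)

lemma measure_S3: "measure S3_vol S3 = 2 * pi\<^sup>2"
  by (simp add: measure_def emeasure_S3)

text \<open>
  The common majorant of all kernels, in the chart centred at the pole: the singularity \<open>1 / \<bar>u\<bar>\<^sup>2\<close> is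
  integrable in dimension three, and the decay \<open>1 / \<bar>u\<bar>\<^sup>4\<close> makes the integral over the whole chart
  finite. The same integral bounds the hyperbolic kernel on compact sets.\<close>

lemma nn_integral_inverse_square:
  "(\<integral>\<^sup>+(u::real^3). ennreal (2 / (u \<bullet> u * (1 + u \<bullet> u))) \<partial>lborel) < \<infinity>"
proof -
  \<comment> \<open>Minus the derivative of \<open>2 / (s\<^sup>2 * (1 + s\<^sup>2))\<close>; times the volume of the ball of radius \<open>s\<close>
    it is at most a multiple of the derivative of \<open>arctan\<close>.\<close>
  let ?f = "\<lambda>s::real. 4 * (1 + 2 * s\<^sup>2) / (s ^ 3 * (1 + s\<^sup>2)\<^sup>2)"
  have layer: "ennreal (2 / (u \<bullet> u * (1 + u \<bullet> u))) \<le> (\<integral>\<^sup>+s. ennreal (?f s) * indicator {norm u ..} s \<partial>lborel)" for u :: "real^3"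
  proof (cases "u = 0")
    case False
    have "(\<integral>\<^sup>+s. ennreal (?f s) * indicator {norm u ..} s \<partial>lborel)
       = ennreal (0 - - 2 / ((norm u)\<^sup>2 * (1 + (norm u)\<^sup>2)))"
    proof (rule nn_integral_FTC_atLeast)
      fix s :: real assume "norm u \<le> s"
      moreover have "norm u > 0" using False by simp
      ultimately have s: "0 < s" by linarith
      show "0 \<le> ?f s" using s by (intro divide_nonneg_nonneg mult_nonneg_nonneg add_nonneg_nonneg) auto
      have p: "1 + s\<^sup>2 \<noteq> 0" using one_plus_square_pos[of s] by simp
      have "((\<lambda>s. - 2 / (s\<^sup>2 * (1 + s\<^sup>2))) has_real_derivative
         (2 * (2 * s * (1 + s\<^sup>2) + s\<^sup>2 * (2 * s))) / ((s\<^sup>2 * (1 + s\<^sup>2)) * (s\<^sup>2 * (1 + s\<^sup>2)))) (at s)"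
      proof -
        have D: "((\<lambda>s. s\<^sup>2 * (1 + s\<^sup>2)) has_real_derivative (2 * s * (1 + s\<^sup>2) + s\<^sup>2 * (2 * s))) (at s)"
          by (auto intro!: derivative_eq_intros simp: algebra_simps power2_eq_square power3_eq_cube)
        show ?thesis
          using DERIV_divide[OF DERIV_const[of "- 2"] D] p s by (simp add: add.commute)
      qed
      moreover have "(2 * (2 * s * (1 + s\<^sup>2) + s\<^sup>2 * (2 * s))) / ((s\<^sup>2 * (1 + s\<^sup>2)) * (s\<^sup>2 * (1 + s\<^sup>2))) = ?f s"
      proof -
        have n: "2 * (2 * s * (1 + s\<^sup>2) + s\<^sup>2 * (2 * s)) = s * (4 * (1 + 2 * s\<^sup>2))"
          by (simp add: algebra_simps power2_eq_square power3_eq_cube)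
        have d: "(s\<^sup>2 * (1 + s\<^sup>2)) * (s\<^sup>2 * (1 + s\<^sup>2)) = s * (s ^ 3 * (1 + s\<^sup>2)\<^sup>2)"
          unfolding power2_eq_square power3_eq_cube by (simp only: mult_ac)
        show ?thesis unfolding n d using s by (intro mult_divide_mult_cancel_left) simp
      qed
      ultimately show "((\<lambda>s. - 2 / (s\<^sup>2 * (1 + s\<^sup>2))) has_real_derivative ?f s) (at s)" by simp
    next
      show "((\<lambda>s::real. - 2 / (s\<^sup>2 * (1 + s\<^sup>2))) \<longlongrightarrow> 0) at_top" by real_asymp
    qed measurable
    then show ?thesis by (simp add: power2_norm_eq_inner)
  qed simp
  have "(\<integral>\<^sup>+(u::real^3). ennreal (2 / (u \<bullet> u * (1 + u \<bullet> u))) \<partial>lborel)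
     \<le> (\<integral>\<^sup>+(u::real^3). (\<integral>\<^sup>+s. ennreal (?f s) * indicator {norm u ..} s \<partial>lborel) \<partial>lborel)"
    by (intro nn_integral_mono layer)
  also have "\<dots> = (\<integral>\<^sup>+s. ennreal (?f s) * ennreal (4 / 3 * pi * s ^ 3) * indicator {0..} s \<partial>lborel)"
    by (rule nn_integral_layers) measurable
  also have "\<dots> \<le> (\<integral>\<^sup>+s. ennreal (32 / 3 * pi * inverse (1 + s\<^sup>2)) * indicator {0..} s \<partial>lborel)"
  proof (intro nn_integral_mono)
    fix s :: real
    show "ennreal (?f s) * ennreal (4 / 3 * pi * s ^ 3) * indicator {0..} s
      \<le> ennreal (32 / 3 * pi * inverse (1 + s\<^sup>2)) * indicator {0..} s"
    proof (cases "s > 0")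
      case True
      define q where "q = 1 + s\<^sup>2"
      have q: "q > 0" "1 + 2 * s\<^sup>2 \<le> 2 * q" "s ^ 3 > 0" using True by (auto simp: q_def intro: add_pos_nonneg)
      have "?f s * (4 / 3 * pi * s ^ 3) = 16 / 3 * pi * ((1 + 2 * s\<^sup>2) / q\<^sup>2)"
        using q True by (simp add: q_def[symmetric] field_simps)
      also have "\<dots> \<le> 16 / 3 * pi * (2 * q / q\<^sup>2)"
        using q by (intro mult_left_mono divide_right_mono) auto
      also have "\<dots> = 32 / 3 * pi * inverse q" using q by (simp add: power2_eq_square divide_simps)
      finally have "?f s * (4 / 3 * pi * s ^ 3) \<le> 32 / 3 * pi * inverse (1 + s\<^sup>2)" by (simp add: q_def)
      then show ?thesis using True by (simp add: ennreal_mult''[symmetric] ennreal_leI)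
    qed (cases "s = 0"; simp)
  qed
  also have "\<dots> = ennreal (32 / 3 * pi * (pi / 2) - 32 / 3 * pi * arctan 0)"
  proof (rule nn_integral_FTC_atLeast)
    show "((\<lambda>s. 32 / 3 * pi * arctan s) has_real_derivative 32 / 3 * pi * inverse (1 + s\<^sup>2)) (at s)" for s
      by (intro DERIV_cmult DERIV_arctan)
    show "((\<lambda>s. 32 / 3 * pi * arctan s) \<longlongrightarrow> 32 / 3 * pi * (pi / 2)) at_top"
      by (intro tendsto_intros tendsto_arctan_at_top)
    show "0 \<le> 32 / 3 * pi * inverse (1 + s\<^sup>2)" for s :: real by simp
  qed measurable
  finally show ?thesis by (auto simp: less_top[symmetric] top_unique)
qed

subsection \<open>Invariance under right translations\<close>

lemma S3_chart_spatial:
  assumes "x \<in> S3" "x$1 \<noteq> - 1"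
  shows "S3_chart ((1 / (1 + x$1)) *\<^sub>R spatial x) = x"
proof -
  define a where "a = 1 + x$1"
  have a: "a \<noteq> 0" using assms by (simp add: a_def add_eq_0_iff)
  have "x \<bullet> x = 1" using assms by (simp add: S3_iff)
  then have "spatial x \<bullet> spatial x = 1 - (x$1)\<^sup>2"
    by (simp add: spatial_def inner_vec_def sum_3 sum_4 power2_eq_square)
  also have "\<dots> = a * (2 - a)" by (simp add: a_def power2_eq_square algebra_simps)
  finally have "1 + ((1 / a) *\<^sub>R spatial x) \<bullet> ((1 / a) *\<^sub>R spatial x) = 2 / a"
    using a by (simp add: field_simps)
  then have "S3_chart ((1 / a) *\<^sub>R spatial x) = a *\<^sub>R (qone + (1 / a) *\<^sub>R emb (spatial x)) - qone"
    unfolding S3_chart_emb using a linear_emb by (simp add: linear_cmul)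
  also have "\<dots> = x" using a qone_spatial[of x] by (simp add: a_def algebra_simps)
  finally show ?thesis by (simp add: a_def)
qed

lemma spatial_S3_chart: "(1 / (1 + S3_chart u $ 1)) *\<^sub>R spatial (S3_chart u) = u"
proof -
  have p: "1 + u \<bullet> u > 0" by (rule one_plus_inner_pos)
  define a where "a = 2 / (1 + u \<bullet> u)"
  have a: "a \<noteq> 0" using p by (simp add: a_def)
  have re: "1 + S3_chart u $ 1 = a" using p by (simp add: S3_chart_re a_def field_simps)
  have sp: "spatial (S3_chart u) = a *\<^sub>R u"
    unfolding S3_chart_emb a_def using linear_spatial by (simp add: linear_diff linear_cmul linear_add)
  show ?thesis unfolding re sp using a by simp
qed

lemma S3_chart_inj: "S3_chart u = S3_chart v \<Longrightarrow> u = v"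
  using spatial_S3_chart by metis

lemma S3_chart_not_antipode: "S3_chart u \<noteq> - qone"
proof
  assume "S3_chart u = - qone"
  then have "S3_chart u $ 1 = - 1" by simp
  then show False using one_plus_inner_pos[of u] by (simp add: S3_chart_re field_simps)
qed

lemma S3_antipode: "x \<in> S3 \<Longrightarrow> x$1 = - 1 \<Longrightarrow> x = - qone"
proof -
  assume x: "x \<in> S3" "x$1 = - 1"
  then have "(x$2)\<^sup>2 + (x$3)\<^sup>2 + (x$4)\<^sup>2 = 0"
    by (simp add: S3_iff(1) inner_vec_def sum_4 power2_eq_square)
  then have "x$2 = 0" "x$3 = 0" "x$4 = 0"
    by (smt (verit) zero_le_power2 power_eq_0_iff pos2)+
  then show ?thesis using x by (simp add: vec_eq_iff forall_4 qone_def)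
qed

lemma det_conformal:
  fixes L :: "real^'n \<Rightarrow> real^'n"
  assumes L: "linear L" and k: "k > 0" "\<And>h. norm (L h) = k * norm h"
  shows "\<bar>det (matrix L)\<bar> = k ^ CARD('n)"
proof -
  let ?G = "\<lambda>h. (1 / k) *\<^sub>R L h"
  have G: "orthogonal_transformation ?G"
    unfolding orthogonal_transformation
    using L k by (auto simp: linear_compose_scale_right)
  have "L = ((*\<^sub>R) k) \<circ> ?G" using k by (auto simp: fun_eq_iff)
  then have "matrix L = matrix ((*\<^sub>R) k) ** matrix ?G"
    using G by (metis matrix_compose orthogonal_transformation linear_scaleR)
  then have "det (matrix L) = k ^ CARD('n) * det (matrix ?G)" by (simp add: det_mul)
  then show ?thesis using orthogonal_transformation_det[OF G] k by (simp add: abs_mult)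
qed

lemma S3_vol_point: "y \<in> S3 \<Longrightarrow> emeasure S3_vol {y} = 0"
proof -
  assume y: "y \<in> S3"
  have m: "{y} \<in> sets (restrict_space borel S3)" using y by (simp add: sets_restrict_space_iff S3_def)
  then have "emeasure S3_vol {y} = (\<integral>\<^sup>+x. indicator {y} x \<partial>S3_vol)" by simp
  also have "\<dots> = (\<integral>\<^sup>+u. ennreal (S3_density u) * indicator {y} (S3_chart u) \<partial>lborel)"
    using m by (intro nn_integral_S3_vol) simp
  also have "\<dots> = (\<integral>\<^sup>+u. 0 \<partial>(lborel :: (real^3) measure))"
  proof (rule nn_integral_cong_AE)
    let ?p = "(1 / (1 + y$1)) *\<^sub>R spatial y"
    have "AE u in lborel. u \<noteq> ?p" by (rule AE_lborel_singleton)
    then show "AE u in lborel. ennreal (S3_density u) * indicator {y} (S3_chart u) = 0"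
      by eventually_elim (use spatial_S3_chart in \<open>auto simp: indicator_def\<close>)
  qed
  finally show ?thesis by simp
qed

lemma integrable_S3_density: "integrable lborel S3_density"
proof (rule integrableI_nonneg)
  have "(\<integral>\<^sup>+u. ennreal (S3_density u) \<partial>lborel) = (\<integral>\<^sup>+x. 1 \<partial>S3_vol)"
    by (subst nn_integral_S3_vol) simp_all
  also have "\<dots> < \<infinity>" by (simp add: emeasure_S3)
  finally show "(\<integral>\<^sup>+u. ennreal (S3_density u) \<partial>lborel) < \<infinity>" .
qed (auto intro: less_imp_le S3_density_pos)

lemma measure_S3_vol_chart:
  assumes A: "A \<in> sets S3_vol"
  shows "measure S3_vol A = integral UNIV (\<lambda>u. indicator A (S3_chart u) * S3_density u)"
    and "integrable lborel (\<lambda>u. indicator A (S3_chart u) * S3_density u)"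
proof -
  have [measurable]: "A \<in> sets (restrict_space borel S3)" using A by simp
  show i: "integrable lborel (\<lambda>u. indicator A (S3_chart u) * S3_density u)"
    by (rule Bochner_Integration.integrable_bound[OF integrable_S3_density])
      (auto simp: indicator_def less_imp_le[OF S3_density_pos])
  have "emeasure S3_vol A = (\<integral>\<^sup>+x. indicator A x \<partial>S3_vol)" using A by simp
  also have "\<dots> = (\<integral>\<^sup>+u. ennreal (S3_density u) * indicator A (S3_chart u) \<partial>lborel)"
    by (intro nn_integral_S3_vol) measurable
  also have "\<dots> = (\<integral>\<^sup>+u. ennreal (indicator A (S3_chart u) * S3_density u) \<partial>lborel)"
    by (intro nn_integral_cong) (auto simp: indicator_def)
  also have "\<dots> = ennreal (LINT u|lborel. indicator A (S3_chart u) * S3_density u)"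
    by (rule nn_integral_eq_integral[OF i]) (auto simp: less_imp_le[OF S3_density_pos])
  finally show "measure S3_vol A = integral UNIV (\<lambda>u. indicator A (S3_chart u) * S3_density u)"
    using integral_lborel[OF i]
    by (simp add: measure_def integral_nonneg_AE less_imp_le[OF S3_density_pos])
qed

lemma S3_right_translation:
  assumes q: "q \<in> S3"
  shows "qmul x q \<in> S3 \<longleftrightarrow> x \<in> S3" "qmul (qmul x q) (qcnj q) = x" "qmul (qmul x (qcnj q)) q = x"
proof -
  have q1: "q \<bullet> q = 1" "norm q = 1" using q S3_iff by auto
  show "qmul x q \<in> S3 \<longleftrightarrow> x \<in> S3" by (simp add: S3_iff(2) norm_qmul q1)
  show "qmul (qmul x q) (qcnj q) = x" "qmul (qmul x (qcnj q)) q = x"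
    by (simp_all add: qmul_assoc qmul_qcnj_left qmul_qcnj_right q1)
qed

lemma measurable_right_translation [measurable]:
  assumes "q \<in> S3"
  shows "(\<lambda>x. qmul x q) \<in> restrict_space borel S3 \<rightarrow>\<^sub>M restrict_space borel S3"
  using S3_right_translation(1)[OF assms]
  by (intro measurable_restrict_space3 borel_measurable_continuous_onI continuous_intros) auto

text \<open>
  In the chart a right translation becomes a map \<open>m\<close>, defined off one point. The translation is an
  isometry and the chart is conformal, so the derivative of \<open>m\<close> is a multiple of an isometry, and its
  Jacobian is the quotient of the densities. The claim is then the change of variables formula.\<close>

lemma S3_vol_right_invariant:
  assumes q: "q \<in> S3"
  shows "distr S3_vol S3_vol (\<lambda>x. qmul x q) = S3_vol"
proof (rule measure_eqI)
  fix A assume "A \<in> sets (distr S3_vol S3_vol (\<lambda>x. qmul x q))"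
  then have A: "A \<in> sets S3_vol" by simp
  let ?T = "\<lambda>x. qmul x q" and ?T' = "\<lambda>x. qmul x (qcnj q)"
  let ?\<pi> = "\<lambda>x::real^4. (1 / (1 + x$1)) *\<^sub>R spatial x"
  have q': "qcnj q \<in> S3" using q by (rule qcnj_S3)
  have T: "?T -` A \<inter> S3 \<in> sets S3_vol"
    using measurable_sets[OF measurable_right_translation[OF q], of A] A by (simp add: space_restrict_space)
  define U where "U = {u. ?T (S3_chart u) $ 1 \<noteq> - 1}"
  define m where "m u = ?\<pi> (?T (S3_chart u))" for u
  have TS: "?T (S3_chart u) \<in> S3" for u using S3_chart_S3 S3_right_translation(1)[OF q] by blast
  have chart_m: "S3_chart (m u) = ?T (S3_chart u)" if "u \<in> U" for u
    using that S3_chart_spatial[OF TS] by (simp add: U_def m_def)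
  have "continuous_on UNIV (\<lambda>u. ?T (S3_chart u) $ 1)"
    by (intro continuous_intros continuous_S3_chart)
  then have U: "open U" unfolding U_def by (intro open_Collect_neq) (auto intro: continuous_intros)
  let ?D = "\<lambda>u. frechet_derivative S3_chart (at u)"
  have dchart: "(S3_chart has_derivative ?D u) (at u)" for u
    using S3_chart_derivative frechet_derivative_works differentiableI by blast
  have dm: "m differentiable (at u)" if "u \<in> U" for u
  proof -
    have nz: "1 + ?T (S3_chart u) $ 1 \<noteq> 0" using that by (simp add: U_def add_eq_0_iff)
    have dT: "(\<lambda>u. ?T (S3_chart u)) differentiable (at u)"
      using bounded_linear.has_derivative[OF bounded_linear_qmul_left dchart] differentiableI by blast
    have "(\<lambda>u. 1 + ?T (S3_chart u) $ 1) differentiable (at u)"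
    proof -
      obtain D' where "((\<lambda>u. ?T (S3_chart u)) has_derivative D') (at u)"
        using dT unfolding differentiable_def by blast
      from has_derivative_add[OF has_derivative_const bounded_linear.has_derivative[OF bounded_linear_vec_nth this]]
      show ?thesis by (rule differentiableI)
    qed
    then have "(\<lambda>u. 1 / (1 + ?T (S3_chart u) $ 1)) differentiable (at u)"
      using nz by (intro differentiable_divide) auto
    moreover have "(\<lambda>u. spatial (?T (S3_chart u))) differentiable (at u)"
      using bounded_linear.has_derivative[OF bounded_linear_spatial] dT unfolding differentiable_def by blast
    ultimately show ?thesis unfolding m_def by (intro differentiable_scaleR)
  qed
  let ?m' = "\<lambda>u. frechet_derivative m (at u)"
  have dm': "(m has_derivative ?m' u) (at u)" if "u \<in> U" for u
    using dm[OF that] frechet_derivative_works by blast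
  have normD: "norm (?D u h) = 2 / (1 + u \<bullet> u) * norm h" for u h
    using S3_chart_conformal[of u h h] one_plus_inner_pos[of u]
    by (simp add: norm_eq_sqrt_inner real_sqrt_mult)
  have det_m: "\<bar>det (matrix (?m' u))\<bar> * S3_density (m u) = S3_density u" if u: "u \<in> U" for u
  proof -
    have "((\<lambda>u. S3_chart (m u)) has_derivative (\<lambda>h. ?D (m u) (?m' u h))) (at u)"
      by (rule has_derivative_compose[OF dm'[OF u] dchart])
    moreover have "((\<lambda>u. S3_chart (m u)) has_derivative (\<lambda>h. ?T (?D u h))) (at u)"
      by (rule has_derivative_transform_within_open[OF bounded_linear.has_derivative[OF bounded_linear_qmul_left dchart] U u])
        (simp add: chart_m)
    ultimately have "(\<lambda>h. ?D (m u) (?m' u h)) = (\<lambda>h. ?T (?D u h))"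
      by (rule has_derivative_unique)
    then have eq: "?D (m u) (?m' u h) = ?T (?D u h)" for h by meson
    let ?k = "(1 + m u \<bullet> m u) / (1 + u \<bullet> u)"
    have "norm (?m' u h) = ?k * norm h" for h
      using arg_cong[OF eq[of h], of norm] q one_plus_inner_pos[of u] one_plus_inner_pos[of "m u"]
      by (simp add: normD norm_qmul S3_iff(2) field_simps)
    then have "\<bar>det (matrix (?m' u))\<bar> = ?k ^ CARD(3)"
      using one_plus_inner_pos[of u] one_plus_inner_pos[of "m u"]
      by (intro det_conformal) (auto intro: has_derivative_linear dm' u)
    then show ?thesis
      using one_plus_inner_pos[of u] one_plus_inner_pos[of "m u"]
      by (simp add: S3_density_def power_divide)
  qed
  have inj: "inj_on m U"
  proof (rule inj_onI)
    fix u v assume uv: "u \<in> U" "v \<in> U" "m u = m v"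
    then have "?T (S3_chart u) = ?T (S3_chart v)" using chart_m by metis
    then show "u = v" using S3_right_translation(2)[OF q] S3_chart_inj by metis
  qed
  let ?f = "\<lambda>u. indicator A (S3_chart u) * S3_density u"
  have nU: "negligible (- U)"
  proof (rule negligible_subset[OF negligible_sing])
    show "- U \<subseteq> {?\<pi> (?T' (- qone))}"
    proof
      fix u assume "u \<in> - U"
      then have "?T (S3_chart u) = - qone" using S3_antipode[OF TS] by (simp add: U_def)
      then have "S3_chart u = ?T' (- qone)" using S3_right_translation(2)[OF q] by metis
      then show "u \<in> {?\<pi> (?T' (- qone))}" using spatial_S3_chart by (metis singletonI)
    qed
  qed
  have nmU: "negligible (- (m ` U))"
  proof (rule negligible_subset[OF negligible_sing])
    show "- (m ` U) \<subseteq> {?\<pi> (?T (- qone))}"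
    proof
      fix v assume v: "v \<in> - (m ` U)"
      let ?x = "?T' (S3_chart v)"
      have x: "?x \<in> S3" using S3_chart_S3 S3_right_translation(1)[OF q'] by blast
      have Tx: "?T ?x = S3_chart v" by (rule S3_right_translation(3)[OF q])
      have "?x$1 = - 1"
      proof (rule ccontr)
        assume "?x$1 \<noteq> - 1"
        then have c: "S3_chart (?\<pi> ?x) = ?x" by (rule S3_chart_spatial[OF x])
        have "S3_chart v $ 1 \<noteq> - 1" using S3_antipode[OF S3_chart_S3] S3_chart_not_antipode by blast
        then have "?\<pi> ?x \<in> U" by (simp add: U_def c Tx)
        moreover have "m (?\<pi> ?x) = v" unfolding m_def c Tx by (rule spatial_S3_chart)
        ultimately have "v \<in> m ` U" by (metis image_eqI)
        then show False using v by simp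
      qed
      then have "?x = - qone" by (rule S3_antipode[OF x])
      then have "S3_chart v = ?T (- qone)" using Tx by simp
      then show "v \<in> {?\<pi> (?T (- qone))}" using spatial_S3_chart by (metis singletonI)
    qed
  qed
  have fi: "?f absolutely_integrable_on UNIV"
    using measure_S3_vol_chart(2)[OF A] by (simp add: set_integrable_def integrable_completion)
  have mU: "m ` U \<in> sets lebesgue"
    using U dm by (intro differentiable_image_in_sets_lebesgue)
      (auto simp: differentiable_on_def intro: differentiable_at_withinI lmeasurable_open)
  have fm: "?f absolutely_integrable_on (m ` U)"
    by (rule set_integrable_subset[OF fi mU]) simp
  \<comment> \<open>The change of variables formula is stated for vector-valued functions.\<close>
  define F :: "real^3 \<Rightarrow> real^1" where "F u = vec (?f u)" for u
  have bl: "bounded_linear (vec :: real \<Rightarrow> real^1)" by (simp add: linear_vec linear_conv_bounded_linear[symmetric])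
  have Fm: "F absolutely_integrable_on (m ` U)"
    using absolutely_integrable_linear[OF fm bl] by (simp add: F_def[abs_def] o_def)
  have dmU: "(m has_derivative ?m' u) (at u within U)" if "u \<in> U" for u
    by (rule has_derivative_at_withinI[OF dm'[OF that]])
  have Ul: "U \<in> sets lebesgue" using U by (simp add: lmeasurable_open)
  have "integral U (\<lambda>u. \<bar>det (matrix (?m' u))\<bar> *\<^sub>R F (m u)) = integral (m ` U) F"
    using has_absolute_integral_change_of_variables[OF Ul dmU inj, of F "integral (m ` U) F"] Fm by blast
  also have "integral (m ` U) F = vec (integral (m ` U) ?f)"
    using integral_linear[OF set_lebesgue_integral_eq_integral(1)[OF fm] bl] by (simp add: F_def[abs_def] o_def)
  also have "integral (m ` U) ?f = integral UNIV ?f"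
    by (rule integral_spike_set) (auto intro: negligible_subset[OF nmU])
  also have "integral U (\<lambda>u. \<bar>det (matrix (?m' u))\<bar> *\<^sub>R F (m u))
      = integral U (\<lambda>u. vec (indicator (?T -` A \<inter> S3) (S3_chart u) * S3_density u))"
  proof (rule integral_cong)
    fix u assume u: "u \<in> U"
    have "\<bar>det (matrix (?m' u))\<bar> * ?f (m u) = indicator (?T -` A \<inter> S3) (S3_chart u) * S3_density u"
      using det_m[OF u] chart_m[OF u] S3_chart_S3[of u] by (auto simp: indicator_def)
    then show "\<bar>det (matrix (?m' u))\<bar> *\<^sub>R F (m u) = vec (indicator (?T -` A \<inter> S3) (S3_chart u) * S3_density u)"
      by (simp add: F_def vec_eq_iff)
  qed
  also have "\<dots> = vec (integral U (\<lambda>u. indicator (?T -` A \<inter> S3) (S3_chart u) * S3_density u))"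
  proof -
    have "(\<lambda>u. indicator (?T -` A \<inter> S3) (S3_chart u) * S3_density u) absolutely_integrable_on UNIV"
      using measure_S3_vol_chart(2)[OF T] by (simp add: set_integrable_def integrable_completion)
    then have "(\<lambda>u. indicator (?T -` A \<inter> S3) (S3_chart u) * S3_density u) absolutely_integrable_on U"
      by (rule set_integrable_subset[OF _ Ul]) simp
    from integral_linear[OF set_lebesgue_integral_eq_integral(1)[OF this] bl]
    show ?thesis by (simp add: o_def)
  qed
  also have "integral U (\<lambda>u. indicator (?T -` A \<inter> S3) (S3_chart u) * S3_density u)
      = integral UNIV (\<lambda>u. indicator (?T -` A \<inter> S3) (S3_chart u) * S3_density u)"
    by (rule integral_spike_set) (auto intro: negligible_subset[OF nU])
  finally have "measure S3_vol (?T -` A \<inter> S3) = measure S3_vol A"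
    using measure_S3_vol_chart(1)[OF T] measure_S3_vol_chart(1)[OF A] by (simp add: vec_eq_iff)
  then have "emeasure S3_vol (?T -` A \<inter> S3) = emeasure S3_vol A"
    by (simp add: S3v.emeasure_eq_measure)
  then show "emeasure (distr S3_vol S3_vol ?T) A = emeasure S3_vol A"
    using A q by (subst emeasure_distr) (auto simp: measurable_cong_sets[OF sets_S3_vol sets_S3_vol])
qed simp

lemma integral_right_translate:
  fixes f :: "real^4 \<Rightarrow> real"
  assumes "q \<in> S3" "f \<in> borel_measurable (restrict_space borel S3)"
  shows "(LINT x|S3_vol. f (qmul x q)) = (LINT x|S3_vol. f x)"
    and "integrable S3_vol (\<lambda>x. f (qmul x q)) \<longleftrightarrow> integrable S3_vol f"
proof -
  have m: "(\<lambda>x. qmul x q) \<in> S3_vol \<rightarrow>\<^sub>M S3_vol" "f \<in> borel_measurable S3_vol"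
    using assms measurable_right_translation by (auto simp: measurable_cong_sets[OF sets_S3_vol sets_S3_vol] measurable_cong_sets[OF sets_S3_vol refl])
  show "(LINT x|S3_vol. f (qmul x q)) = (LINT x|S3_vol. f x)"
    using integral_distr[OF m] by (simp add: S3_vol_right_invariant[OF assms(1)])
  show "integrable S3_vol (\<lambda>x. f (qmul x q)) \<longleftrightarrow> integrable S3_vol f"
    using integrable_distr_eq[OF m] by (simp add: S3_vol_right_invariant[OF assms(1)])
qed

lemma integrable_continuous_S3: "continuous_on S3 f \<Longrightarrow> integrable S3_vol (f :: real^4 \<Rightarrow> real)"
proof -
  assume f: "continuous_on S3 f"
  have "bounded (f ` S3)" by (intro compact_imp_bounded compact_continuous_image f compact_S3)
  then obtain B where "\<And>x. x \<in> S3 \<Longrightarrow> \<bar>f x\<bar> \<le> B" by (auto simp: bounded_iff)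
  then show ?thesis
    using continuous_on_measurable_S3[OF f]
    by (intro S3v.integrable_const_bound[of _ B]) (auto simp: measurable_cong_sets[OF sets_S3_vol refl])
qed

text \<open>
  Since \<open>1 - (x \<bullet> y)\<^sup>2\<close> is the squared sine of the distance, this grows like the inverse square of the
  distance to \<open>y\<close> and to \<open>- y\<close>. Every kernel times the frame derivative that goes with it is bounded
  by a multiple of \<open>weight\<close>.\<close>

definition weight :: "real \<Rightarrow> real" where "weight t = 1 / (1 - t\<^sup>2)"

lemma weight_measurable [measurable]: "weight \<in> borel_measurable borel"
  unfolding weight_def by measurable

lemma integrable_weight_qone: "integrable S3_vol (\<lambda>x. weight (x \<bullet> qone))"
proof (rule integrableI_nonneg)
  have m: "(\<lambda>x. weight (x \<bullet> qone)) \<in> borel_measurable (restrict_space borel S3)"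
    by (rule measurable_restrict_space1) measurable
  then show "(\<lambda>x. weight (x \<bullet> qone)) \<in> borel_measurable S3_vol"
    by (simp add: measurable_cong_sets[OF sets_S3_vol refl])
  have le: "\<bar>x \<bullet> qone\<bar> \<le> 1" if "x \<in> S3" for x
    using Cauchy_Schwarz_ineq2[of x qone] that by (simp add: S3_iff(2))
  have "0 \<le> weight (x \<bullet> qone)" if "x \<in> S3" for x
    using le[OF that] by (simp add: weight_def abs_square_le_1)
  then show "AE x in S3_vol. 0 \<le> weight (x \<bullet> qone)" by (intro AE_I2) simp
  have "(\<integral>\<^sup>+x. ennreal (weight (x \<bullet> qone)) \<partial>S3_vol)
     = (\<integral>\<^sup>+u. ennreal (S3_density u) * ennreal (weight (S3_chart u \<bullet> qone)) \<partial>lborel)"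
    by (rule nn_integral_S3_vol[OF measurable_compose[OF m measurable_ennreal]])
  also have "\<dots> = (\<integral>\<^sup>+(u::real^3). ennreal (2 / (u \<bullet> u * (1 + u \<bullet> u))) \<partial>lborel)"
  proof (intro nn_integral_cong)
    fix u :: "real^3"
    define N where "N = 1 + u \<bullet> u"
    have N: "N > 0" by (simp add: N_def one_plus_inner_pos)
    have "S3_chart u \<bullet> qone = (2 - N) / N"
      using N by (simp add: S3_chart_emb inner_diff_left inner_add_left N_def[symmetric] diff_divide_distrib)
    moreover have "1 - ((2 - N) / N)\<^sup>2 = 4 * (N - 1) / N\<^sup>2"
      using N by (simp add: power2_eq_square field_simps)
    ultimately have "1 - (S3_chart u \<bullet> qone)\<^sup>2 = 4 * (N - 1) / N\<^sup>2" by (simp only:)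
    have "S3_density u * weight (S3_chart u \<bullet> qone) = 2 / ((N - 1) * N)"
    proof (cases "N = 1")
      case False
      then have "4 * N - 4 \<noteq> 0" by simp
      then show ?thesis
        using N False \<open>1 - (S3_chart u \<bullet> qone)\<^sup>2 = 4 * (N - 1) / N\<^sup>2\<close>
        by (simp add: S3_density_def weight_def N_def[symmetric] power3_eq_cube) (simp add: power2_eq_square field_simps)
    qed (use \<open>1 - (S3_chart u \<bullet> qone)\<^sup>2 = 4 * (N - 1) / N\<^sup>2\<close> in \<open>simp add: weight_def\<close>)
    then show "ennreal (S3_density u) * ennreal (weight (S3_chart u \<bullet> qone)) = ennreal (2 / (u \<bullet> u * (1 + u \<bullet> u)))"
      using S3_density_pos[of u] by (simp add: ennreal_mult'[symmetric] N_def)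
  qed
  also have "\<dots> < \<infinity>" by (rule nn_integral_inverse_square)
  finally show "(\<integral>\<^sup>+x. ennreal (weight (x \<bullet> qone)) \<partial>S3_vol) < \<infinity>" .
qed

lemma right_translate_inner: "y \<in> S3 \<Longrightarrow> qmul x y \<bullet> y = x \<bullet> qone"
  by (simp add: inner_qmul_right qmul_qcnj_right S3_iff(1))

text \<open>
  Right translation by \<open>y\<close> moves the pole from \<open>1\<close> to \<open>y\<close>.\<close>

lemma integrable_weight: "y \<in> S3 \<Longrightarrow> integrable S3_vol (\<lambda>x. weight (x \<bullet> y))"
proof -
  assume y: "y \<in> S3"
  have "(\<lambda>x. weight (x \<bullet> y)) \<in> borel_measurable (restrict_space borel S3)"
    by (rule measurable_restrict_space1) measurable
  from integral_right_translate(2)[OF y this] show ?thesis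
    using integrable_weight_qone by (simp add: right_translate_inner[OF y])
qed

lemma AE_S3_not_antipodal: "y \<in> S3 \<Longrightarrow> AE x in S3_vol. \<bar>x \<bullet> y\<bar> < 1"
proof -
  assume y: "y \<in> S3"
  have "AE x in S3_vol. x \<noteq> y" "AE x in S3_vol. x \<noteq> - y"
    using y by (auto intro!: AE_not_in[of "{_}", simplified] simp: null_sets_def S3_vol_point sets_restrict_space_iff S3_def)
  moreover have "AE x in S3_vol. x \<in> S3" by (rule AE_I2) simp
  ultimately show ?thesis
  proof eventually_elim
    case (elim x)
    have n: "norm x = 1" "norm y = 1" using elim y by (simp_all add: S3_iff(2))
    have "\<bar>x \<bullet> y\<bar> \<noteq> 1"
      using norm_cauchy_schwarz_abs_eq[of x y] n elim by auto
    moreover have "\<bar>x \<bullet> y\<bar> \<le> 1" using Cauchy_Schwarz_ineq2[of x y] n by simp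
    ultimately show ?case by linarith
  qed
qed

section \<open>Integration by parts and Green's functions\<close>

lemma has_Lie_along_orbit:
  assumes a: "imaginary_unit a" and F: "has_Lie a F G" and x: "x \<in> S3"
  shows "((\<lambda>t. F (qmul x (qexp a t))) has_real_derivative G (qmul x (qexp a t))) (at t)"
proof -
  have "qmul x (qexp a t) \<in> S3" using x qexp_S3[OF a] qmul_S3 by blast
  then have "((\<lambda>s. F (qmul (qmul x (qexp a t)) (qexp a s))) has_real_derivative G (qmul x (qexp a t))) (at 0)"
    using F by (simp add: has_Lie_def)
  then have "((\<lambda>s. F (qmul x (qexp a (s + t)))) has_real_derivative G (qmul x (qexp a t))) (at 0)"
  proof -
    have "qexp a (s + t) = qmul (qexp a t) (qexp a s)" for s
      using qexp_add[OF a, of t s] by (simp add: add.commute)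
    then show "((\<lambda>s. F (qmul (qmul x (qexp a t)) (qexp a s))) has_real_derivative G (qmul x (qexp a t))) (at 0) \<Longrightarrow> ?thesis"
      by (simp add: qmul_assoc)
  qed
  then show ?thesis by (subst (asm) DERIV_shift[of _ _ 0 t, simplified add_0, symmetric])
qed

text \<open>
  The flow of a left-invariant field consists of right translations, which preserve the volume. Hence
  the difference quotients of \<open>F\<close> along the flow have integral 0; they converge boundedly to \<open>G\<close>.\<close>

lemma integral_Lie_eq_0:
  assumes a: "imaginary_unit a" and F: "has_Lie a F G" "continuous_on S3 F"
  shows "(LINT x|S3_vol. G x) = 0"
proof -
  have cG: "continuous_on S3 G" using F by (simp add: has_Lie_def)
  have "bounded (G ` S3)" by (intro compact_imp_bounded compact_continuous_image cG compact_S3)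
  then obtain B where B: "\<And>x. x \<in> S3 \<Longrightarrow> \<bar>G x\<bar> \<le> B" by (auto simp: bounded_iff)
  define h :: "nat \<Rightarrow> real" where "h n = 1 / real (Suc n)" for n
  have h: "h n > 0" for n by (simp add: h_def)
  define D where "D n x = (F (qmul x (qexp a (h n))) - F x) / h n" for n x
  have e: "qexp a t \<in> S3" for t by (rule qexp_S3[OF a])
  have mF: "F \<in> borel_measurable (restrict_space borel S3)" by (rule continuous_on_measurable_S3[OF F(2)])
  have iF: "integrable S3_vol F" by (rule integrable_continuous_S3[OF F(2)])
  have iT: "integrable S3_vol (\<lambda>x. F (qmul x (qexp a t)))" for t
    using integral_right_translate(2)[OF e mF] iF by simp
  have iD: "integrable S3_vol (D n)" for n
    unfolding D_def by (intro integrable_divide_zero Bochner_Integration.integrable_diff iT iF)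
  have "(LINT x|S3_vol. D n x) = 0" for n
    unfolding D_def using iT iF integral_right_translate(1)[OF e mF] by simp
  moreover have "(\<lambda>n. LINT x|S3_vol. D n x) \<longlonglongrightarrow> (LINT x|S3_vol. G x)"
  proof (rule integral_dominated_convergence)
    show "G \<in> borel_measurable S3_vol" using integrable_continuous_S3[OF cG] by simp
    show "D n \<in> borel_measurable S3_vol" for n using iD by simp
    show "integrable S3_vol (\<lambda>x. B)" by simp
    have h0: "filterlim h (at 0) sequentially"
      unfolding filterlim_at h_def using LIMSEQ_inverse_real_of_nat by (simp add: inverse_eq_divide)
    show "AE x in S3_vol. (\<lambda>n. D n x) \<longlonglongrightarrow> G x"
    proof (rule AE_I2)
      fix x assume "x \<in> space S3_vol"
      then have x: "x \<in> S3" by simp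
      have "((\<lambda>t. F (qmul x (qexp a t))) has_real_derivative G x) (at 0)"
        using F(1) x by (simp add: has_Lie_def)
      then have "((\<lambda>t. (F (qmul x (qexp a t)) - F x) / t) \<longlongrightarrow> G x) (at 0)"
        by (simp add: has_field_derivative_iff)
      from filterlim_compose[OF this h0] show "(\<lambda>n. D n x) \<longlonglongrightarrow> G x" by (simp add: D_def)
    qed
    show "AE x in S3_vol. norm (D n x) \<le> B" for n
    proof (rule AE_I2)
      fix x assume "x \<in> space S3_vol"
      then have x: "x \<in> S3" by simp
      have "\<exists>z>0. z < h n \<and> F (qmul x (qexp a (h n))) - F (qmul x (qexp a 0)) = (h n - 0) * G (qmul x (qexp a z))"
        by (rule MVT2[OF h]) (rule has_Lie_along_orbit[OF a F(1) x])
      then obtain z where "F (qmul x (qexp a (h n))) - F x = h n * G (qmul x (qexp a z))" by auto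
      then have "D n x = G (qmul x (qexp a z))" using h[of n] by (simp add: D_def)
      then show "norm (D n x) \<le> B" using B[OF qmul_S3[OF x e]] by simp
    qed
  qed
  ultimately show ?thesis using LIMSEQ_unique[OF _ tendsto_const] by simp
qed

lemma integral_Lie_by_parts:
  assumes a: "imaginary_unit a" and F: "has_Lie a F F'" "continuous_on S3 F"
    and G: "has_Lie a G G'" "continuous_on S3 G"
  shows "(LINT x|S3_vol. F' x * G x) = - (LINT x|S3_vol. F x * G' x)"
proof -
  have c: "continuous_on S3 F'" "continuous_on S3 G'" using F G by (auto simp: has_Lie_def)
  have "(LINT x|S3_vol. F' x * G x + F x * G' x) = 0"
    by (rule integral_Lie_eq_0[OF a has_Lie_mult]) (use F G in \<open>auto intro!: continuous_intros\<close>)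
  then show ?thesis
    using F G c by (subst (asm) Bochner_Integration.integral_add)
      (auto intro!: integrable_continuous_S3 continuous_intros)
qed

subsection \<open>Zonal kernels with singularities at the pole and the antipode\<close>

lemma S3_inner_bound: "x \<in> S3 \<Longrightarrow> y \<in> S3 \<Longrightarrow> \<bar>x \<bullet> y\<bar> \<le> 1"
  using Cauchy_Schwarz_ineq2[of x y] by (simp add: S3_iff(2))

lemma bessel_two:
  fixes x w y :: "'a::real_inner"
  assumes "x \<bullet> x = 1" "w \<bullet> w = 1" "x \<bullet> w = 0"
  shows "(x \<bullet> y)\<^sup>2 + (w \<bullet> y)\<^sup>2 \<le> y \<bullet> y"
proof -
  let ?v = "y - (x \<bullet> y) *\<^sub>R x - (w \<bullet> y) *\<^sub>R w"
  have wx: "w \<bullet> x = 0" using assms(3) by (simp add: inner_commute)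
  have yx: "y \<bullet> x = x \<bullet> y" "y \<bullet> w = w \<bullet> y" by (rule inner_commute)+
  have "0 \<le> ?v \<bullet> ?v" by simp
  also have "?v \<bullet> ?v = y \<bullet> y - (x \<bullet> y)\<^sup>2 - (w \<bullet> y)\<^sup>2"
    by (simp add: inner_diff_left inner_diff_right assms wx yx power2_eq_square)
  finally show ?thesis by simp
qed

text \<open>
  The left-invariant derivative of \<open>x \<bullet> y\<close> vanishes to first order at the poles. This is what makes
  the derivative of a kernel, although more singular by one order, integrable.\<close>

lemma frame_bessel:
  assumes "x \<in> S3" "y \<in> S3" "imaginary_unit a"
  shows "(qmul x a \<bullet> y)\<^sup>2 \<le> 1 - (x \<bullet> y)\<^sup>2"
proof -
  have "x \<bullet> x = 1" "y \<bullet> y = 1" "qmul x a \<bullet> qmul x a = 1" "x \<bullet> qmul x a = 0"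
    using assms frame_tangent[of a x] by (simp_all add: S3_iff(1) imaginary_unit_def inner_qmul_same)
  then show ?thesis using bessel_two[of x "qmul x a" y] by simp
qed

lemma frame_parseval:
  assumes "x \<in> S3" "y \<in> S3"
  shows "(qmul x qi \<bullet> y)\<^sup>2 + (qmul x qj \<bullet> y)\<^sup>2 + (qmul x qk \<bullet> y)\<^sup>2 = 1 - (x \<bullet> y)\<^sup>2"
proof -
  have "y \<bullet> y = ((x \<bullet> x) *\<^sub>R y) \<bullet> y" using assms by (simp add: S3_iff(1))
  also have "\<dots> = (x \<bullet> y)\<^sup>2 + (qmul x qi \<bullet> y)\<^sup>2 + (qmul x qj \<bullet> y)\<^sup>2 + (qmul x qk \<bullet> y)\<^sup>2"
    unfolding frame_expansion by (simp add: inner_add_left inner_commute[of y] power2_eq_square)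
  finally show ?thesis using assms by (simp add: S3_iff(1))
qed

lemma has_Lie_inner: "has_Lie a (\<lambda>x. x \<bullet> y) (\<lambda>x. qmul x a \<bullet> y)"
  unfolding has_Lie_def
proof safe
  show "continuous_on S3 (\<lambda>x. qmul x a \<bullet> y)" by (intro continuous_intros)
  fix x
  show "((\<lambda>t. qmul x (qexp a t) \<bullet> y) has_real_derivative qmul x a \<bullet> y) (at 0)"
    by (rule curve_has_real_derivative) (auto intro!: bounded_linear_imp_has_derivative bounded_linear_inner_left)
qed

lemma has_Lie_frame_inner: "has_Lie b (\<lambda>x. qmul x a \<bullet> y) (\<lambda>x. qmul x (qmul b a) \<bullet> y)"
  using has_Lie_inner[of b "qmul y (qcnj a)"] by (simp add: inner_qmul_right[symmetric] qmul_assoc)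

lemma has_Lie_zonal:
  assumes k: "\<And>t. \<bar>t\<bar> < 1 \<Longrightarrow> (k has_real_derivative k' t) (at t)" and c: "continuous_on {-1<..<1} k'"
    and r: "0 < r" "r < 1" and y: "y \<in> S3"
  shows "has_Lie a (\<lambda>x. k (r * (x \<bullet> y))) (\<lambda>x. k' (r * (x \<bullet> y)) * (r * (qmul x a \<bullet> y)))"
    and "continuous_on S3 (\<lambda>x. k (r * (x \<bullet> y)))" "continuous_on S3 (\<lambda>x. k' (r * (x \<bullet> y)))"
proof -
  have s: "\<bar>r * (x \<bullet> y)\<bar> < 1" if "x \<in> S3" for x
  proof -
    have "\<bar>r * (x \<bullet> y)\<bar> \<le> r * 1" unfolding abs_mult using r S3_inner_bound[OF that y] by (intro mult_mono) auto
    then show ?thesis using r by simp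
  qed
  then have s': "r * (x \<bullet> y) \<in> {-1<..<1}" if "x \<in> S3" for x using that by (force simp: abs_less_iff)
  have "continuous_on {-1<..<1} k"
    by (intro continuous_at_imp_continuous_on ballI DERIV_isCont[OF k]) (auto simp: abs_less_iff)
  then show "continuous_on S3 (\<lambda>x. k (r * (x \<bullet> y)))"
    by (rule continuous_on_compose2) (auto intro!: continuous_intros s'[unfolded greaterThanLessThan_iff])
  show c': "continuous_on S3 (\<lambda>x. k' (r * (x \<bullet> y)))"
    by (rule continuous_on_compose2[OF c]) (auto intro!: continuous_intros s'[unfolded greaterThanLessThan_iff])
  show "has_Lie a (\<lambda>x. k (r * (x \<bullet> y))) (\<lambda>x. k' (r * (x \<bullet> y)) * (r * (qmul x a \<bullet> y)))"
    unfolding has_Lie_def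
  proof safe
    show "continuous_on S3 (\<lambda>x. k' (r * (x \<bullet> y)) * (r * (qmul x a \<bullet> y)))"
      by (intro continuous_intros c')
    fix x assume x: "x \<in> S3"
    have "((\<lambda>t. r * (qmul x (qexp a t) \<bullet> y)) has_real_derivative r * (qmul x a \<bullet> y)) (at 0)"
      using has_Lie_inner[of a y] x by (intro DERIV_cmult) (simp add: has_Lie_def)
    moreover have "(k has_real_derivative k' (r * (x \<bullet> y))) (at (r * (qmul x (qexp a 0) \<bullet> y)))"
      using k[OF s[OF x]] by simp
    ultimately show "((\<lambda>t. k (r * (qmul x (qexp a t) \<bullet> y))) has_real_derivative k' (r * (x \<bullet> y)) * (r * (qmul x a \<bullet> y))) (at 0)"
      by (rule DERIV_chain2[rotated])
  qed
qed

text \<open>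
  A sequence that tends to 1 from below. For \<open>r < 1\<close> the kernel \<open>k (r * (x \<bullet> y))\<close> is smooth on the
  whole sphere, and its bounds in terms of \<open>1 - (r * t)\<^sup>2 \<ge> 1 - t\<^sup>2\<close> are uniform in \<open>r\<close>.\<close>

definition radius :: "nat \<Rightarrow> real" where "radius n = 1 - 1 / (real n + 2)"

lemma radius: "0 < radius n" "radius n < 1" "radius \<longlonglongrightarrow> 1"
proof -
  show "0 < radius n" "radius n < 1" by (simp_all add: radius_def field_simps)
  show "radius \<longlonglongrightarrow> 1" unfolding radius_def by real_asymp
qed

lemma scaled_bounds:
  assumes "\<bar>t\<bar> < 1" "0 < r" "r < (1::real)"
  shows "\<bar>r * t\<bar> < 1" "0 < 1 - t\<^sup>2" "1 - t\<^sup>2 \<le> 1 - (r * t)\<^sup>2" "1 - r\<^sup>2 \<le> 1 - (r * t)\<^sup>2" "1 - t\<^sup>2 \<le> 1"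
proof -
  show 1: "\<bar>r * t\<bar> < 1" unfolding abs_mult using assms mult_strict_mono[of r 1 "\<bar>t\<bar>" 1] by auto
  show "0 < 1 - t\<^sup>2" using assms by (simp add: abs_square_less_1)
  have t: "t\<^sup>2 \<le> 1" "r\<^sup>2 \<le> 1" using assms by (simp_all add: abs_square_le_1)
  show "1 - t\<^sup>2 \<le> 1 - (r * t)\<^sup>2" using mult_right_mono[OF t(2), of "t\<^sup>2"] by (simp add: power_mult_distrib)
  show "1 - r\<^sup>2 \<le> 1 - (r * t)\<^sup>2" using mult_left_mono[OF t(1), of "r\<^sup>2"] by (simp add: power_mult_distrib)
qed simp

lemma tendsto_radius:
  assumes "continuous_on {-1<..<1} k" "\<bar>t\<bar> < (1::real)"
  shows "(\<lambda>n. k (radius n * t)) \<longlonglongrightarrow> (k t :: real)"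
proof -
  have "isCont k t" using assms continuous_on_eq_continuous_at[of "{-1<..<1}" k] by (auto simp: abs_less_iff)
  moreover have "(\<lambda>n. radius n * t) \<longlonglongrightarrow> 1 * t" by (intro tendsto_intros radius)
  ultimately show ?thesis using isCont_tendsto_compose by force
qed

lemma integral_zonal_limit:
  fixes \<Phi> :: "nat \<Rightarrow> real^4 \<Rightarrow> real"
  assumes y: "y \<in> S3" and \<Phi>: "\<And>n. continuous_on S3 (\<Phi> n)"
    and lim: "\<And>x. x \<in> S3 \<Longrightarrow> \<bar>x \<bullet> y\<bar> < 1 \<Longrightarrow> (\<lambda>n. \<Phi> n x) \<longlonglongrightarrow> \<phi> x"
    and bound: "\<And>n x. x \<in> S3 \<Longrightarrow> \<bar>x \<bullet> y\<bar> < 1 \<Longrightarrow> \<bar>\<Phi> n x\<bar> \<le> C * weight (x \<bullet> y)"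
    and meas: "\<phi> \<in> borel_measurable S3_vol"
  shows "integrable S3_vol \<phi>" "(\<lambda>n. LINT x|S3_vol. \<Phi> n x) \<longlonglongrightarrow> (LINT x|S3_vol. \<phi> x)"
proof -
  have m: "\<Phi> n \<in> borel_measurable S3_vol" for n using integrable_continuous_S3[OF \<Phi>] by simp
  have w: "integrable S3_vol (\<lambda>x. C * weight (x \<bullet> y))" using integrable_weight[OF y] by simp
  have ae: "AE x in S3_vol. x \<in> S3 \<and> \<bar>x \<bullet> y\<bar> < 1"
    using AE_S3_not_antipodal[OF y] AE_space by eventually_elim simp
  have l: "AE x in S3_vol. (\<lambda>n. \<Phi> n x) \<longlonglongrightarrow> \<phi> x" using ae by eventually_elim (simp add: lim)
  have b: "AE x in S3_vol. norm (\<Phi> n x) \<le> C * weight (x \<bullet> y)" for n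
    using ae by eventually_elim (simp add: bound)
  show "integrable S3_vol \<phi>" by (rule integrable_dominated_convergence[OF meas m w l b])
  show "(\<lambda>n. LINT x|S3_vol. \<Phi> n x) \<longlonglongrightarrow> (LINT x|S3_vol. \<phi> x)"
    by (rule integral_dominated_convergence[OF meas m w l b])
qed

lemma zonal_measurable:
  assumes "k \<in> borel_measurable borel"
  shows "(\<lambda>x. k (x \<bullet> y)) \<in> borel_measurable S3_vol"
  unfolding measurable_cong_sets[OF sets_S3_vol refl]
  by (intro measurable_restrict_space1 measurable_compose[OF _ assms] borel_measurable_inner) auto

lemma continuous_S3_bound:
  assumes "continuous_on S3 (F :: real^4 \<Rightarrow> real)"
  obtains M where "M > 0" "\<And>x. x \<in> S3 \<Longrightarrow> \<bar>F x\<bar> \<le> M"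
proof -
  have "bounded (F ` S3)" by (intro compact_imp_bounded compact_continuous_image assms compact_S3)
  then obtain B where "B > 0" "\<And>x. x \<in> S3 \<Longrightarrow> \<bar>F x\<bar> \<le> B" by (auto simp: bounded_pos)
  then show thesis using that by blast
qed

text \<open>
  Integration by parts for \<open>k (r * (x \<bullet> y))\<close>, followed by dominated convergence as \<open>r\<close> tends to 1. The
  derivative \<open>k'\<close> may be as large as the inverse cube of the distance to the poles, because it is
  multiplied by \<open>x a \<bullet> y\<close>.\<close>

lemma zonal_by_parts:
  assumes k: "\<And>t. \<bar>t\<bar> < 1 \<Longrightarrow> (k has_real_derivative k' t) (at t)" and c: "continuous_on {-1<..<1} k'"
    and meas: "k \<in> borel_measurable borel" "k' \<in> borel_measurable borel"
    and b0: "\<And>t. \<bar>t\<bar> < 1 \<Longrightarrow> \<bar>k t\<bar> \<le> C / (1 - t\<^sup>2)"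
    and b1: "\<And>t. \<bar>t\<bar> < 1 \<Longrightarrow> \<bar>k' t\<bar> \<le> C / ((1 - t\<^sup>2) * sqrt (1 - t\<^sup>2))"
    and y: "y \<in> S3" and a: "imaginary_unit a" and F: "has_Lie a F F'" "continuous_on S3 F"
  shows "integrable S3_vol (\<lambda>x. k (x \<bullet> y) * F x)"
    and "integrable S3_vol (\<lambda>x. k' (x \<bullet> y) * (qmul x a \<bullet> y) * F x)"
    and "(LINT x|S3_vol. k' (x \<bullet> y) * (qmul x a \<bullet> y) * F x) = - (LINT x|S3_vol. k (x \<bullet> y) * F' x)"
proof -
  have ck: "continuous_on {-1<..<1} k"
    by (intro continuous_at_imp_continuous_on ballI DERIV_isCont[OF k]) (auto simp: abs_less_iff)
  have C: "C \<ge> 0" using b0[of 0] by (simp add: order_trans[OF abs_ge_zero])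
  have F': "continuous_on S3 F'" using F by (simp add: has_Lie_def)
  have cont: "continuous_on S3 (\<lambda>x. k (radius n * (x \<bullet> y)))" "continuous_on S3 (\<lambda>x. k' (radius n * (x \<bullet> y)))" for n
    using has_Lie_zonal(2,3)[OF k c radius(1,2) y] by auto
  have mF: "G \<in> borel_measurable S3_vol" if "continuous_on S3 G" for G :: "real^4 \<Rightarrow> real"
    using integrable_continuous_S3[OF that] by simp
  have bound0: "\<bar>k (radius n * t)\<bar> \<le> C * weight t" if "\<bar>t\<bar> < 1" for n t
  proof -
    note s = scaled_bounds[OF that radius(1,2)[of n]]
    have "\<bar>k (radius n * t)\<bar> \<le> C / (1 - (radius n * t)\<^sup>2)" by (rule b0[OF s(1)])
    also have "\<dots> \<le> C / (1 - t\<^sup>2)" using s C by (intro divide_left_mono) auto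
    finally show ?thesis by (simp add: weight_def)
  qed
  have lim0: "integrable S3_vol (\<lambda>x. k (x \<bullet> y) * G x) \<and>
      (\<lambda>n. LINT x|S3_vol. k (radius n * (x \<bullet> y)) * G x) \<longlonglongrightarrow> (LINT x|S3_vol. k (x \<bullet> y) * G x)"
    if G: "continuous_on S3 G" for G
  proof -
    obtain M where M: "M > 0" "\<And>x. x \<in> S3 \<Longrightarrow> \<bar>G x\<bar> \<le> M" using continuous_S3_bound[OF G] by blast
    have meas0: "(\<lambda>x. k (x \<bullet> y) * G x) \<in> borel_measurable S3_vol"
      by (intro borel_measurable_times zonal_measurable meas mF G)
    have cont0: "continuous_on S3 (\<lambda>x. k (radius n * (x \<bullet> y)) * G x)" for n
      by (intro continuous_intros cont G)
    have conv: "(\<lambda>n. k (radius n * (x \<bullet> y)) * G x) \<longlonglongrightarrow> k (x \<bullet> y) * G x" if "\<bar>x \<bullet> y\<bar> < 1" for x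
      by (intro tendsto_intros tendsto_radius ck that)
    have bd: "\<bar>k (radius n * (x \<bullet> y)) * G x\<bar> \<le> C * M * weight (x \<bullet> y)" if x: "x \<in> S3" "\<bar>x \<bullet> y\<bar> < 1" for n x
    proof -
      have "\<bar>k (radius n * (x \<bullet> y))\<bar> * \<bar>G x\<bar> \<le> C * weight (x \<bullet> y) * M"
        using bound0[OF x(2)] M(2)[OF x(1)] order_trans[OF abs_ge_zero bound0[OF x(2), of n]] by (intro mult_mono) auto
      then show ?thesis by (simp add: abs_mult mult_ac)
    qed
    show ?thesis
      using integral_zonal_limit[OF y cont0 conv bd meas0] by blast
  qed
  then show "integrable S3_vol (\<lambda>x. k (x \<bullet> y) * F x)" using F by blast
  obtain M where M: "M > 0" "\<And>x. x \<in> S3 \<Longrightarrow> \<bar>F x\<bar> \<le> M" using continuous_S3_bound[OF F(2)] by blast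
  have bound1: "\<bar>k' (radius n * (x \<bullet> y)) * (radius n * (qmul x a \<bullet> y)) * F x\<bar> \<le> C * M * weight (x \<bullet> y)"
    if x: "x \<in> S3" "\<bar>x \<bullet> y\<bar> < 1" for n x
  proof -
    let ?t = "x \<bullet> y"
    let ?d = "1 - ?t\<^sup>2"
    note s = scaled_bounds[OF x(2) radius(1,2)[of n]]
    have "\<bar>k' (radius n * ?t)\<bar> \<le> C / ((1 - (radius n * ?t)\<^sup>2) * sqrt (1 - (radius n * ?t)\<^sup>2))" by (rule b1[OF s(1)])
    also have "\<dots> \<le> C / (?d * sqrt ?d)"
      using s C by (intro divide_left_mono mult_mono) (auto intro!: mult_pos_pos)
    finally have 1: "\<bar>k' (radius n * ?t)\<bar> \<le> C / (?d * sqrt ?d)" .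
    have "\<bar>qmul x a \<bullet> y\<bar> \<le> sqrt ?d"
      using frame_bessel[OF x(1) y a] real_sqrt_le_mono[of "(qmul x a \<bullet> y)\<^sup>2"] by simp
    then have "radius n * \<bar>qmul x a \<bullet> y\<bar> \<le> 1 * sqrt ?d"
      using radius(1,2)[of n] by (intro mult_mono) auto
    then have 2: "\<bar>radius n * (qmul x a \<bullet> y)\<bar> \<le> sqrt ?d" using radius(1)[of n] by (simp add: abs_mult)
    have "\<bar>k' (radius n * ?t)\<bar> * \<bar>radius n * (qmul x a \<bullet> y)\<bar> * \<bar>F x\<bar> \<le> C / (?d * sqrt ?d) * sqrt ?d * M"
      using 1 2 M(2)[OF x(1)] C s by (intro mult_mono) auto
    also have "\<dots> = C * M * weight ?t" using s(2) by (simp add: weight_def)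
    finally show ?thesis by (simp add: abs_mult)
  qed
  have lim1: "(\<lambda>n. k' (radius n * (x \<bullet> y)) * (radius n * (qmul x a \<bullet> y)) * F x)
      \<longlonglongrightarrow> k' (x \<bullet> y) * (1 * (qmul x a \<bullet> y)) * F x" if "\<bar>x \<bullet> y\<bar> < 1" for x
    by (intro tendsto_intros tendsto_radius c that radius)
  have meas1: "(\<lambda>x. k' (x \<bullet> y) * (qmul x a \<bullet> y) * F x) \<in> borel_measurable S3_vol"
    by (intro borel_measurable_times zonal_measurable meas mF F continuous_intros)
  note L = integral_zonal_limit[where C="C * M" and \<phi>="\<lambda>x. k' (x \<bullet> y) * (qmul x a \<bullet> y) * F x"
      and \<Phi>="\<lambda>n x. k' (radius n * (x \<bullet> y)) * (radius n * (qmul x a \<bullet> y)) * F x", OF y]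
  show "integrable S3_vol (\<lambda>x. k' (x \<bullet> y) * (qmul x a \<bullet> y) * F x)"
    by (rule L(1)) (use lim1 bound1 meas1 in \<open>auto intro!: continuous_intros cont F\<close>)
  have "(\<lambda>n. LINT x|S3_vol. k' (radius n * (x \<bullet> y)) * (radius n * (qmul x a \<bullet> y)) * F x)
     \<longlonglongrightarrow> (LINT x|S3_vol. k' (x \<bullet> y) * (qmul x a \<bullet> y) * F x)"
    by (rule L(2)) (use lim1 bound1 meas1 in \<open>auto intro!: continuous_intros cont F\<close>)
  moreover have "(LINT x|S3_vol. k' (radius n * (x \<bullet> y)) * (radius n * (qmul x a \<bullet> y)) * F x)
     = - (LINT x|S3_vol. k (radius n * (x \<bullet> y)) * F' x)" for n
    by (rule integral_Lie_by_parts[OF a has_Lie_zonal(1)[OF k c radius(1,2) y] cont(1) F])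
  ultimately have "(\<lambda>n. - (LINT x|S3_vol. k (radius n * (x \<bullet> y)) * F' x))
     \<longlonglongrightarrow> (LINT x|S3_vol. k' (x \<bullet> y) * (qmul x a \<bullet> y) * F x)" by simp
  moreover have "(\<lambda>n. - (LINT x|S3_vol. k (radius n * (x \<bullet> y)) * F' x))
     \<longlonglongrightarrow> - (LINT x|S3_vol. k (x \<bullet> y) * F' x)"
    using lim0[OF F'] by (intro tendsto_minus) blast
  ultimately show "(LINT x|S3_vol. k' (x \<bullet> y) * (qmul x a \<bullet> y) * F x) = - (LINT x|S3_vol. k (x \<bullet> y) * F' x)"
    by (rule LIMSEQ_unique)
qed

subsection \<open>The kernels of the linking integrals\<close>

text \<open>
  With \<open>t = cos \<alpha>\<close> this is \<open>(\<pi> - \<alpha>) / sin \<alpha>\<close>, that is, \<open>4 \<pi>\<^sup>2 \<phi>(\<alpha>)\<close>. All kernels are built from it,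
  and \<open>pk'\<close> and \<open>pk''\<close> are its derivatives, expressed by the differential equation
  \<open>(1 - t\<^sup>2) p' = 1 + t p\<close>. At \<open>t = 1\<close> and \<open>t = - 1\<close> the values of \<open>pk\<close> and \<open>pk'\<close> are 0, as are the
  gradients of the potentials at these points.\<close>

definition pk :: "real \<Rightarrow> real" where
  "pk t = (if \<bar>t\<bar> < 1 then (pi - arccos t) / sqrt (1 - t\<^sup>2) else 0)"

definition pk' :: "real \<Rightarrow> real" where "pk' t = (1 + t * pk t) / (1 - t\<^sup>2)"

definition pk'' :: "real \<Rightarrow> real" where "pk'' t = (pk t + 3 * t * pk' t) / (1 - t\<^sup>2)"

lemma one_minus_square_pos: "\<bar>t\<bar> < 1 \<Longrightarrow> 0 < 1 - (t::real)\<^sup>2"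
  by (simp add: abs_square_less_1)

lemma pk_derivative:
  assumes t: "\<bar>t\<bar> < 1"
  shows "(pk has_real_derivative pk' t) (at t)"
proof -
  let ?S = "sqrt (1 - t\<^sup>2)"
  have d: "0 < 1 - t\<^sup>2" by (rule one_minus_square_pos[OF t])
  then have S: "?S > 0" "?S * ?S = 1 - t\<^sup>2" by simp_all
  have 1: "((\<lambda>t. pi - arccos t) has_real_derivative 1 / ?S) (at t)"
    using DERIV_diff[OF DERIV_const[of pi] DERIV_arccos[of t]] t S by (simp add: abs_less_iff inverse_eq_divide)
  have "((\<lambda>t. 1 - t\<^sup>2) has_real_derivative - 2 * t) (at t)" by (auto intro!: derivative_eq_intros)
  from DERIV_chain2[OF DERIV_real_sqrt[OF d] this]
  have 2: "((\<lambda>t. sqrt (1 - t\<^sup>2)) has_real_derivative - t / ?S) (at t)" by (simp add: field_simps)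
  have "((\<lambda>t. (pi - arccos t) / sqrt (1 - t\<^sup>2)) has_real_derivative
     (1 / ?S * ?S - (pi - arccos t) * (- t / ?S)) / (?S * ?S)) (at t)"
    by (rule DERIV_divide[OF 1 2]) (use S in auto)
  also have "(1 / ?S * ?S - (pi - arccos t) * (- t / ?S)) / (?S * ?S) = pk' t"
    using S t by (simp add: pk'_def pk_def mult.commute)
  finally show ?thesis
    by (rule has_field_derivative_transform_within_open[of _ _ _ "{-1<..<1}"])
      (use t in \<open>auto simp: pk_def abs_less_iff\<close>)
qed

lemma pk'_derivative:
  assumes t: "\<bar>t\<bar> < 1"
  shows "(pk' has_real_derivative pk'' t) (at t)"
proof -
  have d: "0 < 1 - t\<^sup>2" by (rule one_minus_square_pos[OF t])
  have 1: "((\<lambda>t. 1 + t * pk t) has_real_derivative pk t + t * pk' t) (at t)"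
    using pk_derivative[OF t] by (auto intro!: derivative_eq_intros)
  have 2: "((\<lambda>t. 1 - t\<^sup>2) has_real_derivative - 2 * t) (at t)" by (auto intro!: derivative_eq_intros)
  have "((\<lambda>t. (1 + t * pk t) / (1 - t\<^sup>2)) has_real_derivative
     ((pk t + t * pk' t) * (1 - t\<^sup>2) - (1 + t * pk t) * (- 2 * t)) / ((1 - t\<^sup>2) * (1 - t\<^sup>2))) (at t)"
    by (rule DERIV_divide[OF 1 2]) (use d in auto)
  also have "1 + t * pk t = pk' t * (1 - t\<^sup>2)" using d by (simp add: pk'_def)
  also have "((pk t + t * pk' t) * (1 - t\<^sup>2) - pk' t * (1 - t\<^sup>2) * (- 2 * t)) / ((1 - t\<^sup>2) * (1 - t\<^sup>2))
     = ((1 - t\<^sup>2) * (pk t + 3 * t * pk' t)) / ((1 - t\<^sup>2) * (1 - t\<^sup>2))" by (simp add: algebra_simps)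
  also have "\<dots> = pk'' t" unfolding pk''_def using d by (intro mult_divide_mult_cancel_left) simp
  finally show ?thesis by (simp add: pk'_def[abs_def])
qed

lemma continuous_on_pk: "continuous_on {-1<..<1} pk" "continuous_on {-1<..<1} pk'" "continuous_on {-1<..<1} pk''"
proof -
  show 1: "continuous_on {-1<..<1} pk"
    by (intro continuous_at_imp_continuous_on ballI DERIV_isCont[OF pk_derivative]) (auto simp: abs_less_iff)
  show 2: "continuous_on {-1<..<1} pk'"
    by (intro continuous_at_imp_continuous_on ballI DERIV_isCont[OF pk'_derivative]) (auto simp: abs_less_iff)
  have "1 - t\<^sup>2 \<noteq> 0" if "t \<in> {-1<..<1}" for t :: real
    using one_minus_square_pos[of t] that by (auto simp: abs_less_iff)
  then show "continuous_on {-1<..<1} pk''"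
    unfolding pk''_def by (intro continuous_intros 1 2) auto
qed

lemma pk_measurable [measurable]: "pk \<in> borel_measurable borel" "pk' \<in> borel_measurable borel" "pk'' \<in> borel_measurable borel"
proof -
  have "(\<lambda>t. indicator {-1<..<1} t *\<^sub>R pk t) \<in> borel_measurable borel"
    by (intro borel_measurable_continuous_on_indicator continuous_on_pk) auto
  also have "(\<lambda>t. indicator {-1<..<1} t *\<^sub>R pk t) = pk"
    by (auto simp: fun_eq_iff indicator_def pk_def abs_less_iff)
  finally show [measurable]: "pk \<in> borel_measurable borel" .
  show [measurable]: "pk' \<in> borel_measurable borel" unfolding pk'_def[abs_def] by measurable
  show "pk'' \<in> borel_measurable borel" unfolding pk''_def[abs_def] by measurable
qed

lemma sqrt_bounds:
  assumes "0 < d" "d \<le> (1::real)"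
  shows "0 < sqrt d" "sqrt d \<le> 1" "sqrt d * sqrt d = d" "d \<le> sqrt d" "d * sqrt d \<le> sqrt d" "d * sqrt d \<le> d"
    "d * d * sqrt d \<le> d * sqrt d" "d * d * sqrt d \<le> sqrt d"
proof -
  show s: "0 < sqrt d" "sqrt d \<le> 1" "sqrt d * sqrt d = d" using assms by auto
  show "d \<le> sqrt d" using mult_right_mono[OF s(2), of "sqrt d"] s by simp
  show 1: "d * sqrt d \<le> sqrt d" using mult_right_mono[OF assms(2), of "sqrt d"] s by simp
  show "d * sqrt d \<le> d" using mult_left_mono[OF s(2), of d] assms by simp
  show 2: "d * d * sqrt d \<le> d * sqrt d" using mult_left_mono[OF 1, of d] assms by (simp add: mult.assoc)
  show "d * d * sqrt d \<le> sqrt d" using 1 2 by linarith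
qed

lemma pk_bounds:
  assumes t: "\<bar>t\<bar> < 1"
  defines "d \<equiv> 1 - t\<^sup>2"
  shows "0 \<le> pk t" "\<bar>pk t\<bar> \<le> pi / sqrt d" "\<bar>pk' t\<bar> \<le> (1 + pi) / (d * sqrt d)"
    "\<bar>pk'' t\<bar> \<le> (3 + 4 * pi) / (d * d * sqrt d)" "\<bar>pk'' t\<bar> \<le> (\<bar>pk t\<bar> + 3 * \<bar>pk' t\<bar>) / d"
proof -
  have d: "0 < d" "d \<le> 1" using one_minus_square_pos[OF t] by (auto simp: d_def)
  note s = sqrt_bounds[OF d]
  have a: "0 \<le> arccos t" "arccos t \<le> pi" using t by (auto simp: abs_less_iff intro: arccos_lbound arccos_ubound)
  show 0: "0 \<le> pk t" using a d by (simp add: pk_def d_def[symmetric])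
  have "pk t \<le> pi / sqrt d" using a d t by (auto simp: pk_def d_def[symmetric] intro!: divide_right_mono)
  then show 1: "\<bar>pk t\<bar> \<le> pi / sqrt d" using 0 by simp
  have "\<bar>t * pk t\<bar> \<le> 1 * (pi / sqrt d)" unfolding abs_mult using 1 t by (intro mult_mono) auto
  moreover have "1 \<le> 1 / sqrt d" using s by simp
  ultimately have "\<bar>1 + t * pk t\<bar> \<le> 1 / sqrt d + pi / sqrt d" by linarith
  also have "\<dots> = (1 + pi) / sqrt d" by (simp add: add_divide_distrib)
  finally have "\<bar>1 + t * pk t\<bar> / d \<le> (1 + pi) / sqrt d / d" using d by (intro divide_right_mono) auto
  then show 2: "\<bar>pk' t\<bar> \<le> (1 + pi) / (d * sqrt d)" using d by (simp add: pk'_def d_def[symmetric] mult.commute)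
  have "\<bar>t * pk' t\<bar> \<le> 1 * \<bar>pk' t\<bar>" unfolding abs_mult using t by (intro mult_right_mono) auto
  then have 3: "\<bar>pk t + 3 * t * pk' t\<bar> \<le> \<bar>pk t\<bar> + 3 * \<bar>pk' t\<bar>" by linarith
  then show 5: "\<bar>pk'' t\<bar> \<le> (\<bar>pk t\<bar> + 3 * \<bar>pk' t\<bar>) / d"
    using d by (auto simp: pk''_def d_def[symmetric] intro!: divide_right_mono)
  have "pi / sqrt d \<le> pi / (d * sqrt d)" using s d by (intro divide_left_mono) auto
  then have "\<bar>pk t\<bar> + 3 * \<bar>pk' t\<bar> \<le> pi / (d * sqrt d) + 3 * ((1 + pi) / (d * sqrt d))" using 1 2 by linarith
  also have "\<dots> = (3 + 4 * pi) / (d * sqrt d)" by (simp add: add_divide_distrib[symmetric] distrib_left)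
  finally have "(\<bar>pk t\<bar> + 3 * \<bar>pk' t\<bar>) / d \<le> (3 + 4 * pi) / (d * sqrt d) / d" using d by (intro divide_right_mono) auto
  then show "\<bar>pk'' t\<bar> \<le> (3 + 4 * pi) / (d * d * sqrt d)" using 5 by (simp add: mult_ac)
qed

lemma sin_minus_x_cos_nonneg:
  fixes b :: real
  assumes "0 \<le> b" "b \<le> pi"
  shows "0 \<le> sin b - b * cos b"
proof -
  have "sin 0 - 0 * cos 0 \<le> sin b - b * cos b"
  proof (rule DERIV_nonneg_imp_nondecreasing[OF assms(1)])
    fix x :: real assume x: "0 \<le> x" "x \<le> b"
    have "((\<lambda>x. sin x - x * cos x) has_real_derivative x * sin x) (at x)"
      by (auto intro!: derivative_eq_intros)
    moreover have "0 \<le> x * sin x" using x assms by (intro mult_nonneg_nonneg sin_ge_zero) auto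
    ultimately show "\<exists>y. ((\<lambda>x. sin x - x * cos x) has_real_derivative y) (at x) \<and> 0 \<le> y" by blast
  qed
  then show ?thesis by simp
qed

text \<open>
  The quotient \<open>(\<pi> - \<alpha>) / sin \<alpha>\<close> is smooth at \<open>\<alpha> = \<pi>\<close>, so the kernels are singular only at \<open>t = 1\<close>.
  With \<open>b = \<pi> - \<alpha>\<close> the derivative is \<open>(sin b - b cos b) / sin\<^sup>3 b\<close>, which lies between 0 and 1 for
  \<open>b \<le> \<pi> / 2\<close>.\<close>

lemma pk'_bound_near_antipode:
  assumes "-1 < t" "t \<le> 0"
  shows "\<bar>pk' t\<bar> \<le> 1"
proof -
  define b where "b = pi - arccos t"
  have t: "\<bar>t\<bar> < 1" using assms by auto
  have a: "0 \<le> arccos t" "arccos t \<le> pi" using t by (auto simp: abs_less_iff intro: arccos_lbound arccos_ubound)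
  have cb: "cos b = - t" using t by (simp add: b_def abs_less_iff)
  have d: "0 < 1 - t\<^sup>2" by (rule one_minus_square_pos[OF t])
  have sb: "sin b = sqrt (1 - t\<^sup>2)" using t by (simp add: b_def sin_arccos abs_less_iff)
  then have s: "sin b > 0" using d by simp
  have sb2: "1 - t\<^sup>2 = (sin b)\<^sup>2" using sb d by simp
  have "pk' t = (sin b - b * cos b) / (sin b * (sin b)\<^sup>2)"
    using s t by (simp add: pk'_def pk_def b_def[symmetric] sb[symmetric] sb2 cb field_simps)
  moreover have "sin b - b * cos b \<le> sin b * (sin b)\<^sup>2"
  proof -
    have c: "0 \<le> cos b" "cos b \<le> 1" using assms cb by auto
    have "sin b \<le> b" using a by (intro sin_x_le_x) (auto simp: b_def)
    then have "sin b - b * cos b \<le> sin b - sin b * cos b" using c by (simp add: mult_right_mono)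
    also have "\<dots> = sin b * (1 - cos b)" by (simp add: algebra_simps)
    also have "\<dots> \<le> sin b * (1 - (cos b)\<^sup>2)"
      using c s power_decreasing[of 1 2 "cos b"] by (intro mult_left_mono) (auto simp: power2_eq_square mult_left_le)
    finally show ?thesis by (simp add: sin_squared_eq)
  qed
  moreover have "0 \<le> sin b - b * cos b" using a by (intro sin_minus_x_cos_nonneg) (auto simp: b_def)
  ultimately show ?thesis using s by (simp add: abs_of_nonneg)
qed

text \<open>
  On the sphere this is the Laplace-Beltrami operator, because the frame is orthonormal and its fields
  have geodesic orbits.\<close>

definition Lap :: "(real^4 \<Rightarrow> real) \<Rightarrow> real^4 \<Rightarrow> real" where
  "Lap F x = Lie qi (Lie qi F) x + Lie qj (Lie qj F) x + Lie qk (Lie qk F) x"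

lemma smooth_Lap: "smooth_away_0 F \<Longrightarrow> smooth_away_0 (Lap F)"
  unfolding Lap_def[abs_def] by (intro smooth_add smooth_Lie)

lemma Lap_const [simp]: "Lap (\<lambda>x. c) x = 0"
proof -
  have "Lie a (\<lambda>x. c) = (\<lambda>x. 0)" for a by (simp add: fun_eq_iff)
  then show ?thesis by (simp add: Lap_def)
qed

text \<open>
  With \<open>t = cos \<alpha>\<close>, \<open>gk t\<close> is \<open>(\<pi> - \<alpha>) cot \<alpha> = 4 \<pi>\<^sup>2 \<phi>\<^sub>0(\<alpha>)\<close> and \<open>hk t\<close> is
  \<open>(\<pi> - \<alpha>)\<^sup>2 = 16 \<pi>\<^sup>2 \<phi>\<^sub>1(\<alpha>) + \<pi>\<^sup>2\<close>.\<close>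

definition gk :: "real \<Rightarrow> real" where "gk t = t * pk t"
definition gk' :: "real \<Rightarrow> real" where "gk' t = pk t + t * pk' t"
definition gk'' :: "real \<Rightarrow> real" where "gk'' t = 2 * pk' t + t * pk'' t"
definition hk :: "real \<Rightarrow> real" where "hk t = (1 - t\<^sup>2) * (pk t)\<^sup>2"

lemma gk_derivative: "\<bar>t\<bar> < 1 \<Longrightarrow> (gk has_real_derivative gk' t) (at t)"
  unfolding gk_def[abs_def] gk'_def using pk_derivative by (auto intro!: derivative_eq_intros)

lemma gk'_derivative: "\<bar>t\<bar> < 1 \<Longrightarrow> (gk' has_real_derivative gk'' t) (at t)"
  unfolding gk'_def[abs_def] gk''_def using pk_derivative pk'_derivative by (auto intro!: derivative_eq_intros)

lemma hk_derivative: "\<bar>t\<bar> < 1 \<Longrightarrow> (hk has_real_derivative 2 * pk t) (at t)"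
proof -
  assume t: "\<bar>t\<bar> < 1"
  have "(hk has_real_derivative (1 - t\<^sup>2) * (2 * pk t * pk' t) + (- 2 * t) * (pk t)\<^sup>2) (at t)"
    unfolding hk_def[abs_def] using pk_derivative[OF t] by (auto intro!: derivative_eq_intros)
  also have "(1 - t\<^sup>2) * (2 * pk t * pk' t) + (- 2 * t) * (pk t)\<^sup>2 = 2 * pk t * ((1 - t\<^sup>2) * pk' t) - 2 * t * (pk t)\<^sup>2"
    by (simp add: algebra_simps)
  also have "(1 - t\<^sup>2) * pk' t = 1 + t * pk t" using one_minus_square_pos[OF t] by (simp add: pk'_def)
  also have "2 * pk t * (1 + t * pk t) - 2 * t * (pk t)\<^sup>2 = 2 * pk t" by (simp add: power2_eq_square algebra_simps)
  finally show ?thesis .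
qed

text \<open>
  The left-hand side is the Laplacian on the sphere of \<open>gk (x \<bullet> y)\<close>, as a function of \<open>t = x \<bullet> y\<close>. So
  \<open>gk\<close> is a Green's function: its Laplacian is constant away from the pole \<open>x = y\<close>.\<close>

lemma gk_ode: "\<bar>t\<bar> < 1 \<Longrightarrow> (1 - t\<^sup>2) * gk'' t - 3 * t * gk' t = 2"
proof -
  assume t: "\<bar>t\<bar> < 1"
  have 1: "(1 - t\<^sup>2) * pk' t = 1 + t * pk t" using one_minus_square_pos[OF t] by (simp add: pk'_def)
  have 2: "(1 - t\<^sup>2) * pk'' t = pk t + 3 * t * pk' t" using one_minus_square_pos[OF t] by (simp add: pk''_def)
  have "(1 - t\<^sup>2) * gk'' t - 3 * t * gk' t = 2 * ((1 - t\<^sup>2) * pk' t) + t * ((1 - t\<^sup>2) * pk'' t) - 3 * t * (pk t + t * pk' t)"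
    by (simp add: gk''_def gk'_def algebra_simps)
  also have "\<dots> = 2" unfolding 1 2 by (simp add: algebra_simps)
  finally show ?thesis .
qed

lemma gk_continuous: "continuous_on {-1<..<1} gk" "continuous_on {-1<..<1} gk'" "continuous_on {-1<..<1} gk''"
  unfolding gk_def[abs_def] gk'_def[abs_def] gk''_def[abs_def] by (intro continuous_intros continuous_on_pk)+

lemma gk_measurable [measurable]: "gk \<in> borel_measurable borel" "gk' \<in> borel_measurable borel" "gk'' \<in> borel_measurable borel"
    "hk \<in> borel_measurable borel"
  unfolding gk_def[abs_def] gk'_def[abs_def] gk''_def[abs_def] hk_def[abs_def] by measurable

text \<open>
  Only the powers of \<open>d\<close> matter: a kernel, its first and its second derivative are bounded by the
  powers -1, -3/2 and -5/2 of \<open>d\<close>. The constants are rounded up.\<close>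

lemma kernel_bounds:
  assumes t: "\<bar>t\<bar> < 1"
  defines "d \<equiv> 1 - t\<^sup>2"
  shows "\<bar>pk t\<bar> \<le> 20 / d" "\<bar>pk t\<bar> \<le> 20 / (d * sqrt d)" "\<bar>pk' t\<bar> \<le> 20 / (d * sqrt d)"
    "\<bar>gk t\<bar> \<le> 20 / d" "\<bar>gk' t\<bar> \<le> 20 / (d * sqrt d)" "\<bar>gk'' t\<bar> \<le> 40 / (d * d * sqrt d)" "\<bar>hk t\<bar> \<le> 20 / d"
proof -
  have d: "0 < d" "d \<le> 1" using one_minus_square_pos[OF t] by (auto simp: d_def)
  note s = sqrt_bounds[OF d]
  note b = pk_bounds[OF t, folded d_def]
  have pi4: "pi < 4" by (rule pi_less_4)
  have "pi / sqrt d \<le> 4 / sqrt d" using pi4 s by (intro divide_right_mono) auto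
  then have p: "\<bar>pk t\<bar> \<le> 4 / sqrt d" using b(2) by linarith
  have m1: "4 / sqrt d \<le> 4 / d" "4 / sqrt d \<le> 4 / (d * sqrt d)" using s d by (auto intro!: divide_left_mono)
  have up: "4 / d \<le> 20 / d" "4 / (d * sqrt d) \<le> 20 / (d * sqrt d)" using s d by (auto intro!: divide_right_mono)
  show "\<bar>pk t\<bar> \<le> 20 / d" "\<bar>pk t\<bar> \<le> 20 / (d * sqrt d)" using p m1 up by linarith+
  have "(1 + pi) / (d * sqrt d) \<le> 5 / (d * sqrt d)" using pi4 s d by (intro divide_right_mono) auto
  then have p': "\<bar>pk' t\<bar> \<le> 5 / (d * sqrt d)" using b(3) by linarith
  moreover have "5 / (d * sqrt d) \<le> 20 / (d * sqrt d)" using s d by (intro divide_right_mono) auto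
  ultimately show "\<bar>pk' t\<bar> \<le> 20 / (d * sqrt d)" by linarith
  have tm: "\<bar>t * r\<bar> \<le> \<bar>r\<bar>" for r unfolding abs_mult using t by (intro mult_left_le_one_le) auto
  show "\<bar>gk t\<bar> \<le> 20 / d" using tm[of "pk t"] p m1 up unfolding gk_def by linarith
  have "\<bar>gk' t\<bar> \<le> 4 / (d * sqrt d) + 5 / (d * sqrt d)"
    unfolding gk'_def
    by (rule order_trans[OF abs_triangle_ineq add_mono[OF order_trans[OF p m1(2)] order_trans[OF tm p']]])
  also have "\<dots> = 9 / (d * sqrt d)" by (simp add: add_divide_distrib[symmetric])
  also have "\<dots> \<le> 20 / (d * sqrt d)" using s d by (intro divide_right_mono) auto
  finally show "\<bar>gk' t\<bar> \<le> 20 / (d * sqrt d)" .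
  have "(3 + 4 * pi) / (d * d * sqrt d) \<le> 19 / (d * d * sqrt d)" using pi4 s d by (intro divide_right_mono) auto
  then have p'': "\<bar>pk'' t\<bar> \<le> 19 / (d * d * sqrt d)" using b(4) by linarith
  have "5 / (d * sqrt d) \<le> 5 / (d * d * sqrt d)" using s d by (intro divide_left_mono) auto
  then have *: "5 / (d * sqrt d) \<le> 5 / (d * d * sqrt d)" .
  have "\<bar>gk'' t\<bar> \<le> 2 * (5 / (d * d * sqrt d)) + 19 / (d * d * sqrt d)"
    unfolding gk''_def
  proof (rule order_trans[OF abs_triangle_ineq add_mono])
    show "\<bar>2 * pk' t\<bar> \<le> 2 * (5 / (d * d * sqrt d))"
      unfolding abs_mult using order_trans[OF p' *] by simp
    show "\<bar>t * pk'' t\<bar> \<le> 19 / (d * d * sqrt d)" by (rule order_trans[OF tm p''])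
  qed
  also have "\<dots> = 29 / (d * d * sqrt d)" by (simp add: add_divide_distrib[symmetric])
  also have "\<dots> \<le> 40 / (d * d * sqrt d)" using s d by (intro divide_right_mono) auto
  finally show "\<bar>gk'' t\<bar> \<le> 40 / (d * d * sqrt d)" .
  have "(pk t)\<^sup>2 \<le> (4 / sqrt d)\<^sup>2" using p b(1) by (intro power_mono) auto
  then have "(pk t)\<^sup>2 \<le> 16 / d" using d by (simp add: power_divide)
  then have "hk t \<le> d * (16 / d)" unfolding hk_def d_def[symmetric] using d by (intro mult_left_mono) auto
  then have "hk t \<le> 16" using d by simp
  also have "\<dots> \<le> 20 / d" using d by (simp add: pos_le_divide_eq)
  finally show "\<bar>hk t\<bar> \<le> 20 / d" using d by (simp add: hk_def d_def[symmetric])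
qed

lemma gk_by_parts:
  assumes y: "y \<in> S3" and a: "imaginary_unit a" and F: "smooth_away_0 F"
  shows "integrable S3_vol (\<lambda>x. gk (x \<bullet> y) * F x)"
    and "integrable S3_vol (\<lambda>x. gk' (x \<bullet> y) * (qmul x a \<bullet> y) * F x)"
    and "(LINT x|S3_vol. gk' (x \<bullet> y) * (qmul x a \<bullet> y) * F x) = - (LINT x|S3_vol. gk (x \<bullet> y) * Lie a F x)"
  using zonal_by_parts[OF gk_derivative gk_continuous(2) gk_measurable(1,2) kernel_bounds(4,5) y a has_Lie_Lie[OF F]
      smooth_continuous_on_S3[OF F]] by auto

text \<open>
  The factor in front of \<open>F\<close> is \<open>L_b\<close> applied to \<open>pk (x \<bullet> y) * (x a \<bullet> y)\<close>, and this product is half of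
  \<open>L_a\<close> applied to \<open>hk (x \<bullet> y)\<close>: half the Hessian of \<open>hk\<close> in the frame.\<close>

lemma hk_by_parts:
  assumes y: "y \<in> S3" and a: "imaginary_unit a" "imaginary_unit b" and F: "smooth_away_0 F"
  shows "integrable S3_vol (\<lambda>x. hk (x \<bullet> y) * F x)"
    and "integrable S3_vol (\<lambda>x. (pk' (x \<bullet> y) * (qmul x b \<bullet> y) * (qmul x a \<bullet> y) + pk (x \<bullet> y) * (qmul x (qmul b a) \<bullet> y)) * F x)"
    and "(LINT x|S3_vol. (pk' (x \<bullet> y) * (qmul x b \<bullet> y) * (qmul x a \<bullet> y) + pk (x \<bullet> y) * (qmul x (qmul b a) \<bullet> y)) * F x)
      = (LINT x|S3_vol. hk (x \<bullet> y) * Lie a (Lie b F) x) / 2"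
proof -
  have h1: "\<bar>2 * pk t\<bar> \<le> 40 / ((1 - t\<^sup>2) * sqrt (1 - t\<^sup>2))" and h0: "\<bar>hk t\<bar> \<le> 40 / (1 - t\<^sup>2)" if "\<bar>t\<bar> < 1" for t
  proof -
    have d: "0 < 1 - t\<^sup>2" by (rule one_minus_square_pos[OF that])
    show "\<bar>2 * pk t\<bar> \<le> 40 / ((1 - t\<^sup>2) * sqrt (1 - t\<^sup>2))"
      using kernel_bounds(2)[OF that] by (simp add: abs_mult)
    have "20 / (1 - t\<^sup>2) \<le> 40 / (1 - t\<^sup>2)" using d by (intro divide_right_mono) auto
    then show "\<bar>hk t\<bar> \<le> 40 / (1 - t\<^sup>2)" using kernel_bounds(7)[OF that] by linarith
  qed
  have c2: "continuous_on {-1<..<1} (\<lambda>t. 2 * pk t)" by (intro continuous_intros continuous_on_pk)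
  have m2: "(\<lambda>t. 2 * pk t) \<in> borel_measurable borel" by measurable
  note H = zonal_by_parts[OF hk_derivative c2 gk_measurable(4) m2 h0 h1 y a(1)]
  show "integrable S3_vol (\<lambda>x. hk (x \<bullet> y) * F x)"
    using H(1)[OF _ _ _ has_Lie_Lie[OF F] smooth_continuous_on_S3[OF F]] by blast
  have LbF: "smooth_away_0 (Lie b F)" by (rule smooth_Lie[OF F])
  have H3: "(LINT x|S3_vol. 2 * pk (x \<bullet> y) * (qmul x a \<bullet> y) * Lie b F x) = - (LINT x|S3_vol. hk (x \<bullet> y) * Lie a (Lie b F) x)"
    using H(3)[OF _ _ _ has_Lie_Lie[OF LbF] smooth_continuous_on_S3[OF LbF]] by blast
  have wF: "has_Lie b (\<lambda>x. (qmul x a \<bullet> y) * F x) (\<lambda>x. (qmul x (qmul b a) \<bullet> y) * F x + (qmul x a \<bullet> y) * Lie b F x)"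
    by (rule has_Lie_mult[OF has_Lie_frame_inner has_Lie_Lie[OF F] _ smooth_continuous_on_S3[OF F]])
      (intro continuous_intros)
  have wFc: "continuous_on S3 (\<lambda>x. (qmul x a \<bullet> y) * F x)"
    by (intro continuous_intros smooth_continuous_on_S3 F)
  note P = zonal_by_parts[OF pk_derivative continuous_on_pk(2) pk_measurable(1,2) kernel_bounds(1,3) y a(2)]
  have P2: "integrable S3_vol (\<lambda>x. pk' (x \<bullet> y) * (qmul x b \<bullet> y) * ((qmul x a \<bullet> y) * F x))"
    "(LINT x|S3_vol. pk' (x \<bullet> y) * (qmul x b \<bullet> y) * ((qmul x a \<bullet> y) * F x))
     = - (LINT x|S3_vol. pk (x \<bullet> y) * ((qmul x (qmul b a) \<bullet> y) * F x + (qmul x a \<bullet> y) * Lie b F x))"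
    using P(2,3)[OF _ _ _ wF wFc] by blast+
  have iP: "integrable S3_vol (\<lambda>x. pk (x \<bullet> y) * ((qmul x c \<bullet> y) * G x))" if "smooth_away_0 G" for c G
  proof -
    have "smooth_away_0 (\<lambda>x. (qmul x c \<bullet> y) * G x)"
      by (intro smooth_mult smooth_inner smooth_frame smooth_const that)
    then show ?thesis using P(1)[OF _ _ _ has_Lie_Lie smooth_continuous_on_S3] by blast
  qed
  note i1 = iP[OF F, of "qmul b a"] and i2 = iP[OF LbF, of a]
  show "integrable S3_vol (\<lambda>x. (pk' (x \<bullet> y) * (qmul x b \<bullet> y) * (qmul x a \<bullet> y) + pk (x \<bullet> y) * (qmul x (qmul b a) \<bullet> y)) * F x)"
    using Bochner_Integration.integrable_add[OF P2(1) i1] by (simp add: algebra_simps)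
  have "(LINT x|S3_vol. (pk' (x \<bullet> y) * (qmul x b \<bullet> y) * (qmul x a \<bullet> y) + pk (x \<bullet> y) * (qmul x (qmul b a) \<bullet> y)) * F x)
     = (LINT x|S3_vol. pk' (x \<bullet> y) * (qmul x b \<bullet> y) * ((qmul x a \<bullet> y) * F x))
      + (LINT x|S3_vol. pk (x \<bullet> y) * ((qmul x (qmul b a) \<bullet> y) * F x))"
    using Bochner_Integration.integral_add[OF P2(1) i1] by (simp add: algebra_simps)
  also have "\<dots> = - (LINT x|S3_vol. pk (x \<bullet> y) * ((qmul x a \<bullet> y) * Lie b F x))"
    unfolding P2(2) using Bochner_Integration.integral_add[OF i1 i2] by (simp add: algebra_simps)
  also have "\<dots> = - (LINT x|S3_vol. 2 * pk (x \<bullet> y) * (qmul x a \<bullet> y) * Lie b F x) / 2"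
    by (simp add: mult.assoc)
  also have "\<dots> = (LINT x|S3_vol. hk (x \<bullet> y) * Lie a (Lie b F) x) / 2" unfolding H3 by simp
  finally show "(LINT x|S3_vol. (pk' (x \<bullet> y) * (qmul x b \<bullet> y) * (qmul x a \<bullet> y) + pk (x \<bullet> y) * (qmul x (qmul b a) \<bullet> y)) * F x)
      = (LINT x|S3_vol. hk (x \<bullet> y) * Lie a (Lie b F) x) / 2" .
qed

text \<open>
  The weak form of \<open>\<Delta> hk = 2 - 4 gk\<close>. It is the trace of the previous lemma: the first terms add up by
  Parseval's identity, the second ones because \<open>a a = - 1\<close> for each unit \<open>a\<close>.\<close>

lemma hk_Laplacian:
  assumes y: "y \<in> S3" and F: "smooth_away_0 F"
  shows "(LINT x|S3_vol. hk (x \<bullet> y) * Lap F x) = 2 * (LINT x|S3_vol. F x) - 4 * (LINT x|S3_vol. gk (x \<bullet> y) * F x)"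
proof -
  let ?G = "\<lambda>a x. (pk' (x \<bullet> y) * (qmul x a \<bullet> y) * (qmul x a \<bullet> y) + pk (x \<bullet> y) * (qmul x (qmul a a) \<bullet> y)) * F x"
  have LF: "smooth_away_0 (Lie a (Lie a F))" for a by (intro smooth_Lie F)
  note u = imaginary_units
  note i = hk_by_parts(1)[OF y u(1) u(1) LF]
  have "(LINT x|S3_vol. hk (x \<bullet> y) * Lap F x) = (LINT x|S3_vol. hk (x \<bullet> y) * Lie qi (Lie qi F) x)
     + (LINT x|S3_vol. hk (x \<bullet> y) * Lie qj (Lie qj F) x) + (LINT x|S3_vol. hk (x \<bullet> y) * Lie qk (Lie qk F) x)"
    using i by (simp add: Lap_def distrib_left)
  also have "\<dots> = 2 * ((LINT x|S3_vol. ?G qi x) + (LINT x|S3_vol. ?G qj x) + (LINT x|S3_vol. ?G qk x))"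
    using hk_by_parts(3)[OF y u(1) u(1) F] hk_by_parts(3)[OF y u(2) u(2) F] hk_by_parts(3)[OF y u(3) u(3) F] by simp
  also have "\<dots> = 2 * (LINT x|S3_vol. ?G qi x + ?G qj x + ?G qk x)"
    using hk_by_parts(2)[OF y u(1) u(1) F] hk_by_parts(2)[OF y u(2) u(2) F] hk_by_parts(2)[OF y u(3) u(3) F] by simp
  also have "(LINT x|S3_vol. ?G qi x + ?G qj x + ?G qk x) = (LINT x|S3_vol. F x - 2 * (gk (x \<bullet> y) * F x))"
  proof (rule integral_cong_AE)
    show "(\<lambda>x. ?G qi x + ?G qj x + ?G qk x) \<in> borel_measurable S3_vol"
      using hk_by_parts(2)[OF y u(1) u(1) F] hk_by_parts(2)[OF y u(2) u(2) F] hk_by_parts(2)[OF y u(3) u(3) F] by auto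
    show "(\<lambda>x. F x - 2 * (gk (x \<bullet> y) * F x)) \<in> borel_measurable S3_vol"
      using gk_by_parts(1)[OF y u(1) F] integrable_continuous_S3[OF smooth_continuous_on_S3[OF F]] by auto
    have "AE x in S3_vol. x \<in> S3 \<and> \<bar>x \<bullet> y\<bar> < 1"
      using AE_S3_not_antipodal[OF y] AE_space by eventually_elim simp
    then show "AE x in S3_vol. ?G qi x + ?G qj x + ?G qk x = F x - 2 * (gk (x \<bullet> y) * F x)"
    proof eventually_elim
      case (elim x)
      let ?t = "x \<bullet> y"
      have neg: "qmul x (- qone) \<bullet> y = - ?t"
        by (simp add: bounded_bilinear.minus_right[OF bounded_bilinear_qmul])
      have "pk' ?t * (qmul x qi \<bullet> y) * (qmul x qi \<bullet> y) + pk ?t * (qmul x (qmul qi qi) \<bullet> y)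
          + (pk' ?t * (qmul x qj \<bullet> y) * (qmul x qj \<bullet> y) + pk ?t * (qmul x (qmul qj qj) \<bullet> y))
          + (pk' ?t * (qmul x qk \<bullet> y) * (qmul x qk \<bullet> y) + pk ?t * (qmul x (qmul qk qk) \<bullet> y))
        = pk' ?t * ((qmul x qi \<bullet> y)\<^sup>2 + (qmul x qj \<bullet> y)\<^sup>2 + (qmul x qk \<bullet> y)\<^sup>2) - 3 * ?t * pk ?t"
        by (simp add: quaternion_products neg power2_eq_square algebra_simps)
      also have "\<dots> = pk' ?t * (1 - ?t\<^sup>2) - 3 * ?t * pk ?t"
        using frame_parseval[of x y] elim y by simp
      also have "pk' ?t * (1 - ?t\<^sup>2) = 1 + ?t * pk ?t"
        using one_minus_square_pos[of ?t] elim by (simp add: pk'_def)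
      finally have "pk' ?t * (qmul x qi \<bullet> y) * (qmul x qi \<bullet> y) + pk ?t * (qmul x (qmul qi qi) \<bullet> y)
          + (pk' ?t * (qmul x qj \<bullet> y) * (qmul x qj \<bullet> y) + pk ?t * (qmul x (qmul qj qj) \<bullet> y))
          + (pk' ?t * (qmul x qk \<bullet> y) * (qmul x qk \<bullet> y) + pk ?t * (qmul x (qmul qk qk) \<bullet> y)) = 1 - 2 * gk ?t"
        by (simp add: gk_def)
      from arg_cong[OF this, of "\<lambda>r. r * F x"] show ?case by (simp add: algebra_simps)
    qed
  qed
  also have "\<dots> = (LINT x|S3_vol. F x) - 2 * (LINT x|S3_vol. gk (x \<bullet> y) * F x)"
    using gk_by_parts(1)[OF y u(1) F] integrable_continuous_S3[OF smooth_continuous_on_S3[OF F]] by simp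
  finally show ?thesis by simp
qed

text \<open>
  On the sphere \<open>1 - x \<bullet> y\<close> is half the squared distance of \<open>x\<close> and \<open>y\<close>.\<close>

lemma smooth_Lipschitz_at:
  assumes F: "smooth_away_0 F" and y: "y \<in> S3"
  obtains M where "M > 0" "\<And>x. x \<in> S3 \<Longrightarrow> \<bar>F x - F y :: real\<bar> \<le> M * sqrt (1 - x \<bullet> y)"
proof -
  have "(F has_derivative frechet_derivative F (at y)) (at y)"
    by (rule smooth_has_derivative[OF F]) (use y S3_nonzero in blast)
  then have bl: "bounded_linear (frechet_derivative F (at y))"
    and "\<exists>d>0. \<forall>x. norm (x - y) < d \<longrightarrow> norm (F x - F y - frechet_derivative F (at y) (x - y)) \<le> 1 * norm (x - y)"
    unfolding has_derivative_at_alt using zero_less_one by blast+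
  then obtain d where d: "d > 0" "\<And>x. norm (x - y) < d \<Longrightarrow>
      norm (F x - F y - frechet_derivative F (at y) (x - y)) \<le> norm (x - y)" by auto
  obtain B where B: "B > 0" "\<And>h. norm (frechet_derivative F (at y) h) \<le> norm h * B"
    using bounded_linear.pos_bounded[OF bl] by blast
  obtain K where K: "K > 0" "\<And>x. x \<in> S3 \<Longrightarrow> \<bar>F x\<bar> \<le> K"
    using continuous_S3_bound[OF smooth_continuous_on_S3[OF F]] by blast
  define M where "M = max (1 + B) (2 * K / d)"
  have Mpos: "M > 0" using B by (simp add: M_def)
  have "\<bar>F x - F y\<bar> \<le> M * norm (x - y)" if x: "x \<in> S3" for x
  proof (cases "norm (x - y) < d")
    case True
    have "\<bar>F x - F y\<bar> \<le> norm (x - y) + norm (x - y) * B"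
      using d(2)[OF True] B(2)[of "x - y"] by (simp add: abs_le_iff)
    also have "\<dots> = (1 + B) * norm (x - y)" by (simp add: algebra_simps)
    also have "\<dots> \<le> M * norm (x - y)" by (intro mult_right_mono) (auto simp: M_def)
    finally show ?thesis .
  next
    case False
    have "\<bar>F x - F y\<bar> \<le> 2 * K" using K(2)[OF x] K(2)[OF y] by linarith
    also have "\<dots> = 2 * K / d * d" using d by simp
    also have "\<dots> \<le> M * norm (x - y)"
    proof (rule mult_mono)
      show "2 * K / d \<le> M" by (simp add: M_def)
    qed (use False d Mpos in auto)
    finally show ?thesis .
  qed
  moreover have "norm (x - y) = sqrt 2 * sqrt (1 - x \<bullet> y)" if "x \<in> S3" for x
    using that y by (simp add: norm_eq_sqrt_inner inner_diff_left inner_diff_right inner_commute S3_iff(1) real_sqrt_mult[symmetric])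
  ultimately have "\<bar>F x - F y\<bar> \<le> (M * sqrt 2) * sqrt (1 - x \<bullet> y)" if "x \<in> S3" for x
    using that by (simp add: mult.assoc)
  then show thesis using Mpos that[of "M * sqrt 2"] by simp
qed

text \<open>
  The Laplacian of \<open>gk (r * t)\<close> misses the value 2 of the limit by \<open>(1 - r\<^sup>2) * gk'' (r * t)\<close>, which
  concentrates at \<open>t = 1\<close> as \<open>r\<close> tends to 1. Against a function \<open>u\<close> that vanishes at the pole it is
  dominated uniformly in \<open>r\<close>. For \<open>t \<ge> 0\<close>, the factor \<open>1 - r\<^sup>2 \<le> 1 - (r * t)\<^sup>2\<close> and
  \<open>u = O(sqrt (1 - t))\<close> together lower the exponent from 5/2 to 1. For \<open>t < 0\<close> there is no such decay
  of \<open>u\<close>, but \<open>pk'\<close> is bounded there.\<close>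

lemma regularised_defect_bound:
  assumes t: "\<bar>t\<bar> < 1" and r: "0 < r" "r < 1" and M: "0 < M" and u: "\<bar>u\<bar> \<le> M * sqrt (1 - t)"
  shows "\<bar>(1 - r\<^sup>2) * gk'' (r * t) * u\<bar> \<le> 80 * M * weight t"
proof -
  note s = scaled_bounds[OF t r]
  define e where "e = 1 - (r * t)\<^sup>2"
  define d where "d = 1 - t\<^sup>2"
  have de: "0 < d" "d \<le> e" "1 - r\<^sup>2 \<le> e" "d \<le> 1" "0 < e" "e \<le> 1" using s by (auto simp: e_def d_def)
  have r2: "0 \<le> 1 - r\<^sup>2" using r by (simp add: abs_square_le_1)
  note qd = sqrt_bounds[OF de(1,4)] and qe = sqrt_bounds[OF de(5,6)]
  show ?thesis
  proof (cases "t \<ge> 0")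
    case True
    have "(1 - r\<^sup>2) * \<bar>gk'' (r * t)\<bar> \<le> e * (40 / (e * e * sqrt e))"
      using kernel_bounds(6)[OF s(1)] de r2 by (intro mult_mono) (auto simp: e_def)
    also have "\<dots> = 40 / (e * sqrt e)" using de by simp
    also have "\<dots> \<le> 40 / (d * sqrt d)" using de qd qe by (intro divide_left_mono mult_mono mult_pos_pos) auto
    finally have 1: "(1 - r\<^sup>2) * \<bar>gk'' (r * t)\<bar> \<le> 40 / (d * sqrt d)" .
    have "1 - t \<le> d" using True t mult_left_mono[of t 1 t] by (simp add: d_def power2_eq_square)
    then have "sqrt (1 - t) \<le> sqrt d" by simp
    then have 2: "\<bar>u\<bar> \<le> M * sqrt d" using u M mult_left_mono[of "sqrt (1 - t)" "sqrt d" M] by linarith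
    have "(1 - r\<^sup>2) * \<bar>gk'' (r * t)\<bar> * \<bar>u\<bar> \<le> 40 / (d * sqrt d) * (M * sqrt d)"
      using 1 2 qd de by (intro mult_mono) auto
    also have "\<dots> = 40 * M * weight t" using qd(1) de by (simp add: weight_def d_def[symmetric])
    also have "\<dots> \<le> 80 * M * weight t"
      using M de by (intro mult_right_mono) (auto simp: weight_def d_def[symmetric])
    finally show ?thesis using r2 by (simp add: abs_mult)
  next
    case False
    have "-1 < r * t" "r * t \<le> 0" using s(1) False r by (auto simp: abs_less_iff mult_nonneg_nonpos)
    then have p1: "\<bar>pk' (r * t)\<bar> \<le> 1" by (rule pk'_bound_near_antipode)
    have p0: "\<bar>pk (r * t)\<bar> \<le> 4 / sqrt e"
      using pk_bounds(2)[OF s(1)] pi_less_4 qe divide_right_mono[of pi 4 "sqrt e"] by (simp add: e_def)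
    have "\<bar>pk'' (r * t)\<bar> \<le> (\<bar>pk (r * t)\<bar> + 3 * \<bar>pk' (r * t)\<bar>) / e"
      using pk_bounds(5)[OF s(1)] by (simp add: e_def)
    also have "\<dots> \<le> (4 / sqrt e + 3) / e" using p0 p1 de by (intro divide_right_mono) auto
    finally have p2: "\<bar>pk'' (r * t)\<bar> \<le> (4 / sqrt e + 3) / e" .
    have "\<bar>r * t * pk'' (r * t)\<bar> \<le> \<bar>pk'' (r * t)\<bar>"
      unfolding abs_mult[of "r * t"] using s(1) by (intro mult_left_le_one_le) auto
    then have g: "\<bar>gk'' (r * t)\<bar> \<le> 2 + (4 / sqrt e + 3) / e"
      using p1 p2 unfolding gk''_def by linarith
    have "e * (2 + X / e) = 2 * e + X" for X using de by (simp add: distrib_left)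
    from this[of "4 / sqrt e + 3"] have "e * (2 + (4 / sqrt e + 3) / e) = 2 * e + 4 / sqrt e + 3" by simp
    moreover have "(1 - r\<^sup>2) * \<bar>gk'' (r * t)\<bar> \<le> e * (2 + (4 / sqrt e + 3) / e)"
      using g de r2 by (intro mult_mono) auto
    ultimately have "(1 - r\<^sup>2) * \<bar>gk'' (r * t)\<bar> \<le> 2 * e + 4 / sqrt e + 3" by simp
    also have "\<dots> \<le> 5 * (1 / sqrt e) + 4 / sqrt e"
    proof -
      have "1 \<le> 1 / sqrt e" using qe by simp
      then show ?thesis using de by linarith
    qed
    also have "\<dots> = 9 / sqrt e" by (simp add: add_divide_distrib[symmetric])
    also have "\<dots> \<le> 9 / d"
    proof -
      have "d \<le> sqrt e" using de qe by linarith
      then show ?thesis using de qe by (intro divide_left_mono) auto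
    qed
    finally have 1: "(1 - r\<^sup>2) * \<bar>gk'' (r * t)\<bar> \<le> 9 / d" .
    have "sqrt (1 - t) \<le> sqrt (2\<^sup>2)" using t by (intro real_sqrt_le_mono) (simp add: abs_less_iff)
    then have "M * sqrt (1 - t) \<le> M * 2" using M by (intro mult_left_mono) auto
    then have 2: "\<bar>u\<bar> \<le> M * 2" using u by linarith
    have "(1 - r\<^sup>2) * \<bar>gk'' (r * t)\<bar> * \<bar>u\<bar> \<le> 9 / d * (M * 2)"
      using 1 2 de by (intro mult_mono) auto
    also have "\<dots> = 18 * M * weight t" by (simp add: weight_def d_def[symmetric])
    also have "\<dots> \<le> 80 * M * weight t"
      using M de by (intro mult_right_mono) (auto simp: weight_def d_def[symmetric])
    finally show ?thesis using r2 by (simp add: abs_mult)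
  qed
qed

lemma regularised_Green:
  assumes y: "y \<in> S3" and F: "smooth_away_0 F" and r: "0 < r" "r < 1"
  shows "(LINT x|S3_vol. gk (r * (x \<bullet> y)) * Lap F x) = (LINT x|S3_vol. (2 - (1 - r\<^sup>2) * gk'' (r * (x \<bullet> y))) * F x)"
proof -
  have cF: "continuous_on S3 G" if "smooth_away_0 G" for G :: "real^4 \<Rightarrow> real" using smooth_continuous_on_S3[OF that] .
  note c0 = has_Lie_zonal(2)[OF gk_derivative gk_continuous(2) r y]
  note c1 = has_Lie_zonal(3)[OF gk_derivative gk_continuous(2) r y]
  note c2 = has_Lie_zonal(3)[OF gk'_derivative gk_continuous(3) r y]
  let ?g2 = "\<lambda>a x. (gk'' (r * (x \<bullet> y)) * (r * (qmul x a \<bullet> y))) * (r * (qmul x a \<bullet> y))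
      + gk' (r * (x \<bullet> y)) * (r * (qmul x (qmul a a) \<bullet> y))"
  have parts: "(LINT x|S3_vol. gk (r * (x \<bullet> y)) * Lie a (Lie a F) x) = (LINT x|S3_vol. ?g2 a x * F x)"
    and int: "integrable S3_vol (\<lambda>x. ?g2 a x * F x)" if a: "imaginary_unit a" for a
  proof -
    have La: "smooth_away_0 (Lie a F)" by (rule smooth_Lie[OF F])
    have G1: "has_Lie a (\<lambda>x. gk (r * (x \<bullet> y))) (\<lambda>x. gk' (r * (x \<bullet> y)) * (r * (qmul x a \<bullet> y)))"
      by (rule has_Lie_zonal(1)[OF gk_derivative gk_continuous(2) r y])
    have "has_Lie a (\<lambda>x. r * (qmul x a \<bullet> y)) (\<lambda>x. r * (qmul x (qmul a a) \<bullet> y))"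
      using has_Lie_frame_inner[of a a y] by (auto simp: has_Lie_def intro!: continuous_intros DERIV_cmult)
    moreover have "continuous_on S3 (\<lambda>x. r * (qmul x a \<bullet> y))" by (intro continuous_intros)
    ultimately have G2: "has_Lie a (\<lambda>x. gk' (r * (x \<bullet> y)) * (r * (qmul x a \<bullet> y))) (?g2 a)"
      by (intro has_Lie_mult[OF has_Lie_zonal(1)[OF gk'_derivative gk_continuous(3) r y] _ c1])
    have cG1: "continuous_on S3 (\<lambda>x. gk' (r * (x \<bullet> y)) * (r * (qmul x a \<bullet> y)))"
      by (intro continuous_intros c1)
    have 1: "(LINT x|S3_vol. gk' (r * (x \<bullet> y)) * (r * (qmul x a \<bullet> y)) * Lie a F x)
       = - (LINT x|S3_vol. gk (r * (x \<bullet> y)) * Lie a (Lie a F) x)"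
      by (rule integral_Lie_by_parts[OF a G1 c0 has_Lie_Lie[OF La] cF[OF La]])
    have 2: "(LINT x|S3_vol. ?g2 a x * F x) = - (LINT x|S3_vol. gk' (r * (x \<bullet> y)) * (r * (qmul x a \<bullet> y)) * Lie a F x)"
      by (rule integral_Lie_by_parts[OF a G2 cG1 has_Lie_Lie[OF F] cF[OF F]])
    show "(LINT x|S3_vol. gk (r * (x \<bullet> y)) * Lie a (Lie a F) x) = (LINT x|S3_vol. ?g2 a x * F x)"
      using 1 2 by simp
    show "integrable S3_vol (\<lambda>x. ?g2 a x * F x)"
      by (intro integrable_continuous_S3 continuous_intros c1 c2 cF F)
  qed
  have LF: "smooth_away_0 (Lie a (Lie a F))" for a by (intro smooth_Lie F)
  have i: "integrable S3_vol (\<lambda>x. gk (r * (x \<bullet> y)) * Lie a (Lie a F) x)" for a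
    by (intro integrable_continuous_S3 continuous_intros c0 cF LF)
  note u = imaginary_units
  have "(LINT x|S3_vol. gk (r * (x \<bullet> y)) * Lap F x) = (LINT x|S3_vol. gk (r * (x \<bullet> y)) * Lie qi (Lie qi F) x)
     + (LINT x|S3_vol. gk (r * (x \<bullet> y)) * Lie qj (Lie qj F) x) + (LINT x|S3_vol. gk (r * (x \<bullet> y)) * Lie qk (Lie qk F) x)"
    using i by (simp add: Lap_def distrib_left)
  also have "\<dots> = (LINT x|S3_vol. ?g2 qi x * F x + ?g2 qj x * F x + ?g2 qk x * F x)"
    unfolding parts[OF u(1)] parts[OF u(2)] parts[OF u(3)] using int[OF u(1)] int[OF u(2)] int[OF u(3)] by simp
  also have "\<dots> = (LINT x|S3_vol. (2 - (1 - r\<^sup>2) * gk'' (r * (x \<bullet> y))) * F x)"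
  proof (rule Bochner_Integration.integral_cong[OF refl])
    fix x assume "x \<in> space S3_vol"
    then have x: "x \<in> S3" by simp
    let ?t = "x \<bullet> y"
    have "\<bar>r * ?t\<bar> \<le> r * 1" unfolding abs_mult using r S3_inner_bound[OF x y] by (intro mult_mono) auto
    then have s: "\<bar>r * ?t\<bar> < 1" using r by simp
    have neg: "qmul x (- qone) \<bullet> y = - ?t"
      by (simp add: bounded_bilinear.minus_right[OF bounded_bilinear_qmul])
    have "?g2 qi x + ?g2 qj x + ?g2 qk x = gk'' (r * ?t) * (r\<^sup>2 * ((qmul x qi \<bullet> y)\<^sup>2 + (qmul x qj \<bullet> y)\<^sup>2 + (qmul x qk \<bullet> y)\<^sup>2))
       - 3 * (r * ?t) * gk' (r * ?t)"
      by (simp add: quaternion_products neg power2_eq_square algebra_simps)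
    also have "\<dots> = (1 - (r * ?t)\<^sup>2) * gk'' (r * ?t) - 3 * (r * ?t) * gk' (r * ?t) - (1 - r\<^sup>2) * gk'' (r * ?t)"
      unfolding frame_parseval[OF x y] by (simp add: power2_eq_square algebra_simps)
    also have "\<dots> = 2 - (1 - r\<^sup>2) * gk'' (r * ?t)" using gk_ode[OF s] by simp
    finally have "?g2 qi x + ?g2 qj x + ?g2 qk x = 2 - (1 - r\<^sup>2) * gk'' (r * ?t)" .
    from arg_cong[OF this, of "\<lambda>z. z * F x"]
    show "?g2 qi x * F x + ?g2 qj x * F x + ?g2 qk x * F x = (2 - (1 - r\<^sup>2) * gk'' (r * ?t)) * F x"
      by (simp only: distrib_right)
  qed
  finally show ?thesis .
qed

text \<open>
  The case \<open>F = 1\<close> of the regularised formula says that the concentrating term has integral \<open>4 \<pi>\<^sup>2\<close>,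
  for each \<open>r\<close>, without computing it. Therefore \<open>F\<close> may be replaced by \<open>F - F y\<close>, and then this term
  tends to 0.\<close>

lemma Green_formula:
  assumes y: "y \<in> S3" and F: "smooth_away_0 F"
  shows "(LINT x|S3_vol. gk (x \<bullet> y) * Lap F x) = 2 * (LINT x|S3_vol. F x) - 4 * pi\<^sup>2 * F y"
proof -
  let ?u = "\<lambda>x. F x - F y"
  let ?k = "\<lambda>n x. (1 - (radius n)\<^sup>2) * gk'' (radius n * (x \<bullet> y))"
  have sF: "smooth_away_0 (\<lambda>x. c)" for c :: real by (rule smooth_const)
  have cF: "continuous_on S3 F" by (rule smooth_continuous_on_S3[OF F])
  have cu: "continuous_on S3 ?u" by (intro continuous_intros cF)
  have cL: "continuous_on S3 (Lap F)" by (rule smooth_continuous_on_S3[OF smooth_Lap[OF F]])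
  have ck: "continuous_on S3 (?k n)" for n
    by (intro continuous_intros has_Lie_zonal(3)[OF gk'_derivative gk_continuous(3) radius(1,2) y])
  have cg: "continuous_on S3 (\<lambda>x. gk (radius n * (x \<bullet> y)))" for n
    by (rule has_Lie_zonal(2)[OF gk_derivative gk_continuous(2) radius(1,2) y])
  have k0: "(LINT x|S3_vol. (2 - ?k n x) * 1) = 0" for n
    using regularised_Green[OF y sF[of 1] radius(1,2)[of n]] by simp
  have i: "integrable S3_vol (\<lambda>x. (2 - ?k n x) * F x)" "integrable S3_vol (\<lambda>x. (2 - ?k n x) * 1)"
     "integrable S3_vol (\<lambda>x. ?k n x * ?u x)" "integrable S3_vol ?u" for n
    by (intro integrable_continuous_S3 continuous_intros ck cF)+
  have i5: "integrable S3_vol (\<lambda>x. 2 * ?u x)"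
    by (intro integrable_continuous_S3 continuous_intros cF)
  have eq: "(LINT x|S3_vol. gk (radius n * (x \<bullet> y)) * Lap F x)
      = 2 * (LINT x|S3_vol. ?u x) - (LINT x|S3_vol. ?k n x * ?u x)" for n
  proof -
    have "(LINT x|S3_vol. gk (radius n * (x \<bullet> y)) * Lap F x) = (LINT x|S3_vol. (2 - ?k n x) * F x)"
      by (rule regularised_Green[OF y F radius(1,2)])
    also have "\<dots> = (LINT x|S3_vol. (2 - ?k n x) * F x) - (LINT x|S3_vol. (2 - ?k n x) * 1) * F y"
      by (simp only: k0 mult_zero_left diff_zero)
    also have "\<dots> = (LINT x|S3_vol. (2 - ?k n x) * F x - (2 - ?k n x) * 1 * F y)"
      using i(1,2)[of n] by simp
    also have "\<dots> = (LINT x|S3_vol. 2 * ?u x - ?k n x * ?u x)"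
      by (intro Bochner_Integration.integral_cong refl) (simp add: algebra_simps)
    also have "\<dots> = 2 * (LINT x|S3_vol. ?u x) - (LINT x|S3_vol. ?k n x * ?u x)"
      by (simp only: Bochner_Integration.integral_diff[OF i5 i(3)] integral_mult_right_zero)
    finally show ?thesis .
  qed
  obtain M where M: "M > 0" "\<And>x. x \<in> S3 \<Longrightarrow> \<bar>?u x\<bar> \<le> M * sqrt (1 - x \<bullet> y)"
    using smooth_Lipschitz_at[OF F y] by blast
  have lim1: "(\<lambda>n. LINT x|S3_vol. ?k n x * ?u x) \<longlonglongrightarrow> (LINT x|S3_vol. (0::real))"
  proof (rule integral_zonal_limit(2)[where C="80 * M", OF y])
    show "continuous_on S3 (\<lambda>x. ?k n x * ?u x)" for n by (intro continuous_intros ck cu)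
    fix x assume x: "x \<in> S3" "\<bar>x \<bullet> y\<bar> < 1"
    have "(\<lambda>n. ?k n x * ?u x) \<longlonglongrightarrow> (1 - 1\<^sup>2) * gk'' (x \<bullet> y) * ?u x"
      by (intro tendsto_intros radius tendsto_radius gk_continuous x)
    then show "(\<lambda>n. ?k n x * ?u x) \<longlonglongrightarrow> 0" by simp
    show "\<bar>?k n x * ?u x\<bar> \<le> 80 * M * weight (x \<bullet> y)" for n
      by (rule regularised_defect_bound[OF x(2) radius(1,2) M(1) M(2)[OF x(1)]])
  qed simp
  obtain K where K: "K > 0" "\<And>x. x \<in> S3 \<Longrightarrow> \<bar>Lap F x\<bar> \<le> K" using continuous_S3_bound[OF cL] by blast
  have lim2: "(\<lambda>n. LINT x|S3_vol. gk (radius n * (x \<bullet> y)) * Lap F x) \<longlonglongrightarrow> (LINT x|S3_vol. gk (x \<bullet> y) * Lap F x)"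
  proof (rule integral_zonal_limit(2)[where C="20 * K", OF y])
    show "continuous_on S3 (\<lambda>x. gk (radius n * (x \<bullet> y)) * Lap F x)" for n by (intro continuous_intros cg cL)
    show "(\<lambda>x. gk (x \<bullet> y) * Lap F x) \<in> borel_measurable S3_vol"
      using gk_by_parts(1)[OF y imaginary_units(1) smooth_Lap[OF F]] by simp
    fix x assume x: "x \<in> S3" "\<bar>x \<bullet> y\<bar> < 1"
    show "(\<lambda>n. gk (radius n * (x \<bullet> y)) * Lap F x) \<longlonglongrightarrow> gk (x \<bullet> y) * Lap F x"
      by (intro tendsto_intros tendsto_radius gk_continuous x)
    fix n
    note s = scaled_bounds[OF x(2) radius(1,2)[of n]]
    have "\<bar>gk (radius n * (x \<bullet> y))\<bar> \<le> 20 / (1 - (radius n * (x \<bullet> y))\<^sup>2)" by (rule kernel_bounds(4)[OF s(1)])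
    also have "\<dots> \<le> 20 * weight (x \<bullet> y)" unfolding weight_def using s by (simp add: divide_left_mono)
    finally have "\<bar>gk (radius n * (x \<bullet> y))\<bar> * \<bar>Lap F x\<bar> \<le> 20 * weight (x \<bullet> y) * K"
      using K(2)[OF x(1)] by (intro mult_mono) auto
    then show "\<bar>gk (radius n * (x \<bullet> y)) * Lap F x\<bar> \<le> 20 * K * weight (x \<bullet> y)" by (simp add: abs_mult mult_ac)
  qed
  have "(\<lambda>n. 2 * (LINT x|S3_vol. ?u x) - (LINT x|S3_vol. ?k n x * ?u x)) \<longlonglongrightarrow> 2 * (LINT x|S3_vol. ?u x) - 0"
    using lim1 by (intro tendsto_intros) simp
  from LIMSEQ_unique[OF lim2[unfolded eq] this]
  have "(LINT x|S3_vol. gk (x \<bullet> y) * Lap F x) = 2 * (LINT x|S3_vol. ?u x)" by simp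
  also have "\<dots> = 2 * (LINT x|S3_vol. F x) - 4 * pi\<^sup>2 * F y"
    using integrable_continuous_S3[OF cF] measure_S3 by simp
  finally show ?thesis .
qed

section \<open>Convolutions and the Hodge decomposition\<close>

lemma integrable_times_continuous_S3:
  fixes K G :: "real^4 \<Rightarrow> real"
  assumes K: "integrable S3_vol K" and G: "continuous_on S3 G"
  shows "integrable S3_vol (\<lambda>z. K z * G z)"
proof -
  obtain M where M: "M > 0" "\<And>x. x \<in> S3 \<Longrightarrow> \<bar>G x\<bar> \<le> M" using continuous_S3_bound[OF G] by blast
  have m: "G \<in> borel_measurable S3_vol" using integrable_continuous_S3[OF G] by simp
  show ?thesis
  proof (rule Bochner_Integration.integrable_bound)
    show "integrable S3_vol (\<lambda>z. M * K z)" using K by simp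
    show "AE z in S3_vol. norm (K z * G z) \<le> norm (M * K z)"
    proof (rule AE_I2)
      fix z assume "z \<in> space S3_vol"
      then have "\<bar>K z\<bar> * \<bar>G z\<bar> \<le> \<bar>K z\<bar> * M" using M by (intro mult_left_mono) auto
      then show "norm (K z * G z) \<le> norm (M * K z)" using M(1) by (simp add: abs_mult mult.commute)
    qed
  qed (use K m in auto)
qed

text \<open>
  The norm is multiplicative, so the points \<open>z y\<close> with \<open>z\<close> in the sphere all have norm \<open>\<bar>y\<bar>\<close>. A
  modulus of differentiability that is uniform on this sphere allows differentiation under the
  integral in a convolution.\<close>

lemma smooth_uniformly_differentiable:
  fixes F :: "real^4 \<Rightarrow> real"
  assumes F: "smooth_away_0 F" and r: "r > 0" and e: "e > 0"
  shows "\<exists>d>0. \<forall>w h. norm w = r \<longrightarrow> norm h < d \<longrightarrow> \<bar>F (w + h) - F w - frechet_derivative F (at w) h\<bar> \<le> e * norm h"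
proof -
  \<comment> \<open>A compact shell around the sphere of radius \<open>r\<close> that stays away from 0.\<close>
  define C where "C = cball (0::real^4) (3 * r / 2) - ball 0 (r / 2)"
  have C: "compact C" unfolding C_def by (intro compact_diff) auto
  have C0: "x \<noteq> 0" if "x \<in> C" for x using that r by (auto simp: C_def)
  let ?D = "\<lambda>b w. frechet_derivative F (at w) b"
  define e' where "e' = e / 4"
  have e': "e' > 0" using e by (simp add: e'_def)
  have "\<exists>d>0. \<forall>x\<in>C. \<forall>x'\<in>C. dist x' x < d \<longrightarrow> dist (?D b x') (?D b x) < e'" for b
  proof -
    have "continuous_on C (?D b)"
      using continuous_on_subset[OF smooth_continuous_on[OF smooth_partial[OF F]]] C0 by blast
    then show ?thesis
      using compact_uniformly_continuous[OF _ C] e' unfolding uniformly_continuous_on_def by blast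
  qed
  then obtain \<delta> where \<delta>: "\<And>b. \<delta> b > 0"
    "\<And>b x x'. x \<in> C \<Longrightarrow> x' \<in> C \<Longrightarrow> dist x' x < \<delta> b \<Longrightarrow> dist (?D b x') (?D b x) < e'" by metis
  define d where "d = min (r / 2) (Min (\<delta> ` Basis))"
  have d: "d > 0" "d \<le> r / 2" "\<And>b. b \<in> Basis \<Longrightarrow> d \<le> \<delta> b"
    using r \<delta> by (auto simp: d_def min_le_iff_disj)
  have "\<bar>F (w + h) - F w - frechet_derivative F (at w) h\<bar> \<le> e * norm h" if w: "norm w = r" and h: "norm h < d" for w h
  proof -
    have ballC: "ball w d \<subseteq> C"
    proof
      fix x assume "x \<in> ball w d"
      then have "norm (x - w) < r / 2" using d by (simp add: dist_norm norm_minus_commute)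
      then show "x \<in> C" using norm_triangle_ineq2[of w x] norm_triangle_ineq[of w "x - w"] w
        by (simp add: C_def norm_minus_commute)
    qed
    have w0: "w \<noteq> 0" using w r by auto
    have bl: "bounded_linear (frechet_derivative F (at w))"
      using smooth_has_derivative[OF F w0] has_derivative_bounded_linear by blast
    let ?f = "\<lambda>x. F x - frechet_derivative F (at w) x"
    have "norm (?f (w + h) - ?f w) \<le> e * norm ((w + h) - w)"
    proof (rule differentiable_bound[of "ball w d" ?f "\<lambda>x v. frechet_derivative F (at x) v - frechet_derivative F (at w) v"])
      fix x assume x: "x \<in> ball w d"
      then have xC: "x \<in> C" and wC: "w \<in> C" using ballC d by auto
      have dx: "(F has_derivative frechet_derivative F (at x)) (at x)"
        by (rule smooth_has_derivative[OF F C0[OF xC]])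
      show "(?f has_derivative (\<lambda>v. frechet_derivative F (at x) v - frechet_derivative F (at w) v)) (at x within ball w d)"
        by (rule has_derivative_at_withinI) (rule has_derivative_diff[OF dx bounded_linear_imp_has_derivative[OF bl]])
      show "onorm (\<lambda>v. frechet_derivative F (at x) v - frechet_derivative F (at w) v) \<le> e"
      proof (rule onorm_le)
        fix v :: "real^4"
        have "frechet_derivative F (at x) v - frechet_derivative F (at w) v
           = (\<Sum>b\<in>Basis. (v \<bullet> b) * (?D b x - ?D b w))"
          unfolding frechet_derivative_sum_Basis[OF smooth_differentiable[OF F C0[OF xC]], of v]
            frechet_derivative_sum_Basis[OF smooth_differentiable[OF F w0], of v]
          by (simp add: sum_subtractf right_diff_distrib)
        also have "norm \<dots> \<le> (\<Sum>b\<in>(Basis :: (real^4) set). norm v * e')"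
        proof (rule sum_norm_le)
          fix b :: "real^4" assume b: "b \<in> Basis"
          have "dist x w < \<delta> b" using x d(3)[OF b] by (simp add: dist_commute)
          then have "\<bar>?D b x - ?D b w\<bar> \<le> e'" using \<delta>(2)[OF wC xC, of b] by (simp add: dist_real_def)
          then show "norm ((v \<bullet> b) * (?D b x - ?D b w)) \<le> norm v * e'"
            using Basis_le_norm[OF b, of v] by (simp add: abs_mult mult_mono)
        qed
        also have "\<dots> = e * norm v" by (simp add: e'_def)
        finally show "norm (frechet_derivative F (at x) v - frechet_derivative F (at w) v) \<le> e * norm v" .
      qed
    qed (use h d in \<open>auto simp: dist_norm\<close>)
    then show ?thesis using bl by (simp add: linear_simps algebra_simps)
  qed
  then show ?thesis using d(1) by blast
qed

text \<open>
  The translation is by left multiplication, so that convolution commutes with the left-invariant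
  derivatives, which act by multiplication from the right.\<close>

definition conv :: "(real^4 \<Rightarrow> real) \<Rightarrow> (real^4 \<Rightarrow> real) \<Rightarrow> real^4 \<Rightarrow> real" where
  "conv K F y = (LINT z|S3_vol. K z * F (qmul z y))"

lemma qmul_nonzero: "z \<in> S3 \<Longrightarrow> y \<noteq> 0 \<Longrightarrow> qmul z y \<noteq> 0"
  using norm_qmul[of z y] by (auto simp: S3_iff(2))

lemma continuous_on_conv_integrand:
  assumes F: "smooth_away_0 F" and y: "y \<noteq> 0"
  shows "continuous_on S3 (\<lambda>z. F (qmul z y))"
  by (rule continuous_on_compose2[OF smooth_continuous_on[OF F]])
    (use qmul_nonzero[OF _ y] in \<open>auto intro!: continuous_intros\<close>)

lemma conv_has_derivative:
  assumes K: "integrable S3_vol K" and F: "smooth_away_0 F" and y: "y \<noteq> 0"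
  shows "(conv K F has_derivative (\<lambda>v. \<Sum>b\<in>Basis. conv (\<lambda>z. K z * (qmul z v \<bullet> b)) (\<lambda>w. frechet_derivative F (at w) b) y)) (at y)"
proof -
  let ?D = "\<lambda>b w. frechet_derivative F (at w) b"
  let ?L = "\<lambda>v. \<Sum>b\<in>Basis. conv (\<lambda>z. K z * (qmul z v \<bullet> b)) (?D b) y"
  have cD: "continuous_on S3 (\<lambda>z. ?D b (qmul z y))" for b
    by (rule continuous_on_conv_integrand[OF smooth_partial[OF F] y])
  have iK: "integrable S3_vol (\<lambda>z. K z * (qmul z v \<bullet> b))" for v b
    by (intro integrable_times_continuous_S3 K continuous_intros)
  have iD: "integrable S3_vol (\<lambda>z. K z * (qmul z v \<bullet> b) * ?D b (qmul z y))" for v b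
    by (intro integrable_times_continuous_S3 iK cD)
  have Leq: "?L v = (LINT z|S3_vol. K z * frechet_derivative F (at (qmul z y)) (qmul z v))"
    and Lint: "integrable S3_vol (\<lambda>z. K z * frechet_derivative F (at (qmul z y)) (qmul z v))" for v
  proof -
    have e: "(\<Sum>b\<in>Basis. K z * (qmul z v \<bullet> b) * ?D b (qmul z y)) = K z * frechet_derivative F (at (qmul z y)) (qmul z v)"
      if "z \<in> S3" for z
      using frechet_derivative_sum_Basis[OF smooth_differentiable[OF F qmul_nonzero[OF that y]], of "qmul z v"]
      by (simp add: sum_distrib_left mult.assoc)
    have "?L v = (LINT z|S3_vol. (\<Sum>b\<in>Basis. K z * (qmul z v \<bullet> b) * ?D b (qmul z y)))"
      unfolding conv_def using iD by (simp add: Bochner_Integration.integral_sum)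
    also have "\<dots> = (LINT z|S3_vol. K z * frechet_derivative F (at (qmul z y)) (qmul z v))"
      by (intro Bochner_Integration.integral_cong refl) (simp add: e)
    finally show "?L v = (LINT z|S3_vol. K z * frechet_derivative F (at (qmul z y)) (qmul z v))" .
    have "integrable S3_vol (\<lambda>z. \<Sum>b\<in>Basis. K z * (qmul z v \<bullet> b) * ?D b (qmul z y))"
      by (intro Bochner_Integration.integrable_sum iD)
    then show "integrable S3_vol (\<lambda>z. K z * frechet_derivative F (at (qmul z y)) (qmul z v))"
      by (rule Bochner_Integration.integrable_cong[OF refl, THEN iffD1, rotated]) (simp add: e)
  qed
  have "linear ?L"
  proof (rule linearI)
    fix u v c
    have lin: "linear (frechet_derivative F (at (qmul z y)))" if "z \<in> S3" for z
      by (rule linear_frechet_derivative[OF smooth_differentiable[OF F qmul_nonzero[OF that y]]])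
    have "?L (u + v) = (LINT z|S3_vol. K z * frechet_derivative F (at (qmul z y)) (qmul z u)
         + K z * frechet_derivative F (at (qmul z y)) (qmul z v))"
      unfolding Leq by (intro Bochner_Integration.integral_cong refl)
        (simp add: qmul_linear_simps linear_add[OF lin] distrib_left)
    then show "?L (u + v) = ?L u + ?L v" unfolding Leq using Lint by simp
    have "?L (c *\<^sub>R v) = (LINT z|S3_vol. c * (K z * frechet_derivative F (at (qmul z y)) (qmul z v)))"
      unfolding Leq by (intro Bochner_Integration.integral_cong refl)
        (simp add: qmul_linear_simps linear_cmul[OF lin])
    then show "?L (c *\<^sub>R v) = c *\<^sub>R ?L v" unfolding Leq by simp
  qed
  then have bl: "bounded_linear ?L" by (simp add: linear_conv_bounded_linear)
  show ?thesis
    unfolding has_derivative_at_alt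
  proof (intro conjI bl allI impI)
    fix e :: real assume e: "0 < e"
    define A where "A = (LINT z|S3_vol. \<bar>K z\<bar>) + 1"
    have A: "A > 0" unfolding A_def by (intro add_nonneg_pos integral_nonneg_AE) auto
    have "norm y > 0" "e / A > 0" using y e A by auto
    from smooth_uniformly_differentiable[OF F this] obtain d where d: "d > 0"
      "\<And>w h. norm w = norm y \<Longrightarrow> norm h < d \<Longrightarrow> \<bar>F (w + h) - F w - frechet_derivative F (at w) h\<bar> \<le> e / A * norm h"
      by blast
    show "\<exists>d>0. \<forall>x. norm (x - y) < d \<longrightarrow> norm (conv K F x - conv K F y - ?L (x - y)) \<le> e * norm (x - y)"
    proof (intro exI[of _ "min d (norm y)"] conjI allI impI)
      show "0 < min d (norm y)" using d y by simp
      fix x assume x: "norm (x - y) < min d (norm y)"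
      have x0: "x \<noteq> 0" using x by auto
      have i: "integrable S3_vol (\<lambda>z. K z * F (qmul z w))" if "w \<noteq> 0" for w
        by (intro integrable_times_continuous_S3 K continuous_on_conv_integrand F that)
      let ?R = "\<lambda>z. K z * (F (qmul z x) - F (qmul z y) - frechet_derivative F (at (qmul z y)) (qmul z (x - y)))"
      have "conv K F x - conv K F y - ?L (x - y) = (LINT z|S3_vol. ?R z)"
        unfolding conv_def[of K F] Leq using i[OF x0] i[OF y] Lint by (simp add: right_diff_distrib)
      also have "norm \<dots> \<le> (LINT z|S3_vol. \<bar>K z\<bar> * (e / A * norm (x - y)))"
      proof (rule Bochner_Integration.integral_norm_bound_integral)
        have "integrable S3_vol (\<lambda>z. K z * F (qmul z x) - K z * F (qmul z y) - K z * frechet_derivative F (at (qmul z y)) (qmul z (x - y)))"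
          by (intro Bochner_Integration.integrable_diff i x0 y Lint)
        then show "integrable S3_vol ?R" by (simp add: right_diff_distrib)
        show "integrable S3_vol (\<lambda>z. \<bar>K z\<bar> * (e / A * norm (x - y)))"
          using K by (intro integrable_mult_left integrable_abs)
        fix z assume "z \<in> space S3_vol"
        then have z: "norm z = 1" by (simp add: S3_iff(2))
        have "\<bar>F (qmul z y + qmul z (x - y)) - F (qmul z y) - frechet_derivative F (at (qmul z y)) (qmul z (x - y))\<bar>
          \<le> e / A * norm (qmul z (x - y))"
          using x z by (intro d) (auto simp: norm_qmul)
        then have "\<bar>F (qmul z x) - F (qmul z y) - frechet_derivative F (at (qmul z y)) (qmul z (x - y))\<bar> \<le> e / A * norm (x - y)"
        proof -
          have n: "norm (qmul z (x - y)) = norm (x - y)" using z by (simp add: norm_qmul)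
          have m: "qmul z y + qmul z (x - y) = qmul z x" by (simp add: qmul_linear_simps)
          show "\<bar>F (qmul z y + qmul z (x - y)) - F (qmul z y) - frechet_derivative F (at (qmul z y)) (qmul z (x - y))\<bar>
            \<le> e / A * norm (qmul z (x - y)) \<Longrightarrow> ?thesis" by (simp only: n m)
        qed
        then show "norm (?R z) \<le> \<bar>K z\<bar> * (e / A * norm (x - y))"
          by (simp only: real_norm_def abs_mult) (intro mult_left_mono, auto)
      qed
      also have "\<dots> = (A - 1) / A * (e * norm (x - y))" by (simp add: A_def)
      also have "\<dots> \<le> 1 * (e * norm (x - y))" using A e by (intro mult_right_mono) (auto simp: field_simps)
      finally show "norm (conv K F x - conv K F y - ?L (x - y)) \<le> e * norm (x - y)" by simp
    qed
  qed
qed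

lemma Ck_conv: "integrable S3_vol K \<Longrightarrow> smooth_away_0 F \<Longrightarrow> Ck_on k (- {0}) (conv K F)"
proof (induction k arbitrary: K F)
  case 0
  then have "isCont (conv K F) y" if "y \<noteq> 0" for y
    using has_derivative_continuous[OF conv_has_derivative] that by blast
  then show ?case by (simp add: continuous_at_imp_continuous_on)
next
  case (Suc k)
  have iK: "integrable S3_vol (\<lambda>z. K z * (qmul z v \<bullet> b))" for v b
    by (intro integrable_times_continuous_S3 Suc.prems continuous_intros)
  show ?case
  proof (rule Ck_on_SucI)
    show "(conv K F has_derivative (\<lambda>v. \<Sum>b\<in>Basis. conv (\<lambda>z. K z * (qmul z v \<bullet> b)) (\<lambda>w. frechet_derivative F (at w) b) y)) (at y)"
      if "y \<in> - {0}" for y using conv_has_derivative Suc.prems that by blast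
    show "Ck_on k (- {0}) (\<lambda>y. \<Sum>b\<in>Basis. conv (\<lambda>z. K z * (qmul z v \<bullet> b)) (\<lambda>w. frechet_derivative F (at w) b) y)" for v
      by (intro Ck_on_sum Suc.IH iK smooth_partial Suc.prems) auto
  qed auto
qed

lemma smooth_conv: "integrable S3_vol K \<Longrightarrow> smooth_away_0 F \<Longrightarrow> smooth_away_0 (conv K F)"
  by (simp add: smooth_away_0_def[of "conv K F"] Ck_conv)

lemma Lie_conv:
  assumes K: "integrable S3_vol K" and F: "smooth_away_0 F" and y: "y \<noteq> 0"
  shows "Lie a (conv K F) y = conv K (Lie a F) y"
proof -
  let ?D = "\<lambda>b w. frechet_derivative F (at w) b"
  have cD: "continuous_on S3 (\<lambda>z. ?D b (qmul z y))" for b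
    by (rule continuous_on_conv_integrand[OF smooth_partial[OF F] y])
  have iD: "integrable S3_vol (\<lambda>z. K z * (qmul z v \<bullet> b) * ?D b (qmul z y))" for v b
    by (intro integrable_times_continuous_S3 K continuous_intros cD)
  have "Lie a (conv K F) y = (\<Sum>b\<in>Basis. conv (\<lambda>z. K z * (qmul z (qmul y a) \<bullet> b)) (?D b) y)"
    by (rule Lie_eqI[OF conv_has_derivative[OF K F y]])
  also have "\<dots> = (LINT z|S3_vol. (\<Sum>b\<in>Basis. K z * (qmul z (qmul y a) \<bullet> b) * ?D b (qmul z y)))"
    unfolding conv_def using iD by (simp add: Bochner_Integration.integral_sum)
  also have "\<dots> = conv K (Lie a F) y"
    unfolding conv_def
    by (intro Bochner_Integration.integral_cong refl)
      (simp add: Lie_sum_Basis[OF F qmul_nonzero[OF _ y]] qmul_assoc sum_distrib_left mult.assoc)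
  finally show ?thesis .
qed

lemma Lie_cong_punctured:
  assumes "smooth_away_0 F" "\<And>x. x \<noteq> 0 \<Longrightarrow> F x = G x" "x \<noteq> 0"
  shows "Lie a F x = Lie a G x"
  unfolding Lie_def
  using frechet_derivative_transform_within_open[OF smooth_differentiable[OF assms(1,3)] open_punctured] assms by auto

lemma Lie_Lie_conv:
  assumes K: "integrable S3_vol K" and F: "smooth_away_0 F" and y: "y \<noteq> 0"
  shows "Lie a (Lie b (conv K F)) y = conv K (Lie a (Lie b F)) y"
proof -
  have "Lie a (Lie b (conv K F)) y = Lie a (conv K (Lie b F)) y"
    by (rule Lie_cong_punctured[OF smooth_Lie[OF smooth_conv[OF K F]] Lie_conv[OF K F] y])
  also have "\<dots> = conv K (Lie a (Lie b F)) y" by (rule Lie_conv[OF K smooth_Lie[OF F] y])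
  finally show ?thesis .
qed

lemma integrable_gk_qone: "integrable S3_vol (\<lambda>z. gk (z \<bullet> qone))"
  using gk_by_parts(1)[OF qone_S3 imaginary_units(1) smooth_const[of 1]] by simp

text \<open>
  Substituting \<open>x = z y\<close> turns \<open>z \<bullet> 1\<close> into \<open>x \<bullet> y\<close>.\<close>

lemma conv_zonal:
  assumes k: "k \<in> borel_measurable borel" and F: "smooth_away_0 F" and y: "y \<in> S3"
  shows "conv (\<lambda>z. k (z \<bullet> qone)) F y = (LINT x|S3_vol. k (x \<bullet> y) * F x)"
proof -
  have "(\<lambda>x. k (x \<bullet> y) * F x) \<in> borel_measurable S3_vol"
    using zonal_measurable[OF k] integrable_continuous_S3[OF smooth_continuous_on_S3[OF F]] by simp
  then have "(\<lambda>x. k (x \<bullet> y) * F x) \<in> borel_measurable (restrict_space borel S3)"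
    by (simp add: measurable_cong_sets[OF sets_S3_vol refl])
  from integral_right_translate(1)[OF y this] show ?thesis
    by (simp add: conv_def right_translate_inner[OF y])
qed

lemma Lap_conv_Green:
  assumes F: "smooth_away_0 F" and y: "y \<in> S3"
  shows "Lap (conv (\<lambda>z. gk (z \<bullet> qone)) F) y = 2 * (LINT x|S3_vol. F x) - 4 * pi\<^sup>2 * F y"
proof -
  let ?K = "\<lambda>z. gk (z \<bullet> qone)"
  have y0: "y \<noteq> 0" using y S3_nonzero by blast
  have i: "integrable S3_vol (\<lambda>z. ?K z * Lie a (Lie a F) (qmul z y))" for a
    by (intro integrable_times_continuous_S3 integrable_gk_qone continuous_on_conv_integrand smooth_Lie F y0)
  have "Lap (conv ?K F) y = conv ?K (Lap F) y"
    unfolding Lap_def Lie_Lie_conv[OF integrable_gk_qone F y0] conv_def using i by (simp add: distrib_left)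
  also have "\<dots> = (LINT x|S3_vol. gk (x \<bullet> y) * Lap F x)"
    by (rule conv_zonal[OF gk_measurable(1) smooth_Lap[OF F] y])
  also have "\<dots> = 2 * (LINT x|S3_vol. F x) - 4 * pi\<^sup>2 * F y" by (rule Green_formula[OF y F])
  finally show ?thesis .
qed

lemma integral_Lie_smooth: "imaginary_unit a \<Longrightarrow> smooth_away_0 F \<Longrightarrow> (LINT x|S3_vol. Lie a F x) = 0"
  by (rule integral_Lie_eq_0[OF _ has_Lie_Lie smooth_continuous_on_S3])

text \<open>
  The divergence as a function on the punctured space, so that it can be differentiated again.\<close>

definition field_div :: "(real^4 \<Rightarrow> real^4) \<Rightarrow> real^4 \<Rightarrow> real" where
  "field_div V x = Lie qi (coef V qi) x + Lie qj (coef V qj) x + Lie qk (coef V qk) x"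

lemma smooth_field_div: "S3_field V \<Longrightarrow> smooth_away_0 (field_div V)"
  unfolding field_div_def[abs_def] by (intro smooth_add smooth_Lie smooth_coef)

text \<open>
  Up to a constant \<open>\<Delta> \<phi>\<^sub>0 = - \<delta>\<close>, so convolution with \<open>- \<phi>\<^sub>0\<close> solves Poisson's equation for the
  divergence, which has integral 0.\<close>

definition potential :: "(real^4 \<Rightarrow> real^4) \<Rightarrow> real^4 \<Rightarrow> real" where
  "potential V = (\<lambda>y. - 1 / (4 * pi\<^sup>2) * conv (\<lambda>z. gk (z \<bullet> qone)) (field_div V) y)"

lemma smooth_potential: "S3_field V \<Longrightarrow> smooth_away_0 (potential V)"
  unfolding potential_def by (intro smooth_cmult smooth_conv integrable_gk_qone smooth_field_div)

lemma Lap_cmult: "smooth_away_0 F \<Longrightarrow> x \<noteq> 0 \<Longrightarrow> Lap (\<lambda>x. c * F x) x = c * Lap F x"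
proof -
  assume F: "smooth_away_0 F" and x: "x \<noteq> 0"
  have "Lie a (Lie a (\<lambda>x. c * F x)) x = c * Lie a (Lie a F) x" for a
    using Lie_cong_punctured[OF smooth_Lie[OF smooth_cmult[OF F]] Lie_cmult[OF F] x]
      Lie_cmult[OF smooth_Lie[OF F] x] by simp
  then show ?thesis by (simp add: Lap_def distrib_left)
qed

text \<open>
  Green's formula; its constant term is the integral of a divergence and vanishes.\<close>

lemma Lap_potential:
  assumes V: "S3_field V" and x: "x \<in> S3"
  shows "Lap (potential V) x = field_div V x"
proof -
  have x0: "x \<noteq> 0" using x S3_nonzero by blast
  have D: "smooth_away_0 (field_div V)" by (rule smooth_field_div[OF V])
  have i: "integrable S3_vol (Lie a (coef V b))" for a b
    by (intro integrable_continuous_S3 smooth_continuous_on_S3 smooth_Lie smooth_coef V)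
  have z: "(LINT x|S3_vol. Lie qi (coef V qi) x) = 0" "(LINT x|S3_vol. Lie qj (coef V qj) x) = 0"
      "(LINT x|S3_vol. Lie qk (coef V qk) x) = 0"
    by (intro integral_Lie_smooth smooth_coef V; simp)+
  have "(LINT x|S3_vol. field_div V x) = 0" unfolding field_div_def using i by (simp add: z)
  then show ?thesis
    unfolding potential_def using Lap_conv_Green[OF D x]
    by (subst Lap_cmult[OF smooth_conv[OF integrable_gk_qone D] x0]) simp
qed

text \<open>
  The Laplacian commutes with \<open>L_a\<close>; here this follows from the commutation of \<open>L_a\<close> with convolution,
  by applying Green's formula to the derivative of the divergence.\<close>

lemma Lap_Lie_potential:
  assumes V: "S3_field V" and x: "x \<in> S3" and a: "imaginary_unit a"
  shows "Lap (Lie a (potential V)) x = Lie a (field_div V) x"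
proof -
  have x0: "x \<noteq> 0" using x S3_nonzero by blast
  let ?K = "\<lambda>z. gk (z \<bullet> qone)"
  have D: "smooth_away_0 (field_div V)" by (rule smooth_field_div[OF V])
  have LD: "smooth_away_0 (Lie a (field_div V))" by (rule smooth_Lie[OF D])
  have e: "Lie a (potential V) z = - 1 / (4 * pi\<^sup>2) * conv ?K (Lie a (field_div V)) z" if "z \<noteq> 0" for z
    unfolding potential_def
    by (simp only: Lie_cmult[OF smooth_conv[OF integrable_gk_qone D] that] Lie_conv[OF integrable_gk_qone D that])
  have sc: "smooth_away_0 (\<lambda>z. - 1 / (4 * pi\<^sup>2) * conv ?K (Lie a (field_div V)) z)"
    by (intro smooth_cmult smooth_conv integrable_gk_qone LD)
  have sL: "smooth_away_0 (Lie a (potential V))" by (intro smooth_Lie smooth_potential V)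
  have "Lie b (Lie b (Lie a (potential V))) x = Lie b (Lie b (\<lambda>z. - 1 / (4 * pi\<^sup>2) * conv ?K (Lie a (field_div V)) z)) x" for b
    by (rule Lie_cong_punctured[OF smooth_Lie[OF sL] Lie_cong_punctured[OF sL e] x0])
  then have "Lap (Lie a (potential V)) x = Lap (\<lambda>z. - 1 / (4 * pi\<^sup>2) * conv ?K (Lie a (field_div V)) z) x"
    by (simp add: Lap_def)
  also have "\<dots> = - 1 / (4 * pi\<^sup>2) * Lap (conv ?K (Lie a (field_div V))) x"
    by (rule Lap_cmult[OF smooth_conv[OF integrable_gk_qone LD] x0])
  also have "\<dots> = Lie a (field_div V) x"
    using Lap_conv_Green[OF LD x] integral_Lie_smooth[OF a D] by simp
  finally show ?thesis .
qed

subsection \<open>Divergence-free part\<close>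

text \<open>
  The divergence-free part of the Hodge decomposition. Gradient fields are in the kernel of the
  Biot-Savart operator, so it suffices to know the operator on this part.\<close>

definition solenoidal :: "(real^4 \<Rightarrow> real^4) \<Rightarrow> real^4 \<Rightarrow> real^4" where
  "solenoidal V x = V x - frame_grad (potential V) x"

lemma frame_grad_coef:
  "x \<in> S3 \<Longrightarrow> frame_grad f x \<bullet> qmul x qi = Lie qi f x"
  "x \<in> S3 \<Longrightarrow> frame_grad f x \<bullet> qmul x qj = Lie qj f x"
  "x \<in> S3 \<Longrightarrow> frame_grad f x \<bullet> qmul x qk = Lie qk f x"
  by (simp_all add: frame_grad_def inner_add_left frame_orthonormal S3_iff(1))

lemma S3_field_solenoidal: "S3_field V \<Longrightarrow> S3_field (solenoidal V)"
proof -
  assume V: "S3_field V"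
  have g: "smooth_away_0 (frame_grad (potential V))" "S3_field (frame_grad (potential V))"
    using S3_field_frame_grad[OF smooth_potential[OF V]] by auto
  have "smooth_away_0 (\<lambda>x. radial_ext V x - frame_grad (potential V) x)"
    using V g by (intro smooth_diff smooth_away_0_radial_ext) (auto simp: smooth_vector_field_def)
  then have "smooth_on_mfd S3 (solenoidal V)"
    by (rule smooth_on_S3I) (simp add: solenoidal_def radial_ext_S3)
  moreover have "solenoidal V x \<in> tangent (\<bullet>) x" if "x \<in> S3" for x
    using field_tangent[OF V that] field_tangent[OF g(2) that] by (simp add: solenoidal_def tangent_def inner_diff_right)
  ultimately show ?thesis by (simp add: smooth_vector_field_def)
qed

lemma coef_solenoidal:
  assumes V: "S3_field V" and x: "x \<in> S3" and a: "a \<in> {qi, qj, qk}"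
  shows "coef (solenoidal V) a x = coef V a x - Lie a (potential V) x"
  using a frame_grad_coef[OF x, of "potential V"]
  by (auto simp: coef_S3[OF x] solenoidal_def inner_diff_left)

lemma Lie_coef_solenoidal:
  assumes V: "S3_field V" and x: "x \<in> S3" and a: "a \<in> {qi, qj, qk}" and b: "imaginary_unit b"
  shows "Lie b (coef (solenoidal V) a) x = Lie b (coef V a) x - Lie b (Lie a (potential V)) x"
proof -
  have s: "smooth_away_0 (coef V a)" "smooth_away_0 (Lie a (potential V))"
    by (intro smooth_coef smooth_Lie smooth_potential V)+
  have "Lie b (coef (solenoidal V) a) x = Lie b (\<lambda>x. coef V a x - Lie a (potential V) x) x"
    by (rule Lie_cong_S3[OF smooth_coef[OF S3_field_solenoidal[OF V]] smooth_diff[OF s] coef_solenoidal[OF V _ a] b x])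
  also have "\<dots> = Lie b (coef V a) x - Lie b (Lie a (potential V)) x"
    using x S3_nonzero by (intro Lie_diff s) auto
  finally show ?thesis .
qed

lemma S3_div_solenoidal: "S3_field V \<Longrightarrow> x \<in> S3 \<Longrightarrow> S3_div (solenoidal V) x = 0"
  using Lap_potential[of V x]
  by (simp add: S3_div_eq[OF S3_field_solenoidal] Lie_coef_solenoidal Lap_def field_div_def)

subsection \<open>The Biot-Savart field in the frame\<close>

text \<open>
  Each formula for components is proved for one component \<open>a\<close>; the three components are permuted
  cyclically.\<close>

definition cyclic_units :: "real^4 \<Rightarrow> real^4 \<Rightarrow> real^4 \<Rightarrow> bool" where
  "cyclic_units a b c \<longleftrightarrow> (a, b, c) \<in> {(qi, qj, qk), (qj, qk, qi), (qk, qi, qj)}"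

lemma cyclic_unitsD:
  assumes "cyclic_units a b c"
  shows "imaginary_unit a" "imaginary_unit b" "imaginary_unit c"
    "qmul b c - qmul c b = 2 *\<^sub>R a" "qmul b a - qmul a b = (- 2) *\<^sub>R c" "qmul c a - qmul a c = 2 *\<^sub>R b"
    "a \<in> {qi, qj, qk}" "b \<in> {qi, qj, qk}" "c \<in> {qi, qj, qk}"
    "field_div V x = Lie a (coef V a) x + Lie b (coef V b) x + Lie c (coef V c) x"
    "Lap F x = Lie a (Lie a F) x + Lie b (Lie b F) x + Lie c (Lie c F) x"
  using assms unfolding cyclic_units_def
  by (auto simp: quaternion_products field_div_def Lap_def scaleR_2)

lemma Lie_commute:
  assumes "cyclic_units a b c" "smooth_away_0 F" "x \<noteq> 0"
  shows "Lie b (Lie a F) x = Lie a (Lie b F) x - 2 * Lie c F x"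
    and "Lie c (Lie a F) x = Lie a (Lie c F) x + 2 * Lie b F x"
    and "Lie b (Lie c F) x - Lie c (Lie b F) x = 2 * Lie a F x"
  using Lie_commutator[OF assms(2,3), of b a] Lie_commutator[OF assms(2,3), of c a] Lie_commutator[OF assms(2,3), of b c]
  unfolding cyclic_unitsD(4-6)[OF assms(1)] Lie_direction[OF assms(2,3)] by simp_all

lemma curl_coef:
  assumes "S3_field B" "x \<in> S3" "cyclic_units a b c"
  shows "S3_curl B x \<bullet> qmul x a = Lie b (coef B c) x - Lie c (coef B b) x - 2 * coef B a x"
  using assms(3) S3_curl_eq[OF assms(1,2)] by (auto simp: cyclic_units_def)

text \<open>
  Componentwise \<open>- \<Delta> B = (curl + 2) curl B\<close>. The operator \<open>curl + 2\<close> has the components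
  \<open>L_b W_c - L_c W_b\<close>. In \<open>L_b W_c - L_c W_b\<close> the derivatives \<open>L_b L_a B_b\<close> and \<open>L_c L_a B_c\<close> are
  commuted; with \<open>L_a div B = 0\<close> they become \<open>- L_a L_a B_a\<close> and the commutators cancel the
  first-order terms.\<close>

lemma Lap_of_curl:
  assumes B: "S3_field B" and W: "S3_field W" and div: "\<And>x. x \<in> S3 \<Longrightarrow> S3_div B x = 0"
    and curl: "\<And>x. x \<in> S3 \<Longrightarrow> S3_curl B x = W x" and c: "cyclic_units a b c" and x: "x \<in> S3"
  shows "Lap (coef B a) x = - (Lie b (coef W c) x - Lie c (coef W b) x)"
proof -
  have x0: "x \<noteq> 0" using x S3_nonzero by blast
  have c': "cyclic_units b c a" "cyclic_units c a b" using c by (auto simp: cyclic_units_def)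
  note u = cyclic_unitsD(1-3)[OF c]
  have sB: "smooth_away_0 (coef B e)" for e by (rule smooth_coef[OF B])
  have sL: "smooth_away_0 (Lie d (coef B e))" for d e by (rule smooth_Lie[OF sB])
  have Wc: "coef W c z = Lie a (coef B b) z - Lie b (coef B a) z - 2 * coef B c z"
    and Wb: "coef W b z = Lie c (coef B a) z - Lie a (coef B c) z - 2 * coef B b z" if z: "z \<in> S3" for z
    using curl_coef[OF B z c'(2)] curl_coef[OF B z c'(1)] by (simp_all add: coef_S3[OF z, of W] curl[OF z])
  have sc: "smooth_away_0 (\<lambda>z. Lie a (coef B b) z - Lie b (coef B a) z)" "smooth_away_0 (\<lambda>z. Lie c (coef B a) z - Lie a (coef B c) z)"
    by (intro smooth_diff sL)+
  have "Lie b (coef W c) x = Lie b (\<lambda>z. Lie a (coef B b) z - Lie b (coef B a) z - 2 * coef B c z) x"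
    by (rule Lie_cong_S3[OF smooth_coef[OF W] _ Wc u(2) x]) (intro smooth_diff smooth_cmult sL sB)
  also have "\<dots> = Lie b (Lie a (coef B b)) x - Lie b (Lie b (coef B a)) x - 2 * Lie b (coef B c) x"
    by (simp only: Lie_diff[OF sc(1) smooth_cmult[OF sB] x0] Lie_diff[OF sL sL x0] Lie_cmult[OF sB x0])
  finally have 1: "Lie b (coef W c) x = Lie b (Lie a (coef B b)) x - Lie b (Lie b (coef B a)) x - 2 * Lie b (coef B c) x" .
  have "Lie c (coef W b) x = Lie c (\<lambda>z. Lie c (coef B a) z - Lie a (coef B c) z - 2 * coef B b z) x"
    by (rule Lie_cong_S3[OF smooth_coef[OF W] _ Wb u(3) x]) (intro smooth_diff smooth_cmult sL sB)
  also have "\<dots> = Lie c (Lie c (coef B a)) x - Lie c (Lie a (coef B c)) x - 2 * Lie c (coef B b) x"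
    by (simp only: Lie_diff[OF sc(2) smooth_cmult[OF sB] x0] Lie_diff[OF sL sL x0] Lie_cmult[OF sB x0])
  finally have 2: "Lie c (coef W b) x = Lie c (Lie c (coef B a)) x - Lie c (Lie a (coef B c)) x - 2 * Lie c (coef B b) x" .
  have "Lie a (field_div B) x = Lie a (\<lambda>x. 0) x"
  proof (rule Lie_cong_S3[OF smooth_field_div[OF B] smooth_const _ u(1) x])
    show "field_div B z = 0" if "z \<in> S3" for z using div[OF that] S3_div_eq[OF B that] by (simp add: field_div_def)
  qed
  then have "0 = Lie a (field_div B) x" by simp
  also have "\<dots> = Lie a (\<lambda>x. Lie a (coef B a) x + Lie b (coef B b) x + Lie c (coef B c) x) x"
    by (rule Lie_cong_punctured[OF smooth_field_div[OF B] cyclic_unitsD(10)[OF c] x0])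
  also have "\<dots> = Lie a (Lie a (coef B a)) x + Lie a (Lie b (coef B b)) x + Lie a (Lie c (coef B c)) x"
    by (simp only: Lie_add[OF smooth_add[OF sL sL] sL x0] Lie_add[OF sL sL x0])
  finally have 3: "Lie a (Lie a (coef B a)) x + Lie a (Lie b (coef B b)) x + Lie a (Lie c (coef B c)) x = 0" by simp
  show ?thesis
    unfolding cyclic_unitsD(11)[OF c] 1 2
    using 3 Lie_commute(1)[OF c sB[of b] x0] Lie_commute(2)[OF c sB[of c] x0] by linarith
qed

text \<open>
  Derivatives integrate to 0, so only the term \<open>- 2 B_a\<close> of the curl contributes. It fixes the mean
  values of the coefficients of \<open>B\<close>, which Green's formula leaves open.\<close>

lemma integral_coef_curl:
  assumes B: "S3_field B" and W: "S3_field W"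
    and curl: "\<And>x. x \<in> S3 \<Longrightarrow> S3_curl B x = W x" and c: "cyclic_units a b c"
  shows "(LINT x|S3_vol. coef W a x) = - 2 * (LINT x|S3_vol. coef B a x)"
proof -
  have sB: "smooth_away_0 (coef B e)" for e by (rule smooth_coef[OF B])
  have i: "integrable S3_vol (coef B e)" "integrable S3_vol (Lie d (coef B e))" for d e
    by (intro integrable_continuous_S3 smooth_continuous_on_S3 smooth_Lie sB)+
  have "(LINT x|S3_vol. coef W a x) = (LINT x|S3_vol. Lie b (coef B c) x - Lie c (coef B b) x - 2 * coef B a x)"
    using curl_coef[OF B _ c] curl by (intro Bochner_Integration.integral_cong refl) (simp add: coef_S3[of _ W])
  also have "\<dots> = - 2 * (LINT x|S3_vol. coef B a x)"
    using i integral_Lie_smooth[OF cyclic_unitsD(2)[OF c] sB] integral_Lie_smooth[OF cyclic_unitsD(3)[OF c] sB] by simp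
  finally show ?thesis .
qed

lemma biot_savart_solenoidal:
  assumes BS: "S3_biot_savart BS" and V: "S3_field V" and x: "x \<in> S3"
  shows "BS V x = BS (solenoidal V) x"
proof -
  let ?g = "frame_grad (potential V)"
  have g: "S3_field ?g" by (rule S3_field_frame_grad[OF smooth_potential[OF V]])
  have "BS ?g x = 0"
  proof -
    have "smooth_on_mfd S3 (potential V)" by (rule smooth_on_S3I[OF smooth_potential[OF V]]) simp
    moreover have "\<forall>x\<in>S3. ?g x = S3_grad (potential V) x" using S3_grad_eq[OF smooth_potential[OF V]] by simp
    ultimately show ?thesis using BS g x unfolding S3_biot_savart_def by blast
  qed
  moreover have "BS (\<lambda>z. 1 *\<^sub>R solenoidal V z + 1 *\<^sub>R ?g z) x = 1 *\<^sub>R BS (solenoidal V) x + 1 *\<^sub>R BS ?g x"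
    using BS S3_field_solenoidal[OF V] g x unfolding S3_biot_savart_def by blast
  moreover have "(\<lambda>z. 1 *\<^sub>R solenoidal V z + 1 *\<^sub>R ?g z) = V" by (simp add: fun_eq_iff solenoidal_def)
  ultimately show ?thesis by simp
qed

text \<open>
  Green's formula for \<open>B_a\<close>, with \<open>\<Delta> B_a\<close> and the mean of \<open>B_a\<close> expressed by the solenoidal part
  \<open>W = V - grad f\<close>. The commutator \<open>[L_b, L_c] f = 2 L_a f\<close> leaves an integral of \<open>gk * L_a f\<close>; since
  \<open>\<Delta> L_a f = L_a div V\<close>, the Laplacian of \<open>hk\<close> turns it into an integral of \<open>hk * L_a div V\<close>.\<close>

lemma biot_savart_coef:
  assumes BS: "S3_biot_savart BS" and V: "S3_field V" and y: "y \<in> S3" and c: "cyclic_units a b c"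
  shows "4 * pi\<^sup>2 * (BS V y \<bullet> qmul y a) =
     (LINT x|S3_vol. gk (x \<bullet> y) * Lie b (coef V c) x) - (LINT x|S3_vol. gk (x \<bullet> y) * Lie c (coef V b) x)
     - (LINT x|S3_vol. coef V a x) + (LINT x|S3_vol. hk (x \<bullet> y) * Lie a (field_div V) x) / 2"
proof -
  let ?W = "solenoidal V" and ?f = "potential V"
  let ?B = "BS ?W"
  have W: "S3_field ?W" by (rule S3_field_solenoidal[OF V])
  have B: "S3_field ?B" using BS W by (auto simp: S3_biot_savart_def)
  have div: "S3_div ?B x = 0" if "x \<in> S3" for x using BS W that by (auto simp: S3_biot_savart_def)
  have curl: "S3_curl ?B x = ?W x" if "x \<in> S3" for x
    using BS W S3_div_solenoidal[OF V] that by (auto simp: S3_biot_savart_def)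
  note u = cyclic_unitsD[OF c]
  have sV: "smooth_away_0 (coef V e)" for e by (rule smooth_coef[OF V])
  have sf: "smooth_away_0 ?f" by (rule smooth_potential[OF V])
  have sLf: "smooth_away_0 (Lie a ?f)" by (rule smooth_Lie[OF sf])
  have ig: "integrable S3_vol (\<lambda>x. gk (x \<bullet> y) * F x)" if "smooth_away_0 F" for F
    by (rule gk_by_parts(1)[OF y u(1) that])
  have "(LINT x|S3_vol. gk (x \<bullet> y) * Lap (coef ?B a) x)
      = (LINT x|S3_vol. 2 * (gk (x \<bullet> y) * Lie a ?f x) - (gk (x \<bullet> y) * Lie b (coef V c) x - gk (x \<bullet> y) * Lie c (coef V b) x))"
  proof (rule Bochner_Integration.integral_cong[OF refl])
    fix x assume "x \<in> space S3_vol"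
    then have x: "x \<in> S3" by simp
    have L: "Lap (coef ?B a) x = 2 * Lie a ?f x - (Lie b (coef V c) x - Lie c (coef V b) x)"
      using Lap_of_curl[OF B W div curl c x] Lie_commute(3)[OF c sf S3_nonzero[OF x]]
        Lie_coef_solenoidal[OF V x u(9) u(2)] Lie_coef_solenoidal[OF V x u(8) u(3)] by linarith
    show "gk (x \<bullet> y) * Lap (coef ?B a) x = 2 * (gk (x \<bullet> y) * Lie a ?f x)
       - (gk (x \<bullet> y) * Lie b (coef V c) x - gk (x \<bullet> y) * Lie c (coef V b) x)"
      unfolding L by (simp add: algebra_simps)
  qed
  also have "\<dots> = 2 * (LINT x|S3_vol. gk (x \<bullet> y) * Lie a ?f x)
     - ((LINT x|S3_vol. gk (x \<bullet> y) * Lie b (coef V c) x) - (LINT x|S3_vol. gk (x \<bullet> y) * Lie c (coef V b) x))"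
    using ig[OF sLf] ig[OF smooth_Lie[OF sV]] by simp
  finally have 1: "(LINT x|S3_vol. gk (x \<bullet> y) * Lap (coef ?B a) x) = 2 * (LINT x|S3_vol. gk (x \<bullet> y) * Lie a ?f x)
     - ((LINT x|S3_vol. gk (x \<bullet> y) * Lie b (coef V c) x) - (LINT x|S3_vol. gk (x \<bullet> y) * Lie c (coef V b) x))" .
  have 2: "(LINT x|S3_vol. gk (x \<bullet> y) * Lap (coef ?B a) x) = 2 * (LINT x|S3_vol. coef ?B a x) - 4 * pi\<^sup>2 * coef ?B a y"
    by (rule Green_formula[OF y smooth_coef[OF B]])
  have "(LINT x|S3_vol. coef ?W a x) = (LINT x|S3_vol. coef V a x - Lie a ?f x)"
    using coef_solenoidal[OF V _ u(7)] by (intro Bochner_Integration.integral_cong refl) simp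
  also have "\<dots> = (LINT x|S3_vol. coef V a x)"
    using integral_Lie_smooth[OF u(1) sf] sV sLf by (simp add: integrable_continuous_S3 smooth_continuous_on_S3)
  finally have 3: "2 * (LINT x|S3_vol. coef ?B a x) = - (LINT x|S3_vol. coef V a x)"
    using integral_coef_curl[OF B W curl c] by simp
  have "(LINT x|S3_vol. hk (x \<bullet> y) * Lie a (field_div V) x) = (LINT x|S3_vol. hk (x \<bullet> y) * Lap (Lie a ?f) x)"
    using Lap_Lie_potential[OF V _ u(1)] by (intro Bochner_Integration.integral_cong refl) simp
  also have "\<dots> = 2 * (LINT x|S3_vol. Lie a ?f x) - 4 * (LINT x|S3_vol. gk (x \<bullet> y) * Lie a ?f x)"
    by (rule hk_Laplacian[OF y sLf])
  finally have 4: "(LINT x|S3_vol. hk (x \<bullet> y) * Lie a (field_div V) x) = - 4 * (LINT x|S3_vol. gk (x \<bullet> y) * Lie a ?f x)"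
    using integral_Lie_smooth[OF u(1) sf] by simp
  have "4 * pi\<^sup>2 * coef ?B a y = 4 * pi\<^sup>2 * (BS V y \<bullet> qmul y a)"
    by (simp add: coef_S3[OF y] biot_savart_solenoidal[OF BS V y])
  then show ?thesis using 1 2 3 4 by linarith
qed

section \<open>Double integrals over the sphere\<close>

interpretation S3p: pair_sigma_finite S3_vol S3_vol
  by (intro pair_sigma_finite.intro S3v.sigma_finite_measure_axioms)

lemma ident_S3_vol: "(\<lambda>x. x) \<in> S3_vol \<rightarrow>\<^sub>M borel"
  unfolding measurable_cong_sets[OF sets_S3_vol refl] by (rule measurable_restrict_space1) simp

lemma pair_measurable_continuous:
  fixes P :: "real^4 \<Rightarrow> real^4 \<Rightarrow> real"
  assumes "continuous_on UNIV (\<lambda>p. P (fst p) (snd p))"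
  shows "(\<lambda>p. P (fst p) (snd p)) \<in> borel_measurable (S3_vol \<Otimes>\<^sub>M S3_vol)"
proof -
  have "(\<lambda>p. (fst p, snd p)) \<in> S3_vol \<Otimes>\<^sub>M S3_vol \<rightarrow>\<^sub>M borel \<Otimes>\<^sub>M borel"
    by (intro measurable_Pair measurable_compose[OF measurable_fst ident_S3_vol] measurable_compose[OF measurable_snd ident_S3_vol])
  then have "(\<lambda>p. p) \<in> S3_vol \<Otimes>\<^sub>M S3_vol \<rightarrow>\<^sub>M borel" by (simp add: borel_prod)
  from measurable_compose[OF this borel_measurable_continuous_onI[OF assms]] show ?thesis by simp
qed

lemma pair_measurable_inner [measurable]: "(\<lambda>p. fst p \<bullet> snd p) \<in> borel_measurable (S3_vol \<Otimes>\<^sub>M S3_vol)"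
  by (rule pair_measurable_continuous) (intro continuous_intros)

lemma AE_S3_pair_not_antipodal: "AE p in S3_vol \<Otimes>\<^sub>M S3_vol. \<bar>fst p \<bullet> snd p\<bar> < 1"
proof (rule S3p.AE_pair_measure)
  show "{p \<in> space (S3_vol \<Otimes>\<^sub>M S3_vol). \<bar>fst p \<bullet> snd p\<bar> < 1} \<in> sets (S3_vol \<Otimes>\<^sub>M S3_vol)" by measurable
  show "AE x in S3_vol. AE y in S3_vol. \<bar>fst (x, y) \<bullet> snd (x, y)\<bar> < 1"
  proof (rule AE_I2)
    fix x assume "x \<in> space S3_vol"
    then show "AE y in S3_vol. \<bar>fst (x, y) \<bullet> snd (x, y)\<bar> < 1"
      using AE_S3_not_antipodal[of x] by (simp add: inner_commute)
  qed
qed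

lemma pair_measurable_frame [measurable]: "(\<lambda>p. qmul (fst p) a \<bullet> snd p) \<in> borel_measurable (S3_vol \<Otimes>\<^sub>M S3_vol)"
  by (rule pair_measurable_continuous) (intro continuous_intros)

lemma smooth_measurable_S3_vol: "smooth_away_0 F \<Longrightarrow> (F :: real^4 \<Rightarrow> real) \<in> borel_measurable S3_vol"
  using integrable_continuous_S3[OF smooth_continuous_on_S3] by blast

text \<open>
  By right invariance the integral of \<open>weight (x \<bullet> y)\<close> over \<open>x\<close> is the same for all \<open>y\<close>.\<close>

lemma pair_integrable_kernel:
  fixes f :: "(real^4) \<times> (real^4) \<Rightarrow> real"
  assumes m: "f \<in> borel_measurable (S3_vol \<Otimes>\<^sub>M S3_vol)"
    and b: "\<And>x y. x \<in> S3 \<Longrightarrow> y \<in> S3 \<Longrightarrow> \<bar>x \<bullet> y\<bar> < 1 \<Longrightarrow> \<bar>f (x, y)\<bar> \<le> C * weight (x \<bullet> y)"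
  shows "integrable (S3_vol \<Otimes>\<^sub>M S3_vol) f"
proof -
  have w0: "0 \<le> weight (x \<bullet> y)" if "x \<in> S3" "y \<in> S3" for x y
    using S3_inner_bound[OF that] by (simp add: weight_def abs_square_le_1)
  have mw: "(\<lambda>(x, y). weight (x \<bullet> y)) \<in> borel_measurable (S3_vol \<Otimes>\<^sub>M S3_vol)"
    unfolding case_prod_beta using pair_measurable_inner by measurable
  have const: "(LINT x|S3_vol. weight (x \<bullet> y)) = (LINT x|S3_vol. weight (x \<bullet> qone))" if y: "y \<in> S3" for y
  proof -
    have "(\<lambda>x. weight (x \<bullet> y)) \<in> borel_measurable (restrict_space borel S3)"
      by (rule measurable_restrict_space1) measurable
    from integral_right_translate(1)[OF y this] show ?thesis by (simp add: right_translate_inner[OF y])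
  qed
  have "integrable (S3_vol \<Otimes>\<^sub>M S3_vol) (\<lambda>(x, y). weight (x \<bullet> y))"
  proof (rule integrableI_nonneg[OF mw])
    show "AE p in S3_vol \<Otimes>\<^sub>M S3_vol. 0 \<le> (case p of (x, y) \<Rightarrow> weight (x \<bullet> y))"
      by (rule AE_I2) (auto simp: space_pair_measure w0)
    have "(\<integral>\<^sup>+p. ennreal (case p of (x, y) \<Rightarrow> weight (x \<bullet> y)) \<partial>(S3_vol \<Otimes>\<^sub>M S3_vol))
       = (\<integral>\<^sup>+y. (\<integral>\<^sup>+x. ennreal (weight (x \<bullet> y)) \<partial>S3_vol) \<partial>S3_vol)"
      by (subst S3p.nn_integral_snd[symmetric]) (use mw in \<open>simp_all add: case_prod_beta\<close>)
    also have "\<dots> = (\<integral>\<^sup>+y. ennreal (LINT x|S3_vol. weight (x \<bullet> qone)) \<partial>S3_vol)"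
    proof (rule nn_integral_cong)
      fix y assume "y \<in> space S3_vol"
      then have y: "y \<in> S3" by simp
      have "(\<integral>\<^sup>+x. ennreal (weight (x \<bullet> y)) \<partial>S3_vol) = ennreal (LINT x|S3_vol. weight (x \<bullet> y))"
        by (rule nn_integral_eq_integral[OF integrable_weight[OF y]]) (rule AE_I2, simp add: w0 y)
      then show "(\<integral>\<^sup>+x. ennreal (weight (x \<bullet> y)) \<partial>S3_vol) = ennreal (LINT x|S3_vol. weight (x \<bullet> qone))"
        by (simp add: const[OF y])
    qed
    also have "\<dots> < \<infinity>" by (simp add: emeasure_S3 ennreal_mult_less_top)
    finally show "(\<integral>\<^sup>+p. ennreal (case p of (x, y) \<Rightarrow> weight (x \<bullet> y)) \<partial>(S3_vol \<Otimes>\<^sub>M S3_vol)) < \<infinity>" .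
  qed
  then have iw: "integrable (S3_vol \<Otimes>\<^sub>M S3_vol) (\<lambda>p. C * (case p of (x, y) \<Rightarrow> weight (x \<bullet> y)))" by simp
  show ?thesis
  proof (rule Bochner_Integration.integrable_bound[OF iw m])
    have "AE p in S3_vol \<Otimes>\<^sub>M S3_vol. p \<in> S3 \<times> S3" by (rule AE_I2) (simp add: space_pair_measure)
    then show "AE p in S3_vol \<Otimes>\<^sub>M S3_vol. norm (f p) \<le> norm (C * (case p of (x, y) \<Rightarrow> weight (x \<bullet> y)))"
      using AE_S3_pair_not_antipodal
    proof eventually_elim
      case (elim p)
      obtain x y where p: "p = (x, y)" by (cases p)
      show ?case using b[of x y] elim unfolding p by auto
    qed
  qed
qed

lemma pair_integral_iterated:
  fixes f :: "(real^4) \<times> (real^4) \<Rightarrow> real"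
  assumes "integrable (S3_vol \<Otimes>\<^sub>M S3_vol) f"
  shows "(LINT p|(S3_vol \<Otimes>\<^sub>M S3_vol). f p) = (LINT y|S3_vol. (LINT x|S3_vol. f (x, y)))"
    and "integrable S3_vol (\<lambda>y. LINT x|S3_vol. f (x, y))"
  using S3p.integral_snd[of "\<lambda>x y. f (x, y)"] S3p.integrable_snd[of "\<lambda>x y. f (x, y)"] assms by simp_all

lemma frame_bound: "x \<in> S3 \<Longrightarrow> y \<in> S3 \<Longrightarrow> a \<in> S3 \<Longrightarrow> \<bar>qmul x a \<bullet> y\<bar> \<le> 1"
  using S3_inner_bound[OF qmul_S3] by blast

lemma imaginary_unit_S3: "imaginary_unit a \<Longrightarrow> a \<in> S3"
  by (simp add: imaginary_unit_def S3_iff(1))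

text \<open>
  The derivative of \<open>F\<close> in the formula for the Biot-Savart field is moved to the kernel, for each \<open>y\<close>.\<close>

lemma gk'_pair_integral:
  assumes a: "imaginary_unit a" and F: "smooth_away_0 F" and G: "smooth_away_0 G"
  defines "f \<equiv> \<lambda>p. gk' (fst p \<bullet> snd p) * (qmul (fst p) a \<bullet> snd p) * F (fst p) * G (snd p)"
  shows "integrable (S3_vol \<Otimes>\<^sub>M S3_vol) f"
    and "(LINT p|(S3_vol \<Otimes>\<^sub>M S3_vol). f p) = - (LINT y|S3_vol. (LINT x|S3_vol. gk (x \<bullet> y) * Lie a F x) * G y)"
    and "integrable S3_vol (\<lambda>y. (LINT x|S3_vol. gk (x \<bullet> y) * Lie a F x) * G y)"
proof -
  have [measurable]: "F \<in> borel_measurable S3_vol" "G \<in> borel_measurable S3_vol"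
    using F G smooth_measurable_S3_vol by auto
  have m: "f \<in> borel_measurable (S3_vol \<Otimes>\<^sub>M S3_vol)" unfolding f_def by measurable
  obtain M N where M: "M > 0" "\<And>x. x \<in> S3 \<Longrightarrow> \<bar>F x\<bar> \<le> M" and N: "N > 0" "\<And>x. x \<in> S3 \<Longrightarrow> \<bar>G x\<bar> \<le> N"
    using continuous_S3_bound[OF smooth_continuous_on_S3[OF F]] continuous_S3_bound[OF smooth_continuous_on_S3[OF G]] by metis
  show i: "integrable (S3_vol \<Otimes>\<^sub>M S3_vol) f"
  proof (rule pair_integrable_kernel[where C="20 * M * N", OF m])
    fix x y assume x: "x \<in> S3" and y: "y \<in> S3" and t: "\<bar>x \<bullet> y\<bar> < 1"
    let ?d = "1 - (x \<bullet> y)\<^sup>2"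
    have d: "0 < ?d" by (rule one_minus_square_pos[OF t])
    have "\<bar>qmul x a \<bullet> y\<bar> \<le> sqrt ?d"
      using frame_bessel[OF x y a] real_sqrt_le_mono[of "(qmul x a \<bullet> y)\<^sup>2"] by simp
    then have "\<bar>gk' (x \<bullet> y)\<bar> * \<bar>qmul x a \<bullet> y\<bar> * \<bar>F x\<bar> * \<bar>G y\<bar> \<le> 20 / (?d * sqrt ?d) * sqrt ?d * M * N"
      using kernel_bounds(5)[OF t] M N x y d by (intro mult_mono) auto
    also have "\<dots> = 20 * M * N * weight (x \<bullet> y)" using d by (simp add: weight_def)
    finally show "\<bar>f (x, y)\<bar> \<le> 20 * M * N * weight (x \<bullet> y)" by (simp add: f_def abs_mult)
  qed
  have e: "(LINT x|S3_vol. f (x, y)) = - ((LINT x|S3_vol. gk (x \<bullet> y) * Lie a F x) * G y)" if "y \<in> S3" for y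
    using gk_by_parts(3)[OF that a F] by (simp add: f_def)
  show "(LINT p|(S3_vol \<Otimes>\<^sub>M S3_vol). f p) = - (LINT y|S3_vol. (LINT x|S3_vol. gk (x \<bullet> y) * Lie a F x) * G y)"
    unfolding pair_integral_iterated(1)[OF i] integral_minus[symmetric]
    by (intro Bochner_Integration.integral_cong refl) (simp only: e space_S3_vol)
  have "integrable S3_vol (\<lambda>y. - ((LINT x|S3_vol. gk (x \<bullet> y) * Lie a F x) * G y))"
    by (rule Bochner_Integration.integrable_cong[OF refl, THEN iffD1, OF _ pair_integral_iterated(2)[OF i]]) (simp only: e space_S3_vol)
  then show "integrable S3_vol (\<lambda>y. (LINT x|S3_vol. gk (x \<bullet> y) * Lie a F x) * G y)"
    using Bochner_Integration.integrable_minus by fastforce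
qed

definition hess_kernel :: "real^4 \<Rightarrow> real^4 \<Rightarrow> real^4 \<Rightarrow> real^4 \<Rightarrow> real" where
  "hess_kernel a b x y = pk' (x \<bullet> y) * (qmul x b \<bullet> y) * (qmul x a \<bullet> y) + pk (x \<bullet> y) * (qmul x (qmul b a) \<bullet> y)"

lemma hess_pair_integral:
  assumes a: "imaginary_unit a" and b: "imaginary_unit b" and F: "smooth_away_0 F" and G: "smooth_away_0 G"
  defines "f \<equiv> \<lambda>p. hess_kernel a b (fst p) (snd p) * F (fst p) * G (snd p)"
  shows "integrable (S3_vol \<Otimes>\<^sub>M S3_vol) f"
    and "(LINT p|(S3_vol \<Otimes>\<^sub>M S3_vol). f p) = (LINT y|S3_vol. (LINT x|S3_vol. hk (x \<bullet> y) * Lie a (Lie b F) x) * G y) / 2"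
    and "integrable S3_vol (\<lambda>y. (LINT x|S3_vol. hk (x \<bullet> y) * Lie a (Lie b F) x) * G y)"
proof -
  have [measurable]: "F \<in> borel_measurable S3_vol" "G \<in> borel_measurable S3_vol"
    using F G smooth_measurable_S3_vol by auto
  have m: "f \<in> borel_measurable (S3_vol \<Otimes>\<^sub>M S3_vol)" unfolding f_def hess_kernel_def by measurable
  obtain M N where M: "M > 0" "\<And>x. x \<in> S3 \<Longrightarrow> \<bar>F x\<bar> \<le> M" and N: "N > 0" "\<And>x. x \<in> S3 \<Longrightarrow> \<bar>G x\<bar> \<le> N"
    using continuous_S3_bound[OF smooth_continuous_on_S3[OF F]] continuous_S3_bound[OF smooth_continuous_on_S3[OF G]] by metis
  show i: "integrable (S3_vol \<Otimes>\<^sub>M S3_vol) f"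
  proof (rule pair_integrable_kernel[where C="40 * M * N", OF m])
    fix x y assume x: "x \<in> S3" and y: "y \<in> S3" and t: "\<bar>x \<bullet> y\<bar> < 1"
    let ?d = "1 - (x \<bullet> y)\<^sup>2"
    have d: "0 < ?d" "?d \<le> 1" using one_minus_square_pos[OF t] by auto
    note s = sqrt_bounds[OF d]
    have f: "\<bar>qmul x e \<bullet> y\<bar> \<le> sqrt ?d" if "imaginary_unit e" for e
      using frame_bessel[OF x y that] real_sqrt_le_mono[of "(qmul x e \<bullet> y)\<^sup>2"] by simp
    have "\<bar>pk' (x \<bullet> y)\<bar> * \<bar>qmul x b \<bullet> y\<bar> * \<bar>qmul x a \<bullet> y\<bar> \<le> 20 / (?d * sqrt ?d) * sqrt ?d * 1"
      using kernel_bounds(3)[OF t] f[OF b] order_trans[OF f[OF a] s(2)] d by (intro mult_mono) auto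
    also have "\<dots> = 20 / ?d" using d by simp
    finally have 1: "\<bar>pk' (x \<bullet> y) * (qmul x b \<bullet> y) * (qmul x a \<bullet> y)\<bar> \<le> 20 / ?d" by (simp only: abs_mult)
    have "\<bar>pk (x \<bullet> y)\<bar> * \<bar>qmul x (qmul b a) \<bullet> y\<bar> \<le> 20 / ?d * 1"
      using kernel_bounds(1)[OF t] frame_bound[OF x y qmul_S3[OF imaginary_unit_S3[OF b] imaginary_unit_S3[OF a]]] d
      by (intro mult_mono) auto
    then have 2: "\<bar>pk (x \<bullet> y) * (qmul x (qmul b a) \<bullet> y)\<bar> \<le> 20 / ?d" by (simp only: abs_mult mult_1_right)
    have "\<bar>hess_kernel a b x y\<bar> \<le> 20 / ?d + 20 / ?d"
      unfolding hess_kernel_def by (rule order_trans[OF abs_triangle_ineq add_mono[OF 1 2]])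
    then have "\<bar>hess_kernel a b x y\<bar> \<le> 40 / ?d" by simp
    then have "\<bar>hess_kernel a b x y\<bar> * \<bar>F x\<bar> * \<bar>G y\<bar> \<le> 40 / ?d * M * N"
      using M N x y d by (intro mult_mono) auto
    then show "\<bar>f (x, y)\<bar> \<le> 40 * M * N * weight (x \<bullet> y)" by (simp add: f_def abs_mult weight_def)
  qed
  have e: "(LINT x|S3_vol. f (x, y)) = (1 / 2) * ((LINT x|S3_vol. hk (x \<bullet> y) * Lie a (Lie b F) x) * G y)" if "y \<in> S3" for y
    using hk_by_parts(3)[OF that a b F] by (simp add: f_def hess_kernel_def)
  show "(LINT p|(S3_vol \<Otimes>\<^sub>M S3_vol). f p) = (LINT y|S3_vol. (LINT x|S3_vol. hk (x \<bullet> y) * Lie a (Lie b F) x) * G y) / 2"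
  proof -
    have "(LINT y|S3_vol. (LINT x|S3_vol. f (x, y))) = (LINT y|S3_vol. (1 / 2) * ((LINT x|S3_vol. hk (x \<bullet> y) * Lie a (Lie b F) x) * G y))"
      by (intro Bochner_Integration.integral_cong refl) (simp only: e space_S3_vol)
    then show ?thesis unfolding pair_integral_iterated(1)[OF i] by simp
  qed
  have "integrable S3_vol (\<lambda>y. (1 / 2) * ((LINT x|S3_vol. hk (x \<bullet> y) * Lie a (Lie b F) x) * G y))"
    by (rule Bochner_Integration.integrable_cong[OF refl, THEN iffD1, OF _ pair_integral_iterated(2)[OF i]]) (simp only: e space_S3_vol)
  from integrable_mult_right[OF this, of 2]
  show "integrable S3_vol (\<lambda>y. (LINT x|S3_vol. hk (x \<bullet> y) * Lie a (Lie b F) x) * G y)" by simp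
qed

lemma product_pair_integral:
  fixes F G :: "real^4 \<Rightarrow> real"
  assumes F: "smooth_away_0 F" and G: "smooth_away_0 G"
  shows "integrable (S3_vol \<Otimes>\<^sub>M S3_vol) (\<lambda>p. F (fst p) * G (snd p))"
    and "(LINT p|(S3_vol \<Otimes>\<^sub>M S3_vol). F (fst p) * G (snd p)) = (LINT y|S3_vol. (LINT x|S3_vol. F x) * G y)"
    and "integrable S3_vol (\<lambda>y. (LINT x|S3_vol. F x) * G y)"
proof -
  have [measurable]: "F \<in> borel_measurable S3_vol" "G \<in> borel_measurable S3_vol"
    using F G smooth_measurable_S3_vol by auto
  have m: "(\<lambda>p. F (fst p) * G (snd p)) \<in> borel_measurable (S3_vol \<Otimes>\<^sub>M S3_vol)" by measurable
  obtain M N where M: "M > 0" "\<And>x. x \<in> S3 \<Longrightarrow> \<bar>F x\<bar> \<le> M" and N: "N > 0" "\<And>x. x \<in> S3 \<Longrightarrow> \<bar>G x\<bar> \<le> N"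
    using continuous_S3_bound[OF smooth_continuous_on_S3[OF F]] continuous_S3_bound[OF smooth_continuous_on_S3[OF G]] by metis
  show i: "integrable (S3_vol \<Otimes>\<^sub>M S3_vol) (\<lambda>p. F (fst p) * G (snd p))"
  proof (rule pair_integrable_kernel[where C="M * N", OF m])
    fix x y assume x: "x \<in> S3" and y: "y \<in> S3" and t: "\<bar>x \<bullet> y\<bar> < 1"
    have "1 \<le> weight (x \<bullet> y)" using one_minus_square_pos[OF t] by (simp add: weight_def)
    then have "M * N * 1 \<le> M * N * weight (x \<bullet> y)" using M N by (intro mult_left_mono) auto
    moreover have "\<bar>F x\<bar> * \<bar>G y\<bar> \<le> M * N" using M N x y by (intro mult_mono) auto
    ultimately show "\<bar>F (fst (x, y)) * G (snd (x, y))\<bar> \<le> M * N * weight (x \<bullet> y)" by (simp add: abs_mult)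
  qed
  show "(LINT p|(S3_vol \<Otimes>\<^sub>M S3_vol). F (fst p) * G (snd p)) = (LINT y|S3_vol. (LINT x|S3_vol. F x) * G y)"
    using pair_integral_iterated(1)[OF i] by simp
  show "integrable S3_vol (\<lambda>y. (LINT x|S3_vol. F x) * G y)"
    using pair_integral_iterated(2)[OF i] by simp
qed

text \<open>
  The three integrands of the left-translation formula in coordinates, without the normalising
  factors: the triple product with the gradient of the kernel, the Hessian of \<open>hk\<close>, and the inner
  product. They are kept apart from their geometric form so that only integrable coordinate
  expressions have to be integrated.\<close>

definition linking_integrand :: "(real^4 \<Rightarrow> real^4) \<Rightarrow> ((real^4) \<times> (real^4)) \<Rightarrow> real" where
  "linking_integrand V p = (let x = fst p; y = snd p; t = x \<bullet> y in
     gk' t * (qmul x qi \<bullet> y) * coef V qk x * coef V qj y - gk' t * (qmul x qi \<bullet> y) * coef V qj x * coef V qk y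
   + (gk' t * (qmul x qj \<bullet> y) * coef V qi x * coef V qk y - gk' t * (qmul x qj \<bullet> y) * coef V qk x * coef V qi y)
   + (gk' t * (qmul x qk \<bullet> y) * coef V qj x * coef V qi y - gk' t * (qmul x qk \<bullet> y) * coef V qi x * coef V qj y))"

definition hess_integrand :: "(real^4 \<Rightarrow> real^4) \<Rightarrow> ((real^4) \<times> (real^4)) \<Rightarrow> real" where
  "hess_integrand V p = (\<Sum>a\<in>{qi, qj, qk}. \<Sum>b\<in>{qi, qj, qk}. hess_kernel a b (fst p) (snd p) * coef V b (fst p) * coef V a (snd p))"

definition dot_integrand :: "(real^4 \<Rightarrow> real^4) \<Rightarrow> ((real^4) \<times> (real^4)) \<Rightarrow> real" where
  "dot_integrand V p = (\<Sum>a\<in>{qi, qj, qk}. coef V a (fst p) * coef V a (snd p))"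

lemma units_distinct [simp]: "qi \<noteq> qj" "qi \<noteq> qk" "qj \<noteq> qk" "qj \<noteq> qi" "qk \<noteq> qi" "qk \<noteq> qj"
  by (auto simp: qi_def qj_def qk_def vec_eq_iff forall_4)

text \<open>
  The coordinates of \<open>BS V\<close> from \<open>biot_savart_coef\<close>, multiplied by those of \<open>V\<close> and integrated, with
  all derivatives moved to the kernels.\<close>

lemma helicity_frame_kernel:
  assumes BS: "S3_biot_savart BS" and V: "S3_field V"
  shows "4 * pi\<^sup>2 * helicity (\<bullet>) S3_vol BS V = (LINT p|(S3_vol \<Otimes>\<^sub>M S3_vol). linking_integrand V p)
     - (LINT p|(S3_vol \<Otimes>\<^sub>M S3_vol). dot_integrand V p) + (LINT p|(S3_vol \<Otimes>\<^sub>M S3_vol). hess_integrand V p)"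
    and "integrable (S3_vol \<Otimes>\<^sub>M S3_vol) (linking_integrand V)"
    and "integrable (S3_vol \<Otimes>\<^sub>M S3_vol) (dot_integrand V)"
    and "integrable (S3_vol \<Otimes>\<^sub>M S3_vol) (hess_integrand V)"
proof -
  have s: "smooth_away_0 (coef V a)" for a by (rule smooth_coef[OF V])
  note u = imaginary_units
  let ?G = "\<lambda>a b c y. (LINT x|S3_vol. gk (x \<bullet> y) * Lie a (coef V b) x) * coef V c y"
  let ?H = "\<lambda>a b y. (LINT x|S3_vol. hk (x \<bullet> y) * Lie a (Lie b (coef V b)) x) * coef V a y"
  let ?D = "\<lambda>a y. (LINT x|S3_vol. coef V a x) * coef V a y"
  note g1 = gk'_pair_integral(1)[OF u(1) s s] gk'_pair_integral(1)[OF u(2) s s] gk'_pair_integral(1)[OF u(3) s s]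
  note g2 = gk'_pair_integral(2)[OF u(1) s s] gk'_pair_integral(2)[OF u(2) s s] gk'_pair_integral(2)[OF u(3) s s]
  note g3 = gk'_pair_integral(3)[OF u(1) s s] gk'_pair_integral(3)[OF u(2) s s] gk'_pair_integral(3)[OF u(3) s s]
  have hu: "imaginary_unit a" if "a \<in> {qi, qj, qk}" for a using that u by auto
  note h1 = hess_pair_integral(1)[OF hu hu s s] and h2 = hess_pair_integral(2)[OF hu hu s s] and h3 = hess_pair_integral(3)[OF hu hu s s]
  show iL: "integrable (S3_vol \<Otimes>\<^sub>M S3_vol) (linking_integrand V)"
    unfolding linking_integrand_def[abs_def] Let_def
    by (intro Bochner_Integration.integrable_add Bochner_Integration.integrable_diff g1)
  show iD: "integrable (S3_vol \<Otimes>\<^sub>M S3_vol) (dot_integrand V)"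
    unfolding dot_integrand_def[abs_def] by (intro Bochner_Integration.integrable_sum product_pair_integral(1) s)
  show iH: "integrable (S3_vol \<Otimes>\<^sub>M S3_vol) (hess_integrand V)"
    unfolding hess_integrand_def[abs_def] by (intro Bochner_Integration.integrable_sum h1)
  have L: "(LINT p|(S3_vol \<Otimes>\<^sub>M S3_vol). linking_integrand V p) =
      (LINT y|S3_vol. ?G qi qj qk y) - (LINT y|S3_vol. ?G qi qk qj y) + ((LINT y|S3_vol. ?G qj qk qi y) - (LINT y|S3_vol. ?G qj qi qk y))
     + ((LINT y|S3_vol. ?G qk qi qj y) - (LINT y|S3_vol. ?G qk qj qi y))"
    unfolding linking_integrand_def[abs_def] Let_def
    by (simp add: Bochner_Integration.integral_add Bochner_Integration.integral_diff Bochner_Integration.integrable_add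
        Bochner_Integration.integrable_diff g1 g2)
  have D: "(LINT p|(S3_vol \<Otimes>\<^sub>M S3_vol). dot_integrand V p) = (\<Sum>a\<in>{qi, qj, qk}. LINT y|S3_vol. ?D a y)"
    unfolding dot_integrand_def[abs_def]
    by (subst Bochner_Integration.integral_sum) (simp_all only: product_pair_integral[OF s s])
  have H: "(LINT p|(S3_vol \<Otimes>\<^sub>M S3_vol). hess_integrand V p) = (\<Sum>a\<in>{qi, qj, qk}. \<Sum>b\<in>{qi, qj, qk}. (LINT y|S3_vol. ?H a b y) / 2)"
  proof -
    have "(LINT p|(S3_vol \<Otimes>\<^sub>M S3_vol). hess_integrand V p) = (\<Sum>a\<in>{qi, qj, qk}. \<Sum>b\<in>{qi, qj, qk}.
       (LINT p|(S3_vol \<Otimes>\<^sub>M S3_vol). hess_kernel a b (fst p) (snd p) * coef V b (fst p) * coef V a (snd p)))"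
      unfolding hess_integrand_def[abs_def]
      by (subst Bochner_Integration.integral_sum, (intro Bochner_Integration.integrable_sum h1; assumption),
        intro sum.cong refl, rule Bochner_Integration.integral_sum) (intro h1)
    also have "\<dots> = (\<Sum>a\<in>{qi, qj, qk}. \<Sum>b\<in>{qi, qj, qk}. (LINT y|S3_vol. ?H a b y) / 2)"
      by (intro sum.cong refl h2)
    finally show ?thesis .
  qed
  have point: "4 * pi\<^sup>2 * (BS V y \<bullet> V y) = ?G qi qj qk y - ?G qi qk qj y + (?G qj qk qi y - ?G qj qi qk y)
     + (?G qk qi qj y - ?G qk qj qi y) - (?D qi y + ?D qj y + ?D qk y)
     + (1 / 2) * ((?H qi qi y + ?H qi qj y + ?H qi qk y) + (?H qj qi y + ?H qj qj y + ?H qj qk y) + (?H qk qi y + ?H qk qj y + ?H qk qk y))"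
    if y: "y \<in> S3" for y
  proof -
    have cyc: "cyclic_units qi qj qk" "cyclic_units qj qk qi" "cyclic_units qk qi qj"
      by (simp_all add: cyclic_units_def)
    have split: "(LINT x|S3_vol. hk (x \<bullet> y) * Lie a (field_div V) x) =
       (LINT x|S3_vol. hk (x \<bullet> y) * Lie a (Lie qi (coef V qi)) x) + (LINT x|S3_vol. hk (x \<bullet> y) * Lie a (Lie qj (coef V qj)) x)
        + (LINT x|S3_vol. hk (x \<bullet> y) * Lie a (Lie qk (coef V qk)) x)" if a: "imaginary_unit a" for a
    proof -
      have sL: "smooth_away_0 (Lie b (coef V b))" for b by (rule smooth_Lie[OF s])
      have i: "integrable S3_vol (\<lambda>x. hk (x \<bullet> y) * Lie a (Lie b (coef V b)) x)" for b
        by (rule hk_by_parts(1)[OF y a a smooth_Lie[OF sL]])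
      have "Lie a (field_div V) x = Lie a (Lie qi (coef V qi)) x + Lie a (Lie qj (coef V qj)) x + Lie a (Lie qk (coef V qk)) x"
        if "x \<in> S3" for x
        unfolding field_div_def[abs_def]
        using S3_nonzero[OF that] by (simp add: Lie_add[OF smooth_add[OF sL sL] sL] Lie_add[OF sL sL])
      then have "(LINT x|S3_vol. hk (x \<bullet> y) * Lie a (field_div V) x) = (LINT x|S3_vol. hk (x \<bullet> y) * Lie a (Lie qi (coef V qi)) x
        + hk (x \<bullet> y) * Lie a (Lie qj (coef V qj)) x + hk (x \<bullet> y) * Lie a (Lie qk (coef V qk)) x)"
        by (intro Bochner_Integration.integral_cong refl) (simp add: distrib_left)
      then show ?thesis using i by simp
    qed
    have "BS V y \<bullet> V y = (BS V y \<bullet> qmul y qi) * coef V qi y + (BS V y \<bullet> qmul y qj) * coef V qj y + (BS V y \<bullet> qmul y qk) * coef V qk y"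
      by (subst field_expansion[OF V y]) (simp add: inner_add_right mult.commute)
    then have "4 * pi\<^sup>2 * (BS V y \<bullet> V y) = (4 * pi\<^sup>2 * (BS V y \<bullet> qmul y qi)) * coef V qi y
       + (4 * pi\<^sup>2 * (BS V y \<bullet> qmul y qj)) * coef V qj y + (4 * pi\<^sup>2 * (BS V y \<bullet> qmul y qk)) * coef V qk y"
      by (simp add: algebra_simps)
    then show ?thesis
      unfolding biot_savart_coef[OF BS V y cyc(1)] biot_savart_coef[OF BS V y cyc(2)] biot_savart_coef[OF BS V y cyc(3)]
        split[OF u(1)] split[OF u(2)] split[OF u(3)]
      by (simp add: algebra_simps add_divide_distrib)
  qed
  have "4 * pi\<^sup>2 * helicity (\<bullet>) S3_vol BS V = (LINT y|S3_vol. 4 * pi\<^sup>2 * (BS V y \<bullet> V y))"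
    by (simp add: helicity_def)
  also have "\<dots> = (LINT y|S3_vol. ?G qi qj qk y - ?G qi qk qj y + (?G qj qk qi y - ?G qj qi qk y)
     + (?G qk qi qj y - ?G qk qj qi y) - (?D qi y + ?D qj y + ?D qk y)
     + (1 / 2) * ((?H qi qi y + ?H qi qj y + ?H qi qk y) + (?H qj qi y + ?H qj qj y + ?H qj qk y) + (?H qk qi y + ?H qk qj y + ?H qk qk y)))"
    by (intro Bochner_Integration.integral_cong refl) (simp only: point space_S3_vol)
  also have "\<dots> = (LINT p|(S3_vol \<Otimes>\<^sub>M S3_vol). linking_integrand V p)
     - (LINT p|(S3_vol \<Otimes>\<^sub>M S3_vol). dot_integrand V p) + (LINT p|(S3_vol \<Otimes>\<^sub>M S3_vol). hess_integrand V p)"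
  proof -
    have gen: "(LINT y|S3_vol. f1 y - f2 y + (f3 y - f4 y) + (f5 y - f6 y) - (d1 y + d2 y + d3 y)
         + (1 / 2) * ((h1 y + h2 y + h3 y) + (h4 y + h5 y + h6 y) + (h7 y + h8 y + h9 y)))
      = (LINT y|S3_vol. f1 y) - (LINT y|S3_vol. f2 y) + ((LINT y|S3_vol. f3 y) - (LINT y|S3_vol. f4 y))
         + ((LINT y|S3_vol. f5 y) - (LINT y|S3_vol. f6 y))
         - ((LINT y|S3_vol. d1 y) + (LINT y|S3_vol. d2 y) + (LINT y|S3_vol. d3 y))
         + (1 / 2) * (((LINT y|S3_vol. h1 y) + (LINT y|S3_vol. h2 y) + (LINT y|S3_vol. h3 y))
           + ((LINT y|S3_vol. h4 y) + (LINT y|S3_vol. h5 y) + (LINT y|S3_vol. h6 y))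
           + ((LINT y|S3_vol. h7 y) + (LINT y|S3_vol. h8 y) + (LINT y|S3_vol. h9 y)))"
      if "integrable S3_vol f1" "integrable S3_vol f2" "integrable S3_vol f3" "integrable S3_vol f4"
        "integrable S3_vol f5" "integrable S3_vol f6" "integrable S3_vol d1" "integrable S3_vol d2" "integrable S3_vol d3"
        "integrable S3_vol h1" "integrable S3_vol h2" "integrable S3_vol h3" "integrable S3_vol h4" "integrable S3_vol h5"
        "integrable S3_vol h6" "integrable S3_vol h7" "integrable S3_vol h8" "integrable S3_vol h9"
      for f1 f2 f3 f4 f5 f6 d1 d2 d3 h1 h2 h3 h4 h5 h6 h7 h8 h9 :: "real^4 \<Rightarrow> real"
      using that by simp
    have HH: "(\<Sum>a\<in>{qi, qj, qk}. \<Sum>b\<in>{qi, qj, qk}. (LINT y|S3_vol. ?H a b y) / 2)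
      = (1 / 2) * (((LINT y|S3_vol. ?H qi qi y) + (LINT y|S3_vol. ?H qi qj y) + (LINT y|S3_vol. ?H qi qk y))
       + ((LINT y|S3_vol. ?H qj qi y) + (LINT y|S3_vol. ?H qj qj y) + (LINT y|S3_vol. ?H qj qk y))
       + ((LINT y|S3_vol. ?H qk qi y) + (LINT y|S3_vol. ?H qk qj y) + (LINT y|S3_vol. ?H qk qk y)))"
      by simp
    have DD: "(\<Sum>a\<in>{qi, qj, qk}. LINT y|S3_vol. ?D a y) = (LINT y|S3_vol. ?D qi y) + (LINT y|S3_vol. ?D qj y) + (LINT y|S3_vol. ?D qk y)"
      by simp
    show ?thesis
      unfolding L D H HH DD
      by (rule gen) (rule g3 product_pair_integral(3)[OF s s] | (rule h3; simp))+
  qed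
  finally show "4 * pi\<^sup>2 * helicity (\<bullet>) S3_vol BS V = (LINT p|(S3_vol \<Otimes>\<^sub>M S3_vol). linking_integrand V p)
     - (LINT p|(S3_vol \<Otimes>\<^sub>M S3_vol). dot_integrand V p) + (LINT p|(S3_vol \<Otimes>\<^sub>M S3_vol). hess_integrand V p)" .
qed

section \<open>The integrands on the sphere\<close>

lemma S3_abs_inner_1:
  assumes x: "x \<in> S3" and y: "y \<in> S3" and "\<not> \<bar>x \<bullet> y\<bar> < 1"
  shows "x \<bullet> y = 1 \<and> y = x \<or> x \<bullet> y = - 1 \<and> y = - x"
proof -
  have n: "x \<bullet> x = 1" "y \<bullet> y = 1" using x y by (simp_all add: S3_iff(1))
  consider "x \<bullet> y = 1" | "x \<bullet> y = - 1" using assms(3) S3_inner_bound[OF x y] by linarith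
  then show ?thesis
  proof cases
    case 1
    then have "(y - x) \<bullet> (y - x) = 0" using n by (simp add: inner_diff_left inner_diff_right inner_commute)
    then show ?thesis using 1 by simp
  next
    case 2
    then have "(y + x) \<bullet> (y + x) = 0" using n by (simp add: inner_add_left inner_add_right inner_commute)
    then show ?thesis using 2 by (simp add: eq_neg_iff_add_eq_0)
  qed
qed

lemma S3_grad_zonal_pole:
  assumes x: "x \<in> S3" and y: "y \<in> S3" and t: "\<not> \<bar>x \<bullet> y\<bar> < 1"
  shows "S3_grad (\<lambda>z. k (S3_dist x z)) y = 0"
proof (rule S3.grad_even[OF y])
  fix u t
  assume "y \<bullet> u = 0"
  then have "x \<bullet> u = 0" using S3_abs_inner_1[OF assms] by auto
  then show "k (S3_dist x (cos t *\<^sub>R y + sin t *\<^sub>R u)) = k (S3_dist x (cos t *\<^sub>R y - sin t *\<^sub>R u))"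
    by (simp add: S3_dist_def inner_add_right inner_diff_right)
qed

lemma arccos_open: "\<bar>s\<bar> < 1 \<Longrightarrow> arccos s \<noteq> pi \<and> sin (arccos s) = sqrt (1 - s\<^sup>2) \<and> cos (arccos s) = s \<and> 0 < arccos s"
  using arccos_lt_bounded[of s] by (auto simp: abs_less_iff sin_arccos)

text \<open>
  The gradient of \<open>\<phi>\<^sub>1\<close> sees \<open>hk\<close> only up to a constant.\<close>

lemma S3_kernel_values:
  assumes "\<bar>s\<bar> < 1"
  shows "S3_phi0 (arccos s) = 1 / (4 * pi\<^sup>2) * gk s" "S3_phi (arccos s) = 1 / (4 * pi\<^sup>2) * pk s"
    "S3_phi1 (arccos s) = 1 / (16 * pi\<^sup>2) * hk s - 1 / 16"
proof -
  note a = arccos_open[OF assms]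
  have d: "0 < 1 - s\<^sup>2" by (rule one_minus_square_pos[OF assms])
  show "S3_phi0 (arccos s) = 1 / (4 * pi\<^sup>2) * gk s" "S3_phi (arccos s) = 1 / (4 * pi\<^sup>2) * pk s"
    using a assms by (simp_all add: S3_phi0_def S3_phi_def gk_def pk_def cot_def)
  have "hk s = (pi - arccos s)\<^sup>2"
    using d assms by (simp add: hk_def pk_def power_divide)
  moreover have "- 1 / (16 * pi\<^sup>2) * a * (2 * pi - a) = 1 / (16 * pi\<^sup>2) * (pi - a)\<^sup>2 - 1 / 16" for a
    by (simp add: power2_eq_square field_simps)
  ultimately show "S3_phi1 (arccos s) = 1 / (16 * pi\<^sup>2) * hk s - 1 / 16"
    by (simp only: S3_phi1_def)
qed

lemma S3_grad_zonal:
  assumes y: "y \<in> S3" and t: "\<bar>x \<bullet> y\<bar> < 1"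
    and k: "\<And>s. \<bar>s\<bar> < 1 \<Longrightarrow> f (arccos s) = k s" "(k has_real_derivative k') (at (x \<bullet> y))"
  shows "S3_grad (\<lambda>z. f (S3_dist x z)) y = k' *\<^sub>R (x - (x \<bullet> y) *\<^sub>R y)"
proof -
  have "S3_grad (\<lambda>z. f (S3_dist x z)) y = k' *\<^sub>R (x - (1 * (x \<bullet> y)) *\<^sub>R y)"
    by (rule S3.grad_zonal[OF y _ _ _ k(2), where I="{-1<..<1}"]) (use t k(1) in \<open>auto simp: S3_dist_def abs_less_iff\<close>)
  then show ?thesis by simp
qed

lemma S3_grad_phi0:
  assumes "y \<in> S3" "\<bar>x \<bullet> y\<bar> < 1"
  shows "S3_grad (\<lambda>z. S3_phi0 (S3_dist x z)) y = (1 / (4 * pi\<^sup>2) * gk' (x \<bullet> y)) *\<^sub>R (x - (x \<bullet> y) *\<^sub>R y)"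
  by (rule S3_grad_zonal[OF assms S3_kernel_values(1) DERIV_cmult[OF gk_derivative[OF assms(2)]]])

lemma S3_grad_phi:
  assumes "y \<in> S3" "\<bar>x \<bullet> y\<bar> < 1"
  shows "S3_grad (\<lambda>z. S3_phi (S3_dist x z)) y = (1 / (4 * pi\<^sup>2) * pk' (x \<bullet> y)) *\<^sub>R (x - (x \<bullet> y) *\<^sub>R y)"
  by (rule S3_grad_zonal[OF assms S3_kernel_values(2) DERIV_cmult[OF pk_derivative[OF assms(2)]]])

lemma S3_grad_phi1:
  assumes "y \<in> S3" "\<bar>x \<bullet> y\<bar> < 1"
  shows "S3_grad (\<lambda>z. S3_phi1 (S3_dist x z)) y = (1 / (8 * pi\<^sup>2) * pk (x \<bullet> y)) *\<^sub>R (x - (x \<bullet> y) *\<^sub>R y)"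
proof -
  have "((\<lambda>s. 1 / (16 * pi\<^sup>2) * hk s - 1 / 16) has_real_derivative 1 / (16 * pi\<^sup>2) * (2 * pk (x \<bullet> y)) - 0) (at (x \<bullet> y))"
    by (intro DERIV_diff DERIV_cmult hk_derivative[OF assms(2)] DERIV_const)
  from S3_grad_zonal[OF assms S3_kernel_values(3) this] show ?thesis by simp
qed

lemma S3_left_frame:
  assumes "x \<in> S3"
  shows "S3_left x z w = qmul z (qmul (qcnj x) w)"
  using assms by (simp add: S3_left_def qinv_S3 qmul_assoc)

lemma left_coordinates:
  assumes V: "S3_field V" and x: "x \<in> S3"
  shows "qmul (qcnj x) (V x) = coef V qi x *\<^sub>R qi + coef V qj x *\<^sub>R qj + coef V qk x *\<^sub>R qk"
proof -
  have "qmul (qcnj x) (qmul x a) = a" for a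
    using x by (simp add: qmul_assoc[symmetric] qmul_qcnj_left S3_iff(1) qmul_linear_simps)
  then show ?thesis by (subst field_expansion[OF V x]) (simp add: qmul_linear_simps)
qed

lemma S3_left_coordinates:
  assumes V: "S3_field V" and x: "x \<in> S3"
  shows "S3_left x y (V x) = coef V qi x *\<^sub>R qmul y qi + coef V qj x *\<^sub>R qmul y qj + coef V qk x *\<^sub>R qmul y qk"
  by (simp add: S3_left_frame[OF x] left_coordinates[OF V x] qmul_linear_simps)

lemma S3_cross_inner: "y \<in> S3 \<Longrightarrow> S3_cross y a b \<bullet> d = det4 y a b d"
  using S3.cross_eq[of y 1 a b] by (simp add: S3_cofactor)

lemma det4_frame:
  assumes "y \<in> S3"
  shows "det4 y (qmul y qi) (qmul y qj) d = qmul y qk \<bullet> d" "det4 y (qmul y qj) (qmul y qk) d = qmul y qi \<bullet> d"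
    "det4 y (qmul y qk) (qmul y qi) d = qmul y qj \<bullet> d" "det4 y (qmul y qj) (qmul y qi) d = - (qmul y qk \<bullet> d)"
    "det4 y (qmul y qk) (qmul y qj) d = - (qmul y qi \<bullet> d)" "det4 y (qmul y qi) (qmul y qk) d = - (qmul y qj \<bullet> d)"
proof -
  have yy: "y \<bullet> y = 1" using assms by (simp add: S3_iff(1))
  show 1: "det4 y (qmul y qi) (qmul y qj) d = qmul y qk \<bullet> d" "det4 y (qmul y qj) (qmul y qk) d = qmul y qi \<bullet> d"
    "det4 y (qmul y qk) (qmul y qi) d = qmul y qj \<bullet> d"
    unfolding S3_cofactor[symmetric] cofactor_frame by (simp_all add: yy)
  have sw: "det4 y a b d = - det4 y b a d" for a b by (simp add: det4_expand algebra_simps)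
  show "det4 y (qmul y qj) (qmul y qi) d = - (qmul y qk \<bullet> d)"
    "det4 y (qmul y qk) (qmul y qj) d = - (qmul y qi \<bullet> d)" "det4 y (qmul y qi) (qmul y qk) d = - (qmul y qj \<bullet> d)"
    using 1 sw[of "qmul y qj" "qmul y qi"] sw[of "qmul y qk" "qmul y qj"] sw[of "qmul y qi" "qmul y qk"] by simp_all
qed

text \<open>
  Right multiplication by \<open>a\<close> is skew, so exchanging \<open>x\<close> and \<open>y\<close> changes the sign.\<close>

lemma frame_swap: "imaginary_unit a \<Longrightarrow> qmul y a \<bullet> x = - (qmul x a \<bullet> y)"
  by (auto simp: imaginary_unit_def quat_simps algebra_simps)

lemma frame_swap_product:
  "imaginary_unit a \<Longrightarrow> imaginary_unit b \<Longrightarrow> qmul y (qmul b a) \<bullet> x = qmul x (qmul a b) \<bullet> y"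
  by (auto simp: imaginary_unit_def quat_simps algebra_simps)

text \<open>
  Division by \<open>1 - t\<^sup>2 = 0\<close> gives 0, so the coordinate expressions are 0 at the poles.\<close>

lemma kernels_at_poles: "\<not> \<bar>t\<bar> < 1 \<Longrightarrow> \<bar>t\<bar> \<le> 1 \<Longrightarrow> pk t = 0 \<and> pk' t = 0 \<and> gk' t = 0"
proof -
  assume t: "\<not> \<bar>t\<bar> < 1" "\<bar>t\<bar> \<le> 1"
  then have "\<bar>t\<bar> = 1" by linarith
  then have "t\<^sup>2 = 1" by (metis power2_abs one_power2)
  then show ?thesis using t by (simp add: pk_def pk'_def gk'_def)
qed

lemma linking_term:
  assumes V: "S3_field V" and x: "x \<in> S3" and y: "y \<in> S3"
  shows "S3_cross y (S3_left x y (V x)) (V y) \<bullet> S3_grad (\<lambda>z. S3_phi0 (S3_dist x z)) y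
     = 1 / (4 * pi\<^sup>2) * linking_integrand V (x, y)"
proof (cases "\<bar>x \<bullet> y\<bar> < 1")
  case True
  note u = imaginary_units
  have "S3_cross y (S3_left x y (V x)) (V y) \<bullet> S3_grad (\<lambda>z. S3_phi0 (S3_dist x z)) y
     = 1 / (4 * pi\<^sup>2) * gk' (x \<bullet> y) * det4 y (S3_left x y (V x)) (V y) x"
    unfolding S3_grad_phi0[OF y True] S3_cross_inner[OF y] by (simp add: det4_linear det4_alternating)
  also have "det4 y (S3_left x y (V x)) (V y) x =
      (coef V qj x * coef V qk y - coef V qk x * coef V qj y) * (qmul y qi \<bullet> x)
    + (coef V qk x * coef V qi y - coef V qi x * coef V qk y) * (qmul y qj \<bullet> x)
    + (coef V qi x * coef V qj y - coef V qj x * coef V qi y) * (qmul y qk \<bullet> x)"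
    unfolding S3_left_coordinates[OF V x] field_expansion[OF V y]
    by (simp add: det4_linear det4_alternating det4_frame[OF y] algebra_simps)
  finally show ?thesis
    unfolding frame_swap[OF u(1), of y x] frame_swap[OF u(2), of y x] frame_swap[OF u(3), of y x]
    by (simp add: linking_integrand_def Let_def algebra_simps)
next
  case False
  then show ?thesis
    using S3_grad_zonal_pole[OF x y False] kernels_at_poles[OF False S3_inner_bound[OF x y]]
    by (simp add: linking_integrand_def Let_def)
qed

lemma dot_term:
  assumes V: "S3_field V" and x: "x \<in> S3" and y: "y \<in> S3"
  shows "S3_left x y (V x) \<bullet> V y = dot_integrand V (x, y)"
  unfolding S3_left_coordinates[OF V x] field_expansion[OF V y]
  using y by (simp add: inner_add_left inner_add_right frame_orthonormal S3_iff(1) dot_integrand_def)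

lemma S3_grad_inner:
  assumes y: "y \<in> S3" and f: "(f has_derivative f') (at y within S3)" and v: "v \<in> tangent (\<bullet>) y"
  shows "S3_grad f y \<bullet> v = f' v"
proof -
  have lin: "linear f'" using f has_derivative_linear by blast
  define w where "w = f' (qmul y qi) *\<^sub>R qmul y qi + f' (qmul y qj) *\<^sub>R qmul y qj + f' (qmul y qk) *\<^sub>R qmul y qk"
  have wv: "w \<bullet> v = f' v" if v: "v \<in> tangent (\<bullet>) y" for v
  proof -
    have "f' v = f' ((v \<bullet> qmul y qi) *\<^sub>R qmul y qi + (v \<bullet> qmul y qj) *\<^sub>R qmul y qj + (v \<bullet> qmul y qk) *\<^sub>R qmul y qk)"
      using tangent_frame_expansion[OF y v] by simp
    also have "\<dots> = w \<bullet> v"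
      using lin by (simp add: w_def linear_add linear_cmul inner_add_left inner_commute[of v] mult.commute)
    finally show ?thesis by simp
  qed
  have "S3_grad f y = w"
    by (rule S3.grad_eqI[OF y f _ wv]) (simp_all add: w_def tangent_def inner_add_right)
  then show ?thesis using wv[OF v] by simp
qed

text \<open>
  The function differentiated in the third integral. The component of \<open>x\<close> along \<open>z\<close> in the gradient
  drops out because a left translate of \<open>V x\<close> to \<open>z\<close> is tangent at \<open>z\<close>.\<close>

lemma hess_function:
  assumes V: "S3_field V" and x: "x \<in> S3" and z: "z \<in> S3"
  shows "S3_left x z (V x) \<bullet> S3_grad (\<lambda>w. S3_phi1 (S3_dist x w)) z
     = 1 / (8 * pi\<^sup>2) * (pk (x \<bullet> z) * (qmul z (qmul (qcnj x) (V x)) \<bullet> x))"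
proof -
  have orth: "qmul z (qmul (qcnj x) (V x)) \<bullet> z = 0"
    unfolding left_coordinates[OF V x] by (simp add: qmul_linear_simps inner_commute[of _ z] inner_add_right)
  show ?thesis
  proof (cases "\<bar>x \<bullet> z\<bar> < 1")
    case True
    then show ?thesis
      unfolding S3_grad_phi1[OF z True] S3_left_frame[OF x] by (simp add: inner_diff_right orth)
  next
    case False
    then show ?thesis
      using S3_grad_zonal_pole[OF x z False] kernels_at_poles[OF False S3_inner_bound[OF x z]] by simp
  qed
qed

text \<open>
  The rate \<open>O(1 + s)\<close>, which is the squared distance to the antipode, gives differentiability there.\<close>

lemma pk_near_antipode:
  assumes "-1 < s" "s \<le> - 1 / 2"
  shows "\<bar>pk s - 1\<bar> \<le> 6 * (1 + s)"
proof -
  have t: "\<bar>s\<bar> < 1" using assms by auto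
  have d: "0 < 1 - s\<^sup>2" by (rule one_minus_square_pos[OF t])
  have "1 + s * pk s = pk' s * (1 - s\<^sup>2)" using d by (simp add: pk'_def)
  then have "\<bar>1 + s * pk s\<bar> = \<bar>pk' s\<bar> * (1 - s\<^sup>2)" using d by (simp add: abs_mult)
  also have "\<dots> \<le> 1 * (1 - s\<^sup>2)" using pk'_bound_near_antipode[of s] assms d by (intro mult_right_mono) auto
  also have "1 - s\<^sup>2 = (1 - s) * (1 + s)" by (simp add: power2_eq_square algebra_simps)
  also have "1 * ((1 - s) * (1 + s)) \<le> 2 * (1 + s)"
  proof -
    have "(1 - s) * (1 + s) \<le> 2 * (1 + s)" using assms by (intro mult_right_mono) auto
    then show ?thesis by simp
  qed
  finally have b: "\<bar>1 + s * pk s\<bar> \<le> 2 * (1 + s)" .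
  have "s * pk s - s = (1 + s * pk s) - (1 + s)" by simp
  then have "\<bar>s * pk s - s\<bar> \<le> \<bar>1 + s * pk s\<bar> + \<bar>1 + s\<bar>" by (simp only: abs_triangle_ineq4)
  also have "\<dots> \<le> 2 * (1 + s) + (1 + s)" using b assms by (intro add_mono) auto
  finally have "\<bar>s * pk s - s\<bar> \<le> 3 * (1 + s)" by simp
  then have "\<bar>s\<bar> * \<bar>pk s - 1\<bar> \<le> 3 * (1 + s)" by (simp add: abs_mult[symmetric] right_diff_distrib)
  then have "1 / 2 * \<bar>pk s - 1\<bar> \<le> 3 * (1 + s)"
    by (rule order_trans[rotated]) (use assms in \<open>intro mult_right_mono; simp\<close>)
  then show ?thesis by simp
qed

lemma hess_term_regular:
  assumes V: "S3_field V" and x: "x \<in> S3" and y: "y \<in> S3" and t: "\<bar>x \<bullet> y\<bar> < 1"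
  shows "S3_grad (\<lambda>z. S3_left x z (V x) \<bullet> S3_grad (\<lambda>w. S3_phi1 (S3_dist x w)) z) y \<bullet> V y
     = 1 / (8 * pi\<^sup>2) * hess_integrand V (x, y)"
proof -
  let ?v = "qmul (qcnj x) (V x)"
  note u = imaginary_units
  have dpk: "((\<lambda>z. pk (x \<bullet> z)) has_derivative (\<lambda>h. pk' (x \<bullet> y) * (x \<bullet> h))) (at y)"
    using has_derivative_compose[OF bounded_linear_imp_has_derivative[OF bounded_linear_inner_right[of x]]
      pk_derivative[OF t, unfolded has_field_derivative_def]] .
  have "((\<lambda>z. qmul z ?v \<bullet> x) has_derivative (\<lambda>h. qmul h ?v \<bullet> x)) (at y)"
    by (intro bounded_linear_imp_has_derivative bounded_linear_compose[OF bounded_linear_inner_left bounded_linear_qmul_left])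
  from has_derivative_mult_right[OF has_derivative_mult[OF dpk this], of "1 / (8 * pi\<^sup>2)"]
  have d: "((\<lambda>z. 1 / (8 * pi\<^sup>2) * (pk (x \<bullet> z) * (qmul z ?v \<bullet> x))) has_derivative
     (\<lambda>h. 1 / (8 * pi\<^sup>2) * (pk (x \<bullet> y) * (qmul h ?v \<bullet> x) + pk' (x \<bullet> y) * (x \<bullet> h) * (qmul y ?v \<bullet> x)))) (at y within S3)"
    by (rule has_derivative_at_withinI)
  have "((\<lambda>z. S3_left x z (V x) \<bullet> S3_grad (\<lambda>w. S3_phi1 (S3_dist x w)) z) has_derivative
     (\<lambda>h. 1 / (8 * pi\<^sup>2) * (pk (x \<bullet> y) * (qmul h ?v \<bullet> x) + pk' (x \<bullet> y) * (x \<bullet> h) * (qmul y ?v \<bullet> x)))) (at y within S3)"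
    by (rule has_derivative_transform[OF y _ d]) (rule hess_function[OF V x])
  from S3_grad_inner[OF y this field_tangent[OF V y]]
  have 1: "S3_grad (\<lambda>z. S3_left x z (V x) \<bullet> S3_grad (\<lambda>w. S3_phi1 (S3_dist x w)) z) y \<bullet> V y
     = 1 / (8 * pi\<^sup>2) * (pk (x \<bullet> y) * (qmul (V y) ?v \<bullet> x) + pk' (x \<bullet> y) * (V y \<bullet> x) * (qmul y ?v \<bullet> x))"
    by (simp add: inner_commute[of x])
  have U: "{qi, qj, qk} = insert qi (insert qj (insert qk {}))" by simp
  have a: "(\<Sum>a\<in>{qi, qj, qk}. \<Sum>b\<in>{qi, qj, qk}. coef V b x * coef V a y * (qmul y (qmul a b) \<bullet> x)) = qmul (V y) ?v \<bullet> x"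
    unfolding left_coordinates[OF V x] field_expansion[OF V y]
    by (simp add: qmul_linear_simps qmul_assoc inner_add_left algebra_simps)
  have b: "(\<Sum>a\<in>{qi, qj, qk}. \<Sum>b\<in>{qi, qj, qk}. coef V b x * coef V a y * ((qmul y b \<bullet> x) * (qmul y a \<bullet> x)))
     = (V y \<bullet> x) * (qmul y ?v \<bullet> x)"
    unfolding left_coordinates[OF V x] field_expansion[OF V y]
    by (simp add: qmul_linear_simps inner_add_left algebra_simps)
  have k: "hess_kernel a b x y = pk' (x \<bullet> y) * ((qmul y b \<bullet> x) * (qmul y a \<bullet> x)) + pk (x \<bullet> y) * (qmul y (qmul a b) \<bullet> x)"
    if "a \<in> {qi, qj, qk}" "b \<in> {qi, qj, qk}" for a b
  proof -
    have ab: "imaginary_unit a" "imaginary_unit b" using that u by auto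
    show ?thesis
      by (simp add: hess_kernel_def frame_swap[OF ab(1), of y x] frame_swap[OF ab(2), of y x] frame_swap_product[OF ab(2,1), of y x])
  qed
  have "hess_integrand V (x, y) = (\<Sum>a\<in>{qi, qj, qk}. \<Sum>b\<in>{qi, qj, qk}.
      pk' (x \<bullet> y) * (coef V b x * coef V a y * ((qmul y b \<bullet> x) * (qmul y a \<bullet> x)))
      + pk (x \<bullet> y) * (coef V b x * coef V a y * (qmul y (qmul a b) \<bullet> x)))"
    unfolding hess_integrand_def by (intro sum.cong refl) (simp only: fst_conv snd_conv k, simp add: algebra_simps)
  also have "\<dots> = pk' (x \<bullet> y) * ((V y \<bullet> x) * (qmul y ?v \<bullet> x)) + pk (x \<bullet> y) * (qmul (V y) ?v \<bullet> x)"
    unfolding a[symmetric] b[symmetric] by (simp only: sum.distrib sum_distrib_left)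
  finally show ?thesis unfolding 1 by (simp add: algebra_simps)
qed

text \<open>
  Near \<open>z = x\<close> the potential \<open>\<phi>\<^sub>1\<close> is, to first order, a multiple of the distance, so its gradient
  jumps: along the geodesic in direction \<open>V x\<close> the function tends to \<open>- \<bar>V x\<bar> / (8 \<pi>)\<close>, while its
  value at \<open>x\<close> is 0. It is not differentiable, and the gradient is 0 by convention.\<close>

lemma hess_term_diagonal:
  assumes V: "S3_field V" and x: "x \<in> S3"
  shows "S3_grad (\<lambda>z. S3_left x z (V x) \<bullet> S3_grad (\<lambda>w. S3_phi1 (S3_dist x w)) z) x \<bullet> V x = 0"
proof (cases "V x = 0")
  case False
  let ?v = "qmul (qcnj x) (V x)"
  let ?f = "\<lambda>z. S3_left x z (V x) \<bullet> S3_grad (\<lambda>w. S3_phi1 (S3_dist x w)) z"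
  have xx: "x \<bullet> x = 1" using x by (simp add: S3_iff(1))
  define m where "m = norm (V x)"
  have m: "m > 0" using False by (simp add: m_def)
  define w where "w = (1 / m) *\<^sub>R V x"
  have w: "x \<bullet> w = 0" "w \<bullet> w = 1"
    using field_tangent[OF V x] m by (simp_all add: w_def m_def tangent_def dot_square_norm power2_eq_square)
  have xv: "qmul x ?v = V x" using x by (simp add: qmul_assoc[symmetric] qmul_qcnj_right S3_iff(1) qmul_linear_simps)
  have vre: "?v$1 = 0" unfolding left_coordinates[OF V x] by simp
  have wv: "qmul w ?v \<bullet> x = - m"
  proof -
    have "qmul w ?v \<bullet> x = - (w \<bullet> qmul x ?v)" using vre by (simp add: quat_simps algebra_simps)
    also have "\<dots> = - m" using m by (simp add: xv w_def m_def dot_square_norm power2_eq_square)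
    finally show ?thesis .
  qed
  have "\<not> ?f differentiable (at x within S3)"
  proof
    assume "?f differentiable (at x within S3)"
    then have c: "continuous (at x within S3) ?f" by (rule differentiable_imp_continuous_within)
    define \<gamma> where "\<gamma> t = cos t *\<^sub>R x + sin t *\<^sub>R w" for t
    have \<gamma>S: "\<gamma> t \<in> S3" for t unfolding \<gamma>_def by (rule S3.geodesic_M[OF x w])
    have "((\<lambda>t. \<gamma> t) \<longlongrightarrow> \<gamma> 0) (at_right 0)"
      unfolding \<gamma>_def by (intro tendsto_intros)
    then have \<gamma>l: "(\<gamma> \<longlongrightarrow> x) (at_right 0)" by (simp add: \<gamma>_def[abs_def])
    have lim: "((\<lambda>t. ?f (\<gamma> t)) \<longlongrightarrow> ?f x) (at_right 0)"
      by (rule continuous_within_tendsto_compose[OF c _ \<gamma>l]) (simp add: \<gamma>S)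
    have fx: "?f x = 0" using S3_grad_zonal_pole[OF x x, of S3_phi1] xx by simp
    have val: "?f (\<gamma> t) = - m / (8 * pi\<^sup>2) * (pi - t)" if t: "0 < t" "t < pi" for t
    proof -
      have s: "sin t > 0" using t by (rule sin_gt_zero)
      have xg: "x \<bullet> \<gamma> t = cos t" by (simp add: \<gamma>_def inner_add_right w xx)
      have "cos t < 1" "cos t > - 1" using cos_monotone_0_pi[of 0 t] cos_monotone_0_pi[of t pi] t by auto
      then have "\<bar>cos t\<bar> < 1" by auto
      then have pkt: "pk (cos t) = (pi - t) / sin t"
        using t s by (simp add: pk_def arccos_cos sin_squared_eq[symmetric])
      have "qmul (\<gamma> t) ?v \<bullet> x = - m * sin t"
        using w field_tangent[OF V x] by (simp add: \<gamma>_def qmul_linear_simps xv inner_add_left wv tangent_def inner_commute[of "V x"])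
      then show ?thesis unfolding hess_function[OF V x \<gamma>S] xg pkt using s by simp
    qed
    have "eventually (\<lambda>t. ?f (\<gamma> t) = - m / (8 * pi\<^sup>2) * (pi - t)) (at_right 0)"
      unfolding eventually_at_right_field using val pi_gt_zero by blast
    then have "((\<lambda>t. - m / (8 * pi\<^sup>2) * (pi - t)) \<longlongrightarrow> 0) (at_right 0)"
      by (rule tendsto_cong[THEN iffD1, OF _ lim[unfolded fx]])
    moreover have "((\<lambda>t. - m / (8 * pi\<^sup>2) * (pi - t)) \<longlongrightarrow> - m / (8 * pi\<^sup>2) * (pi - 0)) (at_right 0)"
      by (intro tendsto_intros)
    ultimately have "- m / (8 * pi\<^sup>2) * (pi - 0) = 0" using tendsto_unique trivial_limit_at_right_real by blast
    then show False using m by simp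
  qed
  then show ?thesis by (simp add: grad_def)
qed simp

text \<open>
  At the antipode \<open>pk\<close> extends continuously by 1, whereas \<open>pk (- 1) = 0\<close>. The function differentiated
  is nevertheless differentiable there, because the other factor vanishes at \<open>- x\<close>; its derivative is
  that of this factor times the limit 1.\<close>

lemma hess_term_antipode:
  assumes V: "S3_field V" and x: "x \<in> S3"
  shows "S3_grad (\<lambda>z. S3_left x z (V x) \<bullet> S3_grad (\<lambda>w. S3_phi1 (S3_dist x w)) z) (- x) \<bullet> V (- x)
     = 1 / (8 * pi\<^sup>2) * dot_integrand V (x, - x)"
proof -
  let ?v = "qmul (qcnj x) (V x)" and ?y = "- x"
  let ?f = "\<lambda>z. S3_left x z (V x) \<bullet> S3_grad (\<lambda>w. S3_phi1 (S3_dist x w)) z"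
  let ?L = "\<lambda>h. 1 / (8 * pi\<^sup>2) * (qmul h ?v \<bullet> x)"
  have y: "?y \<in> S3" using x by (simp add: S3_iff(2))
  have xx: "x \<bullet> x = 1" using x by (simp add: S3_iff(1))
  have xv: "qmul x ?v = V x" using x by (simp add: qmul_assoc[symmetric] qmul_qcnj_right S3_iff(1) qmul_linear_simps)
  have Ly: "qmul ?y ?v \<bullet> x = 0"
    using field_tangent[OF V x]
    by (simp add: bounded_bilinear.minus_left[OF bounded_bilinear_qmul] xv tangent_def inner_commute)
  have bl: "bounded_linear ?L"
    by (intro bounded_linear_mult_right[THEN bounded_linear_compose] bounded_linear_compose[OF bounded_linear_inner_left bounded_linear_qmul_left])
  have nv: "norm ?v = norm (V x)" using x by (simp add: norm_qmul S3_iff(2))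
  define C where "C = 3 * norm (V x) / (8 * pi\<^sup>2) + 1"
  have C: "C > 0" by (simp add: C_def add_nonneg_pos)
  have key: "\<bar>?f z - ?f ?y - ?L (z - ?y)\<bar> \<le> C * (norm (z - ?y))\<^sup>2 * norm (z - ?y)"
    if z: "z \<in> S3" and near: "norm (z - ?y) < 1" for z
  proof -
    let ?s = "x \<bullet> z"
    have n2: "(norm (z - ?y))\<^sup>2 = 2 * (1 + ?s)"
      using z xx by (simp add: power2_norm_eq_inner inner_add_left inner_add_right inner_commute S3_iff(1))
    have s: "- 1 \<le> ?s" "?s \<le> - 1 / 2"
    proof -
      show "- 1 \<le> ?s" using S3_inner_bound[OF x z] by linarith
      have "(norm (z - ?y))\<^sup>2 < 1" using near by (simp add: power_less_one_iff abs_square_less_1)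
      then have "2 * (1 + ?s) < 1" unfolding n2 .
      then show "?s \<le> - 1 / 2" by simp
    qed
    have fy: "?f ?y = 0" unfolding hess_function[OF V x y] by (simp add: Ly)
    have Lz: "?L (z - ?y) = 1 / (8 * pi\<^sup>2) * (qmul z ?v \<bullet> x)"
      using Ly by (simp only: qmul_linear_simps inner_diff_left diff_zero)
    have e: "?f z - ?f ?y - ?L (z - ?y) = 1 / (8 * pi\<^sup>2) * ((pk ?s - 1) * (qmul (z - ?y) ?v \<bullet> x))"
      unfolding fy Lz unfolding hess_function[OF V x z]
      using Ly by (simp only: qmul_linear_simps inner_diff_left diff_zero) (simp add: algebra_simps)
    show ?thesis
    proof (cases "?s = - 1")
      case True
      then have "z = ?y" using S3_abs_inner_1[OF x z] by auto
      then show ?thesis by (simp add: bounded_bilinear.zero_left[OF bounded_bilinear_qmul])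
    next
      case False
      then have "\<bar>pk ?s - 1\<bar> \<le> 6 * (1 + ?s)" using s by (intro pk_near_antipode) auto
      also have "\<dots> = 3 * (norm (z - ?y))\<^sup>2" using n2 by simp
      finally have p: "\<bar>pk ?s - 1\<bar> \<le> 3 * (norm (z - ?y))\<^sup>2" .
      have "\<bar>qmul (z - ?y) ?v \<bullet> x\<bar> \<le> norm (qmul (z - ?y) ?v) * norm x" by (rule Cauchy_Schwarz_ineq2)
      also have "\<dots> = norm (z - ?y) * norm (V x)" using x nv by (simp add: norm_qmul S3_iff(2))
      finally have q: "\<bar>qmul (z - ?y) ?v \<bullet> x\<bar> \<le> norm (z - ?y) * norm (V x)" .
      have "\<bar>?f z - ?f ?y - ?L (z - ?y)\<bar> = 1 / (8 * pi\<^sup>2) * (\<bar>pk ?s - 1\<bar> * \<bar>qmul (z - ?y) ?v \<bullet> x\<bar>)"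
        unfolding e by (simp add: abs_mult)
      also have "\<dots> \<le> 1 / (8 * pi\<^sup>2) * (3 * (norm (z - ?y))\<^sup>2 * (norm (z - ?y) * norm (V x)))"
        using p q by (intro mult_left_mono mult_mono) auto
      also have "\<dots> = (C - 1) * (norm (z - ?y))\<^sup>2 * norm (z - ?y)" by (simp add: C_def)
      also have "\<dots> \<le> C * (norm (z - ?y))\<^sup>2 * norm (z - ?y)" by (intro mult_right_mono) auto
      finally show ?thesis .
    qed
  qed
  have "(?f has_derivative ?L) (at ?y within S3)"
    unfolding has_derivative_within_alt
  proof (intro conjI bl allI impI)
    fix e :: real assume e: "0 < e"
    show "\<exists>d>0. \<forall>z\<in>S3. norm (z - ?y) < d \<longrightarrow> norm (?f z - ?f ?y - ?L (z - ?y)) \<le> e * norm (z - ?y)"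
    proof (intro exI[of _ "min 1 (e / C)"] conjI ballI impI)
      show "0 < min 1 (e / C)" using e C by simp
      fix z assume z: "z \<in> S3" "norm (z - ?y) < min 1 (e / C)"
      have "(norm (z - ?y))\<^sup>2 \<le> norm (z - ?y)"
        using z(2) by (simp add: power2_eq_square mult_left_le)
      then have "C * (norm (z - ?y))\<^sup>2 \<le> C * (e / C)" using z(2) C by (intro mult_left_mono) auto
      then have "C * (norm (z - ?y))\<^sup>2 \<le> e" using C by simp
      then have "C * (norm (z - ?y))\<^sup>2 * norm (z - ?y) \<le> e * norm (z - ?y)" by (rule mult_right_mono) simp
      then show "norm (?f z - ?f ?y - ?L (z - ?y)) \<le> e * norm (z - ?y)"
        using key[of z] z unfolding real_norm_def by linarith
    qed
  qed
  from S3_grad_inner[OF y this field_tangent[OF V y]]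
  have "S3_grad ?f ?y \<bullet> V ?y = 1 / (8 * pi\<^sup>2) * (qmul (V ?y) ?v \<bullet> x)" .
  also have "qmul (V ?y) ?v \<bullet> x = dot_integrand V (x, ?y)"
  proof -
    have vre: "?v$1 = 0" unfolding left_coordinates[OF V x] by simp
    have "qmul (V ?y) ?v \<bullet> x = - (V ?y \<bullet> qmul x ?v)" using vre by (simp add: quat_simps algebra_simps)
    also have "\<dots> = S3_left x ?y (V x) \<bullet> V ?y"
      by (simp add: S3_left_frame[OF x] bounded_bilinear.minus_left[OF bounded_bilinear_qmul] inner_commute)
    also have "\<dots> = dot_integrand V (x, ?y)" by (rule dot_term[OF V x y])
    finally show ?thesis .
  qed
  finally show ?thesis .
qed

text \<open>
  Pairs of equal or antipodal points form a null set, but the exact values on it show that the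
  integrand is measurable.\<close>

lemma hess_term:
  assumes V: "S3_field V" and x: "x \<in> S3" and y: "y \<in> S3"
  shows "S3_grad (\<lambda>z. S3_left x z (V x) \<bullet> S3_grad (\<lambda>w. S3_phi1 (S3_dist x w)) z) y \<bullet> V y
     = 1 / (8 * pi\<^sup>2) * (hess_integrand V (x, y) + (if x \<bullet> y = - 1 then dot_integrand V (x, y) else 0))"
proof (cases "\<bar>x \<bullet> y\<bar> < 1")
  case True
  then show ?thesis using hess_term_regular[OF V x y True] by auto
next
  case False
  have h0: "hess_integrand V (x, y) = 0"
    using kernels_at_poles[OF False S3_inner_bound[OF x y]] by (simp add: hess_integrand_def hess_kernel_def)
  from S3_abs_inner_1[OF x y False] show ?thesis
  proof
    assume "x \<bullet> y = 1 \<and> y = x"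
    then show ?thesis using hess_term_diagonal[OF V x] h0 by auto
  next
    assume "x \<bullet> y = - 1 \<and> y = - x"
    then show ?thesis using hess_term_antipode[OF V x] h0 S3_iff(1)[THEN iffD1, OF x] by simp
  qed
qed

text \<open>
  The transported vector enters a determinant that contains \<open>x\<close> and \<open>y\<close>, so it may be replaced by
  \<open>V x\<close>. In coordinates with respect to the frame at \<open>y\<close> the vector \<open>x\<close> has the components
  \<open>t, n1, n2, n3\<close>, and right multiplication by the units expresses the frame at \<open>x\<close> by them. The claim
  is then a polynomial identity modulo \<open>1 = p' (n1\<^sup>2 + n2\<^sup>2 + n3\<^sup>2) - t p\<close>, the differential equation
  of \<open>pk\<close>.\<close>

lemma transport_term:
  assumes V: "S3_field V" and x: "x \<in> S3" and y: "y \<in> S3"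
  shows "S3_cross y (S3_transport x y (V x)) (V y) \<bullet> S3_grad (\<lambda>z. S3_phi (S3_dist x z)) y
     = 1 / (4 * pi\<^sup>2) * (if \<bar>x \<bullet> y\<bar> < 1 then linking_integrand V (x, y) - dot_integrand V (x, y) + hess_integrand V (x, y) else 0)"
proof (cases "\<bar>x \<bullet> y\<bar> < 1")
  case True
  note u = imaginary_units
  let ?t = "x \<bullet> y"
  have yy: "y \<bullet> y = 1" using y by (simp add: S3_iff(1))
  note a = arccos_open[OF True]
  have "sin (arccos ?t) \<noteq> 0" using a one_minus_square_pos[OF True] by simp
  then have tr: "S3_transport x y (V x) = V x - (V x \<bullet> y / (1 + ?t)) *\<^sub>R (x + y)"
    unfolding S3_transport_def S3_dist_def
    using S3.transport_eq[OF x y field_tangent[OF V x], of "arccos ?t"] a by simp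
  have "S3_cross y (S3_transport x y (V x)) (V y) \<bullet> S3_grad (\<lambda>z. S3_phi (S3_dist x z)) y
     = 1 / (4 * pi\<^sup>2) * (pk' ?t * det4 y (S3_transport x y (V x)) (V y) x)"
    unfolding S3_grad_phi[OF y True] S3_cross_inner[OF y] by (simp add: det4_linear det4_alternating)
  also have "det4 y (S3_transport x y (V x)) (V y) x = det4 y (V x) (V y) x"
    unfolding tr by (simp add: det4_linear det4_alternating)
  also have "pk' ?t * det4 y (V x) (V y) x = linking_integrand V (x, y) - dot_integrand V (x, y) + hess_integrand V (x, y)"
  proof -
    define n1 n2 n3 where "n1 = qmul y qi \<bullet> x" and "n2 = qmul y qj \<bullet> x" and "n3 = qmul y qk \<bullet> x"
    define v1 v2 v3 where "v1 = coef V qi x" and "v2 = coef V qj x" and "v3 = coef V qk x"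
    define u1 u2 u3 where "u1 = coef V qi y" and "u2 = coef V qj y" and "u3 = coef V qk y"
    have n: "qmul x qi \<bullet> y = - n1" "qmul x qj \<bullet> y = - n2" "qmul x qk \<bullet> y = - n3"
      using frame_swap[OF u(1), of x y] frame_swap[OF u(2), of x y] frame_swap[OF u(3), of x y]
      by (simp_all add: n1_def n2_def n3_def)
    have sq: "n1\<^sup>2 + n2\<^sup>2 + n3\<^sup>2 = 1 - ?t\<^sup>2" using frame_parseval[OF x y] by (simp add: n)
    have xe: "x = ?t *\<^sub>R y + n1 *\<^sub>R qmul y qi + n2 *\<^sub>R qmul y qj + n3 *\<^sub>R qmul y qk"
      using frame_expansion[of y x] yy by (simp add: n1_def n2_def n3_def inner_commute)
    have Vy: "V y = u1 *\<^sub>R qmul y qi + u2 *\<^sub>R qmul y qj + u3 *\<^sub>R qmul y qk"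
      unfolding u1_def u2_def u3_def by (rule field_expansion[OF V y])
    have Vx: "V x = v1 *\<^sub>R qmul x qi + v2 *\<^sub>R qmul x qj + v3 *\<^sub>R qmul x qk"
      unfolding v1_def v2_def v3_def by (rule field_expansion[OF V x])
    have neg: "qmul y (- a) = - qmul y a" for a
      by (rule bounded_bilinear.minus_right[OF bounded_bilinear_qmul])
    have xi: "qmul x qi = ?t *\<^sub>R qmul y qi - n1 *\<^sub>R y - n2 *\<^sub>R qmul y qk + n3 *\<^sub>R qmul y qj"
      by (subst xe) (simp add: qmul_linear_simps qmul_assoc quaternion_products neg)
    have xj: "qmul x qj = ?t *\<^sub>R qmul y qj + n1 *\<^sub>R qmul y qk - n2 *\<^sub>R y - n3 *\<^sub>R qmul y qi"
      by (subst xe) (simp add: qmul_linear_simps qmul_assoc quaternion_products neg)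
    have xk: "qmul x qk = ?t *\<^sub>R qmul y qk - n1 *\<^sub>R qmul y qj + n2 *\<^sub>R qmul y qi - n3 *\<^sub>R y"
      by (subst xe) (simp add: qmul_linear_simps qmul_assoc quaternion_products neg)
    define X1 X2 X3 where "X1 = ?t * v1 + n2 * v3 - n3 * v2" and "X2 = ?t * v2 + n3 * v1 - n1 * v3" and "X3 = ?t * v3 + n1 * v2 - n2 * v1"
    have Vx': "V x = (- n1 * v1 - n2 * v2 - n3 * v3) *\<^sub>R y + X1 *\<^sub>R qmul y qi + X2 *\<^sub>R qmul y qj + X3 *\<^sub>R qmul y qk"
      unfolding Vx xi xj xk X1_def X2_def X3_def by (simp add: algebra_simps)
    have det: "det4 y (V x) (V y) x = (X2 * u3 - X3 * u2) * n1 + (X3 * u1 - X1 * u3) * n2 + (X1 * u2 - X2 * u1) * n3"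
      unfolding Vx' Vy
      by (simp add: det4_linear det4_alternating det4_frame[OF y] n1_def[symmetric] n2_def[symmetric] n3_def[symmetric] algebra_simps)
    have L: "linking_integrand V (x, y) = gk' ?t * ((v2 * u3 - v3 * u2) * n1 + (v3 * u1 - v1 * u3) * n2 + (v1 * u2 - v2 * u1) * n3)"
      unfolding linking_integrand_def Let_def fst_conv snd_conv n v1_def[symmetric] v2_def[symmetric] v3_def[symmetric]
        u1_def[symmetric] u2_def[symmetric] u3_def[symmetric] by (simp add: algebra_simps)
    have D: "dot_integrand V (x, y) = v1 * u1 + v2 * u2 + v3 * u3"
      by (simp add: dot_integrand_def v1_def v2_def v3_def u1_def u2_def u3_def)
    have negx: "qmul x (- a) \<bullet> y = - (qmul x a \<bullet> y)" for a
      by (simp add: bounded_bilinear.minus_right[OF bounded_bilinear_qmul])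
    have H: "hess_integrand V (x, y) = pk' ?t * ((n1 * v1 + n2 * v2 + n3 * v3) * (n1 * u1 + n2 * u2 + n3 * u3))
       + pk ?t * ((u2 * v3 - u3 * v2) * n1 + (u3 * v1 - u1 * v3) * n2 + (u1 * v2 - u2 * v1) * n3 - ?t * (v1 * u1 + v2 * u2 + v3 * u3))"
      unfolding hess_integrand_def hess_kernel_def fst_conv snd_conv
      by (simp add: quaternion_products negx n v1_def[symmetric] v2_def[symmetric] v3_def[symmetric]
        u1_def[symmetric] u2_def[symmetric] u3_def[symmetric] algebra_simps)
    have ode: "1 = pk' ?t * (n1\<^sup>2 + n2\<^sup>2 + n3\<^sup>2) - ?t * pk ?t"
      unfolding sq using one_minus_square_pos[OF True] by (simp add: pk'_def)
    \<comment> \<open>Used once, on the inner product, the differential equation makes the two sides equal as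
      polynomials.\<close>
    have D': "v1 * u1 + v2 * u2 + v3 * u3 = (pk' ?t * (n1\<^sup>2 + n2\<^sup>2 + n3\<^sup>2) - ?t * pk ?t) * (v1 * u1 + v2 * u2 + v3 * u3)"
      unfolding ode[symmetric] by simp
    show ?thesis
      unfolding det L H D gk'_def X1_def X2_def X3_def
      by (subst D') (simp add: power2_eq_square algebra_simps)
  qed
  finally show ?thesis using True by simp
next
  case False
  then show ?thesis using S3_grad_zonal_pole[OF x y False] by simp
qed

lemma helicity_left_translation:
  assumes BS: "S3_biot_savart BS" and V: "S3_field V"
  shows "helicity (\<bullet>) S3_vol BS V =
          (LINT (x, y)|(S3_vol \<Otimes>\<^sub>M S3_vol).
             S3_cross y (S3_left x y (V x)) (V y) \<bullet> S3_grad (\<lambda>z. S3_phi0 (S3_dist x z)) y)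
          - 1 / (4 * pi\<^sup>2) *
            (LINT (x, y)|(S3_vol \<Otimes>\<^sub>M S3_vol). S3_left x y (V x) \<bullet> V y)
          + 2 *
            (LINT (x, y)|(S3_vol \<Otimes>\<^sub>M S3_vol).
               S3_grad (\<lambda>z. S3_left x z (V x) \<bullet> S3_grad (\<lambda>w. S3_phi1 (S3_dist x w)) z) y \<bullet> V y)"
proof -
  note K = helicity_frame_kernel[OF BS V]
  have sp: "p \<in> space (S3_vol \<Otimes>\<^sub>M S3_vol) \<Longrightarrow> fst p \<in> S3 \<and> snd p \<in> S3" for p
    by (auto simp: space_pair_measure)
  have 1: "(LINT (x, y)|(S3_vol \<Otimes>\<^sub>M S3_vol).
      S3_cross y (S3_left x y (V x)) (V y) \<bullet> S3_grad (\<lambda>z. S3_phi0 (S3_dist x z)) y)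
      = 1 / (4 * pi\<^sup>2) * (LINT p|(S3_vol \<Otimes>\<^sub>M S3_vol). linking_integrand V p)"
    unfolding integral_mult_right_zero[symmetric] case_prod_beta
    by (rule Bochner_Integration.integral_cong[OF refl]) (simp only: linking_term[OF V] sp prod.collapse)
  have 2: "(LINT (x, y)|(S3_vol \<Otimes>\<^sub>M S3_vol). S3_left x y (V x) \<bullet> V y)
      = (LINT p|(S3_vol \<Otimes>\<^sub>M S3_vol). dot_integrand V p)"
    unfolding case_prod_beta
    by (rule Bochner_Integration.integral_cong[OF refl]) (simp only: dot_term[OF V] sp prod.collapse)
  have m: "hess_integrand V \<in> borel_measurable (S3_vol \<Otimes>\<^sub>M S3_vol)" "dot_integrand V \<in> borel_measurable (S3_vol \<Otimes>\<^sub>M S3_vol)"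
    using K(3,4) by auto
  have "(LINT (x, y)|(S3_vol \<Otimes>\<^sub>M S3_vol).
      S3_grad (\<lambda>z. S3_left x z (V x) \<bullet> S3_grad (\<lambda>w. S3_phi1 (S3_dist x w)) z) y \<bullet> V y)
      = (LINT p|(S3_vol \<Otimes>\<^sub>M S3_vol). 1 / (8 * pi\<^sup>2) * (hess_integrand V p + (if fst p \<bullet> snd p = - 1 then dot_integrand V p else 0)))"
    unfolding case_prod_beta
    by (rule Bochner_Integration.integral_cong[OF refl]) (simp only: hess_term[OF V] sp prod.collapse)
  also have "\<dots> = (LINT p|(S3_vol \<Otimes>\<^sub>M S3_vol). 1 / (8 * pi\<^sup>2) * hess_integrand V p)"
  proof (rule integral_cong_AE)
    show "(\<lambda>p. 1 / (8 * pi\<^sup>2) * (hess_integrand V p + (if fst p \<bullet> snd p = - 1 then dot_integrand V p else 0)))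
       \<in> borel_measurable (S3_vol \<Otimes>\<^sub>M S3_vol)"
      using m by measurable
    show "(\<lambda>p. 1 / (8 * pi\<^sup>2) * hess_integrand V p) \<in> borel_measurable (S3_vol \<Otimes>\<^sub>M S3_vol)" using m by simp
    show "AE p in S3_vol \<Otimes>\<^sub>M S3_vol. 1 / (8 * pi\<^sup>2) * (hess_integrand V p + (if fst p \<bullet> snd p = - 1 then dot_integrand V p else 0))
       = 1 / (8 * pi\<^sup>2) * hess_integrand V p"
      using AE_S3_pair_not_antipodal by eventually_elim auto
  qed
  finally have 3: "(LINT (x, y)|(S3_vol \<Otimes>\<^sub>M S3_vol).
      S3_grad (\<lambda>z. S3_left x z (V x) \<bullet> S3_grad (\<lambda>w. S3_phi1 (S3_dist x w)) z) y \<bullet> V y)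
      = 1 / (8 * pi\<^sup>2) * (LINT p|(S3_vol \<Otimes>\<^sub>M S3_vol). hess_integrand V p)" by simp
  show ?thesis unfolding 1 2 3 using K(1) by (simp add: field_simps)
qed

lemma helicity_parallel_transport:
  assumes BS: "S3_biot_savart BS" and V: "S3_field V"
  shows "helicity (\<bullet>) S3_vol BS V =
          (LINT (x, y)|(S3_vol \<Otimes>\<^sub>M S3_vol).
             S3_cross y (S3_transport x y (V x)) (V y) \<bullet> S3_grad (\<lambda>z. S3_phi (S3_dist x z)) y)"
proof -
  note K = helicity_frame_kernel[OF BS V]
  have sp: "p \<in> space (S3_vol \<Otimes>\<^sub>M S3_vol) \<Longrightarrow> fst p \<in> S3 \<and> snd p \<in> S3" for p
    by (auto simp: space_pair_measure)
  let ?I = "\<lambda>p. linking_integrand V p - dot_integrand V p + hess_integrand V p"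
  have m: "?I \<in> borel_measurable (S3_vol \<Otimes>\<^sub>M S3_vol)"
    using K(2,3,4) by auto
  have "(LINT (x, y)|(S3_vol \<Otimes>\<^sub>M S3_vol).
      S3_cross y (S3_transport x y (V x)) (V y) \<bullet> S3_grad (\<lambda>z. S3_phi (S3_dist x z)) y)
      = (LINT p|(S3_vol \<Otimes>\<^sub>M S3_vol). 1 / (4 * pi\<^sup>2) * (if \<bar>fst p \<bullet> snd p\<bar> < 1 then ?I p else 0))"
    unfolding case_prod_beta
    by (rule Bochner_Integration.integral_cong[OF refl]) (simp only: transport_term[OF V] sp prod.collapse)
  also have "\<dots> = (LINT p|(S3_vol \<Otimes>\<^sub>M S3_vol). 1 / (4 * pi\<^sup>2) * ?I p)"
  proof (rule integral_cong_AE)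
    show "(\<lambda>p. 1 / (4 * pi\<^sup>2) * (if \<bar>fst p \<bullet> snd p\<bar> < 1 then ?I p else 0)) \<in> borel_measurable (S3_vol \<Otimes>\<^sub>M S3_vol)"
      using m by measurable
    show "(\<lambda>p. 1 / (4 * pi\<^sup>2) * ?I p) \<in> borel_measurable (S3_vol \<Otimes>\<^sub>M S3_vol)" using m by simp
    show "AE p in S3_vol \<Otimes>\<^sub>M S3_vol. 1 / (4 * pi\<^sup>2) * (if \<bar>fst p \<bullet> snd p\<bar> < 1 then ?I p else 0) = 1 / (4 * pi\<^sup>2) * ?I p"
      using AE_S3_pair_not_antipodal by eventually_elim auto
  qed
  also have "\<dots> = helicity (\<bullet>) S3_vol BS V" using K by (simp add: field_simps)
  finally show ?thesis by simp
qed

section \<open>Hyperbolic space\<close>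

definition H3_height :: "real^3 \<Rightarrow> real" where "H3_height u = sqrt (1 + u \<bullet> u)"

lemma H3_height: "H3_height u > 0" "H3_height u * H3_height u = 1 + u \<bullet> u" "1 \<le> H3_height u"
  using one_plus_inner_pos[of u] by (simp_all add: H3_height_def)

lemma H3_chart_emb: "H3_chart u = H3_height u *\<^sub>R qone + emb u"
  by (simp add: H3_chart_def H3_height_def qone_def emb_def vec_eq_iff forall_4)

lemma lorentz_qone_emb [simp]:
  "lorentz qone qone = - 1" "lorentz qone (emb u) = 0" "lorentz (emb u) qone = 0" "lorentz (emb u) (emb v) = u \<bullet> v"
  by (simp_all add: lorentz_def qone_def emb_def inner_vec_def sum_3)

lemma H3_chart_H3: "H3_chart u \<in> H3"
  using H3_height[of u] by (simp add: H3_def H3_chart_emb lor.add_left lor.add_right lor.scaleR_left lor.scaleR_right)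

lemma H3_spatial:
  assumes "x \<in> H3"
  shows "x$1 = H3_height (spatial x)" "H3_chart (spatial x) = x"
proof -
  have "(x$1)\<^sup>2 = 1 + spatial x \<bullet> spatial x"
    using assms by (simp add: H3_def lorentz_def spatial_def inner_vec_def sum_3 power2_eq_square)
  moreover have "x$1 > 0" using assms by (simp add: H3_def)
  ultimately show 1: "x$1 = H3_height (spatial x)" unfolding H3_height_def by (metis real_sqrt_unique less_imp_le)
  show "H3_chart (spatial x) = x" unfolding H3_chart_emb 1[symmetric] using qone_spatial[of x] by simp
qed

lemma spatial_H3_chart [simp]: "spatial (H3_chart u) = u"
  unfolding H3_chart_emb using linear_spatial by (simp add: linear_add linear_cmul)

lemma H3_chart_re [simp]: "H3_chart u $ 1 = H3_height u"
  by (simp add: H3_chart_emb)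

lemma H3_chart_derivative:
  "(H3_chart has_derivative (\<lambda>h. ((u \<bullet> h) / H3_height u) *\<^sub>R qone + emb h)) (at u)"
proof -
  have p: "1 + u \<bullet> u > 0" by (rule one_plus_inner_pos)
  have "((\<lambda>u. 1 + u \<bullet> u) has_derivative (\<lambda>h. 2 * (u \<bullet> h))) (at u)"
    by (auto intro!: derivative_eq_intros simp: inner_commute)
  from has_derivative_compose[OF this DERIV_real_sqrt[OF p, unfolded has_field_derivative_def]]
  have "(H3_height has_derivative (\<lambda>h. (u \<bullet> h) / H3_height u)) (at u)"
    unfolding H3_height_def[abs_def] by (rule has_derivative_eq_rhs) (rule ext, simp add: field_simps)
  from has_derivative_add[OF has_derivative_scaleR_left[OF this] bounded_linear_imp_has_derivative[OF bounded_linear_emb]]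
  have "((\<lambda>u. H3_height u *\<^sub>R qone + emb u) has_derivative (\<lambda>h. ((u \<bullet> h) / H3_height u) *\<^sub>R qone + emb h)) (at u)"
    .
  then show ?thesis unfolding H3_chart_emb[abs_def] .
qed

definition H3_density :: "real^3 \<Rightarrow> real" where "H3_density u = 1 / H3_height u"

lemma H3_density_le_1: "H3_density u \<le> 1"
  using H3_height[of u] by (simp add: H3_density_def)

lemma H3_density_measurable [measurable]: "H3_density \<in> borel_measurable borel"
  unfolding H3_density_def H3_height_def by measurable

text \<open>
  The metric in this chart is \<open>I - u u\<^sup>T / (1 + \<bar>u\<bar>\<^sup>2)\<close>, with determinant \<open>1 / (1 + \<bar>u\<bar>\<^sup>2)\<close>.\<close>

lemma H3_vol_eq:
  "H3_vol = distr (density lborel (\<lambda>u. ennreal (H3_density u))) (restrict_space borel H3) H3_chart"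
proof -
  have "sqrt (det ((\<chi> i j. lorentz (frechet_derivative H3_chart (at u) (axis i 1)) (frechet_derivative H3_chart (at u) (axis j 1))) :: real^3^3))
    = H3_density u" for u
  proof -
    define N where "N = 1 + u \<bullet> u"
    have N: "N > 0" "H3_height u * H3_height u = N" by (simp_all add: N_def one_plus_inner_pos H3_height)
    have e: "frechet_derivative H3_chart (at u) = (\<lambda>h. ((u \<bullet> h) / H3_height u) *\<^sub>R qone + emb h)"
      using frechet_derivative_at[OF H3_chart_derivative] by simp
    have ax: "u \<bullet> axis i 1 = u $ i" "axis i 1 \<bullet> (axis j 1 :: real^3) = (if i = j then 1 else (0::real))" for i j :: 3
      by (simp add: inner_axis) (simp add: inner_axis_axis)
    have l: "lorentz (frechet_derivative H3_chart (at u) (axis i 1)) (frechet_derivative H3_chart (at u) (axis j 1))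
       = (if i = j then 1 else 0) - u$i * u$j / N" for i j
      unfolding e using H3_height[of u] N
      by (simp add: lor.add_left lor.add_right lor.scaleR_left lor.scaleR_right ax mult.commute)
    have N3: "u$1 * u$1 + u$2 * u$2 + u$3 * u$3 = N - 1" by (simp add: N_def inner_vec_def sum_3)
    have "det ((\<chi> i j. (if i = j then 1 else 0) - u$i * u$j / N) :: real^3^3) = 1 - (u$1 * u$1 + u$2 * u$2 + u$3 * u$3) / N"
      using N by (simp add: det_3 field_simps)
    also have "\<dots> = 1 / N" unfolding N3 using N by (simp add: field_simps)
    finally have "sqrt (det ((\<chi> i j. (if i = j then 1 else 0) - u$i * u$j / N) :: real^3^3)) = 1 / sqrt N"
      by (simp add: real_sqrt_divide)
    then show ?thesis by (simp add: l H3_density_def H3_height_def N_def)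
  qed
  then show ?thesis by (simp add: H3_vol_def riemannian_volume_def)
qed

lemma sets_H3_vol [simp, measurable_cong]: "sets H3_vol = sets (restrict_space borel H3)"
  by (simp add: H3_vol_eq)

lemma space_H3_vol [simp]: "space H3_vol = H3"
  by (simp add: H3_vol_eq space_restrict_space)

lemma H3_chart_measurable [measurable]: "H3_chart \<in> borel \<rightarrow>\<^sub>M restrict_space borel H3"
proof (rule measurable_restrict_space2)
  have "continuous_on UNIV H3_chart"
    by (intro continuous_at_imp_continuous_on ballI has_derivative_continuous[OF H3_chart_derivative])
  then show "H3_chart \<in> borel_measurable borel" by (rule borel_measurable_continuous_onI)
qed (simp add: H3_chart_H3)

lemma nn_integral_H3_vol:
  assumes "f \<in> borel_measurable (restrict_space borel H3)"
  shows "(\<integral>\<^sup>+x. f x \<partial>H3_vol) = (\<integral>\<^sup>+u. ennreal (H3_density u) * f (H3_chart u) \<partial>lborel)"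
proof -
  have [measurable]: "f \<in> borel_measurable (restrict_space borel H3)" by fact
  show ?thesis
    unfolding H3_vol_eq by (subst nn_integral_distr) (auto simp: nn_integral_density)
qed

lemma ident_H3_vol: "(\<lambda>x. x) \<in> H3_vol \<rightarrow>\<^sub>M borel"
  unfolding measurable_cong_sets[OF sets_H3_vol refl] by (rule measurable_restrict_space1) simp

lemma continuous_measurable_H3: "f \<in> borel_measurable borel \<Longrightarrow> f \<in> borel_measurable H3_vol"
  using measurable_compose[OF ident_H3_vol] .

lemma vec_nth_measurable: "f \<in> borel_measurable M \<Longrightarrow> (\<lambda>x. (f x :: real^4) $ i) \<in> borel_measurable M"
  by (rule measurable_compose[OF _ borel_measurable_continuous_onI]) (auto intro: continuous_intros)

lemma det4_measurable:
  "a \<in> borel_measurable M \<Longrightarrow> b \<in> borel_measurable M \<Longrightarrow> c \<in> borel_measurable M \<Longrightarrow> d \<in> borel_measurable M \<Longrightarrow>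
   (\<lambda>p. det4 (a p) (b p) (c p) (d p)) \<in> borel_measurable M"
  unfolding det4_expand
  by (intro borel_measurable_add borel_measurable_diff borel_measurable_times vec_nth_measurable)

lemma lorentz_measurable:
  "a \<in> borel_measurable M \<Longrightarrow> b \<in> borel_measurable M \<Longrightarrow> (\<lambda>p. lorentz (a p) (b p)) \<in> borel_measurable M"
  unfolding lorentz_def
  by (intro borel_measurable_add borel_measurable_diff borel_measurable_times vec_nth_measurable)

subsection \<open>The singularity of the kernel\<close>

text \<open>
  \<open>- lorentz x y - 1\<close> is \<open>cosh \<alpha> - 1\<close>, and its double is the difference of the squared distances of
  the spatial parts and of the time components. For points of height at most \<open>A\<close> the second is smaller
  by a factor \<open>1 - 1 / A\<^sup>2\<close>, because \<open>\<bar>u\<bar> < a\<close> with a uniform margin. Hence \<open>cosh \<alpha> - 1\<close> is at least a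
  multiple of \<open>\<bar>u - w\<bar>\<^sup>2\<close> on bounded sets.\<close>

lemma H3_gap:
  assumes x: "x \<in> H3" "x$1 \<le> A" and y: "y \<in> H3" "y$1 \<le> A"
  shows "(norm (spatial x - spatial y))\<^sup>2 \<le> 2 * A\<^sup>2 * (- lorentz x y - 1)"
    and "\<bar>x$1 - y$1\<bar> \<le> norm (spatial x - spatial y)"
proof -
  define u w where "u = spatial x" and "w = spatial y"
  define a b where "a = x$1" and "b = y$1"
  have ab: "a \<ge> 1" "b \<ge> 1" "a * a = 1 + u \<bullet> u" "b * b = 1 + w \<bullet> w" "a \<le> A" "b \<le> A"
    using H3_spatial(1)[OF x(1)] H3_spatial(1)[OF y(1)] H3_height[of u] H3_height[of w] x y by (simp_all add: a_def b_def u_def w_def)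
  have A: "A \<ge> 1" using ab by linarith
  define D where "D = (norm (u - w))\<^sup>2"
  have xy: "- lorentz x y = a * b - u \<bullet> w"
    by (simp add: lorentz_def a_def b_def u_def w_def spatial_def inner_vec_def sum_3)
  have D: "D = a * a + b * b - 2 - 2 * (u \<bullet> w)"
    using ab by (simp add: D_def power2_norm_eq_inner inner_diff_left inner_diff_right inner_commute)
  define r where "r = 1 - 1 / A\<^sup>2"
  have A2: "1 \<le> A\<^sup>2" using A by (simp add: one_le_power)
  have r: "0 \<le> r" "r \<le> 1" using le_divide_eq_1_pos[of "A\<^sup>2" "A\<^sup>2"] frac_le[of 1 1 1 "A\<^sup>2"] A2 by (auto simp: r_def)
  have nu: "norm u \<le> a * sqrt r" if "a \<ge> 1" "a * a = 1 + u \<bullet> u" "a \<le> A" for a and u :: "real^3"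
  proof (rule power2_le_imp_le)
    have "a * a \<le> A\<^sup>2" using mult_mono[of a A a A] that by (simp add: power2_eq_square)
    then have "a * a / A\<^sup>2 \<le> 1" using A2 by (subst pos_divide_le_eq) auto
    then have "u \<bullet> u \<le> a * a * r" using that(2) by (simp add: r_def right_diff_distrib)
    then show "(norm u)\<^sup>2 \<le> (a * sqrt r)\<^sup>2"
      unfolding power2_norm_eq_inner power_mult_distrib real_sqrt_pow2[OF r(1)] by (simp add: power2_eq_square)
    show "0 \<le> a * sqrt r" using that r by simp
  qed
  have "\<bar>a - b\<bar> * (a + b) = \<bar>(u - w) \<bullet> (u + w)\<bar>"
  proof -
    have "(a - b) * (a + b) = (u - w) \<bullet> (u + w)"
      using ab by (simp add: inner_diff_left inner_add_right inner_commute algebra_simps)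
    then show ?thesis using ab by (metis abs_mult abs_of_nonneg add_nonneg_nonneg order_trans zero_le_one)
  qed
  also have "\<dots> \<le> norm (u - w) * norm (u + w)" by (rule Cauchy_Schwarz_ineq2)
  also have "norm (u + w) \<le> (a + b) * sqrt r"
    using norm_triangle_ineq[of u w] nu[OF ab(1,3,5)] nu[OF ab(2,4,6)] by (simp add: distrib_right)
  finally have "\<bar>a - b\<bar> * (a + b) \<le> norm (u - w) * sqrt r * (a + b)"
    by (simp add: mult_left_mono mult.assoc mult.commute[of "a + b"])
  then have d: "\<bar>a - b\<bar> \<le> norm (u - w) * sqrt r" using ab by (simp add: mult_le_cancel_right)
  also have "\<dots> \<le> norm (u - w) * 1" using r by (intro mult_left_mono) auto
  finally show "\<bar>x$1 - y$1\<bar> \<le> norm (spatial x - spatial y)" by (simp add: a_def b_def u_def w_def)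
  have "(a - b)\<^sup>2 \<le> (norm (u - w) * sqrt r)\<^sup>2" using d by (metis abs_ge_zero power2_abs power_mono)
  also have "\<dots> = D * r" using r by (simp add: D_def power_mult_distrib)
  finally have "D - (a - b)\<^sup>2 \<ge> D / A\<^sup>2" by (simp add: r_def right_diff_distrib)
  moreover have "D - (a - b)\<^sup>2 = 2 * (- lorentz x y - 1)" unfolding xy D by (simp add: power2_eq_square algebra_simps)
  ultimately have "D / A\<^sup>2 \<le> 2 * (- lorentz x y - 1)" by simp
  then have "D \<le> 2 * (- lorentz x y - 1) * A\<^sup>2" using A by (subst (asm) pos_divide_le_eq) auto
  then show "(norm (spatial x - spatial y))\<^sup>2 \<le> 2 * A\<^sup>2 * (- lorentz x y - 1)"
    by (simp only: D_def u_def w_def mult.commute mult.left_commute)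
qed

lemma H3_lorentz_bound:
  assumes "x \<in> H3" "y \<in> H3" "x \<noteq> y"
  shows "lorentz x y < - 1"
proof -
  define A where "A = max (x$1) (y$1)"
  have A: "A > 0" using assms by (auto simp: A_def H3_def)
  have g: "(norm (spatial x - spatial y))\<^sup>2 \<le> 2 * A\<^sup>2 * (- lorentz x y - 1)"
    by (rule H3_gap(1)) (use assms in \<open>auto simp: A_def\<close>)
  have "spatial x \<noteq> spatial y" using H3_spatial(2) assms by metis
  then have "0 < (norm (spatial x - spatial y))\<^sup>2" by simp
  then have "0 < 2 * A\<^sup>2 * (- lorentz x y - 1)" using g by linarith
  then show "lorentz x y < - 1" using A by (simp add: zero_less_mult_iff)
qed

text \<open>
  With \<open>t = - cosh \<alpha>\<close>, csch \<open>\<alpha>\<close> is \<open>1 / sqrt (t\<^sup>2 - 1)\<close>, and this is its derivative with respect to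
  \<open>t\<close>. The value at \<open>t = - 1\<close> is 0.\<close>

definition hker :: "real \<Rightarrow> real" where "hker t = - t / ((t\<^sup>2 - 1) * sqrt (t\<^sup>2 - 1))"

lemma hker_measurable [measurable]: "hker \<in> borel_measurable borel"
  unfolding hker_def[abs_def] by measurable

lemma hker_derivative:
  assumes "t < - 1"
  shows "((\<lambda>t. 1 / sqrt (t\<^sup>2 - 1)) has_real_derivative hker t) (at t)"
proof -
  have "(- 1) * (- 1) < t * t" using mult_strict_mono'[of 1 "- t" 1 "- t"] assms by simp
  then have p: "t\<^sup>2 - 1 > 0" by (simp add: power2_eq_square)
  have "((\<lambda>t. t\<^sup>2 - 1) has_real_derivative 2 * t) (at t)" by (auto intro!: derivative_eq_intros)
  from DERIV_chain2[OF DERIV_real_sqrt[OF p] this]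
  have d: "((\<lambda>t. sqrt (t\<^sup>2 - 1)) has_real_derivative t / sqrt (t\<^sup>2 - 1)) (at t)" by (simp add: field_simps)
  have "((\<lambda>t. 1 / sqrt (t\<^sup>2 - 1)) has_real_derivative (0 * sqrt (t\<^sup>2 - 1) - 1 * (t / sqrt (t\<^sup>2 - 1))) / (sqrt (t\<^sup>2 - 1) * sqrt (t\<^sup>2 - 1))) (at t)"
    by (rule DERIV_divide[OF DERIV_const d]) (use p in auto)
  also have "(0 * sqrt (t\<^sup>2 - 1) - 1 * (t / sqrt (t\<^sup>2 - 1))) / (sqrt (t\<^sup>2 - 1) * sqrt (t\<^sup>2 - 1)) = hker t"
  proof -
    define S where "S = sqrt (t\<^sup>2 - 1)"
    have S: "S \<noteq> 0" "t\<^sup>2 - 1 = S * S" using p by (simp_all add: S_def)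
    have "(0 * S - 1 * (t / S)) / (S * S) = - t / ((S * S) * S)" using S(1) by (simp add: field_simps)
    then show ?thesis unfolding hker_def S_def[symmetric] S(2)[symmetric] .
  qed
  finally show ?thesis .
qed

lemma arcosh_facts: "t < - 1 \<Longrightarrow> sinh (arcosh (- t)) = sqrt (t\<^sup>2 - 1) \<and> cosh (arcosh (- t)) = - t \<and> 0 < arcosh (- t :: real)"
  using sinh_arcosh_real[of "- t"] cosh_arcosh_real[of "- t"] arcosh_real_gt_1_iff[of "- t"] by simp

lemma H3_grad_kernel:
  assumes x: "x \<in> H3" and y: "y \<in> H3" and f: "\<And>t. t < - 1 \<Longrightarrow> f (arcosh (- t)) = r * (1 / sqrt (t\<^sup>2 - 1))"
  shows "H3_grad (\<lambda>z. f (H3_dist x z)) y = (r * hker (lorentz x y)) *\<^sub>R (x + lorentz x y *\<^sub>R y)"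
proof (cases "x = y")
  case False
  have t: "lorentz x y < - 1" by (rule H3_lorentz_bound[OF x y False])
  have "H3_grad (\<lambda>z. f (H3_dist x z)) y = (r * hker (lorentz x y)) *\<^sub>R (x - (- 1 * lorentz x y) *\<^sub>R y)"
    by (rule H3.grad_zonal[OF y _ _ _ DERIV_cmult[OF hker_derivative[OF t]], where I="{..< - 1}"])
      (use t f in \<open>auto simp: H3_dist_def\<close>)
  then show ?thesis by simp
next
  case True
  have "H3_grad (\<lambda>z. f (H3_dist x z)) y = 0"
  proof (rule H3.grad_even[OF y])
    fix u t assume "lorentz y u = 0"
    then have "lorentz x u = 0" using True by simp
    then show "f (H3_dist x (cosh t *\<^sub>R y + sinh t *\<^sub>R u)) = f (H3_dist x (cosh t *\<^sub>R y - sinh t *\<^sub>R u))"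
      by (simp add: H3_dist_def lor.add_right lor.diff_right lor.scaleR_right)
  qed
  moreover have "lorentz x y = - 1" using True y by (simp add: H3_def)
  ultimately show ?thesis by (simp add: hker_def)
qed

lemma H3_grad_phi:
  assumes "x \<in> H3" "y \<in> H3"
  shows "H3_grad (\<lambda>z. H3_phi (H3_dist x z)) y = (1 / (4 * pi) * hker (lorentz x y)) *\<^sub>R (x + lorentz x y *\<^sub>R y)"
    and "H3_grad (\<lambda>z. H3_psi (H3_dist x z)) y = (- 1 / (4 * pi) * hker (lorentz x y)) *\<^sub>R (x + lorentz x y *\<^sub>R y)"
  by (rule H3_grad_kernel[OF assms]; simp add: H3_phi_def H3_psi_def arcosh_facts)+

lemma H3_transport_eq:
  assumes x: "x \<in> H3" and y: "y \<in> H3" and v: "v \<in> tangent lorentz x" and "x \<noteq> y"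
  shows "H3_transport x y v = v - (lorentz v y / (- 1 + lorentz x y)) *\<^sub>R (x + y)"
proof -
  have t: "lorentz x y < - 1" by (rule H3_lorentz_bound[OF x y \<open>x \<noteq> y\<close>])
  note a = arcosh_facts[OF t]
  have "(- 1) * (- 1) < lorentz x y * lorentz x y" using mult_strict_mono'[of 1 "- lorentz x y" 1 "- lorentz x y"] t by simp
  then have "sinh (arcosh (- lorentz x y)) \<noteq> 0" using a by (simp add: power2_eq_square)
  then show ?thesis
    unfolding H3_transport_def H3_dist_def using a by (intro H3.transport_eq[OF x y v]) auto
qed

lemma hker_diagonal: "x \<in> H3 \<Longrightarrow> hker (lorentz x x) = 0"
  by (simp add: H3_def hker_def)

text \<open>
  The multiples of \<open>x + y\<close> and \<open>y\<close> in the transported vector and in the gradient are killed by the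
  determinant.\<close>

lemma H3_linking_term:
  assumes V: "H3_field V" and x: "x \<in> H3" and y: "y \<in> H3"
  shows "lorentz (H3_cross s y (H3_transport x y (V x)) (V y)) (H3_grad (\<lambda>z. H3_phi (H3_dist x z)) y)
     = s / (4 * pi) * hker (lorentz x y) * det4 y (V x) (V y) x"
proof (cases "x = y")
  case False
  have v: "V x \<in> tangent lorentz x" using V x by (simp add: smooth_vector_field_def)
  show ?thesis
    unfolding H3_grad_phi(1)[OF x y] H3.cross_eq[OF y] H3_transport_eq[OF x y v False]
    by (simp add: lor.scaleR_left lor.scaleR_right H3_cofactor det4_linear det4_alternating)
next
  case True
  then show ?thesis unfolding H3_grad_phi(1)[OF x y] using hker_diagonal[OF x] by (simp add: lor.zero_right)
qed

lemma H3_cofactor_linear: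
  "H3_cofactor y (a + a') b = H3_cofactor y a b + H3_cofactor y a' b" "H3_cofactor y (r *\<^sub>R a) b = r *\<^sub>R H3_cofactor y a b"
  "H3_cofactor y a (b + b') = H3_cofactor y a b + H3_cofactor y a b'" "H3_cofactor y a (r *\<^sub>R b) = r *\<^sub>R H3_cofactor y a b"
  "H3_cofactor y (a - a') b = H3_cofactor y a b - H3_cofactor y a' b"
  by (simp_all add: H3_cofactor_def vec_eq_iff forall_4 det4_linear)

lemma H3_cofactor_minus: "H3_cofactor y a (- b) = - H3_cofactor y a b"
  using H3_cofactor_linear(4)[of y a "- 1" b] by simp

lemma H3_cofactor_alternating: "H3_cofactor y a y = 0" "H3_cofactor y y a = 0" "H3_cofactor y a a = 0"
  by (simp_all add: H3_cofactor_def vec_eq_iff forall_4 det4_alternating)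

lemma H3_biot_savart_term:
  assumes V: "H3_field V" and x: "x \<in> H3" and y: "y \<in> H3"
  shows "H3_cross s y (H3_transport x y (V x)) (H3_grad (\<lambda>z. H3_psi (H3_dist x z)) y)
     = (- s / (4 * pi) * hker (lorentz x y)) *\<^sub>R H3_cofactor y (V x) x"
proof (cases "x = y")
  case False
  have v: "V x \<in> tangent lorentz x" using V x by (simp add: smooth_vector_field_def)
  show ?thesis
    unfolding H3_grad_phi(2)[OF x y] H3.cross_eq[OF y] H3_transport_eq[OF x y v False]
    by (simp add: H3_cofactor_linear H3_cofactor_minus H3_cofactor_alternating)
next
  case True
  then show ?thesis unfolding H3_grad_phi(2)[OF x y] H3.cross_eq[OF y]
    using hker_diagonal[OF x] H3_cofactor_linear(4)[of y _ 0] by simp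
qed

subsection \<open>Integrability\<close>

text \<open>
  The determinant is a sum of 24 products.\<close>

lemma det4_bound: "\<bar>det4 x a b d\<bar> \<le> 24 * (norm x * (norm a * norm b * norm d))"
proof -
  let ?N = "norm a * norm b * norm d"
  have c: "\<bar>v $ i\<bar> \<le> norm v" for v :: "real^4" and i by (rule component_le_norm_cart)
  have t: "\<bar>a $ i * b $ j * d $ k\<bar> \<le> ?N" for i j k
    unfolding abs_mult by (intro mult_mono c) auto
  have six: "\<bar>p1 + p2 + p3 - p4 - p5 - p6\<bar> \<le> 6 * N"
    if "\<bar>p1\<bar> \<le> N" "\<bar>p2\<bar> \<le> N" "\<bar>p3\<bar> \<le> N" "\<bar>p4\<bar> \<le> N" "\<bar>p5\<bar> \<le> N" "\<bar>p6\<bar> \<le> N" for p1 p2 p3 p4 p5 p6 N :: real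
    using that by linarith
  have xs: "\<bar>x $ i * P\<bar> \<le> norm x * (6 * ?N)" if "\<bar>P\<bar> \<le> 6 * ?N" for P i
    unfolding abs_mult by (intro mult_mono c that) auto
  have four: "\<bar>p1 - p2 + p3 - p4\<bar> \<le> 4 * N" if "\<bar>p1\<bar> \<le> N" "\<bar>p2\<bar> \<le> N" "\<bar>p3\<bar> \<le> N" "\<bar>p4\<bar> \<le> N" for p1 p2 p3 p4 N :: real
    using that by linarith
  have "\<bar>det4 x a b d\<bar> \<le> 4 * (norm x * (6 * ?N))"
    unfolding det4_expand by (intro four xs six t)
  then show ?thesis by simp
qed

lemma norm_H3_cofactor: "norm (H3_cofactor y a b) \<le> 96 * (norm y * (norm a * norm b))"
proof -
  have "norm (H3_cofactor y a b) \<le> (\<Sum>i\<in>UNIV. \<bar>H3_cofactor y a b $ i\<bar>)" by (rule norm_le_l1_cart)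
  also have "\<dots> = \<bar>det4 y a b (axis 1 1)\<bar> + \<bar>det4 y a b (axis 2 1)\<bar> + \<bar>det4 y a b (axis 3 1)\<bar> + \<bar>det4 y a b (axis 4 1)\<bar>"
    by (simp add: sum_4 H3_cofactor_def)
  also have "\<dots> \<le> 96 * (norm y * (norm a * norm b))"
  proof -
    have "\<bar>det4 y a b (axis i 1)\<bar> \<le> 24 * (norm y * (norm a * norm b))" for i
      using det4_bound[of y a b "axis i 1"] by simp
    from this[of 1] this[of 2] this[of 3] this[of 4] show ?thesis by linarith
  qed
  finally show ?thesis .
qed

lemma H3_norm_bounds:
  assumes x: "x \<in> H3" "x$1 \<le> A" and y: "y \<in> H3" "y$1 \<le> A"
  shows "norm x \<le> 2 * A" "norm (x - y) \<le> 2 * norm (spatial x - spatial y)" "\<bar>lorentz x y\<bar> \<le> 8 * A\<^sup>2"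
proof -
  have n: "norm v \<le> \<bar>v$1\<bar> + norm (spatial v)" for v
  proof -
    have "norm (emb u) = norm u" for u by (simp add: norm_eq_sqrt_inner)
    then show ?thesis using norm_triangle_ineq[of "v$1 *\<^sub>R qone" "emb (spatial v)"] qone_spatial[of v] by simp
  qed
  have s: "norm (spatial z) \<le> z$1" "0 < z$1" if "z \<in> H3" for z
  proof -
    show "norm (spatial z) \<le> z$1"
      unfolding H3_spatial(1)[OF that] H3_height_def norm_eq_sqrt_inner by simp
    show "0 < z$1" using that by (simp add: H3_def)
  qed
  have nb: "norm z \<le> 2 * A" if "z \<in> H3" "z$1 \<le> A" for z using n[of z] s[OF that(1)] that(2) by linarith
  show "norm x \<le> 2 * A" by (rule nb[OF x])
  have "spatial (x - y) = spatial x - spatial y" using linear_spatial by (simp add: linear_diff)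
  then show "norm (x - y) \<le> 2 * norm (spatial x - spatial y)"
    using n[of "x - y"] H3_gap(2)[OF x y] by simp
  have "\<bar>lorentz x y\<bar> \<le> \<bar>spatial x \<bullet> spatial y\<bar> + \<bar>x$1 * y$1\<bar>"
  proof -
    have "lorentz x y = spatial x \<bullet> spatial y - x$1 * y$1"
      by (simp add: lorentz_def spatial_def inner_vec_def sum_3)
    then show ?thesis by linarith
  qed
  also have "\<dots> \<le> norm (spatial x) * norm (spatial y) + \<bar>x$1\<bar> * \<bar>y$1\<bar>"
    using Cauchy_Schwarz_ineq2[of "spatial x" "spatial y"] by (simp add: abs_mult)
  also have "\<dots> \<le> A * A + A * A"
    using s[OF x(1)] s[OF y(1)] x(2) y(2) by (intro add_mono mult_mono) auto
  also have "\<dots> \<le> 8 * A\<^sup>2" by (simp add: power2_eq_square)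
  finally show "\<bar>lorentz x y\<bar> \<le> 8 * A\<^sup>2" .
qed

definition riesz :: "real^3 \<Rightarrow> real^3 \<Rightarrow> real" where "riesz u w = 1 / (norm (u - w))\<^sup>2"

text \<open>
  The kernel has order \<open>1 / n\<^sup>3\<close>, where \<open>n\<close> is the distance of the spatial parts, since \<open>t\<^sup>2 - 1\<close> is
  at least a multiple of \<open>n\<^sup>2\<close>. The factor \<open>x - y\<close>, which the determinant supplies, reduces this to
  \<open>1 / n\<^sup>2\<close>.\<close>

lemma hker_bound:
  assumes x: "x \<in> H3" "x$1 \<le> A" and y: "y \<in> H3" "y$1 \<le> A"
  shows "\<bar>hker (lorentz x y)\<bar> * norm (x - y) \<le> 16 * A ^ 5 * riesz (spatial x) (spatial y)"
proof (cases "x = y")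
  case False
  define n where "n = norm (spatial x - spatial y)"
  have n: "n > 0" using False H3_spatial(2) x(1) y(1) by (metis n_def right_minus_eq zero_less_norm_iff)
  have A: "A > 0" using x by (auto simp: H3_def)
  let ?t = "lorentz x y"
  have t: "?t < - 1" by (rule H3_lorentz_bound[OF x(1) y(1) False])
  define e where "e = ?t\<^sup>2 - 1"
  have "n\<^sup>2 \<le> A\<^sup>2 * (2 * (- ?t - 1))" using H3_gap(1)[OF x y] by (simp only: n_def mult_ac)
  also have "2 * (- ?t - 1) \<le> (1 - ?t) * (- ?t - 1)" using t by (intro mult_right_mono) auto
  also have "(1 - ?t) * (- ?t - 1) = e" by (simp add: e_def power2_eq_square algebra_simps)
  finally have ne: "n\<^sup>2 \<le> A\<^sup>2 * e" by (simp add: mult_left_mono)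
  have e: "e > 0" using ne n A by (metis not_less zero_less_power mult_nonneg_nonpos order_less_le_trans zero_le_power2)
  have "sqrt (n\<^sup>2) \<le> sqrt (A\<^sup>2 * e)" using ne by (rule real_sqrt_le_mono)
  then have ns: "n \<le> A * sqrt e" using n A by (simp add: real_sqrt_mult)
  have "n\<^sup>2 * n \<le> (A\<^sup>2 * e) * (A * sqrt e)" using ne ns n A e by (intro mult_mono) auto
  also have "\<dots> = A ^ 3 * (e * sqrt e)" by (simp add: eval_nat_numeral)
  finally have n3: "n\<^sup>2 * n \<le> A ^ 3 * (e * sqrt e)" .
  have "\<bar>hker ?t\<bar> = \<bar>?t\<bar> / (e * sqrt e)" using e by (simp add: hker_def e_def[symmetric] abs_mult)
  also have "\<dots> \<le> 8 * A\<^sup>2 / (e * sqrt e)" using H3_norm_bounds(3)[OF x y] e by (intro divide_right_mono) auto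
  also have "\<dots> \<le> 8 * A\<^sup>2 * A ^ 3 / (n\<^sup>2 * n)"
  proof -
    have "8 * A\<^sup>2 * (n\<^sup>2 * n) \<le> 8 * A\<^sup>2 * (A ^ 3 * (e * sqrt e))" using n3 by (intro mult_left_mono) auto
    then show ?thesis using e n by (simp add: pos_divide_le_eq pos_le_divide_eq mult_ac)
  qed
  also have "\<dots> = 8 * A ^ 5 / (n\<^sup>2 * n)" by (simp add: power_add[symmetric])
  finally have h: "\<bar>hker ?t\<bar> \<le> 8 * A ^ 5 / (n\<^sup>2 * n)" .
  have "\<bar>hker ?t\<bar> * norm (x - y) \<le> 8 * A ^ 5 / (n\<^sup>2 * n) * (2 * n)"
    using h H3_norm_bounds(2)[OF x y] A n by (intro mult_mono) (auto simp: n_def)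
  also have "\<dots> = 16 * A ^ 5 * riesz (spatial x) (spatial y)" using n by (simp add: riesz_def n_def[symmetric])
  finally show ?thesis .
next
  case True
  then show ?thesis by (simp add: riesz_def)
qed

text \<open>
  After translating \<open>w\<close> to the origin, the kernel is at most a multiple of the majorant used on the
  sphere.\<close>

lemma nn_integral_riesz:
  fixes w :: "real^3"
  assumes R: "0 \<le> R"
  shows "(\<integral>\<^sup>+u. indicator (cball 0 R) u * ennreal (riesz u w) \<partial>lborel)
    \<le> ennreal ((1 + (R + norm w)\<^sup>2) / 2) * (\<integral>\<^sup>+(u::real^3). ennreal (2 / (u \<bullet> u * (1 + u \<bullet> u))) \<partial>lborel)"
proof -
  let ?C = "(1 + (R + norm w)\<^sup>2) / 2"
  have C: "?C \<ge> 0" by (simp add: add_nonneg_nonneg)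
  have mr: "(\<lambda>u. ennreal (riesz u w)) \<in> borel_measurable borel" unfolding riesz_def by measurable
  have mc: "indicator (cball 0 R) \<in> borel_measurable (borel :: (real^3) measure)"
    by (intro borel_measurable_indicator borel_closed) simp
  have "(\<integral>\<^sup>+u. indicator (cball 0 R) u * ennreal (riesz u w) \<partial>lborel)
     = (\<integral>\<^sup>+u. indicator (cball 0 R) u * ennreal (riesz u w) \<partial>(distr lborel borel ((+) w)))"
    by (simp only: lborel_distr_plus)
  also have "\<dots> = (\<integral>\<^sup>+u. indicator (cball 0 R) (w + u) * ennreal (riesz (w + u) w) \<partial>lborel)"
    by (rule nn_integral_distr)
      (simp, simp only: measurable_distr_eq1 borel_measurable_times_ennreal[OF mc mr])
  also have "\<dots> \<le> (\<integral>\<^sup>+(u::real^3). ennreal ?C * ennreal (2 / (u \<bullet> u * (1 + u \<bullet> u))) \<partial>lborel)"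
  proof (intro nn_integral_mono)
    fix u :: "real^3"
    show "indicator (cball 0 R) (w + u) * ennreal (riesz (w + u) w) \<le> ennreal ?C * ennreal (2 / (u \<bullet> u * (1 + u \<bullet> u)))"
    proof (cases "norm (w + u) \<le> R")
      case True
      have "norm u \<le> norm (w + u) + norm w" using norm_triangle_ineq4[of "w + u" w] by simp
      then have "(norm u)\<^sup>2 \<le> (R + norm w)\<^sup>2" using True by (intro power_mono) auto
      then have le: "1 + u \<bullet> u \<le> 2 * ?C" by (simp add: power2_norm_eq_inner)
      have "riesz (w + u) w = (1 + u \<bullet> u) * (1 / (u \<bullet> u * (1 + u \<bullet> u)))"
        using one_plus_inner_pos[of u] by (simp add: riesz_def power2_norm_eq_inner)
      also have "\<dots> \<le> 2 * ?C * (1 / (u \<bullet> u * (1 + u \<bullet> u)))"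
        using le one_plus_inner_pos[of u] by (intro mult_right_mono) auto
      also have "\<dots> = ?C * (2 / (u \<bullet> u * (1 + u \<bullet> u)))" by (simp only: mult.commute[of 2] mult.assoc times_divide_eq_right mult_1_right)
      finally have "riesz (w + u) w \<le> ?C * (2 / (u \<bullet> u * (1 + u \<bullet> u)))" .
      then show ?thesis using True C by (simp add: ennreal_mult'[symmetric] ennreal_leI)
    qed simp
  qed
  also have "\<dots> = ennreal ?C * (\<integral>\<^sup>+(u::real^3). ennreal (2 / (u \<bullet> u * (1 + u \<bullet> u))) \<partial>lborel)"
    by (rule nn_integral_cmult) measurable
  finally show ?thesis .
qed

text \<open>
  A ball around the point \<open>(1, 0, 0, 0)\<close>, described by the height; a compactly supported field
  vanishes off one of them.\<close>

definition H3_cap :: "real \<Rightarrow> (real^4) set" where "H3_cap A = {x \<in> H3. x$1 \<le> A}"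

lemma H3_cap_sets: "H3_cap A \<in> sets H3_vol"
proof -
  have "{x::real^4. x$1 \<le> A} \<in> sets borel" by (intro borel_closed closed_Collect_le continuous_intros)
  moreover have "H3_cap A = H3 \<inter> {x. x$1 \<le> A}" by (auto simp: H3_cap_def)
  ultimately show ?thesis by (auto simp: sets_restrict_space)
qed

lemma H3_cap_chart: "H3_chart u \<in> H3_cap A \<Longrightarrow> u \<in> cball 0 (max 0 A)"
proof -
  assume "H3_chart u \<in> H3_cap A"
  then have "H3_height u \<le> A" by (simp add: H3_cap_def)
  moreover have "norm u \<le> H3_height u" by (simp add: H3_height_def norm_eq_sqrt_inner)
  ultimately show ?thesis by simp
qed

lemma spatial_measurable: "spatial \<in> borel_measurable borel"
  by (rule borel_measurable_continuous_onI[OF linear_continuous_on[OF bounded_linear_spatial]])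

lemma nn_integral_H3_riesz:
  "(\<integral>\<^sup>+x. indicator (H3_cap A) x * ennreal (riesz (spatial x) w) \<partial>H3_vol)
    \<le> ennreal ((1 + (max 0 A + norm w)\<^sup>2) / 2) * (\<integral>\<^sup>+(u::real^3). ennreal (2 / (u \<bullet> u * (1 + u \<bullet> u))) \<partial>lborel)"
proof -
  have "(\<lambda>x. ennreal (riesz (spatial x) w)) \<in> borel_measurable borel"
    unfolding riesz_def using spatial_measurable by measurable
  then have "(\<lambda>x. ennreal (riesz (spatial x) w)) \<in> borel_measurable (restrict_space borel H3)"
    by (rule measurable_restrict_space1)
  moreover have "indicator (H3_cap A) \<in> borel_measurable (restrict_space borel H3)"
    using H3_cap_sets by (intro borel_measurable_indicator) simp
  ultimately have "(\<integral>\<^sup>+x. indicator (H3_cap A) x * ennreal (riesz (spatial x) w) \<partial>H3_vol)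
    = (\<integral>\<^sup>+u. ennreal (H3_density u) * (indicator (H3_cap A) (H3_chart u) * ennreal (riesz (spatial (H3_chart u)) w)) \<partial>lborel)"
    by (intro nn_integral_H3_vol borel_measurable_times_ennreal)
  also have "\<dots> \<le> (\<integral>\<^sup>+u. indicator (cball 0 (max 0 A)) u * ennreal (riesz u w) \<partial>lborel)"
  proof (intro nn_integral_mono)
    fix u
    have d: "ennreal (H3_density u) \<le> 1" using H3_density_le_1[of u] by (simp add: ennreal_le_1)
    show "ennreal (H3_density u) * (indicator (H3_cap A) (H3_chart u) * ennreal (riesz (spatial (H3_chart u)) w))
      \<le> indicator (cball 0 (max 0 A)) u * ennreal (riesz u w)"
    proof (cases "H3_chart u \<in> H3_cap A")
      case True
      then show ?thesis using H3_cap_chart[OF True] mult_right_mono[OF d, of "ennreal (riesz u w)"] by simp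
    qed simp
  qed
  also have "\<dots> \<le> ennreal ((1 + (max 0 A + norm w)\<^sup>2) / 2) * (\<integral>\<^sup>+(u::real^3). ennreal (2 / (u \<bullet> u * (1 + u \<bullet> u))) \<partial>lborel)"
    by (rule nn_integral_riesz) simp
  finally show ?thesis .
qed

lemma emeasure_H3_cap: "emeasure H3_vol (H3_cap A) < \<infinity>"
proof -
  have i: "indicator (H3_cap A) \<in> borel_measurable (restrict_space borel H3)"
    using H3_cap_sets by (intro borel_measurable_indicator) simp
  have "emeasure H3_vol (H3_cap A) = (\<integral>\<^sup>+x. indicator (H3_cap A) x \<partial>H3_vol)"
    using H3_cap_sets by simp
  also have "\<dots> = (\<integral>\<^sup>+u. ennreal (H3_density u) * indicator (H3_cap A) (H3_chart u) \<partial>lborel)"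
    by (rule nn_integral_H3_vol[OF i])
  also have "\<dots> \<le> (\<integral>\<^sup>+u. indicator (cball (0::real^3) (max 0 A)) u \<partial>lborel)"
  proof (intro nn_integral_mono)
    fix u
    have d: "ennreal (H3_density u) \<le> 1" using H3_density_le_1[of u] by (simp add: ennreal_le_1)
    show "ennreal (H3_density u) * indicator (H3_cap A) (H3_chart u) \<le> indicator (cball 0 (max 0 A)) u"
      using d H3_cap_chart[of u A] by (cases "H3_chart u \<in> H3_cap A") (auto simp: indicator_def)
  qed
  also have "\<dots> = emeasure lborel (cball (0::real^3) (max 0 A))"
    by (rule nn_integral_indicator) simp
  also have "\<dots> < \<infinity>" by (rule emeasure_lborel_cball_finite)
  finally show ?thesis .
qed

interpretation H3v: sigma_finite_measure H3_vol
proof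
  show "\<exists>A. countable A \<and> A \<subseteq> sets H3_vol \<and> \<Union> A = space H3_vol \<and> (\<forall>a\<in>A. emeasure H3_vol a \<noteq> \<infinity>)"
  proof (intro exI[of _ "range (\<lambda>n::nat. H3_cap (real n))"] conjI ballI)
    show "\<Union> (range (\<lambda>n::nat. H3_cap (real n))) = space H3_vol"
      using real_arch_simple by (auto simp: H3_cap_def)
  qed (use H3_cap_sets emeasure_H3_cap in \<open>auto simp: less_top[symmetric]\<close>)
qed

interpretation H3p: pair_sigma_finite H3_vol H3_vol
  by (intro pair_sigma_finite.intro H3v.sigma_finite_measure_axioms)

lemma smooth_on_mfd_continuous: "smooth_on_mfd M f \<Longrightarrow> continuous_on M f"
  unfolding continuous_on_eq_continuous_within
proof
  fix p assume "smooth_on_mfd M f" "p \<in> M"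
  then obtain U F where U: "open U" "p \<in> U" "Ck_on 0 U F" "\<And>x. x \<in> U \<inter> M \<Longrightarrow> F x = f x"
    unfolding smooth_on_mfd_def by metis
  then have "isCont F p" using continuous_on_eq_continuous_at by auto
  then have c: "continuous (at p within M) F" by (rule continuous_at_imp_continuous_at_within)
  obtain e where e: "e > 0" "ball p e \<subseteq> U" using U(1,2) openE by blast
  show "continuous (at p within M) f"
    by (rule continuous_transform_within[OF c e(1) \<open>p \<in> M\<close>]) (use U(4) e(2) in \<open>force simp: dist_commute mem_ball\<close>)
qed

lemma closed_H3: "closed H3"
proof -
  have "H3 = {x. lorentz x x = - 1} \<inter> {x. x$1 \<ge> 0}"
  proof (intro set_eqI iffI)
    fix x :: "real^4" assume x: "x \<in> {x. lorentz x x = - 1} \<inter> {x. x$1 \<ge> 0}"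
    have "x$1 \<noteq> 0"
    proof
      assume "x$1 = 0"
      then have "lorentz x x = (x$2)\<^sup>2 + (x$3)\<^sup>2 + (x$4)\<^sup>2" by (simp add: lorentz_def power2_eq_square)
      moreover have "(x$2)\<^sup>2 + (x$3)\<^sup>2 + (x$4)\<^sup>2 \<ge> 0" by (intro add_nonneg_nonneg zero_le_power2)
      moreover have "lorentz x x = - 1" using x by simp
      ultimately show False by linarith
    qed
    then show "x \<in> H3" using x by (simp add: H3_def)
  qed (auto simp: H3_def)
  moreover have "closed ({x. lorentz x x = - 1} \<inter> {x::real^4. x$1 \<ge> 0})"
    unfolding lorentz_def by (intro closed_Int closed_Collect_eq closed_Collect_le continuous_intros)
  ultimately show ?thesis by (rule ssubst)
qed

lemma H3_compact_support:
  assumes V: "H3_field V" and K: "compact (closure {x \<in> H3. V x \<noteq> 0})"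
  obtains A M where "A > 0" "M > 0" "\<And>x. x \<in> H3 \<Longrightarrow> V x \<noteq> 0 \<Longrightarrow> x$1 \<le> A" "\<And>x. x \<in> H3 \<Longrightarrow> norm (V x) \<le> M"
proof -
  let ?K = "closure {x \<in> H3. V x \<noteq> 0}"
  have sub: "?K \<subseteq> H3" using closed_H3 by (intro closure_minimal) auto
  have cV: "continuous_on ?K V"
    using V sub by (intro continuous_on_subset[OF smooth_on_mfd_continuous]) (auto simp: smooth_vector_field_def)
  obtain B where B: "B > 0" "\<And>x. x \<in> ?K \<Longrightarrow> norm x \<le> B" using compact_imp_bounded[OF K] by (auto simp: bounded_pos)
  obtain M where M: "M > 0" "\<And>x. x \<in> ?K \<Longrightarrow> norm (V x) \<le> M"
    using compact_imp_bounded[OF compact_continuous_image[OF cV K]] by (auto simp: bounded_pos)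
  have inK: "x \<in> ?K" if "x \<in> H3" "V x \<noteq> 0" for x
    using that closure_subset[of "{x \<in> H3. V x \<noteq> 0}"] by (intro subsetD[OF closure_subset]) simp
  show thesis
  proof (rule that[OF B(1) M(1)])
    show "x$1 \<le> B" if "x \<in> H3" "V x \<noteq> 0" for x
      using B(2)[OF inK[OF that]] component_le_norm_cart[of x 1] by linarith
    show "norm (V x) \<le> M" if "x \<in> H3" for x using M inK[OF that] by (cases "V x = 0") auto
  qed
qed

text \<open>
  Both sides are integrals of the function \<open>f\<close>, one iterated and one over the product. Two
  applications of the same pointwise bound are needed: integrability over the product, for Fubini's
  theorem, and integrability of the vector-valued Biot-Savart integrand for each \<open>y\<close>, to take the
  inner product with \<open>V y\<close> under the integral.\<close>

lemma helicity_hyperbolic: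
  assumes V: "H3_field V" and K: "compact (closure {x \<in> H3. V x \<noteq> 0})"
  shows "helicity lorentz H3_vol (H3_biot_savart s) V =
          (LINT (x, y)|(H3_vol \<Otimes>\<^sub>M H3_vol).
             lorentz (H3_cross s y (H3_transport x y (V x)) (V y))
                     (H3_grad (\<lambda>z. H3_phi (H3_dist x z)) y))"
proof -
  obtain A M where A: "A > 0" "\<And>x. x \<in> H3 \<Longrightarrow> V x \<noteq> 0 \<Longrightarrow> x$1 \<le> A" and M: "M > 0" "\<And>x. x \<in> H3 \<Longrightarrow> norm (V x) \<le> M"
    using H3_compact_support[OF V K] by metis
  define J where "J = (\<integral>\<^sup>+(u::real^3). ennreal (2 / (u \<bullet> u * (1 + u \<bullet> u))) \<partial>lborel)"
  have J: "J < \<infinity>" unfolding J_def by (rule nn_integral_inverse_square)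
  have mV: "V \<in> borel_measurable H3_vol"
    unfolding measurable_cong_sets[OF sets_H3_vol refl]
    using V by (intro borel_measurable_continuous_on_restrict smooth_on_mfd_continuous) (auto simp: smooth_vector_field_def)
  define f where "f p = s / (4 * pi) * hker (lorentz (fst p) (snd p)) * det4 (snd p) (V (fst p)) (V (snd p)) (fst p)" for p
  let ?M2 = "H3_vol \<Otimes>\<^sub>M H3_vol"
  have mfst: "(\<lambda>p. fst p) \<in> borel_measurable ?M2" "(\<lambda>p. snd p) \<in> borel_measurable ?M2"
    by (intro measurable_compose[OF measurable_fst ident_H3_vol] measurable_compose[OF measurable_snd ident_H3_vol])+
  have mVp: "(\<lambda>p. V (fst p)) \<in> borel_measurable ?M2" "(\<lambda>p. V (snd p)) \<in> borel_measurable ?M2"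
    by (intro measurable_compose[OF measurable_fst mV] measurable_compose[OF measurable_snd mV])+
  have mf: "f \<in> borel_measurable ?M2"
    unfolding f_def[abs_def]
    by (intro borel_measurable_times borel_measurable_const measurable_compose[OF lorentz_measurable hker_measurable]
        det4_measurable mfst mVp)
  \<comment> \<open>The constants 96, 2 and 16 are those of the bounds for the cofactor, for \<open>norm y\<close> and for
    \<open>hker\<close>.\<close>
  have pointwise: "norm (hker (lorentz x y) *\<^sub>R H3_cofactor y (V x) x) \<le> 192 * M * B ^ 6 * 16 * riesz (spatial x) (spatial y)"
    if x: "x \<in> H3" "x$1 \<le> B" and y: "y \<in> H3" "y$1 \<le> B" for x y B
  proof -
    have B: "B > 0" using x by (auto simp: H3_def)
    \<comment> \<open>The cofactor with \<open>y\<close> twice is 0, which brings in the factor \<open>x - y\<close>.\<close>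
    have "H3_cofactor y (V x) x = H3_cofactor y (V x) (x - y)"
      using H3_cofactor_linear(3)[of y "V x" "x - y" y] by (simp add: H3_cofactor_alternating)
    then have "norm (H3_cofactor y (V x) x) \<le> 96 * (norm y * (norm (V x) * norm (x - y)))"
      using norm_H3_cofactor by metis
    also have "\<dots> \<le> 96 * (2 * B * (M * norm (x - y)))"
      using H3_norm_bounds(1)[OF y x] M x B by (intro mult_left_mono mult_mono) auto
    finally have "\<bar>hker (lorentz x y)\<bar> * norm (H3_cofactor y (V x) x) \<le> \<bar>hker (lorentz x y)\<bar> * (96 * (2 * B * (M * norm (x - y))))"
      by (rule mult_left_mono) simp
    also have "\<dots> = 192 * M * B * (\<bar>hker (lorentz x y)\<bar> * norm (x - y))" by simp
    also have "\<dots> \<le> 192 * M * B * (16 * B ^ 5 * riesz (spatial x) (spatial y))"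
      using hker_bound[OF x y] M B by (intro mult_left_mono) auto
    also have "\<dots> = 192 * M * B ^ 6 * 16 * riesz (spatial x) (spatial y)" by (simp add: eval_nat_numeral)
    finally show ?thesis by simp
  qed
  have fdet: "f (x, y) = - s / (4 * pi) * lorentz (hker (lorentz x y) *\<^sub>R H3_cofactor y (V x) x) (V y)" for x y
  proof -
    have "det4 y (V x) x (V y) = - det4 y (V x) (V y) x" by (simp add: det4_expand algebra_simps)
    then show ?thesis by (simp add: f_def lor.scaleR_left H3_cofactor)
  qed
  obtain L where L: "L > 0" "\<And>a b. \<bar>lorentz a b\<bar> \<le> norm a * norm b * L"
    using lor.pos_bounded by (auto simp: real_norm_def)
  have riesz0: "0 \<le> riesz u w" for u w by (simp add: riesz_def)
  have int2: "integrable ?M2 f"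
  proof (rule integrableI_bounded[OF mf])
    define C where "C = \<bar>s\<bar> / (4 * pi) * (192 * M * A ^ 6 * 16 * M * L)"
    have C: "C \<ge> 0" using M A L by (simp add: C_def)
    have fb: "ennreal (norm (f (x, y))) \<le> ennreal C * (indicator (H3_cap A) x * ennreal (riesz (spatial x) (spatial y))) * indicator (H3_cap A) y"
      if xy: "x \<in> H3" "y \<in> H3" for x y
    proof (cases "V x = 0 \<or> V y = 0")
      case True
      then have "f (x, y) = 0" by (auto simp: f_def det4_expand)
      then show ?thesis by simp
    next
      case False
      then have le: "x$1 \<le> A" "y$1 \<le> A" using A xy by auto
      let ?G = "hker (lorentz x y) *\<^sub>R H3_cofactor y (V x) x"
      have "norm (f (x, y)) = \<bar>s\<bar> / (4 * pi) * \<bar>lorentz ?G (V y)\<bar>" unfolding fdet by (simp add: abs_mult)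
      also have "\<dots> \<le> \<bar>s\<bar> / (4 * pi) * (192 * M * A ^ 6 * 16 * riesz (spatial x) (spatial y) * M * L)"
      proof (intro mult_left_mono)
        have "\<bar>lorentz ?G (V y)\<bar> \<le> norm ?G * norm (V y) * L" by (rule L)
        also have "\<dots> \<le> 192 * M * A ^ 6 * 16 * riesz (spatial x) (spatial y) * M * L"
          using pointwise[OF xy(1) le(1) xy(2) le(2)] M xy L A riesz0 by (intro mult_mono mult_nonneg_nonneg) auto
        finally show "\<bar>lorentz ?G (V y)\<bar> \<le> 192 * M * A ^ 6 * 16 * riesz (spatial x) (spatial y) * M * L" .
      qed simp
      also have "\<dots> = C * riesz (spatial x) (spatial y)" by (simp add: C_def)
      finally have "ennreal (norm (f (x, y))) \<le> ennreal (C * riesz (spatial x) (spatial y))" by (rule ennreal_leI)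
      then show ?thesis using xy le C by (simp add: ennreal_mult' H3_cap_def)
    qed
    have "(\<integral>\<^sup>+p. ennreal (norm (f p)) \<partial>?M2) = (\<integral>\<^sup>+y. (\<integral>\<^sup>+x. ennreal (norm (f (x, y))) \<partial>H3_vol) \<partial>H3_vol)"
      using mf by (subst H3p.nn_integral_snd[symmetric]) auto
    also have "\<dots> \<le> (\<integral>\<^sup>+y. ennreal C * (ennreal ((1 + (A + A)\<^sup>2) / 2) * J) * indicator (H3_cap A) y \<partial>H3_vol)"
    proof (rule nn_integral_mono)
      fix y assume "y \<in> space H3_vol"
      then have y: "y \<in> H3" by simp
      show "(\<integral>\<^sup>+x. ennreal (norm (f (x, y))) \<partial>H3_vol) \<le> ennreal C * (ennreal ((1 + (A + A)\<^sup>2) / 2) * J) * indicator (H3_cap A) y"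
      proof (cases "y \<in> H3_cap A")
        case True
        have m: "(\<lambda>x. indicator (H3_cap A) x * ennreal (riesz (spatial x) (spatial y))) \<in> borel_measurable H3_vol"
        proof (rule borel_measurable_times_ennreal)
          show "indicator (H3_cap A) \<in> borel_measurable H3_vol" using H3_cap_sets by (rule borel_measurable_indicator)
          have "(\<lambda>x. ennreal (riesz (spatial x) (spatial y))) \<in> borel_measurable borel"
            unfolding riesz_def using spatial_measurable by measurable
          then show "(\<lambda>x. ennreal (riesz (spatial x) (spatial y))) \<in> borel_measurable H3_vol" by (rule continuous_measurable_H3)
        qed
        have ny: "norm (spatial y) \<le> A"
          using True H3_cap_chart[of "spatial y" A] H3_spatial(2)[OF y] A by simp
        have "(\<integral>\<^sup>+x. ennreal (norm (f (x, y))) \<partial>H3_vol)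
           \<le> (\<integral>\<^sup>+x. ennreal C * (indicator (H3_cap A) x * ennreal (riesz (spatial x) (spatial y))) \<partial>H3_vol)"
        proof (rule nn_integral_mono)
          fix x assume "x \<in> space H3_vol"
          then show "ennreal (norm (f (x, y))) \<le> ennreal C * (indicator (H3_cap A) x * ennreal (riesz (spatial x) (spatial y)))"
            using fb[of x y] y True by simp
        qed
        also have "\<dots> = ennreal C * (\<integral>\<^sup>+x. indicator (H3_cap A) x * ennreal (riesz (spatial x) (spatial y)) \<partial>H3_vol)"
          by (rule nn_integral_cmult[OF m])
        also have "\<dots> \<le> ennreal C * (ennreal ((1 + (max 0 A + norm (spatial y))\<^sup>2) / 2) * J)"
          unfolding J_def by (intro mult_left_mono nn_integral_H3_riesz) simp
        also have "\<dots> \<le> ennreal C * (ennreal ((1 + (A + A)\<^sup>2) / 2) * J)"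
          using ny A by (intro mult_left_mono mult_right_mono ennreal_leI divide_right_mono add_left_mono power_mono) auto
        finally show ?thesis using True by simp
      next
        case False
        have "(\<integral>\<^sup>+x. ennreal (norm (f (x, y))) \<partial>H3_vol) \<le> (\<integral>\<^sup>+x. 0 \<partial>H3_vol)"
        proof (rule nn_integral_mono)
          fix x assume "x \<in> space H3_vol"
          then show "ennreal (norm (f (x, y))) \<le> 0" using fb[of x y] y False by simp
        qed
        then show ?thesis by simp
      qed
    qed
    also have "\<dots> = ennreal C * (ennreal ((1 + (A + A)\<^sup>2) / 2) * J) * emeasure H3_vol (H3_cap A)"
      by (rule nn_integral_cmult_indicator[OF H3_cap_sets])
    also have "\<dots> < \<infinity>" using J emeasure_H3_cap[of A] by (simp add: ennreal_mult_less_top)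
    finally show "(\<integral>\<^sup>+p. ennreal (norm (f p)) \<partial>?M2) < \<infinity>" .
  qed
  have inner: "lorentz (H3_biot_savart s V y) (V y) = (LINT x|H3_vol. f (x, y))" if y: "y \<in> H3" for y
  proof -
    let ?G = "\<lambda>x. (- s / (4 * pi) * hker (lorentz x y)) *\<^sub>R H3_cofactor y (V x) x"
    define B where "B = max A (y$1)"
    have B: "B > 0" "y$1 \<le> B" "A \<le> B" using A by (auto simp: B_def)
    have bb: "bounded_bilinear (H3_cofactor y)"
      by (rule bilinear_conv_bounded_bilinear[THEN iffD1])
        (auto simp: bilinear_def H3_cofactor_linear intro!: linearI)
    have mc: "(\<lambda>x. H3_cofactor y (V x) x) \<in> borel_measurable H3_vol"
    proof (rule borel_measurable_continuous_Pair[OF mV ident_H3_vol])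
      show "continuous_on UNIV (\<lambda>p. H3_cofactor y (fst p) (snd p))"
        by (intro bounded_bilinear.continuous_on[OF bb] continuous_intros)
    qed
    have ml: "(\<lambda>x. hker (lorentz x y)) \<in> borel_measurable H3_vol"
      by (intro measurable_compose[OF lorentz_measurable hker_measurable] ident_H3_vol) simp
    have mG: "?G \<in> borel_measurable H3_vol"
      by (intro borel_measurable_scaleR borel_measurable_times borel_measurable_const ml mc)
    define C where "C = \<bar>s\<bar> / (4 * pi) * (192 * M * B ^ 6 * 16)"
    have C: "C \<ge> 0" using M B by (simp add: C_def)
    have m: "(\<lambda>x. indicator (H3_cap A) x * ennreal (riesz (spatial x) (spatial y))) \<in> borel_measurable H3_vol"
    proof (rule borel_measurable_times_ennreal)
      show "indicator (H3_cap A) \<in> borel_measurable H3_vol" using H3_cap_sets by (rule borel_measurable_indicator)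
      have "(\<lambda>x. ennreal (riesz (spatial x) (spatial y))) \<in> borel_measurable borel"
        unfolding riesz_def using spatial_measurable by measurable
      then show "(\<lambda>x. ennreal (riesz (spatial x) (spatial y))) \<in> borel_measurable H3_vol" by (rule continuous_measurable_H3)
    qed
    have iG: "integrable H3_vol ?G"
    proof (rule integrableI_bounded[OF mG])
      have "(\<integral>\<^sup>+x. ennreal (norm (?G x)) \<partial>H3_vol)
        \<le> (\<integral>\<^sup>+x. ennreal C * (indicator (H3_cap A) x * ennreal (riesz (spatial x) (spatial y))) \<partial>H3_vol)"
      proof (rule nn_integral_mono)
        fix x assume "x \<in> space H3_vol"
        then have x: "x \<in> H3" by simp
        show "ennreal (norm (?G x)) \<le> ennreal C * (indicator (H3_cap A) x * ennreal (riesz (spatial x) (spatial y)))"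
        proof (cases "V x = 0")
          case True
          then have G: "?G x = 0" using H3_cofactor_linear(2)[of y 0] by simp
          show ?thesis unfolding G by simp
        next
          case False
          then have xA: "x$1 \<le> A" by (rule A(2)[OF x])
          have "norm (?G x) = \<bar>s\<bar> / (4 * pi) * norm (hker (lorentz x y) *\<^sub>R H3_cofactor y (V x) x)"
            by (simp add: abs_mult)
          also have "\<dots> \<le> \<bar>s\<bar> / (4 * pi) * (192 * M * B ^ 6 * 16 * riesz (spatial x) (spatial y))"
            using pointwise[OF x _ y B(2)] xA B(3) by (intro mult_left_mono) auto
          also have "\<dots> = C * riesz (spatial x) (spatial y)" by (simp add: C_def)
          finally have "ennreal (norm (?G x)) \<le> ennreal (C * riesz (spatial x) (spatial y))" by (rule ennreal_leI)
          then show ?thesis using x xA C by (simp add: ennreal_mult' H3_cap_def)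
        qed
      qed
      also have "\<dots> = ennreal C * (\<integral>\<^sup>+x. indicator (H3_cap A) x * ennreal (riesz (spatial x) (spatial y)) \<partial>H3_vol)"
        by (rule nn_integral_cmult[OF m])
      also have "\<dots> \<le> ennreal C * (ennreal ((1 + (max 0 A + norm (spatial y))\<^sup>2) / 2) * J)"
        unfolding J_def by (intro mult_left_mono nn_integral_H3_riesz) simp
      also have "\<dots> < \<infinity>" using J by (simp add: ennreal_mult_less_top)
      finally show "(\<integral>\<^sup>+x. ennreal (norm (?G x)) \<partial>H3_vol) < \<infinity>" .
    qed
    have "H3_biot_savart s V y = (LINT x|H3_vol. ?G x)"
      unfolding H3_biot_savart_def
      by (rule Bochner_Integration.integral_cong[OF refl]) (simp only: space_H3_vol H3_biot_savart_term[OF V _ y])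
    then have "lorentz (H3_biot_savart s V y) (V y) = (LINT x|H3_vol. lorentz (?G x) (V y))"
      using integral_bounded_linear[OF lor.bounded_linear_left iG] by simp
    also have "\<dots> = (LINT x|H3_vol. f (x, y))"
      by (rule Bochner_Integration.integral_cong[OF refl]) (simp only: fdet lor.scaleR_left real_scaleR_def mult.assoc)
    finally show ?thesis .
  qed
  have "helicity lorentz H3_vol (H3_biot_savart s) V = (LINT y|H3_vol. (LINT x|H3_vol. f (x, y)))"
    unfolding helicity_def by (rule Bochner_Integration.integral_cong[OF refl]) (simp only: space_H3_vol inner)
  also have "\<dots> = (LINT p|?M2. f p)"
    using H3p.integral_snd[of "\<lambda>x y. f (x, y)"] int2 by simp
  also have "\<dots> = (LINT (x, y)|?M2.
             lorentz (H3_cross s y (H3_transport x y (V x)) (V y))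
                     (H3_grad (\<lambda>z. H3_phi (H3_dist x z)) y))"
    unfolding case_prod_beta
  proof (rule Bochner_Integration.integral_cong[OF refl])
    fix p assume "p \<in> space ?M2"
    then have "fst p \<in> H3" "snd p \<in> H3" by (auto simp: space_pair_measure)
    then show "f p = lorentz (H3_cross s (snd p) (H3_transport (fst p) (snd p) (V (fst p))) (V (snd p)))
                     (H3_grad (\<lambda>z. H3_phi (H3_dist (fst p) z)) (snd p))"
      by (simp only: H3_linking_term[OF V] f_def)
  qed
  finally show ?thesis .
qed

section \<open>Helicity as a double integral\<close>

theorem theorem6:
  shows
    "(\<forall>BS V. S3_biot_savart BS \<and> S3_field V \<longrightarrow>
        helicity (\<bullet>) S3_vol BS V =
          (LINT (x, y)|(S3_vol \<Otimes>\<^sub>M S3_vol).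
             S3_cross y (S3_left x y (V x)) (V y) \<bullet> S3_grad (\<lambda>z. S3_phi0 (S3_dist x z)) y)
          - 1 / (4 * pi\<^sup>2) *
            (LINT (x, y)|(S3_vol \<Otimes>\<^sub>M S3_vol). S3_left x y (V x) \<bullet> V y)
          + 2 *
            (LINT (x, y)|(S3_vol \<Otimes>\<^sub>M S3_vol).
               S3_grad (\<lambda>z. S3_left x z (V x) \<bullet> S3_grad (\<lambda>w. S3_phi1 (S3_dist x w)) z) y \<bullet> V y))
     \<and>
     (\<forall>BS V. S3_biot_savart BS \<and> S3_field V \<longrightarrow>
        helicity (\<bullet>) S3_vol BS V =
          (LINT (x, y)|(S3_vol \<Otimes>\<^sub>M S3_vol).
             S3_cross y (S3_transport x y (V x)) (V y) \<bullet> S3_grad (\<lambda>z. S3_phi (S3_dist x z)) y))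
     \<and>
     (\<forall>s V. (s = 1 \<or> s = - 1) \<and> H3_field V \<and> compact (closure {x \<in> H3. V x \<noteq> 0}) \<longrightarrow>
        helicity lorentz H3_vol (H3_biot_savart s) V =
          (LINT (x, y)|(H3_vol \<Otimes>\<^sub>M H3_vol).
             lorentz (H3_cross s y (H3_transport x y (V x)) (V y))
                     (H3_grad (\<lambda>z. H3_phi (H3_dist x z)) y)))"
  using helicity_left_translation helicity_parallel_transport helicity_hyperbolic by blast

end
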